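(* Let $\lambda$ be a non-zero real number and $\alpha\in\Lambda$. Let $f$ be a $K$-finite joint eigenfunction on $\mathbb H^n$ for all $D\in\mathcal L_K(\mathfrak h_n)$ with eigenvalue $\widetilde\mu^\lambda_\alpha$, such that $f(z,0)\in\mathcal E^\lambda(\mathbb C^n)$. Then $f(z,t)=\big\langle\Pi^\lambda(z,t),\mathcal W^\lambda(P)\big\rangle^\lambda_\alpha$ for some $K$-harmonic polynomial $P$.
   Context: $\mathbb H^n=\mathbb C^n\times\mathbb R$ with product $(z,t)(z',t')=(z+z',t+t'+2\,\mathrm{Im}(z\cdot\overline{z'}))$, $z\cdot w=\sum_jz_jw_j$; $U(n)$ acts by $k\cdot(z,t)=(k\cdot z,t)$. $K$ is a compact connected subgroup of $U(n)$ such that $(K,\mathbb H^n)$ is a Gelfand pair (the convolution algebra of $K$-invariant $L^1$ functions on $\mathbb H^n$ is commutative), and the $K$-action on $\mathbb C^n\cong\mathbb R^{2n}$ is polar: there is a real linear subspace $T$ meeting every $K$-orbit with $(\mathfrak k\cdot x,T)=0$ for all $x\in T$. $\mathcal L_K(\mathfrak h_n)$ is the algebra of differential operators on $\mathbb H^n$ invariant under left translations and under $K$. Eigenfunctions are smooth; "joint eigenfunction with eigenvalue $\mu$" means $Df=\mu(D)f$ for all $D$. $K$-finite means that the span of the translates $f(k^{-1}z,t)$, $k\in K$, is finite dimensional. $\mathcal H^\lambda$: entire functions $u$ on $\mathbb C^n$ with $\|u\|^2=(2|\lambda|/\pi)^n\int|u(w)|^2e^{-2|\lambda||w|^2}dw<\infty$;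 $\mathcal P(\mathbb C^n)$: holomorphic polynomials. $(\Pi^\lambda(z,t)u)(w)=e^{i\lambda t}u(w+\bar z)e^{-2\lambda(w\cdot z+|z|^2/2)}$ if $\lambda>0$, and $e^{i\lambda t}u(w-z)e^{2\lambda(-w\cdot\bar z+|z|^2/2)}$ if $\lambda<0$. $K$ acts on $\mathcal H^\lambda$ by $U^\lambda(k)u=\bar k\cdot u$ if $\lambda>0$, $k\cdot u$ if $\lambda<0$, with $(k\cdot u)(w)=u(k^{-1}w)$. $\mathcal P(\mathbb C^n)=\bigoplus_{\alpha\in\Lambda}V_\alpha$ is the (multiplicity free) decomposition into $U^\lambda$-irreducible subspaces, each consisting of homogeneous polynomials of one degree. $\widetilde\mu^\lambda_\alpha$ is the joint eigenvalue of the bounded $K$-spherical function $\phi^\lambda_\alpha(z,t)=\int_K\langle\Pi^\lambda(k\cdot z,t)v,v\rangle dk$ ($v\in V_\alpha$ any unit vector, $dk$ normalized Haar measure): $D\phi^\lambda_\alpha=\widetilde\mu^\lambda_\alpha(D)\phi^\lambda_\alpha$ for $D\in\mathcal L_K(\mathfrak h_n)$. For linear operators $R,R'$ into $\mathcal H^\lambda$ defined on $V_\alpha$, $\langle R,R'\rangle^\lambda_\alpha=\sum_j\langle Rv_j,R'v_j\rangle$ for any orthonormal basis $\{v_j\}$ of $V_\alpha$ (inner products are linear in the first variable). $\mathcal E^\lambda(\mathbb C^n)$ is the set of smooth $g$ on $\mathbb C^n$ such that $e^{-(|\lambda|-\epsilon)|z|^2}|g(z)|\in L^p(\mathbb C^n)$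 for some $\epsilon>0$ and some $1\le p\le\infty$. $K$-harmonic polynomials are polynomials in $z,\bar z$ annihilated by all constant coefficient differential operators $i(\partial)$, with $i$ a $K$-invariant polynomial on $\mathbb R^{2n}$ without constant term. For $\lambda>0$, on $\mathcal P(\mathbb C^n)$, $\overline W^\lambda_j$ is multiplication by $2|\lambda|w_j$ and $W^\lambda_j=\partial/\partial w_j$; for $\lambda<0$ these are interchanged. For $K$-harmonic $P$, the Weyl correspondence $\mathcal W^\lambda(P)$ is the linear extension of $\zeta^\rho\bar\zeta^\gamma\mapsto\frac12[(\overline W^\lambda)^\gamma(W^\lambda)^\rho+(W^\lambda)^\rho(\overline W^\lambda)^\gamma]$. *)

theory Defs
  imports
    "HOL-Analysis.Analysis"
    "HOL-Library.Function_Algebras"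
    "HOL-Library.Poly_Mapping"
begin

section \<open>Complex vector spaces of functions\<close>

definition cscale :: "complex \<Rightarrow> ('a \<Rightarrow> complex) \<Rightarrow> 'a \<Rightarrow> complex" where
  "cscale c f = (\<lambda>x. c * f x)"

interpretation cfun: vector_space cscale
  by unfold_locales (auto simp: cscale_def fun_eq_iff algebra_simps)


section \<open>Multi-index powers, smooth functions, differential operators\<close>

text \<open>\<open>ops_power A W m\<close> is the product of the powers \<open>W j ^^ m j\<close> for \<open>j \<in> A\<close>. It is only applied to
  operators that commute on the functions at hand, so the chosen enumeration is immaterial.\<close>

definition enum_list :: "'j set \<Rightarrow> 'j list" where
  "enum_list A = (SOME js. distinct js \<and> set js = A)"

definition ops_power :: "'j set \<Rightarrow> ('j \<Rightarrow> 'f \<Rightarrow> 'f) \<Rightarrow> ('j \<Rightarrow> nat) \<Rightarrow> 'f \<Rightarrow> 'f" where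
  "ops_power A W m = foldr (\<lambda>j. W j ^^ m j) (enum_list A)"

definition dir_deriv :: "'a::euclidean_space \<Rightarrow> ('a \<Rightarrow> complex) \<Rightarrow> 'a \<Rightarrow> complex" where
  "dir_deriv b f = (\<lambda>x. frechet_derivative f (at x) b)"

definition smooth :: "('a::euclidean_space \<Rightarrow> complex) \<Rightarrow> bool" where
  "smooth f \<longleftrightarrow> (\<forall>bs x. foldr dir_deriv bs f differentiable (at x))"

text \<open>For multi-indices on a Euclidean space only the values on \<open>Basis\<close> matter.\<close>

definition partials :: "('a::euclidean_space \<Rightarrow> nat) \<Rightarrow> ('a \<Rightarrow> complex) \<Rightarrow> 'a \<Rightarrow> complex" where
  "partials m = ops_power Basis dir_deriv m"

text \<open>A differential operator is determined by its action on smooth functions; its values on other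
  functions are irrelevant and left unconstrained.\<close>

definition differential_operator ::
    "(('a::euclidean_space \<Rightarrow> complex) \<Rightarrow> 'a \<Rightarrow> complex) \<Rightarrow> bool" where
  "differential_operator D \<longleftrightarrow>
     (\<exists>(S :: ('a \<Rightarrow> nat) set) c. finite S \<and> (\<forall>m\<in>S. smooth (c m)) \<and>
        (\<forall>f. smooth f \<longrightarrow> (\<forall>x. D f x = (\<Sum>m\<in>S. c m x * partials m f x))))"

text \<open>Polynomials on a real Euclidean space with complex coefficients, and the constant coefficient
  operator obtained by replacing each coordinate by the corresponding partial derivative.\<close>

definition rpoly_eval :: "(('a::euclidean_space \<Rightarrow> nat) \<Rightarrow>\<^sub>0 complex) \<Rightarrow> 'a \<Rightarrow> complex" where
  "rpoly_eval q x =
     (\<Sum>m\<in>Poly_Mapping.keys q. Poly_Mapping.lookup q m * of_real (\<Prod>b\<in>Basis. (x \<bullet> b) ^ m b))"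

definition rpoly_op ::
    "(('a::euclidean_space \<Rightarrow> nat) \<Rightarrow>\<^sub>0 complex) \<Rightarrow> ('a \<Rightarrow> complex) \<Rightarrow> 'a \<Rightarrow> complex" where
  "rpoly_op q f x =
     (\<Sum>m\<in>Poly_Mapping.keys q. Poly_Mapping.lookup q m * partials m f x)"

definition in_Lp :: "ennreal \<Rightarrow> ('a::euclidean_space \<Rightarrow> real) \<Rightarrow> bool" where
  "in_Lp p h \<longleftrightarrow> h \<in> borel_measurable lborel \<and>
     (if p = \<infinity> then \<exists>C. AE x in lborel. \<bar>h x\<bar> \<le> C
      else integrable lborel (\<lambda>x. \<bar>h x\<bar> powr enn2real p))"


section \<open>Subgroups of the unitary group\<close>

definition cdot :: "complex^'n \<Rightarrow> complex^'n \<Rightarrow> complex" where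
  "cdot z w = (\<Sum>j\<in>UNIV. z $ j * w $ j)"

definition vec_cnj :: "complex^'n \<Rightarrow> complex^'n" where
  "vec_cnj z = (\<chi> j. cnj (z $ j))"

definition mat_cnj :: "complex^'n^'n \<Rightarrow> complex^'n^'n" where
  "mat_cnj A = (\<chi> i j. cnj (A $ i $ j))"

definition unitary_group :: "(complex^'n^'n) set" where
  "unitary_group = {A. A ** transpose (mat_cnj A) = mat 1 \<and> transpose (mat_cnj A) ** A = mat 1}"

definition unitary_subgroup :: "(complex^'n^'n) set \<Rightarrow> bool" where
  "unitary_subgroup K \<longleftrightarrow> K \<subseteq> unitary_group \<and> mat 1 \<in> K \<and>
     (\<forall>k\<in>K. \<forall>l\<in>K. k ** l \<in> K) \<and> (\<forall>k\<in>K. matrix_inv k \<in> K)"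

definition mat_exp :: "complex^'n^'n \<Rightarrow> complex^'n^'n" where
  "mat_exp X = suminf (\<lambda>m. (1 / fact m) *\<^sub>R (((\<lambda>B. X ** B) ^^ m) (mat 1)))"

text \<open>Lie algebra of a closed matrix group.\<close>

definition lie_algebra :: "(complex^'n^'n) set \<Rightarrow> (complex^'n^'n) set" where
  "lie_algebra K = {X. \<forall>s::real. mat_exp (s *\<^sub>R X) \<in> K}"

text \<open>\<open>\<bullet>\<close> on \<open>complex^'n\<close> is the Euclidean inner product of the underlying real space of
  dimension \<open>2n\<close>, and \<open>subspace\<close> refers to real subspaces.\<close>

definition polar_action :: "(complex^'n^'n) set \<Rightarrow> bool" where
  "polar_action K \<longleftrightarrow> (\<exists>T :: (complex^'n) set. subspace T \<and>
     (\<forall>x. \<exists>k\<in>K. k *v x \<in> T) \<and>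
     (\<forall>x\<in>T. \<forall>X\<in>lie_algebra K. \<forall>y\<in>T. (X *v x) \<bullet> y = 0))"

definition normalized_haar :: "(complex^'n^'n) set \<Rightarrow> (complex^'n^'n) measure \<Rightarrow> bool" where
  "normalized_haar K M \<longleftrightarrow> space M = K \<and> sets M = sets (restrict_space borel K) \<and>
     emeasure M K = 1 \<and> (\<forall>k\<in>K. distr M M (\<lambda>x. k ** x) = M)"


section \<open>The Heisenberg group\<close>

type_synonym 'n heis = "(complex^'n) \<times> real"

fun hmult :: "'n::finite heis \<Rightarrow> 'n heis \<Rightarrow> 'n heis" where
  "hmult (z, t) (z', t') = (z + z', t + t' + 2 * Im (cdot z (vec_cnj z')))"

fun hinv :: "'n::finite heis \<Rightarrow> 'n heis" where
  "hinv (z, t) = (- z, - t)"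

fun hact :: "complex^'n^'n \<Rightarrow> 'n heis \<Rightarrow> 'n heis" where
  "hact k (z, t) = (k *v z, t)"

text \<open>Lebesgue measure is the (bi-invariant) Haar measure of the Heisenberg group.\<close>

definition hconv :: "('n::finite heis \<Rightarrow> complex) \<Rightarrow> ('n heis \<Rightarrow> complex) \<Rightarrow> 'n heis \<Rightarrow> complex" where
  "hconv f g x = (\<integral>y. f y * g (hmult (hinv y) x) \<partial>lborel)"

definition K_invariant_L1 :: "(complex^'n^'n) set \<Rightarrow> ('n heis \<Rightarrow> complex) \<Rightarrow> bool" where
  "K_invariant_L1 K f \<longleftrightarrow> integrable lborel f \<and> (\<forall>k\<in>K. AE x in lborel. f (hact k x) = f x)"

definition gelfand_pair :: "(complex^'n^'n) set \<Rightarrow> bool" where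
  "gelfand_pair K \<longleftrightarrow>
     (\<forall>f g. K_invariant_L1 K f \<longrightarrow> K_invariant_L1 K g \<longrightarrow>
        (AE x in lborel. hconv f g x = hconv g f x))"

definition invariant_operators ::
    "(complex^'n^'n) set \<Rightarrow> (('n heis \<Rightarrow> complex) \<Rightarrow> 'n heis \<Rightarrow> complex) set" where
  "invariant_operators K = {D. differential_operator D \<and>
     (\<forall>f. smooth f \<longrightarrow>
        (\<forall>g. D (\<lambda>x. f (hmult g x)) = (\<lambda>x. D f (hmult g x))) \<and>
        (\<forall>k\<in>K. D (\<lambda>x. f (hact k x)) = (\<lambda>x. D f (hact k x))))}"

definition joint_eigenfunction ::
    "(complex^'n^'n) set \<Rightarrow> ((('n heis \<Rightarrow> complex) \<Rightarrow> 'n heis \<Rightarrow> complex) \<Rightarrow> complex) \<Rightarrow>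
     ('n heis \<Rightarrow> complex) \<Rightarrow> bool" where
  "joint_eigenfunction K \<mu> f \<longleftrightarrow> smooth f \<and>
     (\<forall>D\<in>invariant_operators K. D f = (\<lambda>x. \<mu> D * f x))"

definition K_finite :: "(complex^'n^'n) set \<Rightarrow> ('n heis \<Rightarrow> complex) \<Rightarrow> bool" where
  "K_finite K f \<longleftrightarrow>
     (\<exists>B. finite B \<and> cfun.span {\<lambda>x. f (hact (matrix_inv k) x) |k. k \<in> K} = cfun.span B)"

definition E_space :: "real \<Rightarrow> (complex^'n \<Rightarrow> complex) set" where
  "E_space lam = {g. smooth g \<and> (\<exists>\<epsilon>>0. \<exists>p::ennreal. 1 \<le> p \<and>
     in_Lp p (\<lambda>z. exp (- (\<bar>lam\<bar> - \<epsilon>) * (norm z)\<^sup>2) * norm (g z)))}"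


section \<open>The Fock model\<close>

definition cmonom :: "('n::finite \<Rightarrow> nat) \<Rightarrow> complex^'n \<Rightarrow> complex" where
  "cmonom m w = (\<Prod>j\<in>UNIV. (w $ j) ^ m j)"

definition hpoly_eval :: "(('n::finite \<Rightarrow> nat) \<Rightarrow>\<^sub>0 complex) \<Rightarrow> complex^'n \<Rightarrow> complex" where
  "hpoly_eval p w = (\<Sum>m\<in>Poly_Mapping.keys p. Poly_Mapping.lookup p m * cmonom m w)"

definition hol_polys :: "(complex^'n \<Rightarrow> complex) set" where
  "hol_polys = range hpoly_eval"

definition homog_polys :: "nat \<Rightarrow> (complex^'n \<Rightarrow> complex) set" where
  "homog_polys d = {hpoly_eval p |p. \<forall>m\<in>Poly_Mapping.keys p. (\<Sum>j\<in>UNIV. m j) = d}"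

definition fock_inner :: "real \<Rightarrow> (complex^'n \<Rightarrow> complex) \<Rightarrow> (complex^'n \<Rightarrow> complex) \<Rightarrow> complex" where
  "fock_inner lam u v = of_real ((2 * \<bar>lam\<bar> / pi) ^ CARD('n)) *
     (\<integral>w. u w * cnj (v w) * of_real (exp (- 2 * \<bar>lam\<bar> * (norm w)\<^sup>2)) \<partial>lborel)"

fun fock_rep :: "real \<Rightarrow> 'n::finite heis \<Rightarrow> (complex^'n \<Rightarrow> complex) \<Rightarrow> complex^'n \<Rightarrow> complex" where
  "fock_rep lam (z, t) u = (\<lambda>w.
     if lam > 0 then
       exp (\<i> * of_real (lam * t)) * u (w + vec_cnj z) *
       exp (- 2 * of_real lam * (cdot w z + of_real ((norm z)\<^sup>2 / 2)))
     else
       exp (\<i> * of_real (lam * t)) * u (w - z) *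
       exp (2 * of_real lam * (- cdot w (vec_cnj z) + of_real ((norm z)\<^sup>2 / 2))))"

definition K_rep :: "real \<Rightarrow> complex^'n^'n \<Rightarrow> (complex^'n \<Rightarrow> complex) \<Rightarrow> complex^'n \<Rightarrow> complex" where
  "K_rep lam k u = (\<lambda>w. u (matrix_inv (if lam > 0 then mat_cnj k else k) *v w))"

definition K_invariant_subspace ::
    "(complex^'n^'n) set \<Rightarrow> real \<Rightarrow> (complex^'n \<Rightarrow> complex) set \<Rightarrow> bool" where
  "K_invariant_subspace K lam V \<longleftrightarrow> cfun.subspace V \<and> (\<forall>k\<in>K. \<forall>u\<in>V. K_rep lam k u \<in> V)"

definition K_irreducible ::
    "(complex^'n^'n) set \<Rightarrow> real \<Rightarrow> (complex^'n \<Rightarrow> complex) set \<Rightarrow> bool" where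
  "K_irreducible K lam V \<longleftrightarrow> K_invariant_subspace K lam V \<and> V \<noteq> {0} \<and>
     (\<forall>U. U \<subseteq> V \<longrightarrow> K_invariant_subspace K lam U \<longrightarrow> U = {0} \<or> U = V)"

definition K_equivalent ::
    "(complex^'n^'n) set \<Rightarrow> real \<Rightarrow> (complex^'n \<Rightarrow> complex) set \<Rightarrow>
     (complex^'n \<Rightarrow> complex) set \<Rightarrow> bool" where
  "K_equivalent K lam U V \<longleftrightarrow> (\<exists>A. Vector_Spaces.linear cscale cscale A \<and> bij_betw A U V \<and>
     (\<forall>k\<in>K. \<forall>u\<in>U. A (K_rep lam k u) = K_rep lam k (A u)))"

definition multiplicity_free_decomposition ::
    "(complex^'n^'n) set \<Rightarrow> real \<Rightarrow> 'i set \<Rightarrow> ('i \<Rightarrow> (complex^'n \<Rightarrow> complex) set) \<Rightarrow> bool" where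
  "multiplicity_free_decomposition K lam \<Lambda> V \<longleftrightarrow>
     (\<forall>\<alpha>\<in>\<Lambda>. K_irreducible K lam (V \<alpha>) \<and> (\<exists>d. V \<alpha> \<subseteq> homog_polys d)) \<and>
     cfun.span (\<Union>\<alpha>\<in>\<Lambda>. V \<alpha>) = hol_polys \<and>
     (\<forall>S u. finite S \<longrightarrow> S \<subseteq> \<Lambda> \<longrightarrow> (\<forall>\<alpha>\<in>S. u \<alpha> \<in> V \<alpha>) \<longrightarrow> (\<Sum>\<alpha>\<in>S. u \<alpha>) = 0 \<longrightarrow>
        (\<forall>\<alpha>\<in>S. u \<alpha> = 0)) \<and>
     (\<forall>\<alpha>\<in>\<Lambda>. \<forall>\<beta>\<in>\<Lambda>. \<alpha> \<noteq> \<beta> \<longrightarrow> \<not> K_equivalent K lam (V \<alpha>) (V \<beta>))"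

definition spherical_function ::
    "(complex^'n^'n) measure \<Rightarrow> real \<Rightarrow> (complex^'n \<Rightarrow> complex) \<Rightarrow> 'n heis \<Rightarrow> complex" where
  "spherical_function dk lam v x = (\<integral>k. fock_inner lam (fock_rep lam (hact k x) v) v \<partial>dk)"

definition orthonormal_basis ::
    "real \<Rightarrow> (complex^'n \<Rightarrow> complex) set \<Rightarrow> (complex^'n \<Rightarrow> complex) set \<Rightarrow> bool" where
  "orthonormal_basis lam V B \<longleftrightarrow> finite B \<and> B \<subseteq> V \<and> cfun.span B = V \<and>
     (\<forall>u\<in>B. \<forall>v\<in>B. fock_inner lam u v = (if u = v then 1 else 0))"

text \<open>The value does not depend on the chosen orthonormal basis.\<close>

definition op_inner ::
    "real \<Rightarrow> (complex^'n \<Rightarrow> complex) set \<Rightarrow>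
     ((complex^'n \<Rightarrow> complex) \<Rightarrow> complex^'n \<Rightarrow> complex) \<Rightarrow>
     ((complex^'n \<Rightarrow> complex) \<Rightarrow> complex^'n \<Rightarrow> complex) \<Rightarrow> complex" where
  "op_inner lam V R R' = (\<Sum>v\<in>(SOME B. orthonormal_basis lam V B). fock_inner lam (R v) (R' v))"


section \<open>\<open>K\<close>-harmonic polynomials and the Weyl correspondence\<close>

text \<open>The coefficient of \<open>P\<close> at \<open>(\<rho>, \<gamma>)\<close> belongs to the monomial with exponent \<open>\<rho>\<close> in the
  variables \<open>z\<close> and exponent \<open>\<gamma>\<close> in their conjugates.\<close>

type_synonym 'n zpoly = "(('n \<Rightarrow> nat) \<times> ('n \<Rightarrow> nat)) \<Rightarrow>\<^sub>0 complex"

definition zpoly_eval :: "'n::finite zpoly \<Rightarrow> complex^'n \<Rightarrow> complex" where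
  "zpoly_eval P z = (\<Sum>(\<rho>, \<gamma>)\<in>Poly_Mapping.keys P.
     Poly_Mapping.lookup P (\<rho>, \<gamma>) * cmonom \<rho> z * cmonom \<gamma> (vec_cnj z))"

definition K_harmonic :: "(complex^'n^'n) set \<Rightarrow> 'n zpoly \<Rightarrow> bool" where
  "K_harmonic K P \<longleftrightarrow>
     (\<forall>q :: (complex^'n \<Rightarrow> nat) \<Rightarrow>\<^sub>0 complex.
        (\<forall>k\<in>K. \<forall>z. rpoly_eval q (k *v z) = rpoly_eval q z) \<longrightarrow> rpoly_eval q 0 = 0 \<longrightarrow>
        (\<forall>z. rpoly_op q (zpoly_eval P) z = 0))"

definition mult_op :: "real \<Rightarrow> 'n::finite \<Rightarrow> (complex^'n \<Rightarrow> complex) \<Rightarrow> complex^'n \<Rightarrow> complex" where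
  "mult_op lam j u = (\<lambda>w. of_real (2 * \<bar>lam\<bar>) * w $ j * u w)"

definition hol_deriv_op :: "'n::finite \<Rightarrow> (complex^'n \<Rightarrow> complex) \<Rightarrow> complex^'n \<Rightarrow> complex" where
  "hol_deriv_op j u = (\<lambda>w. deriv (\<lambda>s. u (w + axis j s)) 0)"

definition W_op :: "real \<Rightarrow> 'n::finite \<Rightarrow> (complex^'n \<Rightarrow> complex) \<Rightarrow> complex^'n \<Rightarrow> complex" where
  "W_op lam j = (if lam > 0 then hol_deriv_op j else mult_op lam j)"

definition Wbar_op :: "real \<Rightarrow> 'n::finite \<Rightarrow> (complex^'n \<Rightarrow> complex) \<Rightarrow> complex^'n \<Rightarrow> complex" where
  "Wbar_op lam j = (if lam > 0 then mult_op lam j else hol_deriv_op j)"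

definition weyl ::
    "real \<Rightarrow> 'n::finite zpoly \<Rightarrow> (complex^'n \<Rightarrow> complex) \<Rightarrow> complex^'n \<Rightarrow> complex" where
  "weyl lam P u = (\<lambda>w. \<Sum>(\<rho>, \<gamma>)\<in>Poly_Mapping.keys P. Poly_Mapping.lookup P (\<rho>, \<gamma>) * (1 / 2) *
     (ops_power UNIV (Wbar_op lam) \<gamma> (ops_power UNIV (W_op lam) \<rho> u) w +
      ops_power UNIV (W_op lam) \<rho> (ops_power UNIV (Wbar_op lam) \<gamma> u) w))"

end

theory Submission
  imports Defs "HOL-Probability.Distributions" "HOL-Computational_Algebra.Fundamental_Theorem_Algebra"
begin

text \<open>
  Write \<open>f (z, t) = exp (\<i> * lam * t) * g z\<close>, using the eigenvalue of \<open>d/dt\<close>, and pair \<open>g\<close> with the conjugates of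
  the matrix coefficients \<open>mc u v\<close> of the Fock representation, for polynomials \<open>u\<close> and \<open>v\<close>. The growth condition makes
  the pairings converge, and they determine \<open>g\<close>, because the matrix coefficients span the polynomials times a Gaussian.
  An invariant tensor in the generators gives both an invariant differential operator and an operator on polynomials
  that commutes with \<open>K\<close>, hence is scalar on every \<open>V \<beta>\<close>. Averages of such tensors over \<open>K\<close> separate \<open>V \<alpha>\<close> from \<open>V \<beta>\<close>, since
  words in the generators act densely; integrating by parts against a cutoff, the pairing vanishes for \<open>u \<in> V \<beta>\<close>,
  \<open>\<beta> \<noteq> \<alpha>\<close>. By \<open>K\<close>-finiteness it also vanishes for \<open>v \<in> V \<gamma>\<close> for all but finitely many \<open>\<gamma>\<close>. The Moyal orthogonality
  relations then express \<open>g\<close> as a finite sum of matrix coefficients \<open>mc e (R e)\<close>, \<open>e\<close> in an orthonormal basis of \<open>V \<alpha>\<close>.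
  By density \<open>R\<close> is the restriction to \<open>V \<alpha>\<close> of a polynomial in the generators. Its symbol splits by the Fischer
  decomposition into a harmonic part and multiples of invariants; the latter act as scalars on \<open>V \<alpha>\<close> up to terms of
  lower order, so induction on the order makes the symbol harmonic.
\<close>

section \<open>Smooth functions\<close>

text \<open>The growth hypothesis bounds \<open>g\<close> but none of its derivatives, whereas an
  eigenvalue equation is a statement on derivatives of \<open>g\<close>. All derivatives are
  therefore moved to the matrix coefficient before any limit is taken: the error terms of the cutoff
  contain \<open>g\<close> undifferentiated, with a positive power of a small parameter in front.
  The margin \<epsilon> in the growth condition serves twice. It makes the pairings converge, and it
  makes exponential series converge under the integral, so that moments determine the function. The
  inner product of the Fischer decomposition is the Fock inner product with parameter 1/2 in twice
  as many variables, where z and its conjugate become independent. Both signs of \<open>lam\<close>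
  are treated at once: \<open>op\<close>, \<open>swap\<close>, \<open>ks\<close> and
  \<open>av\<close> hide the exchange of derivatives and multiplications.\<close>

lemma smooth_differentiable: "smooth f \<Longrightarrow> f differentiable (at x)"
  unfolding smooth_def by (metis foldr.simps(1) id_apply)

lemma smooth_dir_deriv: "smooth f \<Longrightarrow> smooth (dir_deriv b f)"
  unfolding smooth_def
proof (intro allI)
  fix bs x assume "\<forall>bs x. foldr dir_deriv bs f differentiable (at x)"
  then have "foldr dir_deriv (bs @ [b]) f differentiable (at x)" by blast
  then show "foldr dir_deriv bs (dir_deriv b f) differentiable (at x)" by simp
qed

text \<open>Smoothness is the largest class of differentiable functions stable under
  \<open>dir_deriv\<close>. It is proved below by exhibiting such a class, in place of an induction
  on the order of the derivative.\<close>

lemma smooth_coinduct: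
  assumes "f \<in> C" and "\<And>f x. f \<in> C \<Longrightarrow> f differentiable (at x)"
    and "\<And>f b. f \<in> C \<Longrightarrow> dir_deriv b f \<in> C"
  shows "smooth f"
proof -
  have "foldr dir_deriv bs f \<in> C" for bs
    by (induction bs) (auto simp: assms)
  then show ?thesis unfolding smooth_def using assms(2) by blast
qed

lemma dir_deriv_eqI: "(f has_derivative D) (at x) \<Longrightarrow> dir_deriv b f x = D b"
  unfolding dir_deriv_def using frechet_derivative_at by metis

lemma smooth_has_derivative: "smooth f \<Longrightarrow> (f has_derivative (\<lambda>b. dir_deriv b f x)) (at x)"
  using smooth_differentiable[of f x] frechet_derivative_works unfolding dir_deriv_def by blast

lemma differentiable_has_derivative:
  "f differentiable (at x) \<Longrightarrow> (f has_derivative (\<lambda>b. dir_deriv b f x)) (at x)"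
  using frechet_derivative_works unfolding dir_deriv_def by blast

lemma smooth_continuous: "smooth f \<Longrightarrow> continuous_on S f"
  by (meson continuous_at_imp_continuous_on differentiable_imp_continuous_within smooth_differentiable)

lemma dir_deriv_add: "f differentiable (at x) \<Longrightarrow> g differentiable (at x) \<Longrightarrow>
   dir_deriv b (\<lambda>y. f y + g y) x = dir_deriv b f x + dir_deriv b g x"
  by (rule dir_deriv_eqI[where D="\<lambda>b. dir_deriv b f x + dir_deriv b g x"])
     (auto intro!: has_derivative_add differentiable_has_derivative)

lemma dir_deriv_mult: "f differentiable (at x) \<Longrightarrow> g differentiable (at x) \<Longrightarrow>
   dir_deriv b (\<lambda>y. f y * g y) x = dir_deriv b f x * g x + f x * dir_deriv b g x"
  by (rule dir_deriv_eqI[where D="\<lambda>b. dir_deriv b f x * g x + f x * dir_deriv b g x"])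
     (auto intro!: derivative_eq_intros differentiable_has_derivative)

lemma dir_deriv_const [simp]: "dir_deriv b (\<lambda>x. c) = (\<lambda>x. 0)"
  by (auto simp: dir_deriv_def)

lemma dir_deriv_cmult: "f differentiable (at x) \<Longrightarrow> dir_deriv b (\<lambda>y. c * f y) x = c * dir_deriv b f x"
  by (subst dir_deriv_mult) auto

lemma dir_deriv_sum: "finite S \<Longrightarrow> (\<And>i. i \<in> S \<Longrightarrow> f i differentiable (at x)) \<Longrightarrow>
   dir_deriv b (\<lambda>y. \<Sum>i\<in>S. f i y) x = (\<Sum>i\<in>S. dir_deriv b (f i) x)"
  by (rule dir_deriv_eqI[where D="\<lambda>b. \<Sum>i\<in>S. dir_deriv b (f i) x"])
     (auto intro!: has_derivative_sum differentiable_has_derivative)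

lemma dir_deriv_linear: "f differentiable (at x) \<Longrightarrow>
   dir_deriv (r *\<^sub>R b + s *\<^sub>R b') f x = of_real r * dir_deriv b f x + of_real s * dir_deriv b' f x"
proof -
  assume "f differentiable (at x)"
  then have "linear (\<lambda>b. dir_deriv b f x)"
    using differentiable_has_derivative has_derivative_linear by blast
  from linear_add[OF this] linear_scale[OF this] show ?thesis by (simp add: scaleR_conv_of_real)
qed

lemma dir_deriv_linear_sum: "f differentiable (at x) \<Longrightarrow>
   dir_deriv (\<Sum>i\<in>S. r i *\<^sub>R b i) f x = (\<Sum>i\<in>S. of_real (r i) * dir_deriv (b i) f x)"
proof -
  assume "f differentiable (at x)"
  then have "linear (\<lambda>b. dir_deriv b f x)"
    using differentiable_has_derivative has_derivative_linear by blast
  from linear_sum[OF this, of "\<lambda>i. r i *\<^sub>R b i" S] linear_scale[OF this] show ?thesis by (simp add: scaleR_conv_of_real)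
qed

lemma smooth_const [simp]: "smooth (\<lambda>x. c)"
  by (rule smooth_coinduct[where C="range (\<lambda>c x. c)"]) auto

lemma smooth_bounded_linear: "bounded_linear L \<Longrightarrow> smooth L"
proof (rule smooth_coinduct[where C="insert L (range (\<lambda>c x. c))"])
  assume L: "bounded_linear L"
  then have D: "(L has_derivative L) (at x)" for x by (rule bounded_linear_imp_has_derivative)
  have "dir_deriv b L = (\<lambda>x. L b)" for b
    by (rule ext, rule dir_deriv_eqI[OF D])
  then show "f \<in> insert L (range (\<lambda>c x. c)) \<Longrightarrow> dir_deriv b f \<in> insert L (range (\<lambda>c x. c))" for f b
    by auto
  show "f \<in> insert L (range (\<lambda>c x. c)) \<Longrightarrow> f differentiable at x" for f x
    using D differentiableI by auto
qed simp

text \<open>The product rule turns a product into a sum of products, so sums and products are closed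
  up together to obtain a class for \<open>smooth_coinduct\<close>.\<close>

inductive_set smooth_closure :: "('a::euclidean_space \<Rightarrow> complex) set" where
  base: "smooth f \<Longrightarrow> f \<in> smooth_closure"
| add: "f \<in> smooth_closure \<Longrightarrow> g \<in> smooth_closure \<Longrightarrow> (\<lambda>x. f x + g x) \<in> smooth_closure"
| mult: "f \<in> smooth_closure \<Longrightarrow> g \<in> smooth_closure \<Longrightarrow> (\<lambda>x. f x * g x) \<in> smooth_closure"

lemma smooth_closure_smooth: "f \<in> smooth_closure \<Longrightarrow> smooth f"
proof (rule smooth_coinduct[where C=smooth_closure])
  show diff: "f \<in> smooth_closure \<Longrightarrow> f differentiable (at x)" for f :: "'a \<Rightarrow> complex" and x
    by (induction rule: smooth_closure.induct) (auto intro: smooth_differentiable)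
  show "f \<in> smooth_closure \<Longrightarrow> dir_deriv b f \<in> smooth_closure" for f :: "'a \<Rightarrow> complex" and b
  proof (induction rule: smooth_closure.induct)
    case (base f) then show ?case by (simp add: smooth_closure.base smooth_dir_deriv)
  next
    case (add f g)
    have "dir_deriv b (\<lambda>x. f x + g x) = (\<lambda>x. dir_deriv b f x + dir_deriv b g x)"
      using add diff by (auto intro!: dir_deriv_add)
    then show ?case using add by (simp add: smooth_closure.add)
  next
    case (mult f g)
    have "dir_deriv b (\<lambda>x. f x * g x) = (\<lambda>x. dir_deriv b f x * g x + f x * dir_deriv b g x)"
      using mult diff by (auto intro!: dir_deriv_mult)
    then show ?case using mult by (simp add: smooth_closure.add smooth_closure.mult)
  qed
qed

lemma smooth_add: "smooth f \<Longrightarrow> smooth g \<Longrightarrow> smooth (\<lambda>x. f x + g x)"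
  by (intro smooth_closure_smooth[OF smooth_closure.add] smooth_closure.base)

lemma smooth_mult: "smooth f \<Longrightarrow> smooth g \<Longrightarrow> smooth (\<lambda>x. f x * g x)"
  by (intro smooth_closure_smooth[OF smooth_closure.mult] smooth_closure.base)

lemma smooth_sum: "(\<And>i. i \<in> S \<Longrightarrow> smooth (f i)) \<Longrightarrow> smooth (\<lambda>x. \<Sum>i\<in>S. f i x)"
  by (induction S rule: infinite_finite_induct) (auto intro: smooth_add)

lemma has_derivative_cexp:
  fixes h :: "'a::real_normed_vector \<Rightarrow> complex"
  assumes "(h has_derivative h') (at x)"
  shows "((\<lambda>x. exp (h x)) has_derivative (\<lambda>b. exp (h x) * h' b)) (at x)"
  using has_derivative_compose[OF assms, of exp "(*) (exp (h x))"] DERIV_exp[of "h x"]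
  by (simp add: has_field_derivative_def)

lemma smooth_exp:
  assumes "smooth f" shows "smooth (\<lambda>x. exp (f x))"
\<comment> \<open>The class consists of the smooth multiples of the exponential, since the
  derivative of such a multiple is again one.\<close>
proof (rule smooth_coinduct[where C="{\<lambda>x. g x * exp (f x) |g. smooth g}"])
  show "(\<lambda>x. exp (f x)) \<in> {\<lambda>x. g x * exp (f x) |g. smooth g}"
    by (rule CollectI, rule exI[of _ "\<lambda>x. 1"]) simp
  have D: "((\<lambda>x. g x * exp (f x)) has_derivative
      (\<lambda>b. (dir_deriv b g x + g x * dir_deriv b f x) * exp (f x))) (at x)" if "smooth g" for g x
    using has_derivative_mult[OF smooth_has_derivative[OF that] has_derivative_cexp[OF smooth_has_derivative[OF assms]]]
    by (simp add: algebra_simps)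
  show "h differentiable at x" if "h \<in> {\<lambda>x. g x * exp (f x) |g. smooth g}" for h x
    using that D differentiableI by blast
  show "dir_deriv b h \<in> {\<lambda>x. g x * exp (f x) |g. smooth g}"
    if "h \<in> {\<lambda>x. g x * exp (f x) |g. smooth g}" for h b
  proof -
    from that obtain g where g: "smooth g" "h = (\<lambda>x. g x * exp (f x))" by blast
    have "dir_deriv b h = (\<lambda>x. (dir_deriv b g x + g x * dir_deriv b f x) * exp (f x))"
      unfolding g(2) by (rule ext, rule dir_deriv_eqI[OF D[OF g(1)]])
    moreover have "smooth (\<lambda>x. dir_deriv b g x + g x * dir_deriv b f x)"
      by (intro smooth_add smooth_mult smooth_dir_deriv g(1) assms)
    ultimately show ?thesis by (intro CollectI exI[of _ "\<lambda>x. dir_deriv b g x + g x * dir_deriv b f x"]) simp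
  qed
qed

lemma dir_deriv_affine:
  fixes f :: "'b::euclidean_space \<Rightarrow> complex" and A :: "'a::euclidean_space \<Rightarrow> 'b"
  assumes "f differentiable (at (A x + c))" "linear A"
  shows "dir_deriv b (\<lambda>x. f (A x + c)) x = dir_deriv (A b) f (A x + c)"
proof (rule dir_deriv_eqI)
  have "((\<lambda>x. A x + c) has_derivative A) (at x)"
    using assms(2) by (auto intro!: derivative_eq_intros bounded_linear_imp_has_derivative simp: linear_conv_bounded_linear)
  from has_derivative_compose[OF this differentiable_has_derivative[OF assms(1)]]
  show "((\<lambda>x. f (A x + c)) has_derivative (\<lambda>b. dir_deriv (A b) f (A x + c))) (at x)" .
qed

lemma smooth_affine:
  fixes f :: "'b::euclidean_space \<Rightarrow> complex" and A :: "'a::euclidean_space \<Rightarrow> 'b"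
  assumes "smooth f" "linear A"
  shows "smooth (\<lambda>x. f (A x + c))"
proof (rule smooth_coinduct[where C="{\<lambda>x. f (A x + c) |f. smooth f}"])
  have aff: "((\<lambda>x. A x + c) has_derivative A) (at x)" for x
    using assms(2) by (auto intro!: derivative_eq_intros bounded_linear_imp_has_derivative simp: linear_conv_bounded_linear)
  show "g differentiable at x" if "g \<in> {\<lambda>x. f (A x + c) |f. smooth f}" for g x
  proof -
    from that obtain f where f: "smooth f" "g = (\<lambda>x. f (A x + c))" by blast
    show ?thesis unfolding f(2)
      using has_derivative_compose[OF aff smooth_has_derivative[OF f(1)]] differentiableI by blast
  qed
  show "dir_deriv b g \<in> {\<lambda>x. f (A x + c) |f. smooth f}" if "g \<in> {\<lambda>x. f (A x + c) |f. smooth f}" for g b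
  proof -
    from that obtain f where f: "smooth f" "g = (\<lambda>x. f (A x + c))" by blast
    have "dir_deriv b g = (\<lambda>x. dir_deriv (A b) f (A x + c))"
      unfolding f(2) using dir_deriv_affine[OF smooth_differentiable[OF f(1)] assms(2)] by auto
    then show ?thesis using smooth_dir_deriv[OF f(1)] by blast
  qed
qed (use assms in blast)

text \<open>The mean value theorem is applied to a second difference, along \<open>a\<close> and
  then along \<open>b\<close>. The second difference is symmetric in \<open>a\<close> and
  \<open>b\<close>, so it can be evaluated through the other mixed derivative as well.\<close>

lemma mixed_derivative_mvt:
  fixes h :: "'a::real_normed_vector \<Rightarrow> real"
  assumes h: "\<And>x. (h has_derivative h' x) (at x)" and ha: "\<And>x. ((\<lambda>x. h' x a) has_derivative h'' x) (at x)"
    and s: "s > 0"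
  obtains \<xi> \<eta> where "0 < \<xi>" "\<xi> < s" "0 < \<eta>" "\<eta> < s"
    "h (x + s *\<^sub>R a + s *\<^sub>R b) - h (x + s *\<^sub>R a) - h (x + s *\<^sub>R b) + h x = s\<^sup>2 * h'' (x + \<xi> *\<^sub>R a + \<eta> *\<^sub>R b) b"
proof -
  define G where "G = (\<lambda>t. h (x + t *\<^sub>R a + s *\<^sub>R b) - h (x + t *\<^sub>R a))"
  have lin: "linear (h' y)" "linear (h'' y)" for y using h ha has_derivative_linear by blast+
  have G: "(G has_real_derivative h' (x + t *\<^sub>R a + s *\<^sub>R b) a - h' (x + t *\<^sub>R a) a) (at t)" for t
    unfolding G_def has_field_derivative_def
    by (rule derivative_eq_intros has_derivative_compose[of _ _ _ _ h, OF _ h] refl)+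
       (auto simp: fun_eq_iff linear_scale[OF lin(1)] algebra_simps)
  obtain \<xi> where \<xi>: "0 < \<xi>" "\<xi> < s" "G s - G 0 = (s - 0) * (h' (x + \<xi> *\<^sub>R a + s *\<^sub>R b) a - h' (x + \<xi> *\<^sub>R a) a)"
    using MVT2[OF s, of G, OF G] by blast
  define H where "H = (\<lambda>t. h' (x + \<xi> *\<^sub>R a + t *\<^sub>R b) a)"
  have H: "(H has_real_derivative h'' (x + \<xi> *\<^sub>R a + t *\<^sub>R b) b) (at t)" for t
  proof -
    have "((\<lambda>t. x + \<xi> *\<^sub>R a + t *\<^sub>R b) has_derivative (\<lambda>r. r *\<^sub>R b)) (at t)"
      by (auto intro!: derivative_eq_intros)
    from has_derivative_compose[OF this ha] show ?thesis
      unfolding H_def has_field_derivative_def by (simp add: linear_scale[OF lin(2)] mult_commute_abs)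
  qed
  obtain \<eta> where \<eta>: "0 < \<eta>" "\<eta> < s" "H s - H 0 = (s - 0) * h'' (x + \<xi> *\<^sub>R a + \<eta> *\<^sub>R b) b"
    using MVT2[OF s, of H, OF H] by blast
  show ?thesis
    using that[OF \<xi>(1,2) \<eta>(1,2)] \<xi>(3) \<eta>(3) by (simp add: G_def H_def power2_eq_square algebra_simps)
qed

lemma mixed_derivatives_commute_real:
  fixes h :: "'a::real_normed_vector \<Rightarrow> real"
  assumes h: "\<And>x. (h has_derivative h' x) (at x)" and ha: "\<And>x. ((\<lambda>x. h' x a) has_derivative ha x) (at x)"
    and hb: "\<And>x. ((\<lambda>x. h' x b) has_derivative hb x) (at x)"
    and cont: "continuous_on UNIV (\<lambda>x. ha x b)" "continuous_on UNIV (\<lambda>x. hb x a)"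
  shows "ha x b = hb x a"
proof (rule ccontr)
  assume ne: "ha x b \<noteq> hb x a"
  define e where "e = \<bar>ha x b - hb x a\<bar> / 2"
  have e: "e > 0" using ne by (simp add: e_def)
  obtain d1 where d1: "d1 > 0" "\<And>y. dist y x < d1 \<Longrightarrow> dist (ha y b) (ha x b) < e"
    using cont(1) e unfolding continuous_on_iff by (metis UNIV_I)
  obtain d2 where d2: "d2 > 0" "\<And>y. dist y x < d2 \<Longrightarrow> dist (hb y a) (hb x a) < e"
    using cont(2) e unfolding continuous_on_iff by (metis UNIV_I)
  \<comment> \<open>The step is short enough for both intermediate points to stay within the two
    continuity radii; the summand 1 keeps the quotient defined when \<open>a\<close> and
    \<open>b\<close> are zero.\<close>
  define s where "s = min d1 d2 / (2 * (norm a + norm b + 1))"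
  have s: "s > 0" using d1(1) d2(1) by (simp add: s_def add_nonneg_pos)
  have small: "dist (x + \<xi> *\<^sub>R a + \<eta> *\<^sub>R b) x < min d1 d2"
    if "0 < \<xi>" "\<xi> < s" "0 < \<eta>" "\<eta> < s" for \<xi> \<eta>
  proof -
    have "dist (x + \<xi> *\<^sub>R a + \<eta> *\<^sub>R b) x \<le> \<xi> * norm a + \<eta> * norm b"
      using that norm_triangle_ineq[of "\<xi> *\<^sub>R a" "\<eta> *\<^sub>R b"] by (simp add: dist_norm algebra_simps)
    also have "\<dots> \<le> s * norm a + s * norm b" using that by (intro add_mono mult_right_mono) auto
    also have "\<dots> < s * (2 * (norm a + norm b + 1))" using s
      by (simp add: algebra_simps add_nonneg_pos)
    also have "\<dots> = min d1 d2" using norm_ge_zero[of a] norm_ge_zero[of b]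
      unfolding s_def by (simp add: add_nonneg_eq_0_iff)
    finally show ?thesis .
  qed
  obtain \<xi> \<eta> where 1: "0 < \<xi>" "\<xi> < s" "0 < \<eta>" "\<eta> < s"
    "h (x + s *\<^sub>R a + s *\<^sub>R b) - h (x + s *\<^sub>R a) - h (x + s *\<^sub>R b) + h x = s\<^sup>2 * ha (x + \<xi> *\<^sub>R a + \<eta> *\<^sub>R b) b"
    using mixed_derivative_mvt[OF h ha s] by blast
  obtain \<xi>' \<eta>' where 2: "0 < \<xi>'" "\<xi>' < s" "0 < \<eta>'" "\<eta>' < s"
    "h (x + s *\<^sub>R b + s *\<^sub>R a) - h (x + s *\<^sub>R b) - h (x + s *\<^sub>R a) + h x = s\<^sup>2 * hb (x + \<xi>' *\<^sub>R b + \<eta>' *\<^sub>R a) a"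
    using mixed_derivative_mvt[OF h hb s] by blast
  have "s\<^sup>2 * ha (x + \<xi> *\<^sub>R a + \<eta> *\<^sub>R b) b = s\<^sup>2 * hb (x + \<eta>' *\<^sub>R a + \<xi>' *\<^sub>R b) a"
    using 1(5) 2(5) by (simp add: algebra_simps)
  then have "ha (x + \<xi> *\<^sub>R a + \<eta> *\<^sub>R b) b = hb (x + \<eta>' *\<^sub>R a + \<xi>' *\<^sub>R b) a" using s by simp
  moreover have "dist (ha (x + \<xi> *\<^sub>R a + \<eta> *\<^sub>R b) b) (ha x b) < e" using d1(2) small[OF 1(1-4)] by simp
  moreover have "dist (hb (x + \<eta>' *\<^sub>R a + \<xi>' *\<^sub>R b) a) (hb x a) < e" using d2(2) small[OF 2(3,4,1,2)] by simp
  ultimately have "\<bar>ha x b - hb x a\<bar> < e + e" unfolding dist_real_def by linarith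
  then show False unfolding e_def by simp
qed

text \<open>The mean value theorem requires real values, hence the split into real and imaginary
  parts.\<close>

lemma dir_deriv_commute:
  assumes f: "smooth f"
  shows "dir_deriv a (dir_deriv b f) = dir_deriv b (dir_deriv a f)"
proof
  fix x
  note D = smooth_has_derivative
  note c = smooth_continuous[OF smooth_dir_deriv[OF smooth_dir_deriv[OF f]]]
  have "Re (dir_deriv a (dir_deriv b f) x) = Re (dir_deriv b (dir_deriv a f) x)"
    by (rule mixed_derivatives_commute_real[of "\<lambda>x. Re (f x)" "\<lambda>x v. Re (dir_deriv v f x)" b
          "\<lambda>x v. Re (dir_deriv v (dir_deriv b f) x)" a "\<lambda>x v. Re (dir_deriv v (dir_deriv a f) x)"])
       (intro has_derivative_Re D f smooth_dir_deriv continuous_on_Re c)+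
  moreover have "Im (dir_deriv a (dir_deriv b f) x) = Im (dir_deriv b (dir_deriv a f) x)"
    by (rule mixed_derivatives_commute_real[of "\<lambda>x. Im (f x)" "\<lambda>x v. Im (dir_deriv v f x)" b
          "\<lambda>x v. Im (dir_deriv v (dir_deriv b f) x)" a "\<lambda>x v. Im (dir_deriv v (dir_deriv a f) x)"])
       (intro has_derivative_Im D f smooth_dir_deriv continuous_on_Im c)+
  ultimately show "dir_deriv a (dir_deriv b f) x = dir_deriv b (dir_deriv a f) x"
    by (simp add: complex_eq_iff)
qed

section \<open>Integration on Euclidean spaces\<close>

lemma continuous_lborel: "continuous_on UNIV f \<Longrightarrow> f \<in> borel_measurable lborel"
  unfolding measurable_lborel2 by (rule borel_measurable_continuous_onI)

text \<open>Translation invariance makes the integral of \<open>h (x + b) - h x\<close> vanish. By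
  Fubini it is also the average over t in [0,1] of the integrals of the derivative at
  \<open>x + t *\<^sub>R b\<close>, and these are all equal. Integrability of \<open>h\<close> and
  of the derivative thus suffices, without any rate of decay.\<close>

lemma integral_dir_deriv_zero:
  fixes h :: "'a::euclidean_space \<Rightarrow> complex"
  assumes h: "\<And>x. (h has_derivative D x) (at x)" and c: "continuous_on UNIV (\<lambda>x. D x b)"
    and i: "integrable lborel h" "integrable lborel (\<lambda>x. D x b)"
  shows "(\<integral>x. D x b \<partial>lborel) = 0"
proof -
  let ?M = "lborel :: 'a measure"
  have cm[measurable]: "(\<lambda>x. D x b) \<in> borel_measurable borel" using c by (rule borel_measurable_continuous_onI)
  define F where "F = (\<lambda>(t::real, x). indicator {0..1} t *\<^sub>R D (x + t *\<^sub>R b) b)"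
  have [measurable]: "F \<in> borel_measurable (lborel \<Otimes>\<^sub>M ?M)"
    unfolding F_def by (measurable; simp)
  have shift: "(\<integral>x. g (x + t *\<^sub>R b) \<partial>?M) = (\<integral>x. g x \<partial>?M)" if "g \<in> borel_measurable borel" for g :: "'a \<Rightarrow> complex" and t
    by (subst (2) lborel_distr_plus[of "t *\<^sub>R b", symmetric], subst integral_distr) (use that in \<open>auto simp: add.commute\<close>)
  have shift': "integrable ?M (\<lambda>x. g (x + t *\<^sub>R b))" if "integrable ?M g" for g :: "'a \<Rightarrow> 'c::{banach,second_countable_topology}" and t
  proof -
    have "integrable (distr lborel borel ((+) (t *\<^sub>R b))) g" using that by (simp only: lborel_distr_plus)
    then show ?thesis by (subst (asm) integrable_distr_eq) (use that in \<open>auto simp: add.commute\<close>)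
  qed
  have inn: "(\<integral>x. F (t, x) \<partial>?M) = indicator {0..1} t *\<^sub>R (\<integral>x. D x b \<partial>?M)" for t
    unfolding F_def using shift[of "\<lambda>x. D x b" t] cm by simp
  have "integrable (lborel \<Otimes>\<^sub>M ?M) F"
  proof (rule integrableI_bounded)
    have "(\<integral>\<^sup>+x. norm (F (t, x)) \<partial>?M) = indicator {0..1} t * (\<integral>\<^sup>+x. norm (D x b) \<partial>?M)" for t
    proof -
      have "(\<integral>\<^sup>+x. norm (D (x + t *\<^sub>R b) b) \<partial>?M) = (\<integral>\<^sup>+x. norm (D x b) \<partial>?M)"
        by (subst (2) lborel_distr_plus[of "t *\<^sub>R b", symmetric], subst nn_integral_distr) (use cm in \<open>auto simp: add.commute\<close>)
      then show ?thesis unfolding F_def by (simp split: split_indicator)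
    qed
    moreover have "(\<integral>\<^sup>+x. norm (D x b) \<partial>?M) < \<infinity>" using i(2) by (simp add: integrable_iff_bounded)
    ultimately show "(\<integral>\<^sup>+z. norm (F z) \<partial>(lborel \<Otimes>\<^sub>M ?M)) < \<infinity>"
      by (subst lborel.nn_integral_fst[symmetric]) (auto simp: nn_integral_multc)
  qed simp
  then have I: "integrable (lborel \<Otimes>\<^sub>M ?M) (case_prod (\<lambda>t x. F (t, x)))" by simp
  have "(\<integral>x. D x b \<partial>?M) = (\<integral>t. (\<integral>x. F (t, x) \<partial>?M) \<partial>lborel)"
    unfolding inn by simp
  also have "\<dots> = (\<integral>x. (\<integral>t. F (t, x) \<partial>lborel) \<partial>?M)"
    using lborel_pair.Fubini_integral[OF I] by simp
  also have "\<dots> = (\<integral>x. h (x + 1 *\<^sub>R b) - h x \<partial>?M)"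
  proof (rule Bochner_Integration.integral_cong[OF refl])
    fix x
    have lin: "linear (D y)" for y using h has_derivative_linear by blast
    have "(\<integral>t. indicator {0..1} t *\<^sub>R D (x + t *\<^sub>R b) b \<partial>lborel) = h (x + 1 *\<^sub>R b) - h (x + 0 *\<^sub>R b)"
    proof (rule integral_FTC_Icc)
      show "((\<lambda>t. h (x + t *\<^sub>R b)) has_vector_derivative D (x + t *\<^sub>R b) b) (at t within {0..1})" for t
      proof -
        have "((\<lambda>t. x + t *\<^sub>R b) has_derivative (\<lambda>r. r *\<^sub>R b)) (at t within {0..1})"
          by (auto intro!: derivative_eq_intros)
        from has_derivative_compose[OF this h] show ?thesis
          unfolding has_vector_derivative_def by (simp add: linear_scale[OF lin])
      qed
      show "continuous_on {0..1} (\<lambda>t. D (x + t *\<^sub>R b) b)"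
        by (rule continuous_on_compose2[OF c]) (auto intro!: continuous_intros)
    qed simp
    then show "(\<integral>t. F (t, x) \<partial>lborel) = h (x + 1 *\<^sub>R b) - h x" unfolding F_def by simp
  qed
  also have "\<dots> = 0"
    using shift[of h 1] shift'[OF i(1), of 1] i(1) by simp
  finally show ?thesis .
qed

lemma gaussian_integrable:
  fixes \<delta> :: real assumes "\<delta> > 0"
  shows "integrable lborel (\<lambda>x::'a::euclidean_space. exp (- \<delta> * (norm x)\<^sup>2))"
proof (rule integrableI_nonneg)
  have 1: "integrable lborel (\<lambda>x::real. exp (- \<delta> * x\<^sup>2))"
  proof -
    have "integrable lborel (\<lambda>x::real. std_normal_density x)"
      by (intro integrable_normal_density) simp
    \<comment> \<open>The rescaling turns the exponent -x^2/2 of the normal density into -\<delta>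
      x^2.\<close>
    then have "integrable lborel (\<lambda>x::real. std_normal_density (0 + sqrt (2 * \<delta>) * x))"
      using assms by (intro lborel_integrable_real_affine) auto
    then have "integrable lborel (\<lambda>x::real. sqrt (2 * pi) * std_normal_density (0 + sqrt (2 * \<delta>) * x))"
      by (rule integrable_mult_right)
    then show ?thesis using assms by (simp add: std_normal_density_def power_mult_distrib)
  qed
  have eq: "ennreal (exp (- \<delta> * (norm x)\<^sup>2)) = (\<Prod>b\<in>Basis. ennreal (exp (- \<delta> * (x \<bullet> b)\<^sup>2)))" for x :: 'a
  proof -
    have "(norm x)\<^sup>2 = (\<Sum>b\<in>Basis. (x \<bullet> b)\<^sup>2)"
      unfolding power2_norm_eq_inner by (subst euclidean_inner) (simp add: power2_eq_square)
    then show ?thesis by (simp add: sum_distrib_left exp_sum prod_ennreal sum_negf[symmetric])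
  qed
  have "(\<integral>\<^sup>+x. ennreal (exp (- \<delta> * (norm (x::'a))\<^sup>2)) \<partial>lborel) = (\<Prod>b\<in>(Basis::'a set). \<integral>\<^sup>+x. ennreal (exp (- \<delta> * x\<^sup>2)) \<partial>lborel)"
    unfolding eq by (rule nn_integral_lborel_prod) auto
  also have "\<dots> < \<infinity>"
    using 1 nn_integral_eq_integral[OF 1]
    by (simp add: power_less_top_ennreal)
  finally show "(\<integral>\<^sup>+x. ennreal (exp (- \<delta> * (norm (x::'a))\<^sup>2)) \<partial>lborel) < \<infinity>" .
qed (auto intro!: borel_measurable_continuous_onI continuous_intros)

text \<open>Invariance of Lebesgue measure under an isometry \<open>T\<close> follows from translation invariance alone:
  integrate \<open>f (T y) * G (x - T y)\<close> over \<open>x\<close> and \<open>y\<close> in both orders, with the rotation invariant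
  Gaussian \<open>G\<close>.\<close>

lemma lborel_distr_isometry:
  fixes T :: "'a::euclidean_space \<Rightarrow> 'a"
  assumes lin: "linear T" and iso: "\<And>x. norm (T x) = norm x"
  shows "distr lborel borel T = lborel"
proof (rule measure_eqI)
  define G where "G = (\<lambda>x::'a. ennreal (exp (- 1 * (norm x)\<^sup>2)))"
  have [measurable]: "G \<in> borel_measurable borel"
    unfolding G_def by (auto intro!: borel_measurable_continuous_onI continuous_intros measurable_compose[OF _ measurable_ennreal])
  have T[measurable]: "T \<in> borel_measurable borel"
    using lin by (simp add: borel_measurable_continuous_onI linear_continuous_on linear_linear)
  have GT: "G (T x) = G x" for x by (simp add: G_def iso)
  have inj: "inj T" using iso lin by (metis linear_injective_0 norm_eq_zero)
  then have "surj T" using lin linear_injective_imp_surjective by blast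
  define S where "S = inv T"
  have S: "T (S x) = x" for x unfolding S_def using \<open>surj T\<close> by (simp add: surj_f_inv_f)
  have shift: "(\<integral>\<^sup>+x. g (x + c) \<partial>lborel) = (\<integral>\<^sup>+x. g x \<partial>lborel)"
    if [measurable]: "g \<in> borel_measurable borel" for g :: "'a \<Rightarrow> ennreal" and c
    by (subst (2) lborel_distr_plus[of c, symmetric], subst nn_integral_distr) (auto simp: add.commute)
  define c where "c = (\<integral>\<^sup>+x. G x \<partial>lborel)"
  have fin: "c < \<infinity>"
    using gaussian_integrable[of 1, where 'a='a] unfolding c_def G_def by (simp add: nn_integral_eq_integral)
  have pos: "c \<noteq> 0"
  proof
    assume "c = 0"
    then have "AE x in lborel. G x = 0" unfolding c_def by (subst (asm) nn_integral_0_iff_AE) auto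
    then have "AE x::'a in lborel. False" by (simp add: G_def)
    then have "ae_filter (lborel::'a measure) = bot" by (simp add: trivial_limit_def)
    then show False by (simp add: ae_filter_eq_bot_iff)
  qed
  have main: "(\<integral>\<^sup>+y. f (T y) \<partial>lborel) = (\<integral>\<^sup>+y. f y \<partial>lborel)"
    if [measurable]: "f \<in> borel_measurable borel" for f :: "'a \<Rightarrow> ennreal"
  proof -
    have "(\<integral>\<^sup>+y. f (T y) \<partial>lborel) * c = (\<integral>\<^sup>+y. (\<integral>\<^sup>+x. f (T y) * G (x + - T y) \<partial>lborel) \<partial>lborel)"
      by (subst nn_integral_cmult, simp, subst shift[of G], simp, simp add: nn_integral_multc c_def)
    also have "\<dots> = (\<integral>\<^sup>+x. (\<integral>\<^sup>+y. f (T y) * G (x + - T y) \<partial>lborel) \<partial>lborel)"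
      by (rule lborel_pair.Fubini') measurable
    also have "\<dots> = (\<integral>\<^sup>+x. (\<integral>\<^sup>+y. f (T (y + S x)) * G (x + - T (y + S x)) \<partial>lborel) \<partial>lborel)"
      by (subst shift[of "\<lambda>y. f (T y) * G (_ + - T y)"]) auto
    also have "\<dots> = (\<integral>\<^sup>+x. (\<integral>\<^sup>+y. f (x + T y) * G y \<partial>lborel) \<partial>lborel)"
      by (intro nn_integral_cong) (simp add: linear_add[OF lin] S add.commute, simp add: G_def iso)
    also have "\<dots> = (\<integral>\<^sup>+y. (\<integral>\<^sup>+x. f (x + T y) * G y \<partial>lborel) \<partial>lborel)"
      by (rule lborel_pair.Fubini') measurable
    also have "\<dots> = (\<integral>\<^sup>+y. f y \<partial>lborel) * c"
      by (subst nn_integral_multc, simp, subst shift[of f], simp, simp add: nn_integral_cmult c_def)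
    finally show ?thesis using fin pos by (metis ennreal_mult_cancel_left infinity_ennreal_def mult.commute order_less_irrefl)
  qed
  show "emeasure (distr lborel borel T) A = emeasure lborel A" if "A \<in> sets (distr lborel borel T)" for A
  proof -
    from that have A[measurable]: "A \<in> sets borel" by simp
    have "emeasure (distr lborel borel T) A = (\<integral>\<^sup>+y. indicator A (T y) \<partial>lborel)"
      by (subst nn_integral_indicator[symmetric], use that in simp, subst nn_integral_distr) simp_all
    also have "\<dots> = emeasure lborel A" by (subst main) (simp_all add: nn_integral_indicator)
    finally show ?thesis .
  qed
qed simp

text \<open>The equality of integrals is claimed for every \<open>f\<close>. If \<open>f\<close> is
  not integrable, then neither is its composite, because the inverse isometry would carry
  integrability back, and both integrals are 0 by convention.\<close>

lemma integral_lborel_isometry: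
  fixes T :: "'a::euclidean_space \<Rightarrow> 'a" and f :: "'a \<Rightarrow> 'b::{banach,second_countable_topology}"
  assumes "linear T" "\<And>x. norm (T x) = norm x"
  shows "(\<integral>x. f (T x) \<partial>lborel) = (\<integral>x. f x \<partial>lborel)"
    and "integrable lborel f \<Longrightarrow> integrable lborel (\<lambda>x. f (T x))"
proof -
  have T[measurable]: "T \<in> borel_measurable borel"
    using assms(1) by (simp add: borel_measurable_continuous_onI linear_continuous_on linear_linear)
  have inj: "inj T" using assms by (metis linear_injective_0 norm_eq_zero)
  then have surj: "surj T" using assms(1) linear_injective_imp_surjective by blast
  define S where "S = inv T"
  have TS: "T (S x) = x" for x unfolding S_def using surj by (simp add: surj_f_inv_f)
  have "linear S" unfolding S_def using assms(1) inj by (rule inj_linear_imp_inv_linear)  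
  moreover have nS: "norm (S x) = norm x" for x using assms(2)[of "S x"] by (simp add: TS)
  ultimately have SD: "distr lborel borel S = lborel" by (intro lborel_distr_isometry)
  have Sm: "S \<in> borel_measurable borel"
    using \<open>linear S\<close> by (simp add: borel_measurable_continuous_onI linear_continuous_on linear_linear)
  show I: "integrable lborel (\<lambda>x. g (T x))" if "integrable lborel g" for g :: "'a \<Rightarrow> 'b"
    by (rule integrable_distr[where M'=borel]) (simp_all add: lborel_distr_isometry[OF assms] that)
  show "(\<integral>x. f (T x) \<partial>lborel) = (\<integral>x. f x \<partial>lborel)"
  proof (cases "integrable lborel f")
    case True
    have "(\<integral>x. f x \<partial>distr lborel borel T) = (\<integral>x. f (T x) \<partial>lborel)"
      by (rule integral_distr) (use True in auto)
    then show ?thesis by (simp add: lborel_distr_isometry[OF assms])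
  next
    case False
    have "\<not> integrable lborel (\<lambda>x. f (T x))"
    proof
      assume "integrable lborel (\<lambda>x. f (T x))"
      then have "integrable lborel (\<lambda>x. f (T (S x)))"
        by (intro integrable_distr[where M'=borel and T=S]) (simp_all add: SD Sm)
      then show False using False by (simp add: TS)
    qed
    then show ?thesis using False by (simp add: not_integrable_integral_eq)
  qed
qed

text \<open>All partial sums of the series are dominated by
  \<open>norm (G x) * exp (norm (h x))\<close>. The lemma turns knowledge of the integrals against
  powers of \<open>h\<close> into knowledge of the integral against
  \<open>exp (h x)\<close>.\<close>

lemma integral_exp_series:
  fixes G h :: "'a \<Rightarrow> complex"
  assumes [measurable]: "G \<in> borel_measurable M" "h \<in> borel_measurable M"
    and i: "integrable M (\<lambda>x. norm (G x) * exp (norm (h x)))"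
  shows "integrable M (\<lambda>x. G x * h x ^ k)"
    and "(\<lambda>k. (\<integral>x. G x * h x ^ k \<partial>M) / fact k) sums (\<integral>x. G x * exp (h x) \<partial>M)"
proof -
  have le: "(\<Sum>k<n. y ^ k / fact k) \<le> exp y" if "y \<ge> 0" for y :: real and n
    using sum_le_suminf[OF summable_exp_generic[of y], of "{..<n}"] that
    by (simp add: exp_def scaleR_conv_of_real divide_inverse mult.commute)
  have le1: "y ^ k / fact k \<le> exp y" if "y \<ge> 0" for y :: real and k
    using le[OF that, of "Suc k"] that sum_nonneg[of "{..<k}" "\<lambda>k. y ^ k / fact k"] by simp
  show I: "integrable M (\<lambda>x. G x * h x ^ k)" for k
  proof (rule Bochner_Integration.integrable_bound)
    show "integrable M (\<lambda>x. fact k * (norm (G x) * exp (norm (h x))))" using i by (rule integrable_mult_right)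
    have "norm (G x) * norm (h x) ^ k \<le> norm (G x) * (fact k * exp (norm (h x)))" for x
      using le1[of "norm (h x)" k] by (intro mult_left_mono) (simp_all add: field_simps)
    then show "AE x in M. norm (G x * h x ^ k) \<le> norm (fact k * (norm (G x) * exp (norm (h x))))"
      by (simp add: norm_mult norm_power abs_mult algebra_simps)
  qed simp
  have "(\<lambda>n. \<integral>x. (\<Sum>k<n. G x * h x ^ k / fact k) \<partial>M) \<longlonglongrightarrow> (\<integral>x. G x * exp (h x) \<partial>M)"
  proof (rule integral_dominated_convergence[OF _ _ i])
    have "(\<lambda>k. h x ^ k / fact k) sums exp (h x)" for x
      using summable_sums[OF summable_exp_generic[of "h x"]] by (simp add: exp_def scaleR_conv_of_real divide_inverse mult.commute)
    then have "(\<lambda>k. G x * (h x ^ k / fact k)) sums (G x * exp (h x))" for x by (rule sums_mult)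
    then show "AE x in M. (\<lambda>n. \<Sum>k<n. G x * h x ^ k / fact k) \<longlonglongrightarrow> G x * exp (h x)"
      by (simp add: sums_def)
    show "AE x in M. norm (\<Sum>k<n. G x * h x ^ k / fact k) \<le> norm (G x) * exp (norm (h x))" for n
    proof (rule AE_I2)
      fix x
      have "norm (\<Sum>k<n. G x * h x ^ k / fact k) \<le> (\<Sum>k<n. norm (G x) * (norm (h x) ^ k / fact k))"
        by (rule order_trans[OF norm_sum]) (simp add: norm_mult norm_divide norm_power)
      also have "\<dots> = norm (G x) * (\<Sum>k<n. norm (h x) ^ k / fact k)" by (simp add: sum_distrib_left)
      also have "\<dots> \<le> norm (G x) * exp (norm (h x))" by (intro mult_left_mono le) auto
      finally show "norm (\<Sum>k<n. G x * h x ^ k / fact k) \<le> norm (G x) * exp (norm (h x))" .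
    qed
  qed simp_all
  then show "(\<lambda>k. (\<integral>x. G x * h x ^ k \<partial>M) / fact k) sums (\<integral>x. G x * exp (h x) \<partial>M)"
    unfolding sums_def using I by (simp add: Bochner_Integration.integral_sum)
qed

text \<open>The factor \<open>x \<bullet> y\<close> is allowed for every direction \<open>y\<close>,
  which makes the class visibly stable under linear substitutions, by passing to the
  adjoint.\<close>

inductive_set rpolys :: "('a::euclidean_space \<Rightarrow> complex) set" where
  const: "(\<lambda>x. c) \<in> rpolys"
| add: "p \<in> rpolys \<Longrightarrow> q \<in> rpolys \<Longrightarrow> (\<lambda>x. p x + q x) \<in> rpolys"
| coord: "p \<in> rpolys \<Longrightarrow> (\<lambda>x. of_real (x \<bullet> y) * p x) \<in> rpolys"

lemma rpolys_mult: "p \<in> rpolys \<Longrightarrow> q \<in> rpolys \<Longrightarrow> (\<lambda>x. p x * q x) \<in> rpolys"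
proof (induction arbitrary: q rule: rpolys.induct)
  case (const c)
  from const show ?case
  proof (induction rule: rpolys.induct)
    case (coord p y)
    from rpolys.coord[OF coord.IH, of y] show ?case by (simp add: algebra_simps)
  qed (simp_all add: rpolys.intros distrib_left)
next
  case (add p p')
  from rpolys.add[OF add.IH(1)[OF add.prems] add.IH(2)[OF add.prems]] show ?case by (simp add: algebra_simps)
next
  case (coord p y)
  from rpolys.coord[OF coord.IH[OF coord.prems], of y] show ?case by (simp add: algebra_simps)
qed

lemma rpolys_sum: "(\<And>i. i \<in> S \<Longrightarrow> p i \<in> rpolys) \<Longrightarrow> (\<lambda>x. \<Sum>i\<in>S. p i x) \<in> rpolys"
  by (induction S rule: infinite_finite_induct) (auto intro: rpolys.intros)

lemma rpolys_inner: "(\<lambda>x. of_real (x \<bullet> y)) \<in> rpolys"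
  using rpolys.coord[OF rpolys.const[of 1], of y] by simp

lemma rpolys_norm2: "(\<lambda>x. of_real ((norm x)\<^sup>2)) \<in> rpolys"
proof -
  have "(\<lambda>x::'a. (\<Sum>b\<in>Basis. of_real (x \<bullet> b) * of_real (x \<bullet> b)) :: complex) \<in> rpolys"
    by (intro rpolys_sum rpolys_mult rpolys_inner)
  moreover have "of_real ((norm x)\<^sup>2) = (\<Sum>b\<in>Basis. of_real (x \<bullet> b) * of_real (x \<bullet> b) :: complex)" for x :: 'a
    unfolding power2_norm_eq_inner by (subst euclidean_inner) simp
  ultimately show ?thesis by presburger
qed

lemma rpolys_power: "p \<in> rpolys \<Longrightarrow> (\<lambda>x. p x ^ k) \<in> rpolys"
  by (induction k) (auto intro: rpolys_mult rpolys.const)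

lemma rpolys_smooth: "p \<in> rpolys \<Longrightarrow> smooth p"
proof (induction rule: rpolys.induct)
  case (coord p y)
  have "bounded_linear (\<lambda>x. complex_of_real (x \<bullet> y))"
    by (intro bounded_linear_compose[OF bounded_linear_of_real] bounded_linear_inner_left)
  from smooth_mult[OF smooth_bounded_linear[OF this] coord.IH] show ?case .
qed (auto intro: smooth_add)

lemma rpolys_growth:
  assumes "p \<in> rpolys" "\<epsilon> > 0"
  shows "\<exists>C\<ge>0. \<forall>x. norm (p x) \<le> C * exp (\<epsilon> * (norm x)\<^sup>2)"
  using assms
proof (induction arbitrary: \<epsilon> rule: rpolys.induct)
  case (const c)
  have "norm c \<le> norm c * exp (\<epsilon> * (norm x)\<^sup>2)" for x :: 'a
    using const by (simp add: mult_le_cancel_left1)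
  then show ?case by (intro exI[of _ "norm c"]) auto
next
  case (add p q)
  obtain C where C: "C \<ge> 0" "\<And>x. norm (p x) \<le> C * exp (\<epsilon> * (norm x)\<^sup>2)" using add.IH(1)[OF add.prems] by blast
  obtain C' where C': "C' \<ge> 0" "\<And>x. norm (q x) \<le> C' * exp (\<epsilon> * (norm x)\<^sup>2)" using add.IH(2)[OF add.prems] by blast
  have "norm (p x + q x) \<le> (C + C') * exp (\<epsilon> * (norm x)\<^sup>2)" for x
    using norm_triangle_ineq[of "p x" "q x"] C(2)[of x] C'(2)[of x] by (simp add: algebra_simps)
  then show ?case using C(1) C'(1) by (intro exI[of _ "C + C'"]) auto
next
  case (coord p y)
  \<comment> \<open>Half of \<epsilon> is spent on \<open>p\<close>; the other half absorbs the
    linear factor.\<close>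
  obtain C where C: "C \<ge> 0" "\<And>x. norm (p x) \<le> C * exp ((\<epsilon>/2) * (norm x)\<^sup>2)"
    using coord.IH[of "\<epsilon>/2"] coord.prems by auto
  have le: "norm x \<le> (1 + 2/\<epsilon>) * exp ((\<epsilon>/2) * (norm x)\<^sup>2)" for x :: 'a
  proof -
    have "norm x \<le> 1 + (norm x)\<^sup>2" using zero_le_power2[of "norm x - 1"] norm_ge_zero[of x]
      by (simp add: power2_eq_square algebra_simps; linarith)
    also have "\<dots> \<le> 1 * exp ((\<epsilon>/2) * (norm x)\<^sup>2) + (2/\<epsilon>) * exp ((\<epsilon>/2) * (norm x)\<^sup>2)"
    proof (rule add_mono)
      have "(\<epsilon>/2) * (norm x)\<^sup>2 \<le> exp ((\<epsilon>/2) * (norm x)\<^sup>2)" using exp_ge_add_one_self[of "(\<epsilon>/2) * (norm x)\<^sup>2"] by linarith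
      then show "(norm x)\<^sup>2 \<le> (2/\<epsilon>) * exp ((\<epsilon>/2) * (norm x)\<^sup>2)" using coord.prems by (simp add: field_simps)
    qed (use coord.prems in simp)
    finally show ?thesis by (simp add: algebra_simps)
  qed
  have "norm (of_real (x \<bullet> y) * p x) \<le> (norm y * (1 + 2/\<epsilon>) * C) * exp (\<epsilon> * (norm x)\<^sup>2)" for x
  proof -
    have "norm (of_real (x \<bullet> y) * p x) \<le> (norm y * norm x) * norm (p x)"
      using Cauchy_Schwarz_ineq2[of x y] by (simp add: norm_mult mult.commute mult_left_mono)
    also have "\<dots> \<le> (norm y * ((1 + 2/\<epsilon>) * exp ((\<epsilon>/2) * (norm x)\<^sup>2))) * (C * exp ((\<epsilon>/2) * (norm x)\<^sup>2))"
      using C coord.prems by (intro mult_mono mult_left_mono le) auto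
    also have "\<dots> = (norm y * (1 + 2/\<epsilon>) * C) * (exp ((\<epsilon>/2) * (norm x)\<^sup>2) * exp ((\<epsilon>/2) * (norm x)\<^sup>2))"
      by (simp add: algebra_simps)
    also have "exp ((\<epsilon>/2) * (norm x)\<^sup>2) * exp ((\<epsilon>/2) * (norm x)\<^sup>2) = exp (\<epsilon> * (norm x)\<^sup>2)"
      by (simp add: exp_add[symmetric])
    finally show ?thesis .
  qed
  then show ?case using C(1) coord.prems by (intro exI[of _ "norm y * (1 + 2/\<epsilon>) * C"]) auto
qed

text \<open>Expanding exponentials into power series shows that \<open>G\<close> is orthogonal to
  Gaussians centred at \<open>x0\<close>. As these become narrow, their integrals against
  \<open>G\<close> are governed by the values near \<open>x0\<close>, which cannot be if
  \<open>G x0\<close> is nonzero.\<close>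

lemma moments_zero_imp_zero:
  fixes G :: "'a::euclidean_space \<Rightarrow> complex"
  assumes G: "continuous_on UNIV G" and \<delta>: "\<delta> > 0"
    and i: "integrable lborel (\<lambda>x. norm (G x) * exp (\<delta> * (norm x)\<^sup>2))"
    and zero: "\<And>p. p \<in> rpolys \<Longrightarrow> (\<integral>x. G x * p x \<partial>lborel) = 0"
  shows "G x0 = 0"
proof (rule ccontr)
  assume ne: "G x0 \<noteq> 0"
  have [measurable]: "G \<in> borel_measurable borel" using G by (rule borel_measurable_continuous_onI)
  \<comment> \<open>One half of the margin dominates the series of a Gaussian factor, the other half
    dominates the polynomial.\<close>
  define d where "d = \<delta> / 2"
  have d: "d > 0" "\<delta> = d + d" using \<delta> by (auto simp: d_def)
  have nG: "integrable lborel (\<lambda>x. norm (G x))"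
  proof (rule Bochner_Integration.integrable_bound[OF i])
    show "AE x in lborel. norm (norm (G x)) \<le> norm (norm (G x) * exp (\<delta> * (norm x)\<^sup>2))"
      using \<delta> by (simp add: mult_le_cancel_left1)
  qed simp
  \<comment> \<open>A single expansion is possible only for the width \<open>d\<close> that the
    margin pays for. Multiplying in the factors \<open>exp (- d * (norm x)\<^sup>2)\<close> one at a
    time stays within the same margin at each step and reaches every multiple of
    \<open>d\<close>.\<close>
  have A: "(\<integral>x. G x * p x * exp (of_real (- (real N * d) * (norm x)\<^sup>2)) \<partial>lborel) = 0" if "p \<in> rpolys" for N p
    using that
  proof (induction N arbitrary: p)
    case 0 then show ?case using zero by simp
  next
    case (Suc N)
    note [measurable] = borel_measurable_continuous_onI[OF smooth_continuous[OF rpolys_smooth[OF Suc.prems]]]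
    define H where "H = (\<lambda>x. G x * p x * exp (of_real (- (real N * d) * (norm x)\<^sup>2)))"
    have [measurable]: "H \<in> borel_measurable borel" unfolding H_def by measurable
    let ?h = "\<lambda>x::'a. complex_of_real (- d * (norm x)\<^sup>2)"
    obtain C where C: "C \<ge> 0" "\<And>x. norm (p x) \<le> C * exp (d * (norm x)\<^sup>2)" using rpolys_growth[OF Suc.prems d(1)] by blast
    have "integrable lborel (\<lambda>x. norm (H x) * exp (norm (?h x)))"
    proof (rule Bochner_Integration.integrable_bound[OF integrable_mult_right[OF i, of C]])
      have "norm (H x) * exp (norm (?h x)) \<le> C * (norm (G x) * exp (\<delta> * (norm x)\<^sup>2))" for x
      proof -
        have "norm (?h x) = d * (norm x)\<^sup>2" unfolding norm_of_real using d(1) by (simp add: abs_mult)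
        then have "norm (H x) * exp (norm (?h x)) \<le> (norm (G x) * (C * exp (d * (norm x)\<^sup>2)) * 1) * exp (d * (norm x)\<^sup>2)"
          unfolding H_def norm_mult using C d(1)
          by (intro mult_mono mult_left_mono) (auto simp: norm_exp_eq_Re)
        also have "\<dots> = C * (norm (G x) * exp (\<delta> * (norm x)\<^sup>2))" unfolding d(2) distrib_right exp_add by simp
        finally show ?thesis .
      qed
      then show "AE x in lborel. norm (norm (H x) * exp (norm (?h x))) \<le> norm (C * (norm (G x) * exp (\<delta> * (norm x)\<^sup>2)))"
        using C(1) by simp
    qed simp
    from integral_exp_series(2)[OF _ _ this]
    have s: "(\<lambda>k. (\<integral>x. H x * ?h x ^ k \<partial>lborel) / fact k) sums (\<integral>x. H x * exp (?h x) \<partial>lborel)" by simp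
    have "(\<integral>x. H x * ?h x ^ k \<partial>lborel) = 0" for k
    proof -
      have "(\<lambda>x::'a. p x * ?h x ^ k) \<in> rpolys"
        using rpolys_mult[OF rpolys.const[of "of_real (- d)"] rpolys_norm2] by (intro rpolys_mult[OF Suc.prems] rpolys_power) simp
      from Suc.IH[OF this] show ?thesis by (simp add: H_def algebra_simps)
    qed
    with s have "(\<lambda>k::nat. 0) sums (\<integral>x. H x * exp (?h x) \<partial>lborel)" by simp
    then have z: "(\<integral>x. H x * exp (?h x) \<partial>lborel) = 0" using sums_zero sums_unique2 by blast
    have "H x * exp (?h x) = G x * p x * exp (of_real (- (real (Suc N) * d) * (norm x)\<^sup>2))" for x
      unfolding H_def by (simp add: exp_add[symmetric] algebra_simps)
    then have "(\<integral>x. G x * p x * exp (of_real (- (real (Suc N) * d) * (norm x)\<^sup>2)) \<partial>lborel) = (\<integral>x. H x * exp (?h x) \<partial>lborel)"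
      by (intro Bochner_Integration.integral_cong) auto
    with z show ?case by (simp only:)
  qed
  \<comment> \<open>Recentring at \<open>x0\<close> multiplies the Gaussian by a constant and by the
    exponential of a linear form. The latter is expanded in turn, and \<open>A\<close> kills every
    term.\<close>
  have B: "(\<integral>x. G x * of_real (exp (- (real N * d) * (norm (x - x0))\<^sup>2)) \<partial>lborel) = 0" for N
  proof -
    define H where "H = (\<lambda>x. G x * exp (of_real (- (real N * d) * (norm x)\<^sup>2)))"
    have [measurable]: "H \<in> borel_measurable borel" unfolding H_def by measurable
    let ?h = "\<lambda>x::'a. complex_of_real (2 * (real N * d) * (x \<bullet> x0))"
    have "integrable lborel (\<lambda>x. norm (H x) * exp (norm (?h x)))"
    proof (rule Bochner_Integration.integrable_bound[OF integrable_mult_right[OF nG, of "exp (real N * d * (norm x0)\<^sup>2)"]])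
      have "norm (H x) * exp (norm (?h x)) \<le> exp (real N * d * (norm x0)\<^sup>2) * norm (G x)" for x
      proof -
        have "2 * \<bar>x \<bullet> x0\<bar> \<le> (norm x)\<^sup>2 + (norm x0)\<^sup>2"
          using Cauchy_Schwarz_ineq2[of x x0] zero_le_power2[of "norm x - norm x0"]
          by (simp add: power2_eq_square algebra_simps)
        then have "(real N * d) * (2 * \<bar>x \<bullet> x0\<bar>) \<le> (real N * d) * ((norm x)\<^sup>2 + (norm x0)\<^sup>2)"
          using d(1) by (intro mult_left_mono) auto
        moreover have "norm (?h x) = (real N * d) * (2 * \<bar>x \<bullet> x0\<bar>)" using d(1) by (simp add: norm_mult abs_mult)
        ultimately have "exp (- (real N * d) * (norm x)\<^sup>2) * exp (norm (?h x)) \<le> exp (real N * d * (norm x0)\<^sup>2)"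
          unfolding exp_add[symmetric] by (simp add: algebra_simps)
        from mult_left_mono[OF this norm_ge_zero[of "G x"]]
        show ?thesis unfolding H_def norm_mult by (simp add: norm_exp_eq_Re algebra_simps)
      qed
      then show "AE x in lborel. norm (norm (H x) * exp (norm (?h x))) \<le> norm (exp (real N * d * (norm x0)\<^sup>2) * norm (G x))"
        by simp
    qed simp
    from integral_exp_series(2)[OF _ _ this]
    have s: "(\<lambda>k. (\<integral>x. H x * ?h x ^ k \<partial>lborel) / fact k) sums (\<integral>x. H x * exp (?h x) \<partial>lborel)" by simp
    have "(\<integral>x. H x * ?h x ^ k \<partial>lborel) = 0" for k
    proof -
      have "(\<lambda>x::'a. ?h x ^ k) \<in> rpolys"
        using rpolys_mult[OF rpolys.const[of "of_real (2 * (real N * d))"] rpolys_inner] by (intro rpolys_power) simp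
      from A[OF this] show ?thesis by (simp add: H_def algebra_simps)
    qed
    with s have "(\<lambda>k::nat. 0) sums (\<integral>x. H x * exp (?h x) \<partial>lborel)" by simp
    then have "(\<integral>x. H x * exp (?h x) \<partial>lborel) = 0" using sums_zero sums_unique2 by blast
    moreover have "G x * of_real (exp (- (real N * d) * (norm (x - x0))\<^sup>2)) =
        of_real (exp (- (real N * d) * (norm x0)\<^sup>2)) * (H x * exp (?h x))" for x
    proof -
      have "exp (- (real N * d) * (norm (x - x0))\<^sup>2) = exp (- (real N * d) * (norm x0)\<^sup>2) *
          exp (- (real N * d) * (norm x)\<^sup>2) * exp (2 * (real N * d) * (x \<bullet> x0))"
        unfolding exp_add[symmetric] power2_norm_eq_inner by (simp add: inner_diff inner_commute algebra_simps)
      then show ?thesis unfolding H_def exp_of_real by (simp only: of_real_mult mult_ac)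
    qed
    ultimately show ?thesis by (simp only: integral_mult_right_zero mult_zero_right)
  qed
  \<comment> \<open>Multiplication by the conjugate of \<open>G x0\<close> makes the real part
    positive at \<open>x0\<close>, hence near \<open>x0\<close>.\<close>
  define H where "H = (\<lambda>x. Re (cnj (G x0) * G x))"
  have cH: "continuous_on UNIV H" unfolding H_def by (intro continuous_intros G)
  have [measurable]: "H \<in> borel_measurable borel" using cH by (rule borel_measurable_continuous_onI)
  define \<eta> where "\<eta> = H x0 / 2"
  have H0: "H x0 > 0" using ne by (simp add: H_def complex_neq_0[symmetric] power2_eq_square[symmetric])
  then have \<eta>: "\<eta> > 0" by (simp add: \<eta>_def)
  obtain r where r: "r > 0" "\<And>x. dist x x0 < r \<Longrightarrow> dist (H x) (H x0) < \<eta>"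
    using cH \<eta> unfolding continuous_on_iff by (metis UNIV_I)
  have Hr: "H x \<ge> \<eta>" if "dist x x0 < r" for x
    using r(2)[OF that] H0 unfolding \<eta>_def dist_real_def by linarith
  have iH: "integrable lborel (\<lambda>x. \<bar>H x\<bar>)"
  proof (rule Bochner_Integration.integrable_bound[OF integrable_mult_right[OF nG, of "norm (G x0)"]])
    have "\<bar>H x\<bar> \<le> norm (G x0) * norm (G x)" for x
      using abs_Re_le_cmod[of "cnj (G x0) * G x"] by (simp add: H_def norm_mult)
    then show "AE x in lborel. norm \<bar>H x\<bar> \<le> norm (norm (G x0) * norm (G x))" by simp
  qed simp
  define I where "I = (\<integral>x. \<bar>H x\<bar> \<partial>lborel)"
  define vol where "vol = measure lborel (ball x0 (r/2))"
  have vol: "vol > 0" unfolding vol_def using r(1) by (simp add: content_ball_pos)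
  \<comment> \<open>Write M for \<open>N\<close> times \<open>d\<close>. On the ball of radius r/2
    the Gaussian is at least exp(-M r^2/4), beyond radius r it is at most exp(-M r^2), and in
    between the integrand is nonnegative. The quotient of the two values produces the factor
    3/4.\<close>
  have bound: "\<eta> * vol \<le> I * exp (- (real N * (d * (3/4) * r\<^sup>2)))" for N
  proof -
    let ?M = "real N * d"
    have M: "?M \<ge> 0" using d(1) by simp
    let ?e = "\<lambda>x. exp (- ?M * (norm (x - x0))\<^sup>2)"
    have iHe: "integrable lborel (\<lambda>x. H x * ?e x)"
      by (rule Bochner_Integration.integrable_bound[OF iH])
         (use M in \<open>auto simp: abs_mult mult_le_cancel_left2\<close>)
    have iGe: "integrable lborel (\<lambda>x. G x * of_real (?e x))"
      by (rule Bochner_Integration.integrable_bound[OF nG])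
         (use M in \<open>auto simp: norm_mult mult_le_cancel_left2\<close>)
    have "(\<integral>x. H x * ?e x \<partial>lborel) = (\<integral>x. Re (cnj (G x0) * (G x * of_real (?e x))) \<partial>lborel)"
      by (rule Bochner_Integration.integral_cong) (auto simp: H_def algebra_simps)
    also have "\<dots> = Re (cnj (G x0) * (\<integral>x. G x * of_real (?e x) \<partial>lborel))"
      using integral_Re[OF integrable_mult_right[OF iGe, of "cnj (G x0)"]] by (simp only: integral_mult_right_zero)
    also have "\<dots> = 0" unfolding B by simp
    finally have z: "(\<integral>x. H x * ?e x \<partial>lborel) = 0" .
    have ib: "integrable lborel (\<lambda>x. indicator (ball x0 (r/2)) x :: real)"
      using emeasure_bounded_finite[of "ball x0 (r/2)"] by (intro integrable_real_indicator) auto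
    have "(\<integral>x. \<eta> * exp (- ?M * (r/2)\<^sup>2) * indicator (ball x0 (r/2)) x - exp (- ?M * r\<^sup>2) * \<bar>H x\<bar> \<partial>lborel)
        \<le> (\<integral>x. H x * ?e x \<partial>lborel)"
    proof (rule integral_mono)
      show "integrable lborel (\<lambda>x. \<eta> * exp (- ?M * (r/2)\<^sup>2) * indicator (ball x0 (r/2)) x - exp (- ?M * r\<^sup>2) * \<bar>H x\<bar>)"
        by (intro Bochner_Integration.integrable_diff integrable_mult_right ib iH)
      fix x
      consider "dist x x0 < r/2" | "dist x x0 \<ge> r/2" "dist x x0 < r" | "dist x x0 \<ge> r" by linarith
      then show "\<eta> * exp (- ?M * (r/2)\<^sup>2) * indicator (ball x0 (r/2)) x - exp (- ?M * r\<^sup>2) * \<bar>H x\<bar> \<le> H x * ?e x"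
      proof cases
        case 1
        then have "H x \<ge> \<eta>" using Hr r(1) by simp
        moreover have "exp (- ?M * (r/2)\<^sup>2) \<le> ?e x"
          using 1 M by (simp add: dist_norm mult_left_mono power_mono del: power_divide)
        ultimately have "\<eta> * exp (- ?M * (r/2)\<^sup>2) \<le> H x * ?e x" using \<eta> by (intro mult_mono) auto
        moreover have "exp (- ?M * r\<^sup>2) * \<bar>H x\<bar> \<ge> 0" by simp
        moreover have "indicator (ball x0 (r/2)) x = (1::real)" using 1 by (simp add: dist_commute)
        ultimately show ?thesis by (simp only: mult_1_right; linarith)
      next
        case 2
        then have "H x \<ge> \<eta>" using Hr by simp
        then have "H x * ?e x \<ge> 0" using \<eta> by simp
        moreover have "exp (- ?M * r\<^sup>2) * \<bar>H x\<bar> \<ge> 0" by simp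
        moreover have "indicator (ball x0 (r/2)) x = (0::real)" using 2(1) by (simp add: dist_commute)
        ultimately show ?thesis by (simp only: mult_zero_right; linarith)
      next
        case 3
        then have "?e x \<le> exp (- ?M * r\<^sup>2)"
          using r(1) M by (simp add: dist_norm mult_left_mono power_mono)
        then have "\<bar>H x\<bar> * ?e x \<le> \<bar>H x\<bar> * exp (- ?M * r\<^sup>2)" by (intro mult_left_mono) auto
        moreover have "- (\<bar>H x\<bar> * ?e x) \<le> H x * ?e x"
          using mult_right_mono[of "- \<bar>H x\<bar>" "H x" "?e x"] by simp
        moreover have "indicator (ball x0 (r/2)) x = (0::real)" using 3 r(1) by (simp add: dist_commute)
        ultimately show ?thesis by (simp only: mult_zero_right mult.commute[of "\<bar>H x\<bar>"]; linarith)
      qed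
    qed (rule iHe)
    also have "(\<integral>x. \<eta> * exp (- ?M * (r/2)\<^sup>2) * indicator (ball x0 (r/2)) x - exp (- ?M * r\<^sup>2) * \<bar>H x\<bar> \<partial>lborel)
        = \<eta> * exp (- ?M * (r/2)\<^sup>2) * vol - exp (- ?M * r\<^sup>2) * I"
      unfolding vol_def I_def using ib iH by simp
    finally have le: "\<eta> * exp (- ?M * (r/2)\<^sup>2) * vol \<le> exp (- ?M * r\<^sup>2) * I" using z by simp
    have "\<eta> * vol = exp (?M * (r/2)\<^sup>2) * (\<eta> * exp (- ?M * (r/2)\<^sup>2) * vol)"
      by (simp add: mult_exp_exp algebra_simps)
    also have "\<dots> \<le> exp (?M * (r/2)\<^sup>2) * (exp (- ?M * r\<^sup>2) * I)" using le by (intro mult_left_mono) auto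
    also have "\<dots> = I * (exp (?M * (r/2)\<^sup>2) * exp (- ?M * r\<^sup>2))" by simp
    also have "exp (?M * (r/2)\<^sup>2) * exp (- ?M * r\<^sup>2) = exp (- (real N * (d * (3/4) * r\<^sup>2)))"
      unfolding exp_add[symmetric] by (simp add: power_divide algebra_simps)
    finally show ?thesis .
  qed
  let ?c = "exp (- (d * (3/4) * r\<^sup>2))"
  have c: "?c < 1" using d(1) r(1) by simp
  have "(\<lambda>N. I * ?c ^ N) \<longlonglongrightarrow> I * 0"
    using c by (intro tendsto_mult tendsto_const LIMSEQ_power_zero) auto
  moreover have "\<eta> * vol \<le> I * ?c ^ N" for N using bound[of N] by (simp add: exp_of_nat_mult[symmetric])
  ultimately have "\<eta> * vol \<le> 0" using LIMSEQ_le_const[of "\<lambda>N. I * ?c ^ N" 0 "\<eta> * vol"] by auto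
  then show False using \<eta> vol by (simp add: mult_le_0_iff)
qed

type_synonym 'm cfn = "complex^'m \<Rightarrow> complex"

section \<open>Holomorphic polynomials\<close>

lemma poly_sum_superset:
  assumes "finite S" "Poly_Mapping.keys p \<subseteq> S"
  shows "(\<Sum>m\<in>Poly_Mapping.keys p. Poly_Mapping.lookup p m * F m) = (\<Sum>m\<in>S. Poly_Mapping.lookup p m * (F m :: complex))"
  by (rule sum.mono_neutral_left) (use assms in \<open>auto simp: in_keys_iff\<close>)

lemma poly_sum_add:
  "(\<Sum>m\<in>Poly_Mapping.keys (p + q). Poly_Mapping.lookup (p + q) m * F m) =
   (\<Sum>m\<in>Poly_Mapping.keys p. Poly_Mapping.lookup p m * F m) +
   (\<Sum>m\<in>Poly_Mapping.keys q. Poly_Mapping.lookup q m * (F m :: complex))"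
proof -
  let ?S = "Poly_Mapping.keys p \<union> Poly_Mapping.keys q"
  have "Poly_Mapping.keys (p + q) \<subseteq> ?S" by (rule Poly_Mapping.keys_add)
  then show ?thesis
    by (subst (1 2 3) poly_sum_superset[of ?S]) (auto simp: lookup_add distrib_right sum.distrib)
qed

lemma poly_sum_map:
  "(\<Sum>m\<in>Poly_Mapping.keys (Poly_Mapping.map ((*) c) p). Poly_Mapping.lookup (Poly_Mapping.map ((*) c) p) m * F m) =
   c * (\<Sum>m\<in>Poly_Mapping.keys p. Poly_Mapping.lookup p m * (F m :: complex))"
proof -
  have "Poly_Mapping.keys (Poly_Mapping.map ((*) c) p) \<subseteq> Poly_Mapping.keys p"
    by (auto simp: in_keys_iff Poly_Mapping.map.rep_eq when_def)
  then show ?thesis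
    by (subst (1) poly_sum_superset[of "Poly_Mapping.keys p"])
       (auto simp: Poly_Mapping.map.rep_eq sum_distrib_left algebra_simps when_def intro!: sum.cong)
qed

lemma poly_sum_single:
  "(\<Sum>m\<in>Poly_Mapping.keys (Poly_Mapping.single k c). Poly_Mapping.lookup (Poly_Mapping.single k c) m * F m) = c * (F k :: complex)"
  by (subst poly_sum_superset[of "{k}"]) (auto simp: lookup_single)

text \<open>Monomials are written as words so that they match words in noncommuting operators letter
  by letter; \<open>lmono_mset\<close> forgets the order.\<close>

definition lmono :: "'m list \<Rightarrow> 'm::finite cfn" where
  "lmono xs w = prod_list (map (\<lambda>x. w $ x) xs)"

lemma lmono_simps [simp]: "lmono [] = (\<lambda>w. 1)" "lmono (x # xs) = (\<lambda>w. w $ x * lmono xs w)"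
  by (auto simp: lmono_def)

lemma lmono_append: "lmono (xs @ ys) w = lmono xs w * lmono ys w"
  by (simp add: lmono_def)

lemma lmono_mset: "mset xs = mset ys \<Longrightarrow> lmono xs = lmono ys"
  unfolding lmono_def by (rule ext) (metis mset_map prod_mset_prod_list)

lemma cmonom_Suc: "cmonom (m(j := Suc (m j))) w = w $ j * cmonom m w"
  unfolding cmonom_def by (subst (1 2) prod.remove[of _ j]) (auto intro!: prod.cong)

lemma cmonom_0: "cmonom (\<lambda>_. 0) w = 1"
  by (simp add: cmonom_def)

lemma lmono_cmonom: "lmono xs = cmonom (count_list xs)"
proof (induction xs)
  case Nil
  have "count_list [] = (\<lambda>_. 0)" by auto
  then show ?case by (simp add: cmonom_0 fun_eq_iff)
next
  case (Cons x xs)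
  have "count_list (x # xs) = (count_list xs)(x := Suc (count_list xs x))" by auto
  then show ?case by (intro ext) (simp only: lmono_simps cmonom_Suc Cons.IH)
qed

lemma length_count_list: "length (xs :: 'm::finite list) = (\<Sum>j\<in>UNIV. count_list xs j)"
proof (induction xs)
  case (Cons a xs)
  have "count_list (a # xs) j = count_list xs j + (if a = j then 1 else 0)" for j by simp
  then show ?case using Cons by (simp only: sum.distrib) simp
qed simp

lemma enum_list: "finite A \<Longrightarrow> distinct (enum_list A) \<and> set (enum_list A) = A"
  unfolding enum_list_def by (rule someI_ex) (metis finite_distinct_list)

text \<open>The word spelled out by \<open>ops_power\<close>, by which powers of operators become a
  \<open>foldr\<close> over letters.\<close>

definition mword :: "'j set \<Rightarrow> ('j \<Rightarrow> nat) \<Rightarrow> 'j list" where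
  "mword A m = concat (map (\<lambda>j. replicate (m j) j) (enum_list A))"

lemma count_mword: "finite A \<Longrightarrow> count_list (mword A m) j = (if j \<in> A then m j else 0)"
proof -
  have "distinct js \<Longrightarrow> count_list (concat (map (\<lambda>j. replicate (m j) j) js)) j = (if j \<in> set js then m j else 0)" for js
  proof (induction js)
    case (Cons a js)
    have "count_list (replicate k a) j = (if a = j then k else 0)" for k by (induction k) auto
    then show ?case using Cons by auto
  qed simp
  then show "finite A \<Longrightarrow> ?thesis" unfolding mword_def using enum_list[of A] by auto
qed

lemma ops_power_mword: "ops_power A W m f = foldr W (mword A m) f"
proof -
  have rep: "foldr W (replicate k a) f = (W a ^^ k) f" for k a f by (induction k) auto
  have "foldr (\<lambda>j. W j ^^ m j) js f = foldr W (concat (map (\<lambda>j. replicate (m j) j) js)) f" for js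
    by (induction js) (auto simp: rep)
  then show ?thesis unfolding ops_power_def mword_def .
qed

lemma cmonom_lmono: "cmonom m = lmono (mword UNIV m)"
proof -
  have "count_list (mword UNIV m) = m" by (auto simp: count_mword)
  then show ?thesis by (simp add: lmono_cmonom)
qed

lemma length_mword_UNIV: "length (mword UNIV (m :: 'm::finite \<Rightarrow> nat)) = (\<Sum>j\<in>UNIV. m j)"
  by (simp add: length_count_list count_mword)

lemma foldr_mset_commute:
  assumes C: "\<And>f j. f \<in> C \<Longrightarrow> W j f \<in> C" and comm: "\<And>f i j. f \<in> C \<Longrightarrow> W i (W j f) = W j (W i f)"
    and eq: "mset xs = mset ys" and f: "f \<in> C"
  shows "foldr W xs f = foldr W ys f"
  using eq
proof (induction xs arbitrary: ys)
  case (Cons x xs)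
  have cl: "foldr W zs f \<in> C" for zs by (induction zs) (auto simp: C f)
  from Cons.prems have "x \<in> set ys" by (metis list.set_intros(1) mset_eq_setD)
  then obtain as bs where ys: "ys = as @ x # bs" by (meson split_list)
  have "foldr W (as @ x # bs) f = W x (foldr W (as @ bs) f)"
    by (induction as) (simp_all, metis cl comm foldr_append)
  moreover have "mset xs = mset (as @ bs)" using Cons.prems ys by simp
  ultimately show ?case using Cons.IH[of "as @ bs"] ys by simp
qed simp

text \<open>Polynomials as an inductive class of functions, for inductions that add one coordinate
  factor at a time; \<open>hol_polys_eq\<close> identifies the class with
  \<open>hol_polys\<close>.\<close>

inductive_set polys :: "'m::finite cfn set" where
  const: "(\<lambda>w. c) \<in> polys"
| add: "p \<in> polys \<Longrightarrow> q \<in> polys \<Longrightarrow> (\<lambda>w. p w + q w) \<in> polys"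
| coord: "p \<in> polys \<Longrightarrow> (\<lambda>w. w $ j * p w) \<in> polys"

lemma polys_cmult: "p \<in> polys \<Longrightarrow> (\<lambda>w. c * p w) \<in> polys"
proof (induction rule: polys.induct)
  case (coord p j)
  from polys.coord[OF coord.IH, of j] show ?case by (simp add: algebra_simps)
qed (auto simp: distrib_left intro: polys.intros)

lemma polys_sum: "(\<And>i. i \<in> S \<Longrightarrow> p i \<in> polys) \<Longrightarrow> (\<lambda>w. \<Sum>i\<in>S. p i w) \<in> polys"
  by (induction S rule: infinite_finite_induct) (auto intro: polys.intros)

lemma polys_mult: "p \<in> polys \<Longrightarrow> q \<in> polys \<Longrightarrow> (\<lambda>w. p w * q w) \<in> polys"
proof (induction arbitrary: q rule: polys.induct)
  case (const c) then show ?case by (rule polys_cmult)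
next
  case (add p p')
  from polys.add[OF add.IH(1)[OF add.prems] add.IH(2)[OF add.prems]] show ?case by (simp add: algebra_simps)
next
  case (coord p j)
  from polys.coord[OF coord.IH[OF coord.prems], of j] show ?case by (simp add: algebra_simps)
qed

lemma polys_diff: "p \<in> polys \<Longrightarrow> q \<in> polys \<Longrightarrow> (\<lambda>w. p w - q w) \<in> polys"
  using polys.add[OF _ polys_cmult[of q "-1"], of p] by simp

lemma polys_lmono: "lmono xs \<in> polys"
  by (induction xs) (auto intro: polys.intros)

lemma polys_nth: "(\<lambda>w. w $ j) \<in> polys"
  using polys.coord[OF polys.const[of 1], of j] by simp

lemma cfun_plus: "f + g = (\<lambda>x. f x + (g x :: complex))"
  by (auto simp: plus_fun_def)

lemma polys_subspace: "cfun.subspace polys"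
  unfolding cfun.subspace_def cscale_def cfun_plus zero_fun_def
  by (auto intro: polys.intros polys_cmult)

lemma sum_fun_apply: "(\<Sum>i\<in>S. f i) x = (\<Sum>i\<in>S. f i x :: complex)"
  by (induction S rule: infinite_finite_induct) auto

lemma hpoly_eval_span: "hpoly_eval p \<in> cfun.span (lmono ` mword UNIV ` Poly_Mapping.keys p)"
proof -
  have "hpoly_eval p = (\<Sum>m\<in>Poly_Mapping.keys p. cscale (Poly_Mapping.lookup p m) (lmono (mword UNIV m)))"
    by (auto simp: hpoly_eval_def fun_eq_iff sum_fun_apply cscale_def cmonom_lmono)
  also have "\<dots> \<in> cfun.span (lmono ` mword UNIV ` Poly_Mapping.keys p)"
    by (intro cfun.span_sum cfun.span_scale cfun.span_base) auto
  finally show ?thesis .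
qed

lemma hol_polys_eq: "hol_polys = polys"
proof (intro equalityI subsetI)
  fix p :: "'m::finite cfn" assume "p \<in> hol_polys"
  then obtain q where "p = hpoly_eval q" by (auto simp: hol_polys_def)
  moreover have "cfun.span (lmono ` A) \<subseteq> polys" for A :: "'m list set"
    by (rule cfun.span_minimal[OF _ polys_subspace]) (auto intro: polys_lmono)
  ultimately show "p \<in> polys" using hpoly_eval_span by blast
next
  fix p :: "'m::finite cfn" assume "p \<in> polys"
  then show "p \<in> hol_polys"
  proof (induction rule: polys.induct)
    case (const c)
    have "(\<lambda>w::complex^'m. c) = hpoly_eval (Poly_Mapping.single (\<lambda>_. 0) c)"
      by (auto simp: hpoly_eval_def poly_sum_single cmonom_0)
    then show ?case by (auto simp: hol_polys_def)
  next
    case (add p q)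
    then obtain p' q' where "p = hpoly_eval p'" "q = hpoly_eval q'" by (auto simp: hol_polys_def)
    then have "(\<lambda>w. p w + q w) = hpoly_eval (p' + q')"
      by (auto simp: hpoly_eval_def poly_sum_add)
    then show ?case by (auto simp: hol_polys_def)
  next
    case (coord p j)
    then obtain p' where p': "p = hpoly_eval p'" by (auto simp: hol_polys_def)
    define up where "up = (\<lambda>m::'m \<Rightarrow> nat. m(j := Suc (m j)))"
    define q where "q = (\<Sum>m\<in>Poly_Mapping.keys p'. Poly_Mapping.single (up m) (Poly_Mapping.lookup p' m))"
    have ev: "hpoly_eval (\<Sum>m\<in>S. Poly_Mapping.single (up m) (c m)) w = (\<Sum>m\<in>S. c m * cmonom (up m) w)"
      if "finite S" for S c and w :: "complex^'m"
      using that by (induction S rule: finite_induct)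
        (auto simp: hpoly_eval_def poly_sum_add poly_sum_single)
    have "(\<lambda>w. w $ j * p w) = hpoly_eval q"
      unfolding q_def ev[OF finite_keys] fun_eq_iff
      by (subst p', subst hpoly_eval_def)
         (simp add: ev up_def cmonom_Suc sum_distrib_left algebra_simps)
    then show ?case by (auto simp: hol_polys_def)
  qed
qed

lemma homog_polys_subset: "homog_polys d \<subseteq> cfun.span (lmono ` {xs. length xs = d})"
proof
  fix p :: "'m::finite cfn" assume "p \<in> homog_polys d"
  then obtain q where q: "p = hpoly_eval q" "\<forall>m\<in>Poly_Mapping.keys q. (\<Sum>j\<in>UNIV. m j) = d"
    by (auto simp: homog_polys_def)
  have "lmono ` mword UNIV ` Poly_Mapping.keys q \<subseteq> lmono ` {xs. length xs = d}"
    using q(2) by (auto simp: length_mword_UNIV)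
  then show "p \<in> cfun.span (lmono ` {xs. length xs = d})"
    using hpoly_eval_span[of q] cfun.span_mono unfolding q(1) by blast
qed

lemma polys_span: "polys = cfun.span (range lmono)"
proof (intro equalityI subsetI)
  fix p :: "'m::finite cfn" assume "p \<in> polys"
  then obtain q where "p = hpoly_eval q" using hol_polys_eq by (auto simp: hol_polys_def)
  then show "p \<in> cfun.span (range lmono)"
    using hpoly_eval_span[of q] cfun.span_mono[of "lmono ` mword UNIV ` Poly_Mapping.keys q" "range lmono"] by blast
next
  fix p :: "'m::finite cfn" assume "p \<in> cfun.span (range lmono)"
  then show "p \<in> polys"
    using cfun.span_minimal[OF _ polys_subspace, of "range lmono"] polys_lmono by blast
qed

lemma has_field_derivative_polys:
  assumes "p \<in> polys"
  shows "((\<lambda>s. p (w + axis j s)) has_field_derivative hol_deriv_op j p w) (at 0)"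
proof -
  have "\<exists>d. ((\<lambda>s. p (w + axis j s)) has_field_derivative d) (at 0)"
    using assms
  proof (induction rule: polys.induct)
    case (coord p i)
    then obtain d where d: "((\<lambda>s. p (w + axis j s)) has_field_derivative d) (at 0)" by blast
    have "((\<lambda>s. (w + axis j s) $ i) has_field_derivative (if i = j then 1 else 0)) (at 0)"
      by (cases "i = j") (auto simp: axis_def intro!: derivative_eq_intros)
    from DERIV_mult[OF this d] show ?case by blast
  qed (auto intro: derivative_intros)
  then show ?thesis unfolding hol_deriv_op_def using DERIV_deriv_iff_field_differentiable field_differentiable_def by blast
qed

lemma hol_deriv_op_const [simp]: "hol_deriv_op j (\<lambda>w. c) = (\<lambda>w. 0)"
  by (simp add: hol_deriv_op_def)

lemma hol_deriv_op_add: "p \<in> polys \<Longrightarrow> q \<in> polys \<Longrightarrow>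
    hol_deriv_op j (\<lambda>w. p w + q w) = (\<lambda>w. hol_deriv_op j p w + hol_deriv_op j q w)"
  by (rule ext, subst (1) hol_deriv_op_def, rule DERIV_imp_deriv, intro DERIV_add has_field_derivative_polys)

lemma hol_deriv_op_mult: "p \<in> polys \<Longrightarrow> q \<in> polys \<Longrightarrow>
    hol_deriv_op j (\<lambda>w. p w * q w) = (\<lambda>w. hol_deriv_op j p w * q w + p w * hol_deriv_op j q w)"
proof (rule ext, subst (1) hol_deriv_op_def, rule DERIV_imp_deriv)
  fix w assume "p \<in> polys" "q \<in> polys"
  from DERIV_mult[OF has_field_derivative_polys[OF this(1)] has_field_derivative_polys[OF this(2)], of w j w j]
  show "((\<lambda>s. p (w + axis j s) * q (w + axis j s)) has_field_derivative hol_deriv_op j p w * q w + p w * hol_deriv_op j q w) (at 0)"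
    by (simp add: algebra_simps axis_def zero_vec_def[symmetric] cong: if_cong)
qed

lemma hol_deriv_op_cmult: "p \<in> polys \<Longrightarrow> hol_deriv_op j (\<lambda>w. c * p w) = (\<lambda>w. c * hol_deriv_op j p w)"
  using hol_deriv_op_mult[OF polys.const[of c]] by simp

lemma hol_deriv_op_nth: "hol_deriv_op j (\<lambda>w. w $ i) = (\<lambda>w. if i = j then 1 else 0)"
  by (rule ext, unfold hol_deriv_op_def, rule DERIV_imp_deriv)
     (cases "i = j"; auto simp: axis_def intro!: derivative_eq_intros)

lemma hol_deriv_op_coord: "p \<in> polys \<Longrightarrow>
    hol_deriv_op j (\<lambda>w. w $ i * p w) = (\<lambda>w. (if i = j then p w else 0) + w $ i * hol_deriv_op j p w)"
  by (subst hol_deriv_op_mult) (auto simp: polys_nth hol_deriv_op_nth)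

lemma polys_hol_deriv_op: "p \<in> polys \<Longrightarrow> hol_deriv_op j p \<in> polys"
proof (induction rule: polys.induct)
  case (coord p i)
  then show ?case by (simp add: hol_deriv_op_coord) (cases "i = j"; auto intro!: polys.intros)
qed (auto simp: hol_deriv_op_add intro: polys.intros)

lemma hol_deriv_op_sum: "(\<And>i. i \<in> S \<Longrightarrow> p i \<in> polys) \<Longrightarrow>
    hol_deriv_op j (\<lambda>w. \<Sum>i\<in>S. p i w) = (\<lambda>w. \<Sum>i\<in>S. hol_deriv_op j (p i) w)"
  by (induction S rule: infinite_finite_induct) (auto simp: hol_deriv_op_add polys_sum)

lemma hol_deriv_op_commute: "p \<in> polys \<Longrightarrow> hol_deriv_op i (hol_deriv_op j p) = hol_deriv_op j (hol_deriv_op i p)"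
proof (induction rule: polys.induct)
  case (coord p k)
  note d = polys_hol_deriv_op[OF coord.hyps]
  have z: "(\<lambda>w. if b then q w else 0) \<in> polys" if "q \<in> polys" for b and q :: "'a cfn"
    using that by (cases b) (auto intro: polys.intros)
  have h: "hol_deriv_op l (\<lambda>w. if b then q w else 0) = (\<lambda>w. if b then hol_deriv_op l q w else 0)"
    for b l and q :: "'a cfn" by (cases b) auto
  show ?case using coord.IH
    by (simp add: hol_deriv_op_coord coord.hyps hol_deriv_op_add z d polys.coord h hol_deriv_op_coord[OF d] fun_eq_iff)
qed (simp_all add: hol_deriv_op_add polys_hol_deriv_op)

lemma has_derivative_polys:
  assumes "p \<in> polys"
  shows "(p has_derivative (\<lambda>h. \<Sum>j\<in>UNIV. h $ j * hol_deriv_op j p w)) (at w)"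
  using assms
proof (induction rule: polys.induct)
  case (coord p i)
  have "((\<lambda>w. w $ i) has_derivative (\<lambda>h. h $ i)) (at w)"
    by (rule bounded_linear_imp_has_derivative) (rule bounded_linear_vec_nth)
  from has_derivative_mult[OF this coord.IH]
  have "((\<lambda>w. w $ i * p w) has_derivative (\<lambda>h. w $ i * (\<Sum>j\<in>UNIV. h $ j * hol_deriv_op j p w) + h $ i * p w)) (at w)" .
  moreover have "(\<Sum>j\<in>UNIV. h $ j * hol_deriv_op j (\<lambda>w. w $ i * p w) w) =
      w $ i * (\<Sum>j\<in>UNIV. h $ j * hol_deriv_op j p w) + h $ i * p w" for h
    unfolding hol_deriv_op_coord[OF coord.hyps]
    by (simp add: distrib_left sum.distrib sum_distrib_left algebra_simps if_distrib[of "\<lambda>x. _ * x"] cong: if_cong)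
  ultimately show ?case by simp
qed (auto simp: hol_deriv_op_add distrib_left sum.distrib intro: has_derivative_add)

lemma polys_compose_affine: "p \<in> polys \<Longrightarrow> (\<lambda>w. p (M *v w + a)) \<in> polys"
proof (induction rule: polys.induct)
  case (coord p j)
  have "(\<lambda>w. (M *v w + a) $ j) \<in> polys"
    unfolding matrix_vector_mult_def
    by (auto intro!: polys.add polys_sum polys_cmult polys_nth polys.const)
  then show ?case by (rule polys_mult[OF _ coord.IH])
qed (auto intro: polys.intros)

lemma polys_compose_matrix: "p \<in> polys \<Longrightarrow> (\<lambda>w. p (M *v w)) \<in> polys"
  using polys_compose_affine[of p M 0] by simp

lemma polys_compose_shift: "p \<in> polys \<Longrightarrow> (\<lambda>w. p (w + a)) \<in> polys"
  using polys_compose_affine[of p "mat 1" a] by simp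

lemma hol_deriv_op_affine: "p \<in> polys \<Longrightarrow>
   hol_deriv_op j (\<lambda>w. p (M *v w + a)) = (\<lambda>w. \<Sum>i\<in>UNIV. M $ i $ j * hol_deriv_op i p (M *v w + a))"
proof (induction rule: polys.induct)
  case (coord p k)
  have l: "(\<lambda>w. (M *v w + a) $ k) \<in> polys"
    unfolding matrix_vector_mult_def
    by (auto intro!: polys.add polys_sum polys_cmult polys_nth polys.const)
  have dl: "hol_deriv_op j (\<lambda>w. (M *v w + a) $ k) = (\<lambda>w. M $ k $ j)"
    unfolding matrix_vector_mult_def
    by (simp add: hol_deriv_op_add polys_sum polys_cmult polys_nth polys.const hol_deriv_op_sum hol_deriv_op_cmult
       hol_deriv_op_nth if_distrib[of "\<lambda>x. _ * x"] cong: if_cong)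
  show ?case
    unfolding hol_deriv_op_mult[OF l polys_compose_affine[OF coord.hyps]] dl coord.IH hol_deriv_op_coord[OF coord.hyps]
    by (simp add: fun_eq_iff distrib_left sum.distrib sum_distrib_left algebra_simps
        if_distrib[of "\<lambda>x. _ * x"] cong: if_cong)
qed (simp_all add: hol_deriv_op_add polys_compose_affine distrib_left sum.distrib)

lemma hol_deriv_op_matrix: "p \<in> polys \<Longrightarrow>
   hol_deriv_op j (\<lambda>w. p (M *v w)) = (\<lambda>w. \<Sum>i\<in>UNIV. M $ i $ j * hol_deriv_op i p (M *v w))"
  using hol_deriv_op_affine[of p j M 0] by simp

lemma hol_deriv_op_shift: "p \<in> polys \<Longrightarrow> hol_deriv_op j (\<lambda>w. p (w + a)) = (\<lambda>w. hol_deriv_op j p (w + a))"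
  using hol_deriv_op_affine[of p j "mat 1" a] unfolding matrix_vector_mul_lid
  by (simp add: mat_def if_distrib[of "\<lambda>x. x * _"] cong: if_cong)

lemma nth_conv_inner: "w $ j = of_real (w \<bullet> axis j 1) + \<i> * of_real (w \<bullet> axis j \<i>)" for w :: "complex^'m"
  by (simp add: inner_axis inner_complex_def complex_eq_iff)

lemma rpolys_nth: "(\<lambda>w::complex^'m. w $ j) \<in> rpolys" "(\<lambda>w::complex^'m. cnj (w $ j)) \<in> rpolys"
proof -
  have "(\<lambda>w::complex^'m. of_real (w \<bullet> axis j 1) + c * of_real (w \<bullet> axis j \<i>)) \<in> rpolys" for c
    by (intro rpolys.add rpolys_mult[OF rpolys.const] rpolys_inner)
  from this[of \<i>] this[of "- \<i>"] show "(\<lambda>w::complex^'m. w $ j) \<in> rpolys" "(\<lambda>w::complex^'m. cnj (w $ j)) \<in> rpolys"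
    by (simp_all add: nth_conv_inner)
qed

lemma polys_rpolys: "p \<in> polys \<Longrightarrow> p \<in> rpolys"
  by (induction rule: polys.induct) (auto intro: rpolys.intros rpolys_mult rpolys_nth)

lemma rpolys_cnj: "p \<in> rpolys \<Longrightarrow> (\<lambda>x. cnj (p x)) \<in> rpolys"
  by (induction rule: rpolys.induct) (auto intro: rpolys.intros)

lemma polys_continuous: "p \<in> polys \<Longrightarrow> continuous_on S p"
  by (intro smooth_continuous rpolys_smooth polys_rpolys)

lemma rpolys_dir_deriv: "p \<in> rpolys \<Longrightarrow> dir_deriv b p \<in> rpolys"
proof (induction rule: rpolys.induct)
  case (add p q)
  have "dir_deriv b (\<lambda>x. p x + q x) = (\<lambda>x. dir_deriv b p x + dir_deriv b q x)"
    using add by (auto intro!: dir_deriv_add smooth_differentiable rpolys_smooth)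
  then show ?case using add by (simp add: rpolys.intros)
next
  case (coord p y)
  have bl: "bounded_linear (\<lambda>x. complex_of_real (x \<bullet> y))"
    by (intro bounded_linear_compose[OF bounded_linear_of_real] bounded_linear_inner_left)
  have "dir_deriv b (\<lambda>x. of_real (x \<bullet> y) * p x) = (\<lambda>x. of_real (b \<bullet> y) * p x + of_real (x \<bullet> y) * dir_deriv b p x)"
  proof
    fix x
    show "dir_deriv b (\<lambda>x. of_real (x \<bullet> y) * p x) x = of_real (b \<bullet> y) * p x + of_real (x \<bullet> y) * dir_deriv b p x"
      using coord dir_deriv_eqI[OF bounded_linear_imp_has_derivative[OF bl, of "at x"], of b]
      by (subst dir_deriv_mult) (auto intro!: smooth_differentiable rpolys_smooth differentiableI[OF bounded_linear_imp_has_derivative[OF bl]])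
  qed
  then show ?case using coord by (simp add: rpolys.intros rpolys_mult)
qed (auto intro: rpolys.intros)

section \<open>The Fock inner product\<close>

lemma cdot_le: "norm (cdot w b) \<le> norm w * norm b"
proof -
  have "norm (cdot w b) \<le> (\<Sum>j\<in>UNIV. \<bar>norm (w $ j)\<bar> * \<bar>norm (b $ j)\<bar>)"
    unfolding cdot_def by (rule order_trans[OF norm_sum]) (simp add: norm_mult)
  also have "\<dots> \<le> norm w * norm b" unfolding norm_vec_def by (rule L2_set_mult_ineq)
  finally show ?thesis .
qed

lemma cdot_add: "cdot (w + w') b = cdot w b + cdot w' b" "cdot w (b + b') = cdot w b + cdot w b'"
  by (simp_all add: cdot_def algebra_simps sum.distrib)

lemma bounded_linear_cdot: "bounded_linear (\<lambda>w. cdot w b)"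
  unfolding cdot_def by (intro bounded_linear_sum bounded_linear_mult_const[OF bounded_linear_vec_nth])

locale fock =
  fixes lam :: real
  assumes lam: "lam \<noteq> 0"
begin

definition \<nu> :: real where "\<nu> = \<bar>lam\<bar>"

lemma \<nu>_pos: "\<nu> > 0" using lam by (simp add: \<nu>_def)

definition gauss :: "'m::finite cfn" where
  "gauss w = of_real (exp (- 2 * \<nu> * (norm w)\<^sup>2))"

lemma continuous_gauss: "continuous_on S gauss"
  unfolding gauss_def by (intro continuous_intros)

text \<open>Of the Gaussian rate \<open>2 * \<nu>\<close>, the linear exponent uses up \<nu> after
  completing a square and the polynomial uses half of \<nu>; a Gaussian of rate
  \<open>\<nu> / 2\<close> remains.\<close>

lemma integrable_exp_gauss:
  fixes b :: "complex^'m::finite"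
  assumes "r \<in> rpolys"
  shows "integrable lborel (\<lambda>w. norm (exp (cdot w b) * r w * gauss w))"
    and "integrable lborel (\<lambda>w. exp (cdot w b) * r w * gauss w)"
    and "integrable lborel (\<lambda>w. norm (r w * gauss w) * exp (norm (cdot w b)))"
proof -
  note [measurable] = borel_measurable_continuous_onI[OF smooth_continuous[OF rpolys_smooth[OF assms]]]
    borel_measurable_continuous_onI[OF linear_continuous_on[OF bounded_linear_cdot]]
    borel_measurable_continuous_onI[OF continuous_gauss]
  obtain C where C: "C \<ge> 0" "\<And>x. norm (r x) \<le> C * exp ((\<nu>/2) * (norm x)\<^sup>2)"
    using rpolys_growth[OF assms, of "\<nu>/2"] \<nu>_pos by auto
  have i: "integrable lborel (\<lambda>w::complex^'m. C * exp ((norm b)\<^sup>2 / \<nu>) * exp (- (\<nu>/2) * (norm w)\<^sup>2))"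
    using \<nu>_pos by (intro integrable_mult_right gaussian_integrable) auto
  have le: "norm (r w * gauss w) * exp (norm (cdot w b)) \<le> C * exp ((norm b)\<^sup>2 / \<nu>) * exp (- (\<nu>/2) * (norm w)\<^sup>2)" for w
  proof -
    have "norm (cdot w b) \<le> norm w * norm b" by (rule cdot_le)
    also have "norm w * norm b \<le> \<nu> * (norm w)\<^sup>2 + (norm b)\<^sup>2 / \<nu>"
    proof -
      have "0 \<le> (\<nu> * norm w - norm b / 2)\<^sup>2 + (3/4) * (norm b)\<^sup>2" by simp
      also have "\<dots> = \<nu> * (\<nu> * (norm w)\<^sup>2 + (norm b)\<^sup>2 / \<nu> - norm w * norm b)"
        using \<nu>_pos by (simp add: power2_eq_square algebra_simps)
      finally show ?thesis using \<nu>_pos by (simp add: zero_le_mult_iff)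
    qed
    finally have e: "exp (norm (cdot w b)) \<le> exp (\<nu> * (norm w)\<^sup>2 + (norm b)\<^sup>2 / \<nu>)" by simp
    have "norm (r w * gauss w) * exp (norm (cdot w b)) \<le>
        C * exp ((\<nu>/2) * (norm w)\<^sup>2) * exp (- 2 * \<nu> * (norm w)\<^sup>2) * exp (\<nu> * (norm w)\<^sup>2 + (norm b)\<^sup>2 / \<nu>)"
      unfolding norm_mult gauss_def norm_of_real abs_exp_cancel
      using C e by (intro mult_mono) auto
    also have "\<dots> = C * exp ((norm b)\<^sup>2 / \<nu>) * exp (- (\<nu>/2) * (norm w)\<^sup>2)"
      by (simp add: mult.assoc exp_add[symmetric] algebra_simps)
    finally show ?thesis .
  qed
  show 3: "integrable lborel (\<lambda>w. norm (r w * gauss w) * exp (norm (cdot w b)))"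
    by (rule Bochner_Integration.integrable_bound[OF i]) (use le C(1) in auto)
  have "norm (exp (cdot w b) * r w * gauss w) \<le> norm (r w * gauss w) * exp (norm (cdot w b))" for w
  proof -
    have "norm (exp (cdot w b) * r w * gauss w) = norm (r w * gauss w) * exp (Re (cdot w b))"
      by (simp add: norm_mult norm_exp_eq_Re)
    also have "\<dots> \<le> norm (r w * gauss w) * exp (norm (cdot w b))"
      by (intro mult_left_mono) (auto simp: complex_Re_le_cmod)
    finally show ?thesis .
  qed
  then show "integrable lborel (\<lambda>w. exp (cdot w b) * r w * gauss w)"
    by (intro Bochner_Integration.integrable_bound[OF 3]) auto
  then show "integrable lborel (\<lambda>w. norm (exp (cdot w b) * r w * gauss w))"
    by (rule integrable_norm)
qed

text \<open>The integrand is the derivative in direction \<open>h\<close> of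
  \<open>exp (cdot w b) * r w * gauss w\<close>. The adjointness relations of the Fock inner product
  come from this identity.\<close>

lemma gauss_ibp:
  fixes b :: "complex^'m::finite"
  assumes r: "r \<in> rpolys"
  shows "(\<integral>w. exp (cdot w b) * (cdot h b * r w + dir_deriv h r w - of_real (4 * \<nu> * (w \<bullet> h)) * r w) * gauss w \<partial>lborel) = 0"
proof (rule integral_dir_deriv_zero[where h="\<lambda>w. exp (cdot w b) * r w * gauss w" and b = h and
    D="\<lambda>w h. exp (cdot w b) * (cdot h b * r w + dir_deriv h r w - of_real (4 * \<nu> * (w \<bullet> h)) * r w) * gauss w"])
  fix w :: "complex^'m"
  have e: "((\<lambda>w. exp (cdot w b)) has_derivative (\<lambda>h. exp (cdot w b) * cdot h b)) (at w)"
    by (rule has_derivative_cexp[OF bounded_linear_imp_has_derivative[OF bounded_linear_cdot]])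
  have g: "(gauss has_derivative (\<lambda>h. of_real (exp (- 2 * \<nu> * (norm w)\<^sup>2) * (- 4 * \<nu> * (w \<bullet> h))))) (at w)"
    unfolding gauss_def power2_norm_eq_inner
    by (rule has_derivative_of_real) (auto intro!: derivative_eq_intros simp: inner_commute)
  from has_derivative_mult[OF has_derivative_mult[OF e smooth_has_derivative[OF rpolys_smooth[OF r]]] g]
  show "((\<lambda>w. exp (cdot w b) * r w * gauss w) has_derivative
     (\<lambda>h. exp (cdot w b) * (cdot h b * r w + dir_deriv h r w - of_real (4 * \<nu> * (w \<bullet> h)) * r w) * gauss w)) (at w)"
    by (simp add: gauss_def algebra_simps)
next
  have q: "(\<lambda>w. cdot h b * r w + dir_deriv h r w - of_real (4 * \<nu> * (w \<bullet> h)) * r w) \<in> rpolys"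
    using rpolys.add[OF rpolys.add[OF rpolys_mult[OF rpolys.const[of "cdot h b"] r] rpolys_dir_deriv[OF r, of h]]
       rpolys_mult[OF rpolys.const[of "- of_real (4 * \<nu>)"] rpolys.coord[OF r, of h]]] by (simp add: algebra_simps)
  show "integrable lborel (\<lambda>w. exp (cdot w b) * (cdot h b * r w + dir_deriv h r w - of_real (4 * \<nu> * (w \<bullet> h)) * r w) * gauss w)"
    by (rule integrable_exp_gauss(2)[OF q])
  show "continuous_on UNIV (\<lambda>w. exp (cdot w b) * (cdot h b * r w + dir_deriv h r w - of_real (4 * \<nu> * (w \<bullet> h)) * r w) * gauss w)"
    by (intro continuous_on_mult continuous_on_exp linear_continuous_on bounded_linear_cdot continuous_gauss
        smooth_continuous[OF rpolys_smooth[OF q]])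
qed (rule integrable_exp_gauss(2)[OF r])

text \<open>The representation multiplies by such exponentials, so the adjointness relations are
  stated with this factor; \<open>b = 0\<close> recovers the plain ones.\<close>

definition E :: "complex^'m::finite \<Rightarrow> 'm cfn" where "E b w = exp (cdot w b)"

lemma E_0 [simp]: "E 0 = (\<lambda>w. 1)" by (auto simp: E_def cdot_def)

abbreviation inn :: "'m cfn \<Rightarrow> 'm::finite cfn \<Rightarrow> complex" where
  "inn \<equiv> fock_inner lam"

lemma fock_inner_eq:
  "inn u (v :: 'm::finite cfn) = of_real ((2 * \<nu> / pi) ^ CARD('m)) * (\<integral>w. u w * cnj (v w) * gauss w \<partial>lborel)"
  by (simp add: fock_inner_def gauss_def \<nu>_def)

lemma inn_integrable:
  "u \<in> polys \<Longrightarrow> v \<in> polys \<Longrightarrow> integrable lborel (\<lambda>w. (E b w * u w) * cnj (v w) * gauss w)"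
  using integrable_exp_gauss(2)[OF rpolys_mult[OF polys_rpolys rpolys_cnj[OF polys_rpolys]]]
  by (simp add: E_def mult.assoc)

lemma inn_E_add_left: "u \<in> polys \<Longrightarrow> u' \<in> polys \<Longrightarrow> v \<in> polys \<Longrightarrow>
   inn (\<lambda>w. E b w * (u w + u' w)) v = inn (\<lambda>w. E b w * u w) v + inn (\<lambda>w. E b w * u' w) v"
  using Bochner_Integration.integral_add[OF inn_integrable[of u v b] inn_integrable[of u' v b]]
  by (simp add: fock_inner_eq algebra_simps)

lemma inn_E_add_right: "u \<in> polys \<Longrightarrow> v \<in> polys \<Longrightarrow> v' \<in> polys \<Longrightarrow>
   inn (\<lambda>w. E b w * u w) (\<lambda>w. v w + v' w) = inn (\<lambda>w. E b w * u w) v + inn (\<lambda>w. E b w * u w) v'"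
  using Bochner_Integration.integral_add[OF inn_integrable[of u v b] inn_integrable[of u v' b]]
  by (simp add: fock_inner_eq algebra_simps)

lemma inn_cmult_left: "inn (\<lambda>w. c * u w) v = c * inn u v"
  by (simp add: fock_inner_eq mult.assoc)

lemma inn_cmult_right: "inn u (\<lambda>w. c * v w) = cnj c * inn u v"
proof -
  have "(\<lambda>w. u w * cnj (c * v w) * gauss w) = (\<lambda>w. cnj c * (u w * cnj (v w) * gauss w))"
    by (auto simp: algebra_simps)
  then show ?thesis by (simp only: fock_inner_eq integral_mult_right_zero) simp
qed

lemma inn_cnj: "inn u v = cnj (inn v u)"
proof -
  have "(\<integral>w. u w * cnj (v w) * gauss w \<partial>lborel) = cnj (\<integral>w. v w * cnj (u w) * gauss w \<partial>lborel)"
    by (subst Bochner_Integration.integral_cnj[symmetric]) (simp add: gauss_def mult.commute)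
  then show ?thesis by (simp add: fock_inner_eq)
qed

lemma inn_0 [simp]: "inn (\<lambda>w. 0) v = 0" "inn u (\<lambda>w. 0) = 0"
  by (simp_all add: fock_inner_eq)

lemma inn_add_left: "u \<in> polys \<Longrightarrow> u' \<in> polys \<Longrightarrow> v \<in> polys \<Longrightarrow> inn (\<lambda>w. u w + u' w) v = inn u v + inn u' v"
  using inn_E_add_left[of u u' v 0] by simp

lemma inn_add_right: "u \<in> polys \<Longrightarrow> v \<in> polys \<Longrightarrow> v' \<in> polys \<Longrightarrow> inn u (\<lambda>w. v w + v' w) = inn u v + inn u v'"
  using inn_E_add_right[of u v v' 0] by simp

lemma inn_diff_left: "u \<in> polys \<Longrightarrow> u' \<in> polys \<Longrightarrow> v \<in> polys \<Longrightarrow> inn (\<lambda>w. u w - u' w) v = inn u v - inn u' v"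
  using inn_add_left[OF _ polys_cmult[of u' "-1"], of u v] inn_cmult_left[of "-1" u' v] by simp

lemma inn_sum_left: "(\<And>i. i \<in> S \<Longrightarrow> u i \<in> polys) \<Longrightarrow> v \<in> polys \<Longrightarrow>
   inn (\<lambda>w. \<Sum>i\<in>S. u i w) v = (\<Sum>i\<in>S. inn (u i) v)"
  by (induction S rule: infinite_finite_induct) (auto simp: inn_add_left polys_sum)

lemma inn_sum_right: "(\<And>i. i \<in> S \<Longrightarrow> v i \<in> polys) \<Longrightarrow> u \<in> polys \<Longrightarrow>
   inn u (\<lambda>w. \<Sum>i\<in>S. v i w) = (\<Sum>i\<in>S. inn u (v i))"
  by (induction S rule: infinite_finite_induct) (auto simp: inn_add_right polys_sum)

text \<open>Integration by parts along \<open>axis j 1\<close> and \<open>axis j \<i>\<close> is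
  combined into the two Wirtinger derivatives. One of them differentiates only \<open>v\<close>, the
  other only \<open>E b w * u w\<close>.\<close>

lemma inn_E_adjoint:
  assumes u: "u \<in> polys" and v: "v \<in> polys"
  shows "2 * \<nu> * inn (\<lambda>w. E b w * (w $ j * u w)) v = inn (\<lambda>w. E b w * u w) (hol_deriv_op j v)"
    and "inn (\<lambda>w. E b w * (b $ j * u w + hol_deriv_op j u w)) v = 2 * \<nu> * inn (\<lambda>w. E b w * u w) (\<lambda>w. w $ j * v w)"
proof -
  let ?r = "\<lambda>w. u w * cnj (v w)"
  have r: "?r \<in> rpolys" using u v by (intro rpolys_mult rpolys_cnj polys_rpolys)
  have dr: "dir_deriv h ?r w = (\<Sum>j\<in>UNIV. h $ j * hol_deriv_op j u w) * cnj (v w) + u w * cnj (\<Sum>j\<in>UNIV. h $ j * hol_deriv_op j v w)" for h w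
  proof (rule dir_deriv_eqI)
    from has_derivative_mult[OF has_derivative_polys[OF u, of w] has_derivative_cnj[OF has_derivative_polys[OF v, of w]]]
    show "(?r has_derivative (\<lambda>h. (\<Sum>j\<in>UNIV. h $ j * hol_deriv_op j u w) * cnj (v w) + u w * cnj (\<Sum>j\<in>UNIV. h $ j * hol_deriv_op j v w))) (at w)"
      by (simp add: algebra_simps)
  qed
  have ax: "(\<Sum>i\<in>UNIV. axis j c $ i * F i) = c * F j" for c :: complex and F
    by (simp add: axis_def if_distrib[of "\<lambda>x. x * _"] cong: if_cong)
  have cd: "cdot (axis j c) b = c * b $ j" for c unfolding cdot_def by (rule ax)
  let ?F = "\<lambda>h w. exp (cdot w b) * (cdot h b * ?r w + dir_deriv h ?r w - of_real (4 * \<nu> * (w \<bullet> h)) * ?r w) * gauss w"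
  have q: "(\<lambda>w. cdot h b * ?r w + dir_deriv h ?r w - of_real (4 * \<nu> * (w \<bullet> h)) * ?r w) \<in> rpolys" for h
    using rpolys.add[OF rpolys.add[OF rpolys_mult[OF rpolys.const[of "cdot h b"] r] rpolys_dir_deriv[OF r, of h]]
       rpolys_mult[OF rpolys.const[of "- of_real (4 * \<nu>)"] rpolys.coord[OF r, of h]]] by (simp add: algebra_simps)
  note int = integrable_exp_gauss(2)[OF q, of b]
  have comb: "(\<integral>w. ?F (axis j 1) w + c * ?F (axis j \<i>) w \<partial>lborel) = 0" for c
    by (subst Bochner_Integration.integral_add[OF int integrable_mult_right[OF int]])
       (simp only: integral_mult_right_zero gauss_ibp[OF r] mult_zero_right add_0)
  have wj: "of_real (w \<bullet> axis j 1) + \<i> * of_real (w \<bullet> axis j \<i>) = w $ j"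
     "of_real (w \<bullet> axis j 1) - \<i> * of_real (w \<bullet> axis j \<i>) = cnj (w $ j)" for w :: "complex^'a"
    using nth_conv_inner[of w j] by simp_all
  \<comment> \<open>This combination is twice the antiholomorphic derivative, so the holomorphic
    factors \<open>E b\<close> and \<open>u\<close> are not differentiated.\<close>
  have F1: "?F (axis j 1) w + \<i> * ?F (axis j \<i>) w = 2 * ((E b w * u w) * cnj (hol_deriv_op j v w) * gauss w)
      - 2 * (2 * \<nu> * ((E b w * (w $ j * u w)) * cnj (v w) * gauss w))" for w
  proof -
    have "?F (axis j 1) w + \<i> * ?F (axis j \<i>) w = exp (cdot w b) * gauss w * (2 * u w * cnj (hol_deriv_op j v w)
       - 4 * \<nu> * (of_real (w \<bullet> axis j 1) + \<i> * of_real (w \<bullet> axis j \<i>)) * ?r w)"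
      unfolding dr ax cd by (simp add: algebra_simps)
    then show ?thesis unfolding wj E_def by (simp add: algebra_simps)
  qed
  \<comment> \<open>The opposite combination annihilates \<open>cnj (v w)\<close> and brings down
    \<open>b $ j\<close> from the exponential.\<close>
  have F2: "?F (axis j 1) w + (- \<i>) * ?F (axis j \<i>) w = 2 * ((E b w * (b $ j * u w + hol_deriv_op j u w)) * cnj (v w) * gauss w)
      - 2 * (2 * \<nu> * ((E b w * u w) * cnj (w $ j * v w) * gauss w))" for w
  proof -
    have "?F (axis j 1) w + (- \<i>) * ?F (axis j \<i>) w = exp (cdot w b) * gauss w * (2 * (b $ j * u w + hol_deriv_op j u w) * cnj (v w)
       - 4 * \<nu> * (of_real (w \<bullet> axis j 1) - \<i> * of_real (w \<bullet> axis j \<i>)) * ?r w)"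
      unfolding dr ax cd by (simp add: algebra_simps)
    then show ?thesis unfolding wj E_def by (simp add: algebra_simps)
  qed
  show "2 * \<nu> * inn (\<lambda>w. E b w * (w $ j * u w)) v = inn (\<lambda>w. E b w * u w) (hol_deriv_op j v)"
  proof -
    have "(\<integral>w. 2 * ((E b w * u w) * cnj (hol_deriv_op j v w) * gauss w)
      - 2 * (2 * \<nu> * ((E b w * (w $ j * u w)) * cnj (v w) * gauss w)) \<partial>lborel) =
      2 * (\<integral>w. (E b w * u w) * cnj (hol_deriv_op j v w) * gauss w \<partial>lborel) -
      2 * (2 * \<nu> * (\<integral>w. (E b w * (w $ j * u w)) * cnj (v w) * gauss w \<partial>lborel))"
      by (subst Bochner_Integration.integral_diff, (intro integrable_mult_right inn_integrable polys_hol_deriv_op polys.coord u v)+)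
         (simp only: integral_mult_right_zero)
    with comb[of \<i>] show ?thesis unfolding F1 fock_inner_eq by simp
  qed
  show "inn (\<lambda>w. E b w * (b $ j * u w + hol_deriv_op j u w)) v = 2 * \<nu> * inn (\<lambda>w. E b w * u w) (\<lambda>w. w $ j * v w)"
  proof -
    have "(\<integral>w. 2 * ((E b w * (b $ j * u w + hol_deriv_op j u w)) * cnj (v w) * gauss w)
      - 2 * (2 * \<nu> * ((E b w * u w) * cnj (w $ j * v w) * gauss w)) \<partial>lborel) =
      2 * (\<integral>w. (E b w * (b $ j * u w + hol_deriv_op j u w)) * cnj (v w) * gauss w \<partial>lborel) -
      2 * (2 * \<nu> * (\<integral>w. (E b w * u w) * cnj (w $ j * v w) * gauss w \<partial>lborel))"
      by (subst Bochner_Integration.integral_diff,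
           (intro integrable_mult_right inn_integrable polys_hol_deriv_op polys.coord polys.add polys_cmult u v)+)
         (simp only: integral_mult_right_zero)
    with comb[of "- \<i>"] show ?thesis unfolding F2 fock_inner_eq by simp
  qed
qed

lemma inn_coord_left: "u \<in> polys \<Longrightarrow> v \<in> polys \<Longrightarrow> inn (\<lambda>w. w $ j * u w) v = inn u (hol_deriv_op j v) / (2 * \<nu>)"
  using inn_E_adjoint(1)[of u v 0 j] \<nu>_pos by (simp add: field_simps)

lemma inn_deriv_left: "u \<in> polys \<Longrightarrow> v \<in> polys \<Longrightarrow> inn (hol_deriv_op j u) v = 2 * \<nu> * inn u (\<lambda>w. w $ j * v w)"
  using inn_E_adjoint(2)[of u v 0 j] by simp

text \<open>The squared norm of the vacuum vector. The normalisation of the measure makes it 1; it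
  is carried along as a symbol, with \<open>c0_nonzero\<close>.\<close>

definition c0 :: "'m::finite itself \<Rightarrow> complex" where
  "c0 _ = inn (\<lambda>w::complex^'m. 1) (\<lambda>w. 1)"

lemma inn_self_pos:
  assumes "u \<in> polys" "u \<noteq> (\<lambda>w. 0)"
  shows "Re (inn u u) > 0" "Im (inn u u) = 0"
proof -
  show "Im (inn u u) = 0" using inn_cnj[of u u] by (simp add: complex_eq_iff)
  define h where "h = (\<lambda>w. (norm (u w))\<^sup>2 * exp (- 2 * \<nu> * (norm w)\<^sup>2))"
  have eq: "u w * cnj (u w) * gauss w = of_real (h w)" for w
    unfolding h_def gauss_def by (simp add: complex_norm_square[symmetric])
  have i: "integrable lborel h"
    using integrable_Re[OF inn_integrable[OF assms(1) assms(1), of 0]] unfolding E_0 by (simp add: eq)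
  have ch: "continuous_on UNIV h"
    unfolding h_def by (intro continuous_intros polys_continuous assms)
  have "(\<integral>w. h w \<partial>lborel) \<noteq> 0"
  proof
    assume "(\<integral>w. h w \<partial>lborel) = 0"
    then have ae: "AE w in lborel. h w = 0"
      using integral_nonneg_eq_0_iff_AE[OF i] by (simp add: h_def)
    have "h w = 0" for w
    proof (rule ccontr)
      assume "h w \<noteq> 0"
      have "open (h -` (- {0}))" using ch by (intro open_vimage) auto
      moreover have "w \<in> h -` (- {0})" using \<open>h w \<noteq> 0\<close> by simp
      ultimately obtain e where e: "e > 0" "ball w e \<subseteq> h -` (- {0})" using open_contains_ball by blast
      have "AE x in lborel. x \<notin> ball w e" using ae by eventually_elim (use e(2) in auto)
      then have "emeasure lborel (ball w e) = 0"
        using AE_iff_measurable[of "ball w e" lborel "\<lambda>x. x \<notin> ball w e"] by (auto simp: ball_def)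
      moreover have "measure lborel (ball w e) > 0" using e(1) by (simp add: content_ball_pos)
      ultimately show False by (simp add: measure_def)
    qed
    then have "u = (\<lambda>w. 0)" by (auto simp: h_def)
    with assms(2) show False by simp
  qed
  moreover have "(\<integral>w. h w \<partial>lborel) \<ge> 0" by (simp add: h_def)
  moreover have "inn u u = of_real ((2 * \<nu> / pi) ^ CARD('a) * (\<integral>w. h w \<partial>lborel))"
    unfolding fock_inner_eq eq by (simp add: integral_of_real)
  ultimately show "Re (inn u u) > 0" using \<nu>_pos by (simp add: zero_less_power)
qed

lemma inn_self_eq_0: "u \<in> polys \<Longrightarrow> inn u u = 0 \<Longrightarrow> u = (\<lambda>w. 0)"
  using inn_self_pos[of u] by fastforce

lemma c0_nonzero: "c0 TYPE('m::finite) \<noteq> 0"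
  unfolding c0_def using inn_self_eq_0[OF polys.const[of 1, where 'm='m]] by (auto simp: fun_eq_iff)

text \<open>In the expansion of the exponential each power of \<open>cdot w b\<close> beyond the
  constant term contains a coordinate factor, whose adjoint differentiates the constant 1 and gives
  0.\<close>

lemma inn_E_one: "inn (E b :: 'm::finite cfn) (\<lambda>w. 1) = c0 TYPE('m)"
proof -
  have one: "(\<lambda>w::complex^'m. 1) \<in> rpolys" by (rule rpolys.const)
  have cd: "(\<lambda>w. cdot w b) \<in> polys" unfolding cdot_def
    by (intro polys_sum polys.coord polys.const)
  have pw: "(\<lambda>w. cdot w b ^ k) \<in> polys" for k
    by (induction k) (auto intro: polys_mult cd polys.const)
  have s: "(\<lambda>k. (\<integral>w. gauss w * cdot w b ^ k \<partial>lborel) / fact k) sums (\<integral>w. gauss w * exp (cdot w b) \<partial>lborel)"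
  proof (rule integral_exp_series(2))
    show "gauss \<in> borel_measurable lborel"
      by (subst measurable_lborel2, rule borel_measurable_continuous_onI, rule continuous_gauss)
    show "(\<lambda>w. cdot w b) \<in> borel_measurable lborel"
      by (subst measurable_lborel2, rule borel_measurable_continuous_onI, rule linear_continuous_on, rule bounded_linear_cdot)
    show "integrable lborel (\<lambda>w. norm (gauss w) * exp (norm (cdot w b)))"
      using integrable_exp_gauss(3)[OF one, of b] unfolding mult_1_left .
  qed
  have z: "(\<integral>w. gauss w * cdot w b ^ k \<partial>lborel) = 0" if k0: "k > 0" for k
  proof -
    obtain l where k: "k = Suc l" using k0 by (cases k) auto
    have "inn (\<lambda>w. \<Sum>j\<in>UNIV. w $ j * (b $ j * cdot w b ^ l)) (\<lambda>w. 1) = (\<Sum>j\<in>UNIV. 0)"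
      by (subst inn_sum_left) (simp_all add: inn_coord_left polys_cmult pw polys.coord polys.const)
    moreover have "(\<lambda>w. \<Sum>j\<in>UNIV. w $ j * (b $ j * cdot w b ^ l)) = (\<lambda>w. cdot w b ^ k)"
      unfolding k by (auto simp: cdot_def sum_distrib_right algebra_simps)
    ultimately have "inn (\<lambda>w. cdot w b ^ k) (\<lambda>w. 1) = 0" by simp
    then show ?thesis using \<nu>_pos unfolding fock_inner_eq by (simp add: mult.commute)
  qed
  have "(\<lambda>k. (\<integral>w. gauss w * cdot w b ^ k \<partial>lborel) / fact k) sums ((\<integral>w. gauss w * cdot w b ^ 0 \<partial>lborel) / fact 0)"
  proof -
    have "(\<lambda>k. (\<integral>w. gauss w * cdot w b ^ k \<partial>lborel) / fact k) =
        (\<lambda>k. if k = 0 then (\<integral>w. gauss w * cdot w b ^ k \<partial>lborel) / fact k else 0)"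
      using z by (auto simp: fun_eq_iff)
    then show ?thesis using sums_single[of 0 "\<lambda>k. (\<integral>w. gauss w * cdot w b ^ k \<partial>lborel) / fact k"] by (simp only:)
  qed
  with s have "(\<integral>w. gauss w * exp (cdot w b) \<partial>lborel) = (\<integral>w. gauss w * cdot w b ^ 0 \<partial>lborel) / fact 0"
    by (rule sums_unique2)
  then show ?thesis unfolding c0_def fock_inner_eq E_def by (simp add: mult.commute)
qed

end

section \<open>Linear algebra in function spaces\<close>

interpretation cpair: vector_space_pair "cscale :: complex \<Rightarrow> ('a \<Rightarrow> complex) \<Rightarrow> 'a \<Rightarrow> complex"
  "cscale :: complex \<Rightarrow> ('b \<Rightarrow> complex) \<Rightarrow> 'b \<Rightarrow> complex"
  by unfold_locales

lemma cfun_zero: "0 = (\<lambda>x. 0 :: complex)"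
  by (auto simp: zero_fun_def)

lemma subspace_cadd: "cfun.subspace V \<Longrightarrow> u \<in> V \<Longrightarrow> v \<in> V \<Longrightarrow> (\<lambda>w. u w + v w) \<in> V"
  using cfun.subspace_add[of V u v] by (simp add: cfun_plus)

lemma subspace_cscale: "cfun.subspace V \<Longrightarrow> u \<in> V \<Longrightarrow> (\<lambda>w. c * u w) \<in> V"
  using cfun.subspace_scale[of V u c] by (simp add: cscale_def)

lemma subspace_czero: "cfun.subspace V \<Longrightarrow> (\<lambda>w. 0) \<in> V"
  using cfun.subspace_0[of V] by (simp add: cfun_zero)

lemma subspace_csum: "cfun.subspace V \<Longrightarrow> (\<And>i. i \<in> S \<Longrightarrow> u i \<in> V) \<Longrightarrow> (\<lambda>w. \<Sum>i\<in>S. c i * u i w) \<in> V"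
proof (induction S rule: infinite_finite_induct)
  case (insert i S)
  then have "(\<lambda>w. c i * u i w + (\<Sum>i\<in>S. c i * u i w)) \<in> V"
    by (intro subspace_cadd subspace_cscale) auto
  then show ?case using insert by simp
qed (simp_all add: subspace_czero)

lemma subspace_cdiff: "cfun.subspace V \<Longrightarrow> u \<in> V \<Longrightarrow> v \<in> V \<Longrightarrow> (\<lambda>w. u w - v w) \<in> V"
  using subspace_cadd[OF _ _ subspace_cscale[of V v "-1"], of u] by simp

lemma subspaceI_fun:
  assumes "(\<lambda>w. 0) \<in> V" "\<And>u v. u \<in> V \<Longrightarrow> v \<in> V \<Longrightarrow> (\<lambda>w. u w + v w) \<in> V"
    "\<And>c u. u \<in> V \<Longrightarrow> (\<lambda>w. c * u w) \<in> V"
  shows "cfun.subspace V"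
  unfolding cfun.subspace_def cscale_def cfun_plus cfun_zero using assms by auto

lemma span_induct_fun [consumes 1, case_names zero add scale base]:
  assumes "u \<in> cfun.span S" "P (\<lambda>w. 0)"
    "\<And>u v. u \<in> cfun.span S \<Longrightarrow> v \<in> cfun.span S \<Longrightarrow> P u \<Longrightarrow> P v \<Longrightarrow> P (\<lambda>w. u w + v w)"
    "\<And>c u. u \<in> cfun.span S \<Longrightarrow> P u \<Longrightarrow> P (\<lambda>w. c * u w)" "\<And>u. u \<in> S \<Longrightarrow> P u"
  shows "P u"
proof -
  have "cfun.span S \<subseteq> {u \<in> cfun.span S. P u}"
  proof (rule cfun.span_minimal)
    show "S \<subseteq> {u \<in> cfun.span S. P u}" using assms(5) cfun.span_base by auto
    show "cfun.subspace {u \<in> cfun.span S. P u}"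
      by (rule subspaceI_fun)
        (simp_all add: assms(2-4) subspace_czero subspace_cadd subspace_cscale cfun.subspace_span)
  qed
  with assms(1) show ?thesis by blast
qed

text \<open>The vectors form a family and not a set: a repeated member yields the relation with
  coefficients 1 and -1.\<close>

lemma family_dependent:
  fixes x :: "nat \<Rightarrow> 'a \<Rightarrow> complex"
  assumes F: "finite F" "card F \<le> n" and x: "\<And>i. i \<le> n \<Longrightarrow> x i \<in> cfun.span F"
  shows "\<exists>a. (\<exists>i\<le>n. a i \<noteq> 0) \<and> (\<forall>w. (\<Sum>i\<le>n. a i * x i w) = 0)"
proof (cases "inj_on x {..n}")
  case True
  have "card (x ` {..n}) > card F" using F True by (simp add: card_image)
  moreover have "x ` {..n} \<subseteq> cfun.span F" using x by auto
  ultimately have "cfun.dependent (x ` {..n})" using cfun.independent_span_bound[OF F(1)] by (meson not_less)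
  then obtain u where u: "\<exists>v\<in>x ` {..n}. u v \<noteq> 0" "(\<Sum>v\<in>x ` {..n}. cscale (u v) v) = 0"
    using cfun.dependent_finite[of "x ` {..n}"] by auto
  have "(\<Sum>i\<le>n. cscale (u (x i)) (x i)) = 0" using u(2) by (simp add: sum.reindex[OF True])
  then have "(\<Sum>i\<le>n. u (x i) * x i w) = 0" for w
    by (metis (no_types, lifting) cscale_def sum.cong sum_fun_apply zero_fun_apply)
  with u(1) show ?thesis by (intro exI[of _ "\<lambda>i. u (x i)"]) auto
next
  case False
  then obtain i j where ij: "i \<le> n" "j \<le> n" "i \<noteq> j" "x i = x j" unfolding inj_on_def by auto
  define a where "a = (\<lambda>k. if k = i then 1 else if k = j then -1 else (0::complex))"
  have "(\<Sum>k\<le>n. a k * x k w) = 0" for w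
  proof -
    have "(\<Sum>k\<le>n. a k * x k w) = (\<Sum>k\<in>{i, j}. a k * x k w)"
      by (rule sum.mono_neutral_right) (use ij in \<open>auto simp: a_def\<close>)
    also have "\<dots> = 0" using ij by (simp add: a_def)
    finally show ?thesis .
  qed
  moreover have "a i \<noteq> 0" by (simp add: a_def)
  ultimately show ?thesis using ij(1) by blast
qed

text \<open>Derivatives are additive only on functions for which they exist, so linearity is
  relative to a set, usually \<open>polys\<close> or the smooth functions.\<close>

definition lin_on :: "('a \<Rightarrow> complex) set \<Rightarrow> (('a \<Rightarrow> complex) \<Rightarrow> 'b \<Rightarrow> complex) \<Rightarrow> bool" where
  "lin_on V S \<longleftrightarrow> (\<forall>u\<in>V. \<forall>v\<in>V. S (\<lambda>w. u w + v w) = (\<lambda>w. S u w + S v w)) \<and>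
     (\<forall>c. \<forall>u\<in>V. S (\<lambda>w. c * u w) = (\<lambda>w. c * S u w))"

lemma lin_onD: "lin_on V S \<Longrightarrow> u \<in> V \<Longrightarrow> v \<in> V \<Longrightarrow> S (\<lambda>w. u w + v w) = (\<lambda>w. S u w + S v w)"
  "lin_on V S \<Longrightarrow> u \<in> V \<Longrightarrow> S (\<lambda>w. c * u w) = (\<lambda>w. c * S u w)"
  by (auto simp: lin_on_def)

lemma lin_on_zero: "lin_on V S \<Longrightarrow> cfun.subspace V \<Longrightarrow> S (\<lambda>w. 0) = (\<lambda>w. 0)"
  using lin_onD(2)[of V S "\<lambda>w. 0" 0] subspace_czero[of V] by simp

lemma lin_on_diff:
  assumes "lin_on V S" "cfun.subspace V" "u \<in> V" "v \<in> V"
  shows "S (\<lambda>w. u w - v w) = (\<lambda>w. S u w - S v w)"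
proof -
  have "S (\<lambda>w. u w + (-1) * v w) = (\<lambda>w. S u w + (-1) * S v w)"
    by (simp only: lin_onD(1)[OF assms(1,3) subspace_cscale[OF assms(2,4)]] lin_onD(2)[OF assms(1,4)])
  then show ?thesis by simp
qed

lemma lin_on_sum: "lin_on V S \<Longrightarrow> cfun.subspace V \<Longrightarrow> (\<And>i. i \<in> I \<Longrightarrow> u i \<in> V) \<Longrightarrow>
   S (\<lambda>w. \<Sum>i\<in>I. c i * u i w) = (\<lambda>w. \<Sum>i\<in>I. c i * S (u i) w)"
proof (induction I rule: infinite_finite_induct)
  case (insert i I)
  then show ?case
    by (simp add: lin_onD(1)[OF insert.prems(1) subspace_cscale[OF insert.prems(2)] subspace_csum] lin_onD(2)[OF insert.prems(1)])
qed (auto simp: lin_on_zero)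

lemma lin_on_subset: "lin_on V S \<Longrightarrow> W \<subseteq> V \<Longrightarrow> lin_on W S"
  unfolding lin_on_def by blast

lemma lin_on_compose: "lin_on V S \<Longrightarrow> (\<And>u. u \<in> V \<Longrightarrow> S u \<in> W) \<Longrightarrow> lin_on W T \<Longrightarrow> lin_on V (\<lambda>u. T (S u))"
  unfolding lin_on_def by auto

text \<open>The vectors \<open>(S ^^ i) u0\<close> are dependent, so some nonzero polynomial in
  \<open>S\<close> kills \<open>u0\<close>. Roots are split off one at a time until a factor with a
  nonzero value at \<open>u0\<close> is met; that value is an eigenvector.\<close>

lemma eigenvalue_exists:
  fixes S :: "('a \<Rightarrow> complex) \<Rightarrow> 'a \<Rightarrow> complex"
  assumes V: "cfun.subspace V" and F: "finite F" "V \<subseteq> cfun.span F" and S: "lin_on V S" "\<And>u. u \<in> V \<Longrightarrow> S u \<in> V"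
    and u0: "u0 \<in> V" "u0 \<noteq> (\<lambda>w. 0)"
  shows "\<exists>c. \<exists>u\<in>V. u \<noteq> (\<lambda>w. 0) \<and> S u = (\<lambda>w. c * u w)"
proof -
  define x where "x = (\<lambda>i. (S ^^ i) u0)"
  have xV: "x i \<in> V" for i unfolding x_def by (induction i) (auto simp: u0 S)
  have xS: "S (x i) = x (Suc i)" for i by (simp add: x_def)
  define N where "N = card F"
  \<comment> \<open>For \<open>degree p \<le> N\<close> this is p(S) applied to
    \<open>u0\<close>.\<close>
  define ev where "ev = (\<lambda>p w. \<Sum>i\<le>N. coeff p i * x i w)"
  have evV: "ev p \<in> V" for p unfolding ev_def by (intro subspace_csum V xV)
  obtain a where a: "\<exists>i\<le>N. a i \<noteq> 0" "\<forall>w. (\<Sum>i\<le>N. a i * x i w) = 0"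
    using family_dependent[OF F(1), of N x] F(2) xV unfolding N_def by blast
  define p0 where "p0 = (\<Sum>i\<le>N. monom (a i) i)"
  have cp0: "coeff p0 i = (if i \<le> N then a i else 0)" for i
    by (simp add: p0_def coeff_sum)
  have "p0 \<noteq> 0" using a(1) cp0 by (metis coeff_0)
  moreover have "degree p0 \<le> N" by (rule degree_le) (simp add: cp0)
  moreover have "ev p0 = (\<lambda>w. 0)" using a(2) by (simp add: ev_def cp0)
  moreover have "\<exists>c. \<exists>u\<in>V. u \<noteq> (\<lambda>w. 0) \<and> S u = (\<lambda>w. c * u w)"
    if "p \<noteq> 0" "degree p \<le> N" "ev p = (\<lambda>w. 0)" for p
    using that
  proof (induction "degree p" arbitrary: p rule: less_induct)
    case less
    show ?case
    proof (cases "degree p = 0")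
      case True
      then obtain b where b: "p = [:b:]" using degree_eq_zeroE by blast
      have "ev p = (\<lambda>w. b * u0 w)"
      proof
        fix w
        have "ev p w = (\<Sum>i\<in>{0}. coeff p i * x i w)"
          unfolding ev_def by (rule sum.mono_neutral_right) (auto simp: b coeff_pCons split: nat.splits)
        then show "ev p w = b * u0 w" by (simp add: b x_def)
      qed
      with less.prems b u0 show ?thesis by (auto simp: fun_eq_iff)
    next
      case False
      then have "\<not> constant (poly p)" by (simp add: constant_degree)
      then obtain c where c: "poly p c = 0" using fundamental_theorem_of_algebra by blast
      then obtain q where q: "p = [:-c, 1:] * q" using poly_eq_0_iff_dvd by (metis dvdE)
      have q0: "q \<noteq> 0" using q less.prems by auto
      have dq: "degree p = Suc (degree q)" unfolding q by (subst degree_mult_eq) (use q0 in auto)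
      have cN: "coeff q N = 0" using dq less.prems(2) by (intro coeff_eq_0) simp
      have cp: "coeff p i = (case i of 0 \<Rightarrow> 0 | Suc k \<Rightarrow> coeff q k) - c * coeff q i" for i
        unfolding q by (simp add: coeff_pCons split: nat.splits)
      have "(\<lambda>w. S (ev q) w - c * ev q w) = ev p"
      proof
        fix w
        have "S (ev q) w = (\<Sum>i\<le>N. coeff q i * x (Suc i) w)"
          unfolding ev_def lin_on_sum[OF S(1) V xV] xS ..
        also have "\<dots> = (\<Sum>i<N. coeff q i * x (Suc i) w)" by (simp add: cN lessThan_Suc_atMost[symmetric])
        also have "\<dots> = (\<Sum>i\<le>N. (case i of 0 \<Rightarrow> 0 | Suc k \<Rightarrow> coeff q k) * x i w)"
          by (cases N) (simp_all add: sum.atMost_Suc_shift lessThan_Suc_atMost del: sum.atMost_Suc)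
        finally show "S (ev q) w - c * ev q w = ev p w"
          by (simp add: ev_def cp left_diff_distrib sum_subtractf sum_distrib_left mult.assoc)
      qed
      with less.prems(3) have eq: "S (ev q) = (\<lambda>w. c * ev q w)" by (auto simp: fun_eq_iff)
      show ?thesis
      \<comment> \<open>Either the cofactor \<open>q\<close> still kills \<open>u0\<close> and the
        induction goes on, or its value is the eigenvector sought.\<close>
      proof (cases "ev q = (\<lambda>w. 0)")
        case True
        show ?thesis by (rule less.hyps[OF _ q0]) (use dq less.prems(2) True in auto)
      next
        case False then show ?thesis using eq evV by blast
      qed
    qed
  qed
  ultimately show ?thesis by blast
qed

section \<open>Orthonormal systems\<close>

context fock begin

definition onb :: "'m::finite cfn set \<Rightarrow> bool" where
  "onb B \<longleftrightarrow> finite B \<and> B \<subseteq> polys \<and> (\<forall>u\<in>B. \<forall>v\<in>B. inn u v = (if u = v then 1 else 0))"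

definition proj :: "'m::finite cfn set \<Rightarrow> 'm cfn \<Rightarrow> 'm cfn" where
  "proj B u = (\<lambda>w. \<Sum>e\<in>B. inn u e * e w)"

lemma span_polys: "B \<subseteq> polys \<Longrightarrow> u \<in> cfun.span B \<Longrightarrow> u \<in> polys"
  using cfun.span_minimal[OF _ polys_subspace] by blast

lemma proj_span: "proj B u \<in> cfun.span B"
  unfolding proj_def by (intro subspace_csum cfun.subspace_span cfun.span_base)

lemma proj_polys: "onb B \<Longrightarrow> proj B u \<in> polys"
  using proj_span span_polys unfolding onb_def by blast

lemma inn_proj: "onb B \<Longrightarrow> e \<in> B \<Longrightarrow> inn (proj B u) e = inn u e"
proof -
  assume B: "onb B" "e \<in> B"
  have "inn (proj B u) e = (\<Sum>i\<in>B. inn u i * inn i e)"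
    unfolding proj_def using B by (subst inn_sum_left) (auto simp: inn_cmult_left onb_def intro: polys_cmult)
  also have "\<dots> = (\<Sum>i\<in>B. if i = e then inn u i else 0)"
    by (rule sum.cong) (use B in \<open>auto simp: onb_def\<close>)
  also have "\<dots> = inn u e" using B by (simp add: onb_def)
  finally show ?thesis .
qed

lemma inn_span_zero:
  assumes "B \<subseteq> polys" "u \<in> polys" "\<And>e. e \<in> B \<Longrightarrow> inn u e = 0" "v \<in> cfun.span B"
  shows "inn u v = 0"
  using assms(4)
proof (induction rule: span_induct_fun)
  case (add v v')
  then show ?case using inn_add_right[OF assms(2)] span_polys[OF assms(1)] by simp
qed (auto simp: inn_cmult_right assms)

lemma inn_diff_proj:
  assumes "onb B" "u \<in> polys" "v \<in> cfun.span B"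
  shows "inn (\<lambda>w. u w - proj B u w) v = 0"
proof (rule inn_span_zero[OF _ _ _ assms(3)])
  show "B \<subseteq> polys" using assms(1) by (simp add: onb_def)
  show "(\<lambda>w. u w - proj B u w) \<in> polys" by (intro polys_diff assms proj_polys)
  show "inn (\<lambda>w. u w - proj B u w) e = 0" if "e \<in> B" for e
    using assms that by (subst inn_diff_left) (auto simp: inn_proj proj_polys onb_def)
qed

text \<open>The projection is characterised by membership in the span and orthogonality of the
  remainder. In this form symmetries can be carried through \<open>proj\<close> without computing in
  the basis.\<close>

lemma proj_unique:
  assumes "onb B" "u \<in> polys" "a \<in> cfun.span B" "\<And>v. v \<in> cfun.span B \<Longrightarrow> inn (\<lambda>w. u w - a w) v = 0"
  shows "proj B u = a"
proof -
  have B: "B \<subseteq> polys" using assms(1) by (simp add: onb_def)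
  have a: "a \<in> polys" using span_polys[OF B assms(3)] .
  let ?d = "\<lambda>w. proj B u w - a w"
  have d: "?d \<in> cfun.span B" by (intro subspace_cdiff cfun.subspace_span proj_span assms)
  have "inn (\<lambda>w. u w - a w) ?d - inn (\<lambda>w. u w - proj B u w) ?d = inn ?d ?d"
    using inn_diff_left[of "\<lambda>w. u w - a w" "\<lambda>w. u w - proj B u w" ?d] span_polys[OF B d]
    by (simp add: polys_diff a assms(2) proj_polys[OF assms(1)])
  then have "inn ?d ?d = 0" using assms(4)[OF d] inn_diff_proj[OF assms(1,2) d] by simp
  then have "?d = (\<lambda>w. 0)" using inn_self_eq_0 span_polys[OF B d] by blast
  then show ?thesis by (auto simp: fun_eq_iff)
qed

lemma proj_id: "onb B \<Longrightarrow> u \<in> cfun.span B \<Longrightarrow> proj B u = u"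
  by (rule proj_unique) (auto simp: onb_def dest: span_polys)

lemma lin_on_proj: "onb B \<Longrightarrow> lin_on polys (proj B)"
  unfolding lin_on_def proj_def onb_def
  by (auto simp: fun_eq_iff sum.distrib sum_distrib_left distrib_right inn_add_left inn_cmult_left subset_iff algebra_simps
      intro!: sum.cong)

lemma gram_schmidt:
  assumes "finite S" "S \<subseteq> polys"
  shows "\<exists>B. onb B \<and> cfun.span B = cfun.span S"
  using assms
proof (induction S rule: finite_induct)
  case empty
  then show ?case by (intro exI[of _ "{}"]) (auto simp: onb_def)
next
  case (insert s S)
  then obtain B where B: "onb B" "cfun.span B = cfun.span S" by auto
  have s: "s \<in> polys" using insert by auto
  define r where "r = (\<lambda>w. s w - proj B s w)"
  have r: "r \<in> polys" unfolding r_def by (intro polys_diff s proj_polys B)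
  have ins: "cfun.span (insert s S) = cfun.span (insert s B)"
    using B(2) by (simp add: cfun.span_insert)
  show ?case
  proof (cases "r = (\<lambda>w. 0)")
    case True
    then have "s = proj B s" by (auto simp: r_def fun_eq_iff)
    then have "s \<in> cfun.span B" using proj_span by metis
    then have "cfun.span (insert s B) = cfun.span B" by (simp add: cfun.span_redundant)
    then show ?thesis using B ins by auto
  next
    case False
    define d where "d = Re (inn r r)"
    have d: "d > 0" "inn r r = of_real d" using inn_self_pos[OF r False] by (auto simp: d_def complex_eq_iff)
    define e where "e = (\<lambda>w. of_real (1 / sqrt d) * r w)"
    have e: "e \<in> polys" unfolding e_def by (rule polys_cmult[OF r])
    have ee: "inn e e = 1"
      unfolding e_def inn_cmult_left inn_cmult_right d(2) using d(1)
      by (simp flip: of_real_mult add: real_div_sqrt)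
    have eb: "inn e b = 0" "inn b e = 0" if "b \<in> B" for b
    proof -
      have "inn r b = 0" unfolding r_def by (rule inn_diff_proj[OF B(1) s cfun.span_base[OF that]])
      then show 1: "inn e b = 0" unfolding e_def inn_cmult_left by simp
      show "inn b e = 0" using inn_cnj[of b e] 1 by simp
    qed
    have "onb (insert e B)" using B(1) e ee eb unfolding onb_def by auto
    moreover have "cfun.span (insert e B) = cfun.span (insert s B)"
    proof (intro equalityI cfun.span_minimal cfun.subspace_span insert_subsetI)
      have ps: "proj B s \<in> cfun.span (insert x B)" for x
        using proj_span cfun.span_mono[of B "insert x B"] by blast
      show "e \<in> cfun.span (insert s B)"
        unfolding e_def r_def by (intro subspace_cscale subspace_cdiff cfun.subspace_span ps cfun.span_base) simp
      have "s = (\<lambda>w. of_real (sqrt d) * e w + proj B s w)"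
        using d(1) by (auto simp: e_def r_def fun_eq_iff simp flip: of_real_mult)
      also have "\<dots> \<in> cfun.span (insert e B)"
        by (intro subspace_cadd subspace_cscale cfun.subspace_span ps cfun.span_base) simp
      finally show "s \<in> cfun.span (insert e B)" .
      show "B \<subseteq> cfun.span (insert s B)" "B \<subseteq> cfun.span (insert e B)" by (auto intro: cfun.span_base)
    qed
    ultimately show ?thesis using ins by blast
  qed
qed

lemma subspace_onb:
  assumes "cfun.subspace N" "N \<subseteq> cfun.span F" "finite F" "F \<subseteq> polys"
  shows "\<exists>B. onb B \<and> cfun.span B = N"
proof -
  obtain C where C: "C \<subseteq> N" "cfun.independent C" "N \<subseteq> cfun.span C"
    by (rule cfun.basis_exists)
  have "finite C" using cfun.independent_span_bound[OF assms(3) C(2)] C(1) assms(2) by auto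
  moreover have "C \<subseteq> polys" using C(1) assms(2) span_polys[OF assms(4)] by blast
  moreover have "cfun.span C = N" using C assms(1) cfun.span_minimal by blast
  ultimately show ?thesis using gram_schmidt by metis
qed

end

section \<open>Unitary matrices acting on polynomials\<close>

lemma matrix_inv_eqI:
  fixes A B :: "complex^'m::finite^'m"
  assumes "A ** B = mat 1" "B ** A = mat 1" shows "matrix_inv A = B"
proof -
  have "A ** matrix_inv A = mat 1 \<and> matrix_inv A ** A = mat 1"
    unfolding matrix_inv_def by (rule someI_ex) (use assms in blast)
  then have "matrix_inv A = matrix_inv A ** (A ** B)" "matrix_inv A ** A = mat 1" using assms by auto
  then show ?thesis by (simp add: matrix_mul_assoc)
qed

lemma unitary_inv:
  assumes "A \<in> unitary_group"
  shows "matrix_inv A = transpose (mat_cnj A)" "A ** matrix_inv A = mat 1" "matrix_inv A ** A = mat 1"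
proof -
  have A: "A ** transpose (mat_cnj A) = mat 1" "transpose (mat_cnj A) ** A = mat 1"
    using assms by (auto simp: unitary_group_def)
  then show 1: "matrix_inv A = transpose (mat_cnj A)" by (rule matrix_inv_eqI)
  show "A ** matrix_inv A = mat 1" "matrix_inv A ** A = mat 1" using A by (simp_all add: 1)
qed

lemma mat_cnj_mult: "mat_cnj (A ** B) = mat_cnj A ** mat_cnj B"
  by (simp add: mat_cnj_def matrix_matrix_mult_def vec_eq_iff)

lemma mat_cnj_cnj [simp]: "mat_cnj (mat_cnj A) = A"
  by (simp add: mat_cnj_def vec_eq_iff)

lemma mat_cnj_transpose: "mat_cnj (transpose A) = transpose (mat_cnj A)"
  by (simp add: mat_cnj_def transpose_def vec_eq_iff)

lemma mat_cnj_1 [simp]: "mat_cnj (mat 1) = mat 1"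
  by (simp add: mat_cnj_def mat_def vec_eq_iff)

lemma unitary_mat_cnj: "A \<in> unitary_group \<Longrightarrow> mat_cnj A \<in> unitary_group"
proof -
  assume "A \<in> unitary_group"
  then have "mat_cnj (A ** transpose (mat_cnj A)) = mat_cnj (mat 1)" "mat_cnj (transpose (mat_cnj A) ** A) = mat_cnj (mat 1)"
    by (simp_all add: unitary_group_def)
  then show ?thesis by (simp add: unitary_group_def mat_cnj_mult mat_cnj_transpose)
qed

lemma unitary_matrix_inv: "A \<in> unitary_group \<Longrightarrow> matrix_inv A \<in> unitary_group"
  using unitary_inv(1)[of A] unfolding unitary_group_def by (simp add: mat_cnj_transpose)

lemma matrix_inv_mat_cnj: "A \<in> unitary_group \<Longrightarrow> matrix_inv (mat_cnj A) = mat_cnj (matrix_inv A)"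
  by (simp add: unitary_inv unitary_mat_cnj mat_cnj_transpose)

lemma vec_cnj_mult: "vec_cnj (A *v w) = mat_cnj A *v vec_cnj w"
  by (simp add: vec_cnj_def mat_cnj_def matrix_vector_mult_def vec_eq_iff)

lemma norm_cdot: "of_real ((norm w)\<^sup>2) = cdot w (vec_cnj w)"
  unfolding power2_norm_eq_inner inner_vec_def cdot_def vec_cnj_def
  by (simp add: inner_complex_def complex_eq_iff)

lemma cdot_matrix: "cdot (A *v w) x = cdot w (transpose A *v x)"
proof -
  have "cdot (A *v w) x = (\<Sum>i\<in>UNIV. \<Sum>j\<in>UNIV. A $ i $ j * w $ j * x $ i)"
    by (simp add: cdot_def matrix_vector_mult_def sum_distrib_right)
  also have "\<dots> = (\<Sum>j\<in>UNIV. \<Sum>i\<in>UNIV. A $ i $ j * w $ j * x $ i)" by (rule sum.swap)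
  finally show ?thesis
    by (simp add: cdot_def matrix_vector_mult_def transpose_def sum_distrib_left algebra_simps)
qed

lemma cdot_unitary:
  assumes A: "A \<in> unitary_group"
  shows "cdot (A *v w) (mat_cnj A *v x) = cdot w x"
proof -
  have "transpose A ** mat_cnj A = mat_cnj (transpose (mat_cnj A) ** A)"
    by (simp add: mat_cnj_mult mat_cnj_transpose)
  also have "\<dots> = mat 1" using A by (simp add: unitary_group_def)
  finally show ?thesis by (simp add: cdot_matrix matrix_vector_mul_assoc)
qed

lemma unitary_norm: "A \<in> unitary_group \<Longrightarrow> norm (A *v w) = norm w"
proof -
  assume A: "A \<in> unitary_group"
  have "complex_of_real ((norm (A *v w))\<^sup>2) = of_real ((norm w)\<^sup>2)"
    unfolding norm_cdot vec_cnj_mult cdot_unitary[OF A] ..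
  then have "(norm (A *v w))\<^sup>2 = (norm w)\<^sup>2" by (simp only: of_real_eq_iff)
  then show ?thesis by simp
qed

locale fockK = fock lam for lam :: real +
  fixes K :: "(complex^'n::finite^'n) set"
  assumes K: "unitary_subgroup K"
begin

text \<open>The matrix by which k acts on the variables. The conjugation prescribed for
  \<open>lam > 0\<close> is hidden here, so that later arguments are uniform in the sign.\<close>

definition ks :: "complex^'n^'n \<Rightarrow> complex^'n^'n" where
  "ks k = (if lam > 0 then mat_cnj k else k)"

lemma K_unitary: "k \<in> K \<Longrightarrow> k \<in> unitary_group"
  and K_1: "mat 1 \<in> K" and K_mult: "k \<in> K \<Longrightarrow> l \<in> K \<Longrightarrow> k ** l \<in> K" and K_inv: "k \<in> K \<Longrightarrow> matrix_inv k \<in> K"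
  using K by (auto simp: unitary_subgroup_def)

lemma ks_unitary: "k \<in> K \<Longrightarrow> ks k \<in> unitary_group"
  by (simp add: ks_def K_unitary unitary_mat_cnj)

lemma ks_inv: "k \<in> K \<Longrightarrow> ks (matrix_inv k) = matrix_inv (ks k)"
  by (simp add: ks_def matrix_inv_mat_cnj K_unitary)

lemma ks_mult: "ks (k ** l) = ks k ** ks l"
  by (simp add: ks_def mat_cnj_mult)

lemma inv_inv: "k \<in> K \<Longrightarrow> matrix_inv (matrix_inv k) = k"
  using unitary_inv[OF K_unitary] by (intro matrix_inv_eqI) auto

abbreviation U :: "complex^'n^'n \<Rightarrow> 'n cfn \<Rightarrow> 'n cfn" where
  "U \<equiv> K_rep lam"

lemma U_eq: "U k u = (\<lambda>w. u (matrix_inv (ks k) *v w))"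
  by (simp add: K_rep_def ks_def)

lemma U_inv_eq: "k \<in> K \<Longrightarrow> U (matrix_inv k) u = (\<lambda>w. u (ks k *v w))"
  using inv_inv K_inv ks_inv by (metis (no_types, lifting) U_eq)

lemma U_inv: "k \<in> K \<Longrightarrow> U k (U (matrix_inv k) u) = u" "k \<in> K \<Longrightarrow> U (matrix_inv k) (U k u) = u"
  by (simp_all add: U_inv_eq, simp_all add: U_eq matrix_vector_mul_assoc unitary_inv(2,3)[OF ks_unitary])

lemma U_mult: "k \<in> K \<Longrightarrow> l \<in> K \<Longrightarrow> U (k ** l) u = U k (U l u)"
proof -
  assume kl: "k \<in> K" "l \<in> K"
  have "matrix_inv (ks (k ** l)) = matrix_inv (ks l) ** matrix_inv (ks k)"
  proof (rule matrix_inv_eqI)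
    note [simp] = unitary_inv(2,3)[OF ks_unitary[OF kl(1)]] unitary_inv(2,3)[OF ks_unitary[OF kl(2)]]
    have "ks k ** ks l ** (matrix_inv (ks l) ** matrix_inv (ks k)) = ks k ** (ks l ** matrix_inv (ks l)) ** matrix_inv (ks k)"
      by (simp only: matrix_mul_assoc)
    then show "ks (k ** l) ** (matrix_inv (ks l) ** matrix_inv (ks k)) = mat 1" by (simp add: ks_mult)
    have "matrix_inv (ks l) ** matrix_inv (ks k) ** (ks k ** ks l) = matrix_inv (ks l) ** (matrix_inv (ks k) ** ks k) ** ks l"
      by (simp only: matrix_mul_assoc)
    then show "matrix_inv (ks l) ** matrix_inv (ks k) ** ks (k ** l) = mat 1" by (simp add: ks_mult)
  qed
  then show ?thesis by (simp add: U_eq matrix_vector_mul_assoc)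
qed

lemma U_polys: "u \<in> polys \<Longrightarrow> U k u \<in> polys"
  unfolding U_eq by (rule polys_compose_matrix)

lemma U_linear: "U k (\<lambda>w. u w + v w) = (\<lambda>w. U k u w + U k v w)" "U k (\<lambda>w. c * u w) = (\<lambda>w. c * U k u w)"
  "U k (\<lambda>w. u w - v w) = (\<lambda>w. U k u w - U k v w)"
  by (auto simp: U_eq)

lemma gauss_unitary: "A \<in> unitary_group \<Longrightarrow> gauss (A *v w) = gauss w"
  by (simp add: gauss_def unitary_norm)

lemma inn_unitary:
  assumes "A \<in> unitary_group" shows "inn (\<lambda>w. u (A *v w)) (\<lambda>w. v (A *v w)) = inn u v"
  using integral_lborel_isometry(1)[of "\<lambda>w. A *v w" "\<lambda>w. u w * cnj (v w) * gauss w"]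
  by (simp add: fock_inner_eq unitary_norm[OF assms] gauss_unitary[OF assms])

lemma inn_U: "k \<in> K \<Longrightarrow> inn (U k u) (U k v) = inn u v"
  unfolding U_eq by (rule inn_unitary[OF unitary_matrix_inv[OF ks_unitary]])

lemma inn_U_left: "k \<in> K \<Longrightarrow> inn (U k u) v = inn u (U (matrix_inv k) v)"
  using inn_U[of k u "U (matrix_inv k) v"] U_inv by simp

lemma proj_U:
  assumes "onb B" "K_invariant_subspace K lam (cfun.span B)" "k \<in> K" "u \<in> polys"
  shows "proj B (U k u) = U k (proj B u)"
proof (rule proj_unique[OF assms(1)])
  show "U k u \<in> polys" by (rule U_polys[OF assms(4)])
  show "U k (proj B u) \<in> cfun.span B"
    using assms(2,3) proj_span by (auto simp: K_invariant_subspace_def)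
  show "inn (\<lambda>w. U k u w - U k (proj B u) w) v = 0" if v: "v \<in> cfun.span B" for v
  proof -
    have "U (matrix_inv k) v \<in> cfun.span B"
      using assms(2) K_inv[OF assms(3)] v by (auto simp: K_invariant_subspace_def)
    then show ?thesis
      unfolding U_linear(3)[symmetric] inn_U_left[OF assms(3)] by (rule inn_diff_proj[OF assms(1,4)])
  qed
qed

lemma K_irreducibleD: "K_irreducible K lam W \<Longrightarrow> K_invariant_subspace K lam W' \<Longrightarrow> W' \<subseteq> W \<Longrightarrow> W' = {0} \<or> W' = W"
  by (simp add: K_irreducible_def)

text \<open>Kernel and image are invariant subspaces, so irreducibility of both spaces makes
  \<open>S\<close> bijective.\<close>

lemma schur:
  assumes V: "K_irreducible K lam V" and W: "K_irreducible K lam W"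
    and S: "lin_on V S" "\<And>u. u \<in> V \<Longrightarrow> S u \<in> W" "\<And>k u. k \<in> K \<Longrightarrow> u \<in> V \<Longrightarrow> S (U k u) = U k (S u)"
    and ne: "u0 \<in> V" "S u0 \<noteq> (\<lambda>w. 0)"
  shows "K_equivalent K lam V W"
proof -
  have sV: "cfun.subspace V" and sW: "cfun.subspace W"
    and iV: "\<And>k u. k \<in> K \<Longrightarrow> u \<in> V \<Longrightarrow> U k u \<in> V" and iW: "\<And>k u. k \<in> K \<Longrightarrow> u \<in> W \<Longrightarrow> U k u \<in> W"
    using V W by (auto simp: K_irreducible_def K_invariant_subspace_def)
  let ?ker = "{u \<in> V. S u = (\<lambda>w. 0)}"
  have "K_invariant_subspace K lam ?ker"
    unfolding K_invariant_subspace_def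
    by (auto intro!: subspaceI_fun subspace_czero[OF sV] subspace_cadd[OF sV] subspace_cscale[OF sV] iV
        simp: lin_on_zero[OF S(1) sV] lin_onD[OF S(1)] S(3)) (auto simp: U_eq)
  then have "?ker = {0} \<or> ?ker = V" by (rule K_irreducibleD[OF V]) auto
  with ne have ker: "?ker = {0}" by auto
  let ?im = "S ` V"
  have "cfun.subspace ?im"
  proof (rule subspaceI_fun)
    have "S (\<lambda>w. 0) \<in> ?im" using subspace_czero[OF sV] by (rule imageI)
    then show "(\<lambda>w. 0) \<in> ?im" unfolding lin_on_zero[OF S(1) sV] .
    show "(\<lambda>w. u w + v w) \<in> ?im" if uv: "u \<in> ?im" "v \<in> ?im" for u v
    proof -
      obtain u' v' where "u' \<in> V" "v' \<in> V" "u = S u'" "v = S v'" using uv by blast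
      then show ?thesis
        by (intro image_eqI[of _ S "\<lambda>w. u' w + v' w"]) (simp_all add: lin_onD(1)[OF S(1)] subspace_cadd[OF sV])
    qed
    show "(\<lambda>w. c * u w) \<in> ?im" if u: "u \<in> ?im" for c u
    proof -
      obtain u' where "u' \<in> V" "u = S u'" using u by blast
      then show ?thesis
        by (intro image_eqI[of _ S "\<lambda>w. c * u' w"]) (simp_all add: lin_onD(2)[OF S(1)] subspace_cscale[OF sV])
    qed
  qed
  moreover have "U k u \<in> ?im" if ku: "k \<in> K" "u \<in> ?im" for k u
  proof -
    obtain u' where u': "u' \<in> V" "u = S u'" using ku by blast
    show ?thesis unfolding u'(2) S(3)[OF ku(1) u'(1), symmetric] using iV[OF ku(1) u'(1)] by (rule imageI)
  qed
  ultimately have "K_invariant_subspace K lam ?im" by (simp add: K_invariant_subspace_def)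
  moreover have "?im \<subseteq> W" using S(2) by auto
  ultimately have "?im = {0} \<or> ?im = W" by (intro K_irreducibleD[OF W])
  with ne have im: "?im = W" by (auto simp: cfun_zero)
  have "inj_on S V"
  proof (rule inj_onI)
    fix u v assume uv: "u \<in> V" "v \<in> V" "S u = S v"
    have "S (\<lambda>w. u w - v w) = (\<lambda>w. 0)"
      using uv by (simp add: lin_on_diff[OF S(1) sV])
    moreover have "(\<lambda>w. u w - v w) \<in> V" using uv by (intro subspace_cdiff sV)
    ultimately have "(\<lambda>w. u w - v w) \<in> ?ker" by simp
    then have "(\<lambda>w. u w - v w) = (\<lambda>w. 0)" unfolding ker by (simp add: cfun_zero)
    then show "u = v" by (auto simp: fun_eq_iff)
  qed
  with im have bij: "bij_betw S V W" by (simp add: bij_betw_def)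
  \<comment> \<open>\<open>K_equivalent\<close> asks for a map that is linear on all functions,
    whereas \<open>S\<close> is linear on \<open>V\<close> only; the map required is the extension
    of \<open>S\<close> from a basis of \<open>V\<close>.\<close>
  obtain C where C: "C \<subseteq> V" "cfun.independent C" "V \<subseteq> cfun.span C"
    by (rule cfun.basis_exists)
  obtain A where A: "Vector_Spaces.linear cscale cscale A" "\<forall>x\<in>C. A x = S x"
    using cpair.linear_independent_extend[OF C(2)] by blast
  have CV: "cfun.span C \<subseteq> V" using C(1) sV by (rule cfun.span_minimal)
  have AS: "A u = S u" if "u \<in> V" for u
  proof -
    from that C(3) have "u \<in> cfun.span C" by blast
    then show ?thesis
    proof (induction rule: span_induct_fun)
      case zero
      show ?case using cpair.linear_0[OF A(1)] lin_on_zero[OF S(1) sV] by (simp add: cfun_zero)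
    next
      case (add u v)
      then show ?case using cpair.linear_add[OF A(1), of u v] lin_onD(1)[OF S(1), of u v] CV
        by (simp add: cfun_plus subset_iff)
    next
      case (scale c u)
      then show ?case using cpair.linear_scale[OF A(1), of c u] lin_onD(2)[OF S(1), of u c] CV
        by (simp add: cscale_def subset_iff)
    qed (use A(2) in auto)
  qed
  have "bij_betw A V W" using bij bij_betw_cong[of V A S W] AS by blast
  moreover have "A (U k u) = U k (A u)" if "k \<in> K" "u \<in> V" for k u using that AS iV S(3) by simp
  ultimately show ?thesis unfolding K_equivalent_def using A(1) by blast
qed

end

section \<open>Operators commuting with K on a multiplicity free decomposition\<close>

locale mult_free = fockK lam K for lam :: real and K :: "(complex^'n::finite^'n) set" +
  fixes \<Lambda> :: "'i set" and V :: "'i \<Rightarrow> 'n cfn set"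
  assumes mf: "multiplicity_free_decomposition K lam \<Lambda> V"
begin

lemma V_irred: "\<beta> \<in> \<Lambda> \<Longrightarrow> K_irreducible K lam (V \<beta>)"
  and V_span: "cfun.span (\<Union>\<alpha>\<in>\<Lambda>. V \<alpha>) = polys"
  and V_ineq: "\<beta> \<in> \<Lambda> \<Longrightarrow> \<gamma> \<in> \<Lambda> \<Longrightarrow> \<beta> \<noteq> \<gamma> \<Longrightarrow> \<not> K_equivalent K lam (V \<beta>) (V \<gamma>)"
  using mf hol_polys_eq by (auto simp: multiplicity_free_decomposition_def)

lemma V_Kinv: "\<beta> \<in> \<Lambda> \<Longrightarrow> K_invariant_subspace K lam (V \<beta>)"
  using V_irred[of \<beta>] by (simp add: K_irreducible_def)

lemma V_sub: "\<beta> \<in> \<Lambda> \<Longrightarrow> cfun.subspace (V \<beta>)"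
  using V_Kinv[of \<beta>] by (simp add: K_invariant_subspace_def)

lemma V_inv: "\<beta> \<in> \<Lambda> \<Longrightarrow> k \<in> K \<Longrightarrow> u \<in> V \<beta> \<Longrightarrow> U k u \<in> V \<beta>"
  using V_Kinv[of \<beta>] by (simp add: K_invariant_subspace_def)

lemma V_nonzero: "\<beta> \<in> \<Lambda> \<Longrightarrow> \<exists>u\<in>V \<beta>. u \<noteq> (\<lambda>w. 0)"
proof (rule ccontr)
  assume b: "\<beta> \<in> \<Lambda>" and n: "\<not> (\<exists>u\<in>V \<beta>. u \<noteq> (\<lambda>w. 0))"
  have "V \<beta> \<subseteq> {0}" unfolding cfun_zero using n by (intro subsetI) simp
  moreover have "0 \<in> V \<beta>" unfolding cfun_zero by (rule subspace_czero[OF V_sub[OF b]])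
  ultimately have "V \<beta> = {0}" by (simp add: subset_singleton_iff) (metis empty_iff)
  then show False using V_irred[OF b] by (simp add: K_irreducible_def)
qed

lemma V_homog: "\<beta> \<in> \<Lambda> \<Longrightarrow> \<exists>d. V \<beta> \<subseteq> cfun.span (lmono ` {xs. length xs = d})"
proof -
  assume "\<beta> \<in> \<Lambda>"
  then obtain d where "V \<beta> \<subseteq> homog_polys d" using mf unfolding multiplicity_free_decomposition_def by meson
  then show ?thesis using homog_polys_subset[of d] by (intro exI[of _ d]) (rule order_trans)
qed

lemma V_polys: "\<beta> \<in> \<Lambda> \<Longrightarrow> V \<beta> \<subseteq> polys"
proof
  fix u assume "\<beta> \<in> \<Lambda>" "u \<in> V \<beta>"
  then have "u \<in> cfun.span (\<Union>\<alpha>\<in>\<Lambda>. V \<alpha>)" by (intro cfun.span_base) auto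
  then show "u \<in> polys" by (simp only: V_span)
qed

definition BV :: "'i \<Rightarrow> 'n cfn set" where
  "BV \<beta> = (SOME B. onb B \<and> cfun.span B = V \<beta>)"

lemma BV: assumes "\<beta> \<in> \<Lambda>" shows "onb (BV \<beta>)" "cfun.span (BV \<beta>) = V \<beta>"
proof -
  obtain d where "V \<beta> \<subseteq> cfun.span (lmono ` {xs. length xs = d})" using V_homog[OF assms] by blast
  then have "\<exists>B. onb B \<and> cfun.span B = V \<beta>"
    by (intro subspace_onb[OF V_sub[OF assms]])
       (use finite_lists_length_eq[of "UNIV :: 'n set" d] in \<open>auto intro: polys_lmono\<close>)
  then have "onb (BV \<beta>) \<and> cfun.span (BV \<beta>) = V \<beta>" unfolding BV_def by (rule someI_ex)
  then show "onb (BV \<beta>)" "cfun.span (BV \<beta>) = V \<beta>" by auto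
qed

text \<open>A nonzero component of \<open>T\<close> from \<open>V \<beta>\<close> to
  \<open>V \<gamma>\<close> would intertwine two inequivalent irreducible spaces.\<close>

lemma proj_commuting_zero:
  assumes T: "lin_on polys T" "\<And>u. u \<in> polys \<Longrightarrow> T u \<in> polys" "\<And>k u. k \<in> K \<Longrightarrow> u \<in> polys \<Longrightarrow> T (U k u) = U k (T u)"
    and bg: "\<beta> \<in> \<Lambda>" "\<gamma> \<in> \<Lambda>" "\<beta> \<noteq> \<gamma>" and u: "u \<in> V \<beta>"
  shows "proj (BV \<gamma>) (T u) = (\<lambda>w. 0)"
proof (rule ccontr)
  assume ne: "proj (BV \<gamma>) (T u) \<noteq> (\<lambda>w. 0)"
  note p = V_polys[OF bg(1)]
  have "K_equivalent K lam (V \<beta>) (V \<gamma>)"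
  proof (rule schur[where S="\<lambda>u. proj (BV \<gamma>) (T u)" and ?u0.0=u, OF V_irred[OF bg(1)] V_irred[OF bg(2)]])
    show "lin_on (V \<beta>) (\<lambda>u. proj (BV \<gamma>) (T u))"
      by (rule lin_on_compose[OF lin_on_subset[OF T(1) p] _ lin_on_proj[OF BV(1)[OF bg(2)]]]) (use T(2) p in auto)
    show "proj (BV \<gamma>) (T v) \<in> V \<gamma>" for v using proj_span BV(2)[OF bg(2)] by blast
    show "proj (BV \<gamma>) (T (U k v)) = U k (proj (BV \<gamma>) (T v))" if "k \<in> K" "v \<in> V \<beta>" for k v
    proof -
      have v: "v \<in> polys" using that p by auto
      show ?thesis unfolding T(3)[OF that(1) v]
        by (rule proj_U[OF BV(1)[OF bg(2)] _ that(1) T(2)[OF v]]) (simp add: BV(2)[OF bg(2)] V_Kinv[OF bg(2)])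
    qed
  qed (use u ne in simp_all)
  then show False using V_ineq bg by blast
qed

lemma proj_zero_inn: "\<gamma> \<in> \<Lambda> \<Longrightarrow> x \<in> polys \<Longrightarrow> proj (BV \<gamma>) x = (\<lambda>w. 0) \<Longrightarrow> v \<in> V \<gamma> \<Longrightarrow> inn x v = 0"
  using inn_diff_proj[OF BV(1), of \<gamma> x v] BV(2) by simp

text \<open>The identity commutes with \<open>K\<close>, so the vanishing of mixed components
  applies to it.\<close>

lemma V_orth: "\<beta> \<in> \<Lambda> \<Longrightarrow> \<gamma> \<in> \<Lambda> \<Longrightarrow> \<beta> \<noteq> \<gamma> \<Longrightarrow> u \<in> V \<beta> \<Longrightarrow> v \<in> V \<gamma> \<Longrightarrow> inn u v = 0"
  using proj_commuting_zero[of "\<lambda>u. u" \<beta> \<gamma> u] proj_zero_inn[of \<gamma> u v] V_polys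
  by (auto simp: lin_on_def)

lemma orth_all_zero:
  assumes "u \<in> polys" "\<And>\<gamma> v. \<gamma> \<in> \<Lambda> \<Longrightarrow> v \<in> V \<gamma> \<Longrightarrow> inn u v = 0"
  shows "u = (\<lambda>w. 0)"
proof -
  have "inn u v = 0" if "v \<in> polys" for v
    by (rule inn_span_zero[of "\<Union>\<alpha>\<in>\<Lambda>. V \<alpha>"]) (use assms V_polys V_span that in auto)
  then show ?thesis using inn_self_eq_0 assms(1) by blast
qed

text \<open>The components of \<open>T u\<close> outside \<open>V \<beta>\<close> vanish by
  inequivalence. The component inside has an eigenvector, and the eigenspace is invariant, hence all
  of \<open>V \<beta>\<close>.\<close>

theorem commuting_scalar:
  assumes T: "lin_on polys T" "\<And>u. u \<in> polys \<Longrightarrow> T u \<in> polys" "\<And>k u. k \<in> K \<Longrightarrow> u \<in> polys \<Longrightarrow> T (U k u) = U k (T u)"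
    and b: "\<beta> \<in> \<Lambda>"
  shows "\<exists>c. \<forall>u\<in>V \<beta>. T u = (\<lambda>w. c * u w)"
proof -
  note p = V_polys[OF b] and B = BV[OF b]
  have pB: "BV \<beta> \<subseteq> polys" "finite (BV \<beta>)" using B(1) by (auto simp: onb_def)
  define S where "S = (\<lambda>u. proj (BV \<beta>) (T u))"
  have S: "lin_on (V \<beta>) S" "S u \<in> V \<beta>" for u
    unfolding S_def using proj_span[of "BV \<beta>"] B(2)
    by (auto intro!: lin_on_compose[OF lin_on_subset[OF T(1) p] _ lin_on_proj[OF B(1)]] T(2) simp: subsetD[OF p])
  have SU: "S (U k v) = U k (S v)" if "k \<in> K" "v \<in> V \<beta>" for k v
  proof -
    have v: "v \<in> polys" using that p by auto
    show ?thesis unfolding S_def T(3)[OF that(1) v]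
      by (rule proj_U[OF B(1) _ that(1) T(2)[OF v]]) (simp add: B(2) V_Kinv[OF b])
  qed
  obtain u0 where u0: "u0 \<in> V \<beta>" "u0 \<noteq> (\<lambda>w. 0)" using V_nonzero[OF b] by blast
  obtain c u1 where c: "u1 \<in> V \<beta>" "u1 \<noteq> (\<lambda>w. 0)" "S u1 = (\<lambda>w. c * u1 w)"
    using eigenvalue_exists[OF V_sub[OF b] pB(2) _ S u0] B(2) by auto
  let ?E = "{u \<in> V \<beta>. S u = (\<lambda>w. c * u w)}"
  have "K_invariant_subspace K lam ?E"
    unfolding K_invariant_subspace_def
    by (auto intro!: subspaceI_fun subspace_czero[OF V_sub[OF b]] subspace_cadd[OF V_sub[OF b]] subspace_cscale[OF V_sub[OF b]] V_inv[OF b]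
        simp: lin_on_zero[OF S(1) V_sub[OF b]] lin_onD[OF S(1)] SU U_linear algebra_simps)
  then have "?E = {0} \<or> ?E = V \<beta>" by (rule K_irreducibleD[OF V_irred[OF b]]) auto
  with c have E: "?E = V \<beta>" by (auto simp: cfun_zero)
  have "T u = (\<lambda>w. c * u w)" if u: "u \<in> V \<beta>" for u
  proof -
    have up: "u \<in> polys" using u p by auto
    have "(\<lambda>w. T u w - c * u w) = (\<lambda>w. 0)"
    proof (rule orth_all_zero)
      show "(\<lambda>w. T u w - c * u w) \<in> polys" by (intro polys_diff polys_cmult T(2) up)
      fix \<gamma> v assume g: "\<gamma> \<in> \<Lambda>" and v: "v \<in> V \<gamma>"
      have vp: "v \<in> polys" using V_polys g v by blast
      show "inn (\<lambda>w. T u w - c * u w) v = 0"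
      proof (cases "\<gamma> = \<beta>")
        case True
        have "S u = (\<lambda>w. c * u w)" using E u by blast
        then show ?thesis
          using inn_diff_proj[OF B(1) T(2)[OF up], of v] v True B(2) by (simp add: S_def)
      next
        case False
        have "inn (T u) v = 0"
          using proj_zero_inn[OF g T(2)[OF up] proj_commuting_zero[OF T b g _ u] v] False by blast
        moreover have "inn u v = 0" using V_orth[OF b g _ u v] False by blast
        ultimately show ?thesis
          using inn_diff_left[OF T(2)[OF up] polys_cmult[OF up] vp, of c] inn_cmult_left[of c u v] by simp
      qed
    qed
    then show ?thesis by (auto simp: fun_eq_iff)
  qed
  then show ?thesis by blast
qed

end

section \<open>Words in the generators of the Weyl algebra\<close>

type_synonym 'm pop = "'m cfn \<Rightarrow> 'm cfn"

definition words :: "nat \<Rightarrow> 'x list set" where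
  "words N = {xs. length xs = N}"

lemma finite_words [simp]: "finite (words N :: 'x::finite list set)"
  unfolding words_def using finite_lists_length_eq[of "UNIV :: 'x set" N] by simp

lemma words_0 [simp]: "words 0 = {[]}"
  by (auto simp: words_def)

lemma sum_words_Suc: "(\<Sum>zs\<in>words (Suc N). F zs) = (\<Sum>x\<in>UNIV. \<Sum>xs\<in>words N. F (x # xs))"
  for F :: "'x::finite list \<Rightarrow> 'b::comm_monoid_add"
proof -
  have "(\<Sum>x\<in>UNIV. \<Sum>xs\<in>words N. F (x # xs)) = (\<Sum>p\<in>UNIV \<times> words N. F (fst p # snd p))"
    by (simp add: sum.cartesian_product split_beta)
  also have "\<dots> = (\<Sum>zs\<in>words (Suc N). F zs)"
    by (rule sum.reindex_bij_witness[where i="\<lambda>zs. (hd zs, tl zs)" and j="\<lambda>p. fst p # snd p"])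
       (auto simp: words_def length_Suc_conv)
  finally show ?thesis ..
qed

lemma sum_words_snoc: "(\<Sum>zs\<in>words (Suc N). F zs) = (\<Sum>x\<in>UNIV. \<Sum>xs\<in>words N. F (xs @ [x]))"
  for F :: "'x::finite list \<Rightarrow> 'b::comm_monoid_add"
proof -
  have "(\<Sum>x\<in>UNIV. \<Sum>xs\<in>words N. F (xs @ [x])) = (\<Sum>p\<in>UNIV \<times> words N. F (snd p @ [fst p]))"
    by (simp add: sum.cartesian_product split_beta)
  also have "\<dots> = (\<Sum>zs\<in>words (Suc N). F zs)"
    by (rule sum.reindex_bij_witness[where i="\<lambda>zs. (last zs, butlast zs)" and j="\<lambda>p. snd p @ [fst p]"])
       (auto simp: words_def length_Suc_conv_rev)
  finally show ?thesis ..
qed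

text \<open>Entries of a tensor power of the matrix \<open>\<kappa>\<close>, indexed by words. The
  default equation is meant for two empty words.\<close>

fun tensor_power :: "('x \<Rightarrow> 'x \<Rightarrow> complex) \<Rightarrow> 'x list \<Rightarrow> 'x list \<Rightarrow> complex" where
  "tensor_power \<kappa> (y # ys) (x # xs) = \<kappa> y x * tensor_power \<kappa> ys xs"
| "tensor_power \<kappa> _ _ = 1"

lemma tensor_power_mult:
  fixes \<kappa> \<kappa>' :: "'x::finite \<Rightarrow> 'x \<Rightarrow> complex"
  assumes "length ys = N" "length zs = N"
  shows "(\<Sum>xs\<in>words N. tensor_power \<kappa> ys xs * tensor_power \<kappa>' xs zs) = tensor_power (\<lambda>y z. \<Sum>x\<in>UNIV. \<kappa> y x * \<kappa>' x z) ys zs"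
  using assms
proof (induction N arbitrary: ys zs)
  case (Suc N)
  obtain y ys' z zs' where yz: "ys = y # ys'" "zs = z # zs'" "length ys' = N" "length zs' = N"
    using Suc.prems by (auto simp: length_Suc_conv)
  have "(\<Sum>xs\<in>words (Suc N). tensor_power \<kappa> ys xs * tensor_power \<kappa>' xs zs) =
      (\<Sum>x\<in>UNIV. \<Sum>xs\<in>words N. (\<kappa> y x * \<kappa>' x z) * (tensor_power \<kappa> ys' xs * tensor_power \<kappa>' xs zs'))"
    by (simp add: sum_words_Suc yz(1,2) algebra_simps)
  also have "\<dots> = (\<Sum>x\<in>UNIV. \<kappa> y x * \<kappa>' x z) * (\<Sum>xs\<in>words N. tensor_power \<kappa> ys' xs * tensor_power \<kappa>' xs zs')"
    by (simp add: sum_distrib_left[symmetric] sum_distrib_right)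
  finally show ?case by (simp add: Suc.IH[OF yz(3,4)] yz(1,2))
qed simp

lemma foldr_closed: "(\<And>x f. f \<in> C \<Longrightarrow> \<Phi> x f \<in> C) \<Longrightarrow> f \<in> C \<Longrightarrow> foldr \<Phi> xs f \<in> C"
  by (induction xs) auto

text \<open>Moving \<open>R\<close> past one letter mixes the letters by the matrix
  \<open>\<kappa>\<close>, so moving it past a word mixes words by the tensor power. The lemma is
  applied to the operators on polynomials, to partial derivatives and to left invariant
  fields.\<close>

lemma foldr_intertwine:
  fixes \<Phi> :: "'x::finite \<Rightarrow> ('a \<Rightarrow> complex) \<Rightarrow> 'a \<Rightarrow> complex"
  assumes C: "cfun.subspace C" and lin: "\<And>x. lin_on C (\<Phi> x)" and cl: "\<And>x f. f \<in> C \<Longrightarrow> \<Phi> x f \<in> C"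
    and R: "\<And>f. f \<in> C \<Longrightarrow> R f \<in> C"
    and tw: "\<And>x f. f \<in> C \<Longrightarrow> \<Phi> x (R f) = (\<lambda>w. \<Sum>y\<in>UNIV. \<kappa> y x * R (\<Phi> y f) w)" and f: "f \<in> C"
  shows "foldr \<Phi> xs (R f) = (\<lambda>w. \<Sum>ys\<in>words (length xs). tensor_power \<kappa> ys xs * R (foldr \<Phi> ys f) w)"
proof (induction xs)
  case (Cons x xs)
  note fc = foldr_closed[of C \<Phi>, OF cl f]
  have "\<Phi> x (foldr \<Phi> xs (R f)) = (\<lambda>w. \<Sum>ys\<in>words (length xs). tensor_power \<kappa> ys xs * \<Phi> x (R (foldr \<Phi> ys f)) w)"
    unfolding Cons.IH by (rule lin_on_sum[OF lin C]) (intro R fc)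
  also have "\<dots> = (\<lambda>w. \<Sum>ys\<in>words (length xs). tensor_power \<kappa> ys xs * (\<Sum>y\<in>UNIV. \<kappa> y x * R (\<Phi> y (foldr \<Phi> ys f)) w))"
    by (simp only: tw[OF fc])
  also have "\<dots> = (\<lambda>w. \<Sum>y\<in>UNIV. \<Sum>ys\<in>words (length xs). (\<kappa> y x * tensor_power \<kappa> ys xs) * R (\<Phi> y (foldr \<Phi> ys f)) w)"
    by (subst sum.swap) (simp add: sum_distrib_left mult_ac)
  finally show ?case by (simp add: sum_words_Suc)
qed simp

section \<open>The Weyl algebra, its adjoints and its filtration by order\<close>

context fock begin

definition op :: "'m + 'm \<Rightarrow> 'm::finite cfn \<Rightarrow> 'm cfn" where
  "op x = (case x of Inl j \<Rightarrow> W_op lam j | Inr j \<Rightarrow> Wbar_op lam j)"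

text \<open>Passes to the adjoint letter, for either sign of \<open>lam\<close>; see
  \<open>op_adjoint\<close>.\<close>

definition swap :: "'m + 'm \<Rightarrow> 'm + 'm" where
  "swap x = (case x of Inl j \<Rightarrow> Inr j | Inr j \<Rightarrow> Inl j)"

lemma swap_simps [simp]: "swap (Inl j) = Inr j" "swap (Inr j) = Inl j" "swap (swap x) = x"
  by (auto simp: swap_def split: sum.splits)

lemma mult_op_eq: "mult_op lam j u = (\<lambda>w. of_real (2 * \<nu>) * w $ j * u w)"
  by (simp add: mult_op_def \<nu>_def)

text \<open>One of a letter and its \<open>swap\<close> is a derivative and the other a
  multiplication. Case splits in this form avoid the sign of \<open>lam\<close>.\<close>

lemma op_cases:
  obtains j where "op x = hol_deriv_op j" "op (swap x) = mult_op lam j"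
  | j where "op x = mult_op lam j" "op (swap x) = hol_deriv_op j"
  by (cases x; cases "lam > 0") (auto simp: op_def W_op_def Wbar_op_def)

lemma mult_op_polys: "u \<in> polys \<Longrightarrow> mult_op lam j u \<in> polys"
  using polys_cmult[OF polys.coord[of u j], of "of_real (2 * \<nu>)"] by (simp add: mult_op_eq mult.assoc)

lemma op_polys: "u \<in> polys \<Longrightarrow> op x u \<in> polys"
  by (cases x rule: op_cases) (simp_all add: polys_hol_deriv_op mult_op_polys)

lemma lin_on_op: "lin_on polys (op x)"
  by (cases x rule: op_cases) (auto simp: lin_on_def hol_deriv_op_add hol_deriv_op_cmult mult_op_eq algebra_simps)

lemma op_adjoint: "u \<in> polys \<Longrightarrow> v \<in> polys \<Longrightarrow> inn (op x u) v = inn u (op (swap x) v)"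
proof (cases x rule: op_cases)
  case (1 j)
  assume uv: "u \<in> polys" "v \<in> polys"
  show ?thesis unfolding 1 inn_deriv_left[OF uv] mult_op_eq
    by (simp add: mult.assoc inn_cmult_right)
next
  case (2 j)
  assume uv: "u \<in> polys" "v \<in> polys"
  show ?thesis unfolding 2 mult_op_eq using \<nu>_pos
    by (simp add: mult.assoc inn_cmult_left inn_coord_left[OF uv])
qed

lemma ops_polys: "u \<in> polys \<Longrightarrow> foldr op xs u \<in> polys"
  by (rule foldr_closed[of polys]) (auto intro: op_polys)

lemma lin_on_ops: "lin_on polys (foldr op xs)"
proof (induction xs)
  case (Cons x xs)
  show ?case using lin_on_compose[OF Cons.IH _ lin_on_op[of x]] by (simp add: ops_polys o_def)
qed (simp add: lin_on_def)

lemma ops_adjoint: "u \<in> polys \<Longrightarrow> v \<in> polys \<Longrightarrow> inn (foldr op xs u) v = inn u (foldr op (rev (map swap xs)) v)"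
  by (induction xs arbitrary: v) (auto simp: op_adjoint ops_polys op_polys)

text \<open>The canonical commutation relations, recorded only as the fact that commutators are
  scalars: the later arguments count lengths of words.\<close>

lemma op_commutator:
  "\<exists>c. \<forall>u\<in>polys. op x (op y u) = (\<lambda>w. op y (op x u) w + c * u w)"
proof -
  have dm: "hol_deriv_op i (mult_op lam j u) = (\<lambda>w. mult_op lam j (hol_deriv_op i u) w + (if j = i then of_real (2 * \<nu>) else 0) * u w)"
    if "u \<in> polys" for i j and u :: "'m::finite cfn"
  proof -
    have "mult_op lam j u = (\<lambda>w. of_real (2 * \<nu>) * (w $ j * u w))" by (simp add: mult_op_eq mult.assoc)
    then show ?thesis using that
      by (simp add: hol_deriv_op_cmult polys.coord hol_deriv_op_coord) (simp add: mult_op_eq algebra_simps)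
  qed
  show ?thesis
  proof (cases x rule: op_cases)
    case (1 i)
    note x = this
    show ?thesis
    proof (cases y rule: op_cases)
      case (1 j)
      show ?thesis unfolding x 1 by (rule exI[of _ 0]) (auto simp: hol_deriv_op_commute)
    next
      case (2 j)
      show ?thesis unfolding x 2 by (rule exI, rule ballI, rule dm)
    qed
  next
    case (2 i)
    note x = this
    show ?thesis
    proof (cases y rule: op_cases)
      case (1 j)
      show ?thesis unfolding x 1
        by (rule exI[of _ "- (if i = j then of_real (2 * \<nu>) else 0)"]) (simp add: dm)
    next
      case (2 j)
      show ?thesis unfolding x 2 by (rule exI[of _ 0]) (auto simp: mult_op_eq algebra_simps)
    qed
  qed
qed

text \<open>The filtration of the Weyl algebra by order, with a strict bound: words have length
  below \<open>N\<close>. Thus operators in \<open>wop 0\<close> vanish on polynomials, and the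
  corrections to a word of length \<open>N\<close> lie in \<open>wop N\<close>. The rule
  \<open>ext\<close> identifies operators that agree on polynomials.\<close>

inductive wop :: "nat \<Rightarrow> ('m::finite cfn \<Rightarrow> 'm cfn) \<Rightarrow> bool" for N where
  zero: "wop N (\<lambda>u w. 0)"
| word: "length xs < N \<Longrightarrow> wop N (foldr op xs)"
| add: "wop N A \<Longrightarrow> wop N B \<Longrightarrow> wop N (\<lambda>u w. A u w + B u w)"
| scale: "wop N A \<Longrightarrow> wop N (\<lambda>u w. c * A u w)"
| ext: "wop N A \<Longrightarrow> (\<And>u. u \<in> polys \<Longrightarrow> A u = B u) \<Longrightarrow> wop N B"

lemma wop_lin: "wop N A \<Longrightarrow> lin_on polys A \<and> (\<forall>u\<in>polys. A u \<in> polys)"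
proof (induction rule: wop.induct)
  case (ext A B)
  then have e: "\<And>u. u \<in> polys \<Longrightarrow> B u = A u" by simp
  show ?case using ext.IH
    by (simp add: lin_on_def e polys.add polys_cmult)
qed (auto simp: lin_on_ops ops_polys polys.const polys.add polys_cmult lin_on_def[of _ "\<lambda>u w. _ u w + _ u w"]
   lin_on_def[of _ "\<lambda>u w. 0"] lin_on_def[of _ "\<lambda>u w. _ * _ u w"] lin_onD algebra_simps)

lemma wop_polys: "wop N A \<Longrightarrow> u \<in> polys \<Longrightarrow> A u \<in> polys"
  using wop_lin by blast

lemma wop_mono: "wop N A \<Longrightarrow> N \<le> M \<Longrightarrow> wop M A"
proof (induction rule: wop.induct)
  case (ext A B)
  show ?case by (rule wop.ext[OF ext.IH[OF ext.prems] ext.hyps(2)])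
qed (auto intro: wop.zero wop.word wop.add wop.scale)

lemma wop_diff: "wop N A \<Longrightarrow> wop N B \<Longrightarrow> wop N (\<lambda>u w. A u w - B u w)"
  using wop.add[OF _ wop.scale[of N B "-1"], of A] by simp

lemma wop_sum: "(\<And>i. i \<in> S \<Longrightarrow> wop N (A i)) \<Longrightarrow> wop N (\<lambda>u w. \<Sum>i\<in>S. A i u w)"
proof (induction S rule: infinite_finite_induct)
  case (insert i S)
  have "wop N (\<lambda>u w. A i u w + (\<Sum>i\<in>S. A i u w))" by (rule wop.add) (use insert in auto)
  then show ?case using insert by simp
qed (auto intro: wop.zero)

text \<open>Lengths below \<open>N\<close> and lengths at most \<open>M\<close> add up to lengths
  below \<open>N + M\<close>; the successor in the second bound makes the strict bounds fit.\<close>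

lemma wop_compose:
  assumes "wop N A" "wop (Suc M) B" shows "wop (N + M) (\<lambda>u. A (B u))"
  using assms(1)
proof (induction rule: wop.induct)
  case (word xs)
  from assms(2) show ?case
  proof (induction rule: wop.induct)
    case zero
    have "foldr op xs (\<lambda>w. 0) = (\<lambda>w. 0)" by (rule lin_on_zero[OF lin_on_ops polys_subspace])
    then show ?case by (simp add: wop.zero)
  next
    case (word ys)
    have "wop (N + M) (foldr op (xs @ ys))" using word \<open>length xs < N\<close> by (intro wop.word) simp
    then show ?case by (rule wop.ext) simp
  next
    case (add A B)
    show ?case by (rule wop.ext[OF wop.add[OF add.IH]]) (simp add: lin_onD[OF lin_on_ops] wop_polys[OF add.hyps(1)] wop_polys[OF add.hyps(2)])
  next
    case (scale A c)
    show ?case by (rule wop.ext[OF wop.scale[OF scale.IH]]) (simp add: lin_onD[OF lin_on_ops] wop_polys[OF scale.hyps(1)])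
  next
    case (ext A B)
    show ?case by (rule wop.ext[OF ext.IH]) (simp add: ext.hyps(2))
  qed
next
  case (ext A B)
  show ?case by (rule wop.ext[OF ext.IH]) (simp add: ext.hyps(2) wop_polys[OF assms(2)])
qed (auto intro: wop.zero wop.add wop.scale)

text \<open>Each exchange of \<open>x\<close> with a neighbour costs a scalar times a word that is
  shorter by two letters, hence just below the stated bound.\<close>

lemma wop_move:
  "wop (length as + length bs) (\<lambda>u w. foldr op (as @ x # bs) u w - foldr op (x # as @ bs) u w)"
proof (induction as)
  case Nil
  show ?case by (simp add: wop.zero)
next
  case (Cons a as)
  let ?D = "\<lambda>u w. foldr op (as @ x # bs) u w - foldr op (x # as @ bs) u w"
  have "wop (Suc (Suc 0)) (foldr op [a])" by (rule wop.word) simp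
  moreover have "foldr op [a] = op a" by auto
  ultimately have "wop (Suc (Suc 0)) (op a)" by simp
  have 1: "wop (length (a # as) + length bs) (\<lambda>u. op a (?D u))"
  proof (cases "length as + length bs")
    case 0
    then have "as = []" by simp
    then show ?thesis using lin_on_zero[OF lin_on_op polys_subspace, of a] by (simp add: wop.zero)
  next
    case (Suc M)
    then have "wop (Suc (Suc 0) + M) (\<lambda>u. op a (?D u))"
      using wop_compose[OF \<open>wop (Suc (Suc 0)) (op a)\<close>, of M ?D] Cons by simp
    then show ?thesis using Suc by simp
  qed
  obtain c where c: "\<And>u. u \<in> polys \<Longrightarrow> op a (op x u) = (\<lambda>w. op x (op a u) w + c * u w)"
    using op_commutator[of a x] by blast
  have 2: "wop (length (a # as) + length bs) (\<lambda>u w. c * foldr op (as @ bs) u w)"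
    by (intro wop.scale wop.word) simp
  show ?case
  proof (rule wop.ext[OF wop.add[OF 1 2]])
    fix u :: "'a cfn" assume u: "u \<in> polys"
    have p: "foldr op zs u \<in> polys" for zs by (rule ops_polys[OF u])
    have "op a (?D u) = (\<lambda>w. op a (foldr op (as @ x # bs) u) w - op a (foldr op (x # as @ bs) u) w)"
      by (rule lin_on_diff[OF lin_on_op polys_subspace p p])
    moreover have "op a (foldr op (x # as @ bs) u) = (\<lambda>w. op x (op a (foldr op (as @ bs) u)) w + c * foldr op (as @ bs) u w)"
      using c[OF p, of "as @ bs"] by simp
    ultimately show "(\<lambda>w. op a (?D u) w + c * foldr op (as @ bs) u w) =
       (\<lambda>w. foldr op ((a # as) @ x # bs) u w - foldr op (x # (a # as) @ bs) u w)"
      by (simp add: fun_eq_iff)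
  qed
qed

text \<open>Reordering the letters changes an operator by lower order terms only: the graded algebra
  of the filtration is commutative.\<close>

lemma wop_perm: "mset xs = mset ys \<Longrightarrow> wop (length xs) (\<lambda>u w. foldr op xs u w - foldr op ys u w)"
proof (induction xs arbitrary: ys)
  case Nil then show ?case by (simp add: wop.zero)
next
  case (Cons x xs)
  from Cons.prems have "x \<in> set ys" by (metis list.set_intros(1) mset_eq_setD)
  then obtain as bs where ys: "ys = as @ x # bs" by (meson split_list)
  have m: "mset xs = mset (as @ bs)" using Cons.prems ys by simp
  then have len: "length xs = length as + length bs" by (metis length_append size_mset)
  let ?D = "\<lambda>u w. foldr op xs u w - foldr op (as @ bs) u w"
  have "wop (Suc (Suc 0)) (foldr op [x])" by (rule wop.word) simp
  moreover have "foldr op [x] = op x" by auto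
  ultimately have x: "wop (Suc (Suc 0)) (op x)" by simp
  have 1: "wop (length (x # xs)) (\<lambda>u. op x (?D u))"
  proof (cases "length xs")
    case 0
    then show ?thesis using m lin_on_zero[OF lin_on_op polys_subspace, of x] by (simp add: wop.zero)
  next
    case (Suc M)
    then show ?thesis using wop_compose[OF x, of M ?D] Cons.IH[OF m] by simp
  qed
  have 2: "wop (length (x # xs)) (\<lambda>u w. foldr op (as @ x # bs) u w - foldr op (x # as @ bs) u w)"
    by (rule wop_mono[OF wop_move]) (simp add: len)
  show ?case
  proof (rule wop.ext[OF wop_diff[OF 1 2]])
    fix u :: "'a cfn" assume u: "u \<in> polys"
    have "op x (?D u) = (\<lambda>w. op x (foldr op xs u) w - op x (foldr op (as @ bs) u) w)"
      by (rule lin_on_diff[OF lin_on_op polys_subspace ops_polys[OF u] ops_polys[OF u]])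
    then show "(\<lambda>w. op x (?D u) w - (foldr op (as @ x # bs) u w - foldr op (x # as @ bs) u w)) =
        (\<lambda>w. foldr op (x # xs) u w - foldr op ys u w)"
      unfolding ys by (simp add: fun_eq_iff)
  qed
qed

lemma wop_expand:
  "wop N A \<Longrightarrow> \<exists>c. \<forall>u\<in>polys. \<forall>w. A u w = (\<Sum>n<N. \<Sum>xs\<in>words n. c xs * foldr op xs u w)"
proof (induction rule: wop.induct)
  case zero then show ?case by (intro exI[of _ "\<lambda>_. 0"]) simp
next
  case (word ys)
  have e: "foldr op ys u w = (\<Sum>n<N. \<Sum>xs\<in>words n. (if xs = ys then 1 else 0) * foldr op xs u w)" for u w
  proof -
    have "(\<Sum>xs\<in>words n. (if xs = ys then 1 else 0) * foldr op xs u w) = (if n = length ys then foldr op ys u w else 0)" for n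
    proof -
      have "(\<Sum>xs\<in>words n. (if xs = ys then 1 else 0) * foldr op xs u w) = (\<Sum>xs\<in>words n. if xs = ys then foldr op xs u w else 0)"
        by (rule sum.cong) auto
      then show ?thesis by (auto simp: words_def[of n] simp del: finite_words) (simp_all add: sum.delta[OF finite_words, unfolded words_def])
    qed
    then show ?thesis using word by simp
  qed
  show ?case by (rule exI[of _ "\<lambda>xs. if xs = ys then 1 else 0"], intro ballI allI, rule e)
next
  case (add A B)
  then obtain c d where c: "\<And>u w. u \<in> polys \<Longrightarrow> A u w = (\<Sum>n<N. \<Sum>xs\<in>words n. c xs * foldr op xs u w)"
    "\<And>u w. u \<in> polys \<Longrightarrow> B u w = (\<Sum>n<N. \<Sum>xs\<in>words n. d xs * foldr op xs u w)" by blast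
  show ?case
    by (rule exI[of _ "\<lambda>xs. c xs + d xs"], intro ballI allI) (simp only: c distrib_right sum.distrib)
next
  case (scale A b)
  then obtain c where c: "\<And>u w. u \<in> polys \<Longrightarrow> A u w = (\<Sum>n<N. \<Sum>xs\<in>words n. c xs * foldr op xs u w)" by blast
  show ?case
    by (rule exI[of _ "\<lambda>xs. b * c xs"], intro ballI allI) (simp only: c sum_distrib_left mult.assoc)
next
  case (ext A B)
  then obtain c where c: "\<And>u w. u \<in> polys \<Longrightarrow> A u w = (\<Sum>n<N. \<Sum>xs\<in>words n. c xs * foldr op xs u w)" by blast
  show ?case
    by (rule exI[of _ c], intro ballI allI) (simp only: c ext.hyps(2)[symmetric])
qed

section \<open>Density of the Weyl algebra\<close>

lemma letter_exists: "\<exists>x. op x = hol_deriv_op j \<and> op (swap x) = mult_op lam j"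
proof (cases "lam > 0")
  case True
  then show ?thesis by (intro exI[of _ "Inl j"]) (simp add: op_def W_op_def Wbar_op_def)
next
  case False
  then show ?thesis by (intro exI[of _ "Inr j"]) (simp add: op_def W_op_def Wbar_op_def)
qed

lemma wop_letter: "wop 2 (hol_deriv_op j)" "wop 2 (mult_op lam j)"
proof -
  have w: "wop 2 (op y)" for y :: "'a + 'a"
  proof -
    have "wop 2 (foldr op [y])" by (rule wop.word) simp
    moreover have "foldr op [y] = op y" by auto
    ultimately show ?thesis by simp
  qed
  obtain x where x: "op x = hol_deriv_op j" "op (swap x) = mult_op lam j" using letter_exists[of j] by blast
  show "wop 2 (hol_deriv_op j)" "wop 2 (mult_op lam j)" using w[of x] w[of "swap x"] by (simp_all add: x)
qed

definition euler :: "'m::finite cfn \<Rightarrow> 'm cfn" where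
  "euler u = (\<lambda>w. \<Sum>j\<in>UNIV. w $ j * hol_deriv_op j u w)"

lemma euler_lmono: "euler (lmono xs) = (\<lambda>w. of_nat (length xs) * lmono xs w)"
proof (induction xs)
  case Nil show ?case by (simp add: euler_def)
next
  case (Cons x xs)
  have "euler (lmono (x # xs)) w = w $ x * lmono xs w + w $ x * euler (lmono xs) w" for w
    by (simp add: euler_def hol_deriv_op_coord[OF polys_lmono] distrib_left sum.distrib sum_distrib_left mult_ac
        if_distrib[of "\<lambda>x. _ * x"] cong: if_cong)
  then show ?case unfolding Cons.IH by (simp add: algebra_simps fun_eq_iff)
qed

lemma wop_euler: "wop 3 euler"
proof -
  have "wop (2 + 1) (\<lambda>u. mult_op lam j (hol_deriv_op j u))" for j :: 'a
    by (rule wop_compose[OF wop_letter(2)]) (use wop_letter(1) in \<open>simp add: numeral_2_eq_2\<close>)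
  then have "wop 3 (\<lambda>u w. \<Sum>j\<in>UNIV. (1 / of_real (2 * \<nu>)) * mult_op lam (j::'a) (hol_deriv_op j u) w)"
    by (intro wop_sum wop.scale) simp
  then show ?thesis by (rule wop.ext) (use \<nu>_pos in \<open>simp add: euler_def mult_op_eq\<close>)
qed

definition span_deg :: "nat \<Rightarrow> 'm::finite cfn set" where
  "span_deg d = cfun.span (lmono ` {xs. length xs \<le> d})"

lemma span_deg_polys: "u \<in> span_deg d \<Longrightarrow> u \<in> polys"
  unfolding span_deg_def by (rule span_polys[rotated]) (auto intro: polys_lmono)

lemma lin_on_ev: "lin_on polys (\<lambda>u w. u 0)"
  by (simp add: lin_on_def)

lemma lin_on_eq_span:
  assumes "lin_on C S" "lin_on C T" "cfun.subspace C" "B \<subseteq> C" "\<And>b. b \<in> B \<Longrightarrow> S b = T b" "u \<in> cfun.span B"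
  shows "S u = T u"
proof -
  have BC: "x \<in> C" if "x \<in> cfun.span B" for x using cfun.span_minimal[OF assms(4,3)] that by blast
  from assms(6) show ?thesis
  proof (induction rule: span_induct_fun)
    case zero show ?case by (simp add: lin_on_zero[OF assms(1,3)] lin_on_zero[OF assms(2,3)])
  next
    case (add u v) then show ?case by (simp add: lin_onD(1)[OF assms(1)] lin_onD(1)[OF assms(2)] BC)
  next
    case (scale c u) then show ?case by (simp add: lin_onD(2)[OF assms(1)] lin_onD(2)[OF assms(2)] BC)
  qed (rule assms(5))
qed

text \<open>The operators \<open>1 - euler / k\<close> for k = 1, ..., d fix the constants, and each
  kills the monomials of its degree k. Their product is evaluation at 0 on polynomials of degree at
  most \<open>d\<close>.\<close>

lemma wop_eval0: "\<exists>N (A :: 'm::finite pop). wop N A \<and> (\<forall>u\<in>span_deg d. A u = (\<lambda>w. u 0))"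
proof -
  have "\<exists>N (A :: 'm pop). wop N A \<and> (\<forall>xs. length xs \<le> d \<longrightarrow> A (lmono xs) = (\<lambda>w. lmono xs 0))"
  proof (induction d)
    case 0
    show ?case
    proof (intro exI conjI)
      show "wop 1 (foldr op [])" by (rule wop.word) simp
    qed simp
  next
    case (Suc d)
    then obtain N and A :: "'m pop" where A: "wop N A" "\<And>xs. length xs \<le> d \<Longrightarrow> A (lmono xs) = (\<lambda>w. lmono xs 0)" by blast
    have lA: "lin_on polys A" using wop_lin[OF A(1)] by blast
    let ?E = "\<lambda>(u :: 'm cfn) w. u w - (1 / of_nat (Suc d)) * euler u w"
    have "wop 3 (foldr op [])" by (rule wop.word) simp
    from wop_diff[OF this wop.scale[OF wop_euler, of "1 / of_nat (Suc d)"]]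
    have "wop 3 (\<lambda>(u :: 'm cfn) w. foldr op [] u w - (1 / of_nat (Suc d)) * euler u w)" .
    then have "wop 3 ?E" by (rule wop.ext) simp
    then have "wop (Suc 2) ?E" by (simp add: numeral_3_eq_3 numeral_2_eq_2)
    from wop_compose[OF A(1) this] have w: "wop (N + 2) (\<lambda>u. A (?E u))" .
    have "A (?E (lmono xs)) = (\<lambda>w. lmono xs 0)" if le: "length xs \<le> Suc d" for xs :: "'m list"
    proof -
      have E: "?E (lmono xs) = (\<lambda>w. (1 - of_nat (length xs) / of_nat (Suc d)) * lmono xs w)"
        by (simp add: euler_lmono algebra_simps)
      have AE: "A (?E (lmono xs)) = (\<lambda>w. (1 - of_nat (length xs) / of_nat (Suc d)) * A (lmono xs) w)"
        unfolding E by (rule lin_onD(2)[OF lA polys_lmono])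
      have z: "lmono ys 0 = 0" if "ys \<noteq> []" for ys :: "'m list" using that by (cases ys) auto
      consider "length xs = Suc d" | "xs = []" | "xs \<noteq> []" "length xs \<le> d" using le by (metis le_SucE)
      then show ?thesis
      proof cases
        case 1
        then have "xs \<noteq> []" by auto
        have c: "(1 - of_nat (length xs) / of_nat (Suc d) :: complex) = 0" unfolding 1 by (simp del: of_nat_Suc)
        show ?thesis unfolding AE c z[OF \<open>xs \<noteq> []\<close>] by simp
      next
        case 2 then show ?thesis unfolding AE using A(2)[of "[]"] by simp
      next
        case 3 then show ?thesis unfolding AE A(2)[OF 3(2)] by (simp add: z)
      qed
    qed
    with w show ?case by blast
  qed
  then obtain N and A :: "'m pop" where A: "wop N A" "\<And>xs. length xs \<le> d \<Longrightarrow> A (lmono xs) = (\<lambda>w. lmono xs 0)" by blast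
  have "A u = (\<lambda>w. u 0)" if "u \<in> span_deg d" for u
    by (rule lin_on_eq_span[OF _ lin_on_ev polys_subspace _ _ that[unfolded span_deg_def]])
       (use wop_lin[OF A(1)] A(2) in \<open>auto intro: polys_lmono\<close>)
  with A(1) show ?thesis by blast
qed

lemma inn_one_right: "p \<in> polys \<Longrightarrow> inn p (\<lambda>w::complex^'m. 1) = c0 TYPE('m::finite) * p 0"
proof (induction rule: polys.induct)
  case (const c)
  show ?case using inn_cmult_left[of c "\<lambda>w. 1" "\<lambda>w::complex^'m. 1"] by (simp add: c0_def)
next
  case (add p q) then show ?case by (simp add: inn_add_left polys.const algebra_simps)
next
  case (coord p j) then show ?case by (simp add: inn_coord_left polys.const)
qed

lemma hol_deriv_op_span_deg: "u \<in> span_deg d \<Longrightarrow> hol_deriv_op j u \<in> span_deg d"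
proof -
  have l: "hol_deriv_op j (lmono xs) \<in> span_deg d" if "length xs \<le> d" for xs :: "'a list" and d
    using that
  proof (induction xs arbitrary: d)
    case Nil
    show ?case unfolding span_deg_def by (simp add: subspace_czero)
  next
    case (Cons x xs)
    obtain d' where d': "d = Suc d'" "length xs \<le> d'" using Cons.prems by (cases d) auto
    have up: "(\<lambda>w. w $ x * u w) \<in> span_deg d" if "u \<in> span_deg d'" for u :: "'a cfn"
      using that unfolding span_deg_def[of d']
    proof (induction rule: span_induct_fun)
      case zero show ?case by (simp add: span_deg_def subspace_czero)
    next
      case (add u v)
      then show ?case using subspace_cadd[of "span_deg d"] by (simp add: span_deg_def algebra_simps)
    next
      case (scale c u)
      then show ?case using subspace_cscale[of "span_deg d" "\<lambda>w. w $ x * u w" c] by (simp add: span_deg_def algebra_simps)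
    next
      case (base u)
      then obtain ys where ys: "u = lmono ys" "length ys \<le> d'" by blast
      then have "(\<lambda>w. w $ x * u w) = lmono (x # ys)" by simp
      also have "\<dots> \<in> span_deg d" unfolding span_deg_def by (rule cfun.span_base, rule imageI) (simp add: ys d')
      finally show ?case .
    qed
    have 1: "(\<lambda>w. (if x = j then 1 else 0) * lmono xs w) \<in> span_deg d"
      unfolding span_deg_def by (intro subspace_cscale cfun.subspace_span cfun.span_base imageI) (use d' in simp)
    have 2: "(\<lambda>w. w $ x * hol_deriv_op j (lmono xs) w) \<in> span_deg d" by (rule up[OF Cons.IH[OF d'(2)]])
    have "(\<lambda>w. (if x = j then 1 else 0) * lmono xs w + w $ x * hol_deriv_op j (lmono xs) w) \<in> span_deg d"
      using subspace_cadd[of "span_deg d", OF _ 1 2] by (simp add: span_deg_def)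
    moreover have "hol_deriv_op j (lmono (x # xs)) = (\<lambda>w. (if x = j then 1 else 0) * lmono xs w + w $ x * hol_deriv_op j (lmono xs) w)"
      by (simp add: hol_deriv_op_coord[OF polys_lmono] fun_eq_iff)
    ultimately show ?case by simp
  qed
  assume "u \<in> span_deg d"
  then show ?thesis unfolding span_deg_def[of d]
  proof (induction rule: span_induct_fun)
    case zero show ?case by (simp add: subspace_czero)
  next
    case (add u v)
    have "u \<in> polys" "v \<in> polys" using add.hyps span_deg_polys[of _ d] unfolding span_deg_def by blast+
    then show ?case using add.IH by (simp add: span_deg_def hol_deriv_op_add subspace_cadd)
  next
    case (scale c u)
    have "u \<in> polys" using scale.hyps span_deg_polys[of _ d] unfolding span_deg_def by blast
    then show ?case using scale.IH by (simp add: span_deg_def hol_deriv_op_cmult subspace_cscale)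
  next
    case (base u) then show ?case using l[of _ d] unfolding span_deg_def by blast
  qed
qed

text \<open>The value of the functional is delivered as a constant function. A coordinate factor of
  \<open>q\<close> is moved to \<open>u\<close> as a derivative, until \<open>q\<close> is constant
  and the inner product is a multiple of evaluation at 0.\<close>

lemma wop_functional:
  fixes q :: "'m::finite cfn"
  assumes "q \<in> polys"
  shows "\<exists>N A. wop N A \<and> (\<forall>u\<in>span_deg d. A u = (\<lambda>w. inn u q))"
  using assms
proof (induction rule: polys.induct)
  case (const c)
  obtain N and A :: "'m cfn \<Rightarrow> 'm cfn"
    where A: "wop N A" "\<And>u. u \<in> span_deg d \<Longrightarrow> A u = (\<lambda>w. u 0)" using wop_eval0[of d] by blast
  have e: "inn u (\<lambda>w. c) = cnj c * c0 TYPE('m) * u 0" if "u \<in> polys" for u :: "'m cfn"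
    using inn_cmult_right[of u c "\<lambda>w. 1"] inn_one_right[OF that] by simp
  show ?case
    by (rule exI[of _ N], rule exI[of _ "\<lambda>u w. (cnj c * c0 TYPE('m)) * A u w"])
       (use A in \<open>auto intro!: wop.scale simp: e span_deg_polys\<close>)
next
  case (add p q)
  obtain N A where A: "wop N A" "\<And>u. u \<in> span_deg d \<Longrightarrow> A u = (\<lambda>w. inn u p)" using add.IH by blast
  obtain M B where B: "wop M B" "\<And>u. u \<in> span_deg d \<Longrightarrow> B u = (\<lambda>w. inn u q)" using add.IH by blast
  have "wop (max N M) (\<lambda>u w. A u w + B u w)"
    by (intro wop.add wop_mono[OF A(1)] wop_mono[OF B(1)]) auto
  moreover have "(\<lambda>w. A u w + B u w) = (\<lambda>w. inn u (\<lambda>w. p w + q w))" if u: "u \<in> span_deg d" for u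
    by (simp add: A(2)[OF u] B(2)[OF u] inn_add_right[OF span_deg_polys[OF u] add.hyps])
  ultimately show ?case by (intro exI[where x="max N M"], intro exI[where x="\<lambda>u w. A u w + B u w"]) blast
next
  case (coord p j)
  obtain N A where A: "wop N A" "\<And>u. u \<in> span_deg d \<Longrightarrow> A u = (\<lambda>w. inn u p)" using coord.IH by blast
  have "wop (Suc 1) (hol_deriv_op j)" using wop_letter(1)[of j] by (simp add: numeral_2_eq_2)
  from wop.scale[OF wop_compose[OF A(1) this], of "1 / of_real (2 * \<nu>)"]
  have w: "wop (N + 1) (\<lambda>u w. 1 / of_real (2 * \<nu>) * A (hol_deriv_op j u) w)" .
  have "(\<lambda>w. 1 / of_real (2 * \<nu>) * A (hol_deriv_op j u) w) = (\<lambda>w. inn u (\<lambda>w. w $ j * p w))" if u: "u \<in> span_deg d" for u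
  proof -
    have "inn (hol_deriv_op j u) p = 2 * \<nu> * inn u (\<lambda>w. w $ j * p w)"
      by (rule inn_deriv_left[OF span_deg_polys[OF u] coord.hyps])
    then show ?thesis using A(2)[OF hol_deriv_op_span_deg[OF u]] \<nu>_pos by simp
  qed
  with w show ?case by blast
qed

lemma wop_multiplication: "q \<in> polys \<Longrightarrow> \<exists>N A. wop N A \<and> (\<forall>u\<in>polys. A u = (\<lambda>w. q w * u w))"
proof (induction rule: polys.induct)
  case (const c)
  show ?case
  proof (intro exI conjI)
    show "wop 1 (\<lambda>u w. c * foldr op [] u w)" by (rule wop.scale, rule wop.word) simp
  qed simp
next
  case (add p q)
  obtain N A where A: "wop N A" "\<And>u. u \<in> polys \<Longrightarrow> A u = (\<lambda>w. p w * u w)" using add.IH by blast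
  obtain M B where B: "wop M B" "\<And>u. u \<in> polys \<Longrightarrow> B u = (\<lambda>w. q w * u w)" using add.IH by blast
  have "wop (max N M) (\<lambda>u w. A u w + B u w)"
    by (intro wop.add wop_mono[OF A(1)] wop_mono[OF B(1)]) auto
  moreover have "(\<lambda>w. A u w + B u w) = (\<lambda>w. (p w + q w) * u w)" if u: "u \<in> polys" for u
    by (simp add: A(2)[OF u] B(2)[OF u] distrib_right)
  ultimately show ?case by (intro exI[where x="max N M"], intro exI[where x="\<lambda>u w. A u w + B u w"]) blast
next
  case (coord p j)
  obtain N A where A: "wop N A" "\<And>u. u \<in> polys \<Longrightarrow> A u = (\<lambda>w. p w * u w)" using coord.IH by blast
  have "wop (Suc 1) (mult_op lam j)" using wop_letter(2)[of j] by (simp add: numeral_2_eq_2)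
  from wop.scale[OF wop_compose[OF A(1) this], of "1 / of_real (2 * \<nu>)"]
  have w: "wop (N + 1) (\<lambda>u w. 1 / of_real (2 * \<nu>) * A (mult_op lam j u) w)" .
  have "(\<lambda>w. 1 / of_real (2 * \<nu>) * A (mult_op lam j u) w) = (\<lambda>w. w $ j * p w * u w)" if u: "u \<in> polys" for u
    using A(2)[OF mult_op_polys[OF u]] \<nu>_pos by (simp add: mult_op_eq fun_eq_iff)
  with w show ?case by blast
qed

text \<open>On a bounded range of degrees, \<open>wop_functional\<close> followed by a
  multiplication realises the rank one operator sending \<open>u\<close> to \<open>inn u v\<close>
  times \<open>r v\<close>. Summing over the orthonormal set \<open>B\<close> prescribes arbitrary
  values on it.\<close>

theorem weyl_density:
  fixes B :: "'m::finite cfn set"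
  assumes B: "onb B" and r: "\<And>v. v \<in> B \<Longrightarrow> r v \<in> polys"
  shows "\<exists>N A. wop N A \<and> (\<forall>v\<in>B. A v = r v)"
proof -
  have fB: "finite B" "B \<subseteq> polys" using B by (auto simp: onb_def)
  have "\<exists>d. \<forall>v\<in>C. v \<in> span_deg d" if "finite C" "C \<subseteq> polys" for C :: "'m cfn set"
    using that
  proof (induction C rule: finite_induct)
    case (insert v C)
    then obtain d where d: "\<forall>v\<in>C. v \<in> span_deg d" by auto
    have mono: "span_deg a \<subseteq> span_deg b" if "a \<le> b" for a b
      unfolding span_deg_def by (rule cfun.span_mono) (use that in auto)
    have "v \<in> cfun.span (range lmono)" using insert.prems polys_span by blast
    then have "\<exists>e. v \<in> span_deg e"
    proof (induction rule: span_induct_fun)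
      case zero show ?case by (simp add: span_deg_def subspace_czero)
    next
      case (add u v)
      then obtain a b where "u \<in> span_deg a" "v \<in> span_deg b" by blast
      then have "u \<in> span_deg (max a b)" "v \<in> span_deg (max a b)"
        using mono[of a "max a b"] mono[of b "max a b"] by auto
      then show ?case using subspace_cadd unfolding span_deg_def using cfun.subspace_span by blast
    next
      case (scale c u) then show ?case using subspace_cscale unfolding span_deg_def using cfun.subspace_span by blast
    next
      case (base u)
      then obtain xs where "u = lmono xs" by blast
      then have "u \<in> span_deg (length xs)" unfolding span_deg_def by (simp add: cfun.span_base)
      then show ?case by blast
    qed
    then obtain e where e: "v \<in> span_deg e" by blast
    have "\<forall>x\<in>insert v C. x \<in> span_deg (max d e)"
      using d e mono[of d "max d e"] mono[of e "max d e"] by auto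
    then show ?case by blast
  qed simp
  from this[OF fB] obtain d where d': "\<forall>v\<in>B. v \<in> span_deg d" by (rule exE)
  then have d: "\<And>v. v \<in> B \<Longrightarrow> v \<in> span_deg d" by simp
  have "\<exists>N A. wop N A \<and> (\<forall>u\<in>B. A u = (\<lambda>w. r v w * inn u v))" if v: "v \<in> B" for v
  proof -
    have vp: "v \<in> polys" using v fB by blast
    obtain M F where F: "wop M F" "\<And>u. u \<in> span_deg d \<Longrightarrow> F u = (\<lambda>w. inn u v)" using wop_functional[OF vp, of d] by blast
    obtain N G where G: "wop N G" "\<And>u. u \<in> polys \<Longrightarrow> G u = (\<lambda>w. r v w * u w)" using wop_multiplication[OF r[OF v]] by blast
    have "wop (N + M) (\<lambda>u. G (F u))" by (rule wop_compose[OF G(1) wop_mono[OF F(1)]]) simp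
    moreover have "G (F u) = (\<lambda>w. r v w * inn u v)" if "u \<in> B" for u
      using F(2)[OF d[OF that]] G(2)[OF polys.const] by simp
    ultimately show ?thesis by blast
  qed
  then obtain N A where A: "\<And>v. v \<in> B \<Longrightarrow> wop (N v) (A v)" "\<And>v u. v \<in> B \<Longrightarrow> u \<in> B \<Longrightarrow> A v u = (\<lambda>w. r v w * inn u v)"
    by metis
  have "wop (\<Sum>v\<in>B. N v) (\<lambda>u w. \<Sum>v\<in>B. A v u w)"
    by (rule wop_sum, rule wop_mono[OF A(1)]) (use fB member_le_sum[of _ B N] in auto)
  moreover have "(\<lambda>w. \<Sum>v\<in>B. A v u w) = r u" if u: "u \<in> B" for u
  proof
    fix w
    have "(\<Sum>v\<in>B. A v u w) = (\<Sum>v\<in>B. if v = u then r v w else 0)"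
      by (rule sum.cong) (use u B A(2) in \<open>auto simp: onb_def\<close>)
    then show "(\<Sum>v\<in>B. A v u w) = r u w" using u fB by simp
  qed
  ultimately show ?thesis by blast
qed

end

section \<open>Symbols and harmonic polynomials\<close>

lemma sum_UNIV_Plus: "(\<Sum>x\<in>(UNIV :: ('a::finite + 'b::finite) set). F x) = (\<Sum>i\<in>UNIV. F (Inl i)) + (\<Sum>j\<in>UNIV. F (Inr j))"
  by (subst UNIV_Plus_UNIV[symmetric], subst sum.Plus) auto

lemma prod_UNIV_Plus: "(\<Prod>x\<in>(UNIV :: ('a::finite + 'b::finite) set). F x) = (\<Prod>i\<in>UNIV. F (Inl i)) * (\<Prod>j\<in>UNIV. F (Inr j))"
  by (subst UNIV_Plus_UNIV[symmetric], subst prod.Plus) auto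

text \<open>With parameter 1/2 the factor \<open>2 * \<nu>\<close> is 1 and the Fock inner product
  becomes the Fischer inner product, for which multiplication by a coordinate is adjoint to the
  partial derivative.\<close>

interpretation F: fock "1/2"
  by unfold_locales simp

lemma F_nu: "F.\<nu> = 1/2"
  by (simp add: F.\<nu>_def)

lemma F_deriv_left: "u \<in> polys \<Longrightarrow> v \<in> polys \<Longrightarrow> fock_inner (1/2) (hol_deriv_op j u) v = fock_inner (1/2) u (\<lambda>w. w $ j * v w)"
  by (simp add: F.inn_deriv_left F_nu)

lemma inn_lmono_zero:
  assumes p: "p \<in> polys" and z: "\<And>xs. fock_inner (1/2) p (lmono xs) = 0"
  shows "p = (\<lambda>w. 0)"
proof -
  have "fock_inner (1/2) p p = 0"
  proof (rule F.inn_span_zero[of "range lmono"])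
    show "range lmono \<subseteq> polys" by (rule image_subsetI) (rule polys_lmono)
    show "p \<in> cfun.span (range lmono)" using p unfolding polys_span .
    show "fock_inner (1/2) p e = 0" if "e \<in> range lmono" for e using that z by (elim imageE) simp
  qed (rule p)
  then show ?thesis by (rule F.inn_self_eq_0[OF p])
qed

definition hom :: "nat \<Rightarrow> 'm::finite cfn set" where
  "hom N = cfun.span (lmono ` words N)"

lemma hom_subspace: "cfun.subspace (hom N)"
  by (simp add: hom_def)

lemma hom_polys: "p \<in> hom N \<Longrightarrow> p \<in> polys"
  unfolding hom_def by (rule F.span_polys[rotated]) (auto intro: polys_lmono)

lemma lmono_hom: "xs \<in> words N \<Longrightarrow> lmono xs \<in> hom N"
  unfolding hom_def by (intro cfun.span_base imageI)

lemma hom_mult: "p \<in> hom N \<Longrightarrow> q \<in> hom M \<Longrightarrow> (\<lambda>w. p w * q w) \<in> hom (N + M)"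
proof -
  assume p: "p \<in> hom N" and q: "q \<in> hom M"
  from p show ?thesis unfolding hom_def[of N]
  proof (induction rule: span_induct_fun)
    case zero show ?case by (simp add: subspace_czero hom_subspace)
  next
    case (add u v)
    from subspace_cadd[OF hom_subspace add.IH] show ?case by (simp add: distrib_right)
  next
    case (scale c u)
    from subspace_cscale[OF hom_subspace scale.IH, of c] show ?case by (simp add: mult.assoc)
  next
    case (base u)
    then obtain xs where xs: "xs \<in> words N" "u = lmono xs" by auto
    from q show ?case unfolding hom_def[of M] xs(2)
    proof (induction rule: span_induct_fun)
      case zero show ?case by (simp add: subspace_czero hom_subspace)
    next
      case (add u v)
      from subspace_cadd[OF hom_subspace add.IH] show ?case by (simp add: distrib_left)
    next
      case (scale c u)
      from subspace_cscale[OF hom_subspace scale.IH, of c] show ?case by (simp add: mult_ac)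
    next
      case (base u)
      then obtain ys where ys: "ys \<in> words M" "u = lmono ys" by auto
      have "xs @ ys \<in> words (N + M)" using xs ys by (simp add: words_def)
      from lmono_hom[OF this] show ?case by (simp add: ys lmono_append[abs_def] fun_eq_iff)
    qed
  qed
qed

lemma hol_deriv_lmono: "hol_deriv_op x (lmono ys) = (\<lambda>w. of_nat (count_list ys x) * lmono (remove1 x ys) w)"
proof (induction ys)
  case (Cons y ys)
  show ?case
  proof (cases "y = x")
    case True
    have h: "w $ x * (of_nat (count_list ys x) * lmono (remove1 x ys) w) = of_nat (count_list ys x) * lmono ys w" for w :: "complex^'a"
    proof (cases "x \<in> set ys")
      case True
      have "lmono (x # remove1 x ys) = lmono ys" by (rule lmono_mset) (use True in simp)
      then have "w $ x * lmono (remove1 x ys) w = lmono ys w" by (metis lmono_simps(2))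
      then show ?thesis by (simp add: mult.left_commute)
    next
      case False
      then show ?thesis by (simp add: count_list_0_iff)
    qed
    show ?thesis using True by (simp add: hol_deriv_op_coord[OF polys_lmono] Cons.IH h distrib_right)
  next
    case False
    then show ?thesis by (simp add: hol_deriv_op_coord[OF polys_lmono] Cons.IH algebra_simps)
  qed
qed simp

abbreviation dd :: "'m list \<Rightarrow> 'm::finite cfn \<Rightarrow> 'm cfn" where
  "dd \<equiv> foldr hol_deriv_op"

lemma lin_on_hol_deriv_op: "lin_on polys (hol_deriv_op j)"
  by (auto simp: lin_on_def hol_deriv_op_add hol_deriv_op_cmult)

lemma dd_polys: "p \<in> polys \<Longrightarrow> dd xs p \<in> polys"
  by (rule foldr_closed[of polys]) (auto intro: polys_hol_deriv_op)

lemma lin_on_dd: "lin_on polys (dd xs)"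
proof (induction xs)
  case (Cons x xs)
  show ?case using lin_on_compose[OF Cons.IH _ lin_on_hol_deriv_op[of x]] by (simp add: dd_polys o_def)
qed (simp add: lin_on_def)

lemma dd_snoc_lmono: "dd (xs @ [x]) (lmono ys) w = of_nat (count_list ys x) * dd xs (lmono (remove1 x ys)) w"
  using lin_onD(2)[OF lin_on_dd polys_lmono, of xs "of_nat (count_list ys x)" "remove1 x ys"]
  by (simp add: hol_deriv_lmono)

lemma dd_lmono_mset: "length xs = length ys \<Longrightarrow> dd xs (lmono ys) 0 \<noteq> 0 \<Longrightarrow> mset xs = mset ys"
proof (induction xs arbitrary: ys rule: rev_induct)
  case (snoc x xs)
  then have "count_list ys x \<noteq> 0" and nz: "dd xs (lmono (remove1 x ys)) 0 \<noteq> 0"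
    by (auto simp: dd_snoc_lmono simp del: foldr_append)
  then have x: "x \<in> set ys" by (simp add: count_list_0_iff)
  then have "length xs = length (remove1 x ys)" using snoc.prems(1) by (simp add: length_remove1)
  from snoc.IH[OF this nz] x show ?case by simp
qed simp

text \<open>The number \<open>dd xs (lmono ys) 0\<close> counts the permutations of positions that
  carry \<open>ys\<close> to \<open>xs\<close>, so the sum over \<open>xs\<close> counts all
  permutations.\<close>

lemma dd_lmono_sum: "length ys = N \<Longrightarrow> (\<Sum>xs\<in>words N. dd xs (lmono ys) 0) = fact N"
proof (induction N arbitrary: ys)
  case (Suc N)
  have s: "(\<Sum>xs\<in>words N. dd xs (lmono (remove1 x ys)) 0) = fact N" if "x \<in> set ys" for x
    by (rule Suc.IH) (use that Suc.prems in \<open>simp add: length_remove1\<close>)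
  have "(\<Sum>xs\<in>words (Suc N). dd xs (lmono ys) 0) = (\<Sum>x\<in>UNIV. of_nat (count_list ys x) * (\<Sum>xs\<in>words N. dd xs (lmono (remove1 x ys)) 0))"
    by (simp only: sum_words_snoc dd_snoc_lmono sum_distrib_left)
  also have "\<dots> = (\<Sum>x\<in>UNIV. of_nat (count_list ys x) * fact N)"
  proof (rule sum.cong[OF refl])
    fix x
    show "of_nat (count_list ys x) * (\<Sum>xs\<in>words N. dd xs (lmono (remove1 x ys)) 0) = of_nat (count_list ys x) * fact N"
      by (cases "x \<in> set ys") (simp_all add: s count_list_0_iff)
  qed
  also have "\<dots> = of_nat (\<Sum>x\<in>UNIV. count_list ys x) * fact N" by (simp add: sum_distrib_right)
  also have "(\<Sum>x\<in>UNIV. count_list ys x) = Suc N" using Suc.prems length_count_list by metis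
  finally show ?case by simp
qed simp

text \<open>The symmetric tensor of a homogeneous polynomial: by Taylor's formula, \<open>p\<close>
  of degree \<open>N\<close> is the sum of \<open>symb N p xs * lmono xs\<close> over words of
  length \<open>N\<close>. Contracting it with words of operators, as \<open>opT\<close> does, is
  the symmetrised quantization of \<open>p\<close>.\<close>

definition symb :: "nat \<Rightarrow> 'm::finite cfn \<Rightarrow> 'm list \<Rightarrow> complex" where
  "symb N p xs = dd xs p 0 / fact N"

lemma symb_add: "p \<in> polys \<Longrightarrow> q \<in> polys \<Longrightarrow> symb N (\<lambda>w. p w + q w) = (\<lambda>xs. symb N p xs + symb N q xs)"
  by (rule ext) (simp add: symb_def lin_onD(1)[OF lin_on_dd] add_divide_distrib)

lemma symb_scale: "p \<in> polys \<Longrightarrow> symb N (\<lambda>w. c * p w) = (\<lambda>xs. c * symb N p xs)"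
  by (rule ext) (simp add: symb_def lin_onD(2)[OF lin_on_dd])

lemma symb_zero: "symb N (\<lambda>w. 0) = (\<lambda>xs. 0)"
  using symb_scale[OF polys.const[of 0], of N 0] by simp

section \<open>Symmetrised quantization of symbols\<close>

context fock begin

definition opT :: "nat \<Rightarrow> (('m + 'm) list \<Rightarrow> complex) \<Rightarrow> 'm::finite pop" where
  "opT N e u = (\<lambda>w. \<Sum>xs\<in>words N. e xs * foldr op xs u w)"

lemma wop_opT: "wop (Suc N) (opT N e)"
proof -
  have "wop (Suc N) (\<lambda>u w. \<Sum>xs\<in>words N. e xs * foldr op xs u w)"
    by (intro wop_sum wop.scale wop.word) (simp add: words_def)
  then show ?thesis unfolding opT_def[abs_def] .
qed

lemma opT_add: "opT N (\<lambda>xs. d xs + e xs) u w = opT N d u w + opT N e u w"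
  by (simp add: opT_def distrib_right sum.distrib)

lemma opT_scale: "opT N (\<lambda>xs. c * e xs) u w = c * opT N e u w"
  by (simp add: opT_def sum_distrib_left mult.assoc)

lemma opT_zero: "opT N (\<lambda>xs. 0) u w = 0"
  by (simp add: opT_def)

lemma wop_zero_iff: "wop 0 A \<Longrightarrow> u \<in> polys \<Longrightarrow> A u = (\<lambda>w. 0)"
  by (induction rule: wop.induct) auto

lemma wop_compose': assumes "wop (Suc N) A" "wop M B" shows "wop (N + M) (\<lambda>u. A (B u))"
proof (cases M)
  case 0
  have "lin_on polys A" using wop_lin[OF assms(1)] by simp
  then have "A (B u) = (\<lambda>w. 0)" if "u \<in> polys" for u
    using wop_zero_iff[OF assms(2)[unfolded 0] that] lin_on_zero[OF _ polys_subspace] by simp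
  then show ?thesis using wop.ext[OF wop.zero, of "\<lambda>u. A (B u)"] by simp
next
  case (Suc M')
  then show ?thesis using wop_compose[OF assms(1), of M' B] assms(2) by simp
qed

text \<open>The weights \<open>symb N (lmono ys) xs\<close> are carried by the rearrangements of
  \<open>ys\<close> and sum to 1, and a rearrangement costs lower order terms only.\<close>

lemma opT_symb_lmono:
  assumes "ys \<in> words N"
  shows "wop N (\<lambda>u w. opT N (symb N (lmono ys)) u w - foldr op ys u w)"
proof -
  have len: "length ys = N" using assms by (simp add: words_def)
  have "wop N (\<lambda>u w. \<Sum>xs\<in>words N. symb N (lmono ys) xs * (foldr op xs u w - foldr op ys u w))"
  proof (rule wop_sum)
    fix xs :: "('a + 'a) list" assume "xs \<in> words N"
    then have l: "length xs = N" by (simp add: words_def)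
    show "wop N (\<lambda>u w. symb N (lmono ys) xs * (foldr op xs u w - foldr op ys u w))"
    proof (cases "dd xs (lmono ys) 0 = 0")
      case True
      then show ?thesis by (simp add: symb_def wop.zero)
    next
      case False
      then have "mset xs = mset ys" by (intro dd_lmono_mset) (simp_all add: l len)
      from wop.scale[OF wop_perm[OF this]] show ?thesis by (simp add: l)
    qed
  qed
  moreover have "(\<Sum>xs\<in>words N. symb N (lmono ys) xs) = 1"
    using dd_lmono_sum[OF len] by (simp add: symb_def sum_divide_distrib[symmetric])
  then have "(\<Sum>xs\<in>words N. symb N (lmono ys) xs * (foldr op xs u w - foldr op ys u w)) =
      opT N (symb N (lmono ys)) u w - foldr op ys u w" for u w
    by (simp add: opT_def right_diff_distrib sum_subtractf sum_distrib_right[symmetric])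
  ultimately show ?thesis by simp
qed

lemma opT_symb_mult_lmono:
  assumes "ys \<in> words N" "zs \<in> words M"
  shows "wop (N + M) (\<lambda>u w. opT (N + M) (symb (N + M) (\<lambda>w. lmono ys w * lmono zs w)) u w -
    opT N (symb N (lmono ys)) (opT M (symb M (lmono zs)) u) w)"
proof -
  let ?A = "opT N (symb N (lmono ys))" and ?B = "opT M (symb M (lmono zs))"
  have yz: "ys @ zs \<in> words (N + M)" using assms by (simp add: words_def)
  have lm: "lmono (ys @ zs) = (\<lambda>w. lmono ys w * lmono zs w)" by (simp add: fun_eq_iff lmono_append)
  have 1: "wop (N + M) (\<lambda>u w. opT (N + M) (symb (N + M) (\<lambda>w. lmono ys w * lmono zs w)) u w - foldr op (ys @ zs) u w)"
    using opT_symb_lmono[OF yz] unfolding lm .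
  have 2: "wop (N + M) (\<lambda>u. (\<lambda>u w. ?A u w - foldr op ys u w) (?B u))"
    by (rule wop_compose[OF opT_symb_lmono[OF assms(1)] wop_opT])
  have "wop (Suc N) (foldr op ys)" using assms(1) by (intro wop.word) (simp add: words_def)
  then have 3: "wop (N + M) (\<lambda>u. foldr op ys (\<lambda>w. ?B u w - foldr op zs u w))"
    by (rule wop_compose'[OF _ opT_symb_lmono[OF assms(2)]])
  show ?thesis
  proof (rule wop.ext[OF wop_diff[OF wop_diff[OF 1 2] 3]])
    fix u :: "'a cfn" assume u: "u \<in> polys"
    have "foldr op ys (\<lambda>w. ?B u w - foldr op zs u w) = (\<lambda>w. foldr op ys (?B u) w - foldr op ys (foldr op zs u) w)"
      by (rule lin_on_diff[OF lin_on_ops polys_subspace wop_polys[OF wop_opT u] ops_polys[OF u]])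
    then show "(\<lambda>w. opT (N + M) (symb (N + M) (\<lambda>w. lmono ys w * lmono zs w)) u w - foldr op (ys @ zs) u w -
         (?A (?B u) w - foldr op ys (?B u) w) - foldr op ys (\<lambda>w. ?B u w - foldr op zs u w) w) =
        (\<lambda>w. opT (N + M) (symb (N + M) (\<lambda>w. lmono ys w * lmono zs w)) u w - ?A (?B u) w)"
      by (simp add: fun_eq_iff)
  qed
qed

text \<open>Both terms are bilinear in \<open>p\<close> and \<open>q\<close>. For monomials each of
  them is the concatenated word up to lower order.\<close>

lemma opT_symb_mult:
  assumes p: "p \<in> hom N" and q: "q \<in> hom M"
  shows "wop (N + M) (\<lambda>u w. opT (N + M) (symb (N + M) (\<lambda>w. p w * q w)) u w -
    opT N (symb N p) (opT M (symb M q) u) w)"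
proof -
  have linA: "lin_on polys (opT N e)" for e using wop_lin[OF wop_opT] by blast
  have step: "wop (N + M) (\<lambda>u w. opT (N + M) (symb (N + M) (\<lambda>w. lmono ys w * q w)) u w - opT N (symb N (lmono ys)) (opT M (symb M q) u) w)"
    if ys: "ys \<in> words N" for ys
    using q unfolding hom_def
  proof (induction rule: span_induct_fun)
    case zero
    show ?case
      by (rule wop.ext[OF wop.zero])
         (simp add: symb_zero opT_zero[abs_def] lin_on_zero[OF linA polys_subspace])
  next
    case (add u v)
    then have h: "u \<in> hom M" "v \<in> hom M" by (simp_all add: hom_def)
    note pu = hom_polys[OF h(1)] hom_polys[OF h(2)]
    have e1: "symb (N + M) (\<lambda>w. lmono ys w * (u w + v w)) = (\<lambda>xs. symb (N + M) (\<lambda>w. lmono ys w * u w) xs + symb (N + M) (\<lambda>w. lmono ys w * v w) xs)"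
      using symb_add[OF polys_mult[OF polys_lmono[of ys] pu(1)] polys_mult[OF polys_lmono[of ys] pu(2)]] by (simp add: distrib_left)
    show ?case
    proof (rule wop.ext[OF wop.add[OF add.IH]])
      fix f :: "'a cfn" assume f: "f \<in> polys"
      have "opT N (symb N (lmono ys)) (opT M (symb M (\<lambda>w. u w + v w)) f) =
        (\<lambda>w. opT N (symb N (lmono ys)) (opT M (symb M u) f) w + opT N (symb N (lmono ys)) (opT M (symb M v) f) w)"
        unfolding symb_add[OF pu] opT_add[abs_def]
        by (rule lin_onD(1)[OF linA wop_polys[OF wop_opT f] wop_polys[OF wop_opT f]])
      then show "(\<lambda>w. opT (N + M) (symb (N + M) (\<lambda>w. lmono ys w * u w)) f w - opT N (symb N (lmono ys)) (opT M (symb M u) f) w +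
          (opT (N + M) (symb (N + M) (\<lambda>w. lmono ys w * v w)) f w - opT N (symb N (lmono ys)) (opT M (symb M v) f) w)) =
        (\<lambda>w. opT (N + M) (symb (N + M) (\<lambda>w. lmono ys w * (u w + v w))) f w - opT N (symb N (lmono ys)) (opT M (symb M (\<lambda>w. u w + v w)) f) w)"
        by (simp add: e1 opT_add fun_eq_iff)
    qed
  next
    case (scale c u)
    then have h: "u \<in> hom M" by (simp add: hom_def)
    note pu = hom_polys[OF h]
    have e1: "symb (N + M) (\<lambda>w. lmono ys w * (c * u w)) = (\<lambda>xs. c * symb (N + M) (\<lambda>w. lmono ys w * u w) xs)"
      using symb_scale[OF polys_mult[OF polys_lmono[of ys] pu], of "N + M" c] by (simp add: mult.left_commute)
    show ?case
    proof (rule wop.ext[OF wop.scale[OF scale.IH, of c]])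
      fix f :: "'a cfn" assume f: "f \<in> polys"
      have "opT N (symb N (lmono ys)) (opT M (symb M (\<lambda>w. c * u w)) f) =
        (\<lambda>w. c * opT N (symb N (lmono ys)) (opT M (symb M u) f) w)"
        unfolding symb_scale[OF pu] opT_scale[abs_def]
        by (rule lin_onD(2)[OF linA wop_polys[OF wop_opT f]])
      then show "(\<lambda>w. c * (opT (N + M) (symb (N + M) (\<lambda>w. lmono ys w * u w)) f w - opT N (symb N (lmono ys)) (opT M (symb M u) f) w)) =
        (\<lambda>w. opT (N + M) (symb (N + M) (\<lambda>w. lmono ys w * (c * u w))) f w - opT N (symb N (lmono ys)) (opT M (symb M (\<lambda>w. c * u w)) f) w)"
        by (simp add: e1 opT_scale fun_eq_iff right_diff_distrib)
    qed
  next
    case (base u)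
    then obtain zs where zs: "zs \<in> words M" "u = lmono zs" by auto
    show ?case unfolding zs(2) by (rule opT_symb_mult_lmono[OF ys zs(1)])
  qed
  from p show ?thesis unfolding hom_def[of N]
  proof (induction rule: span_induct_fun)
    case zero
    show ?case
      by (rule wop.ext[OF wop.zero]) (simp add: symb_zero opT_zero[abs_def])
  next
    case (add u v)
    then have h: "u \<in> hom N" "v \<in> hom N" by (simp_all add: hom_def)
    note pu = hom_polys[OF h(1)] hom_polys[OF h(2)]
    have e1: "symb (N + M) (\<lambda>w. (u w + v w) * q w) = (\<lambda>xs. symb (N + M) (\<lambda>w. u w * q w) xs + symb (N + M) (\<lambda>w. v w * q w) xs)"
      using symb_add[OF polys_mult[OF pu(1) hom_polys[OF q]] polys_mult[OF pu(2) hom_polys[OF q]]] by (simp add: distrib_right)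
    show ?case
      by (rule wop.ext[OF wop.add[OF add.IH]]) (simp add: e1 opT_add symb_add[OF pu] fun_eq_iff)
  next
    case (scale c u)
    then have h: "u \<in> hom N" by (simp add: hom_def)
    note pu = hom_polys[OF h]
    have e1: "symb (N + M) (\<lambda>w. (c * u w) * q w) = (\<lambda>xs. c * symb (N + M) (\<lambda>w. u w * q w) xs)"
      using symb_scale[OF polys_mult[OF pu hom_polys[OF q]], of "N + M" c] by (simp add: mult.assoc)
    show ?case
      by (rule wop.ext[OF wop.scale[OF scale.IH, of c]]) (simp add: e1 opT_scale symb_scale[OF pu] fun_eq_iff right_diff_distrib)
  next
    case (base u)
    then obtain ys where ys: "ys \<in> words N" "u = lmono ys" by auto
    show ?case unfolding ys(2) by (rule step[OF ys(1)])
  qed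
qed

end

text \<open>Polynomials in \<open>z\<close> and its conjugate are restrictions of holomorphic polynomials to the totally real
  subspace \<open>range emb\<close>.\<close>

definition emb :: "complex^'m::finite \<Rightarrow> complex^('m + 'm)" where
  "emb z = (\<chi> x. case x of Inl j \<Rightarrow> z $ j | Inr j \<Rightarrow> cnj (z $ j))"

lemma emb_nth [simp]: "emb z $ Inl j = z $ j" "emb z $ Inr j = cnj (z $ j)"
  by (simp_all add: emb_def)

lemma emb_0 [simp]: "emb 0 = 0"
  by (simp add: emb_def vec_eq_iff split: sum.splits)

lemma linear_emb: "linear emb"
  by (rule linearI) (simp_all add: emb_def vec_eq_iff split: sum.splits)

text \<open>The derivative along \<open>emb b\<close> in the doubled variables; on
  \<open>range emb\<close> it is the real derivative in direction \<open>b\<close>.\<close>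

definition delta :: "complex^'m::finite \<Rightarrow> (complex^('m + 'm) \<Rightarrow> complex) \<Rightarrow> complex^('m + 'm) \<Rightarrow> complex" where
  "delta b p = (\<lambda>w. \<Sum>x\<in>UNIV. emb b $ x * hol_deriv_op x p w)"

lemma delta_polys: "p \<in> polys \<Longrightarrow> delta b p \<in> polys"
  unfolding delta_def by (intro polys_sum polys_cmult polys_hol_deriv_op)

lemma lin_on_delta: "lin_on polys (delta b)"
  by (auto simp: lin_on_def delta_def hol_deriv_op_add hol_deriv_op_cmult distrib_left sum.distrib sum_distrib_left mult_ac)

lemma dir_deriv_emb:
  assumes "p \<in> polys" shows "dir_deriv b (\<lambda>z. p (emb z)) = (\<lambda>z. delta b p (emb z))"
proof
  fix z :: "complex^'a"
  have "(emb has_derivative emb) (at z)"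
    by (intro bounded_linear_imp_has_derivative) (simp add: linear_conv_bounded_linear[symmetric] linear_emb)
  from dir_deriv_eqI[OF has_derivative_compose[OF this has_derivative_polys[OF assms, of "emb z"]]]
  show "dir_deriv b (\<lambda>z. p (emb z)) z = delta b p (emb z)" by (simp add: delta_def)
qed

lemma foldr_dir_deriv_emb: "p \<in> polys \<Longrightarrow> foldr dir_deriv bs (\<lambda>z. p (emb z)) = (\<lambda>z. foldr delta bs p (emb z))"
proof (induction bs)
  case (Cons b bs)
  have "foldr delta bs p \<in> polys" by (rule foldr_closed[of polys]) (auto intro: delta_polys Cons.prems)
  then show ?case using Cons by (simp add: dir_deriv_emb)
qed simp

lemma sum_axis: "(\<Sum>i\<in>UNIV. axis j c $ i * G i) = c * G j" "(\<Sum>i\<in>UNIV. cnj (axis j c $ i) * G i) = cnj c * G j"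
  for c :: complex
  by (simp_all add: axis_def if_distrib[of "\<lambda>x. x * _"] if_distrib[of cnj] cong: if_cong)

text \<open>If a polynomial vanishes on \<open>range emb\<close>, so do its derivatives along every
  \<open>emb b\<close>. The choices 1 and \<open>\<i>\<close> for the entry of \<open>b\<close>
  separate the two kinds of partial derivatives, so all Taylor coefficients at 0 vanish.\<close>

lemma emb_zero_imp_zero:
  assumes p: "p \<in> polys" and z: "\<And>z. p (emb z) = 0"
  shows "p = (\<lambda>w. 0)"
proof -
  have step: "hol_deriv_op x q (emb z) = 0" if q: "q \<in> polys" "\<And>z. q (emb z) = 0" for q x z
  proof -
    have d: "delta b q (emb z) = 0" for b
      using dir_deriv_emb[OF q(1), of b] q(2) by (simp add: fun_eq_iff)

    have e: "c * hol_deriv_op (Inl j) q (emb z) + cnj c * hol_deriv_op (Inr j) q (emb z) = 0" for c j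
      using d[of "axis j c"] by (simp add: delta_def sum_UNIV_Plus sum_axis)
    show ?thesis
    proof (cases x)
      case (Inl j)
      from e[of 1 j] e[of \<i> j] show ?thesis unfolding Inl by (simp add: algebra_simps eq_neg_iff_add_eq_0)
    next
      case (Inr j)
      from e[of 1 j] e[of \<i> j] show ?thesis unfolding Inr by (simp add: algebra_simps eq_neg_iff_add_eq_0)
    qed
  qed
  have "fock_inner (1/2) q (lmono xs) = 0" if "q \<in> polys" "\<And>z. q (emb z) = 0" for q :: "complex^('a + 'a) \<Rightarrow> complex" and xs
    using that
  proof (induction xs arbitrary: q)
    case Nil
    then show ?case using F.inn_one_right[OF Nil(1)] Nil(2)[of 0] by simp
  next
    case (Cons x xs)
    have "fock_inner (1/2) (hol_deriv_op x q) (lmono xs) = 0"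
      by (rule Cons.IH, rule polys_hol_deriv_op, rule Cons.prems(1), rule step, rule Cons.prems(1), rule Cons.prems(2))
    then show ?case using F_deriv_left[OF Cons.prems(1) polys_lmono[of xs]] by simp
  qed
  from this[OF p z] show ?thesis by (rule inn_lmono_zero[OF p])
qed

text \<open>The linear form whose multiplication operator is adjoint to \<open>delta b\<close> for
  the Fischer inner product, by \<open>inn_delta\<close>.\<close>

definition ell :: "complex^'m::finite \<Rightarrow> complex^('m + 'm) \<Rightarrow> complex" where
  "ell b w = (\<Sum>x\<in>UNIV. cnj (emb b $ x) * w $ x)"

lemma ell_hom: "ell b \<in> hom 1"
proof -
  have "(\<lambda>w. \<Sum>x\<in>UNIV. cnj (emb b $ x) * lmono [x] w) \<in> hom 1"
    by (intro subspace_csum hom_subspace lmono_hom) (simp add: words_def)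
  then show ?thesis by (simp add: ell_def[abs_def])
qed

lemma ell_emb: "ell b (emb z) = 2 * of_real (z \<bullet> b)"
proof -
  have "cnj (b $ j) * z $ j + b $ j * cnj (z $ j) = 2 * of_real (z $ j \<bullet> b $ j)" for j
    by (simp add: complex_eq_iff inner_complex_def)
  then show ?thesis
    by (simp add: ell_def sum_UNIV_Plus sum.distrib[symmetric] inner_vec_def sum_distrib_left)
qed

lemma inn_delta: "u \<in> polys \<Longrightarrow> v \<in> polys \<Longrightarrow> fock_inner (1/2) (delta b u) v = fock_inner (1/2) u (\<lambda>w. ell b w * v w)"
proof -
  assume uv: "u \<in> polys" "v \<in> polys"
  have "fock_inner (1/2) (delta b u) v = (\<Sum>x\<in>UNIV. emb b $ x * fock_inner (1/2) u (\<lambda>w. w $ x * v w))"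
    unfolding delta_def
    by (subst F.inn_sum_left) (auto intro: polys_cmult polys_hol_deriv_op uv simp: F.inn_cmult_left F_deriv_left[OF uv])
  also have "\<dots> = fock_inner (1/2) u (\<lambda>w. \<Sum>x\<in>UNIV. cnj (emb b $ x) * (w $ x * v w))"
    by (subst F.inn_sum_right) (auto intro: polys_cmult[OF polys.coord[OF uv(2)]] uv simp: F.inn_cmult_right)
  also have "(\<lambda>w. \<Sum>x\<in>UNIV. cnj (emb b $ x) * (w $ x * v w)) = (\<lambda>w. ell b w * v w)"
    by (simp add: ell_def sum_distrib_right mult.assoc)
  finally show ?thesis .
qed

definition ells :: "(complex^'m::finite) list \<Rightarrow> complex^('m + 'm) \<Rightarrow> complex" where
  "ells bs w = prod_list (map (\<lambda>b. ell b w) bs)"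

lemma ells_hom: "ells bs \<in> hom (length bs)"
proof (induction bs)
  case Nil
  show ?case using lmono_hom[of "[]" 0] by (simp add: ells_def[abs_def])
next
  case (Cons b bs)
  from hom_mult[OF ell_hom[of b] Cons] show ?case by (simp add: ells_def[abs_def])
qed

lemma inn_deltas: "u \<in> polys \<Longrightarrow> v \<in> polys \<Longrightarrow> fock_inner (1/2) (foldr delta bs u) v = fock_inner (1/2) u (\<lambda>w. ells bs w * v w)"
proof (induction bs arbitrary: v)
  case (Cons b bs)
  have p: "foldr delta bs u \<in> polys" by (rule foldr_closed[of polys]) (auto intro: delta_polys Cons.prems)
  have "(\<lambda>w. ell b w * v w) \<in> polys" by (rule polys_mult[OF hom_polys[OF ell_hom] Cons.prems(2)])
  from Cons.IH[OF Cons.prems(1) this] show ?case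
    by (simp add: inn_delta[OF p Cons.prems(2)] ells_def mult_ac)
qed (simp add: ells_def)

text \<open>The Euler operator is symmetric and has the degree as its eigenvalue on homogeneous
  polynomials.\<close>

lemma hom_orth:
  assumes "p \<in> hom N" "q \<in> hom M" "N \<noteq> M"
  shows "fock_inner (1/2) p q = 0"
proof -
  have lm: "fock_inner (1/2) (lmono xs :: 'a cfn) (lmono ys) = 0" if "length xs \<noteq> length ys" for xs ys
  proof -
    let ?x = "lmono xs :: 'a cfn" and ?y = "lmono ys :: 'a cfn"
    have "fock_inner (1/2) (F.euler ?x) ?y = fock_inner (1/2) ?x (F.euler ?y)"
    proof -
      have "fock_inner (1/2) (F.euler ?x) ?y = (\<Sum>j\<in>UNIV. fock_inner (1/2) (hol_deriv_op j ?x) (hol_deriv_op j ?y))"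
        unfolding F.euler_def
        by (subst F.inn_sum_left) (auto intro: polys.coord polys_hol_deriv_op polys_lmono simp: F.inn_coord_left[OF polys_hol_deriv_op[OF polys_lmono] polys_lmono] F_nu)
      also have "\<dots> = fock_inner (1/2) ?x (F.euler ?y)"
        unfolding F.euler_def
        by (subst F.inn_sum_right) (auto intro: polys.coord polys_hol_deriv_op polys_lmono simp: F_deriv_left[OF polys_lmono polys_hol_deriv_op[OF polys_lmono]])
      finally show ?thesis .
    qed
    then have "of_nat (length xs) * fock_inner (1/2) ?x ?y = of_nat (length ys) * fock_inner (1/2) ?x ?y"
      by (simp add: F.euler_lmono F.inn_cmult_left F.inn_cmult_right)
    with that show ?thesis by simp
  qed
  have "fock_inner (1/2) p e = 0" if e: "e \<in> lmono ` words M" for e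
  proof -
    obtain ys where ys: "ys \<in> words M" "e = lmono ys" using e by auto
    have "fock_inner (1/2) e p = 0"
    proof (rule F.inn_span_zero[OF _ _ _ assms(1)[unfolded hom_def]])
      show "fock_inner (1/2) e f = 0" if "f \<in> lmono ` words N" for f
        using that ys assms(3) by (auto simp: words_def intro!: lm)
    qed (auto simp: ys polys_lmono)
    then show ?thesis using F.inn_cnj[of p e] by simp
  qed
  then show ?thesis
    by (intro F.inn_span_zero[OF _ hom_polys[OF assms(1)] _ assms(2)[unfolded hom_def]]) (auto simp: polys_lmono)
qed

lemma count_list_map_inj: "inj f \<Longrightarrow> count_list (map f xs) (f x) = count_list xs x"
  by (induction xs) (auto simp: inj_eq)

lemma count_list_map_other: "(\<And>y. f y \<noteq> x) \<Longrightarrow> count_list (map f xs) x = 0"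
  by (induction xs) auto

lemma mset_mword_split:
  "mset (map Inr (mword UNIV (\<lambda>j. count_list ys (Inr j))) @ map Inl (mword UNIV (\<lambda>j. count_list ys (Inl j)))) = mset (ys :: ('m::finite + 'm) list)"
proof (rule multiset_eqI)
  fix x
  let ?r = "map Inr (mword UNIV (\<lambda>j. count_list ys (Inr j))) :: ('m + 'm) list"
  let ?l = "map Inl (mword UNIV (\<lambda>j. count_list ys (Inl j))) :: ('m + 'm) list"
  have "count_list ?r x + count_list ?l x = count_list ys x"
    by (cases x) (simp_all add: count_list_map_inj count_list_map_other count_mword)
  then show "count (mset (?r @ ?l)) x = count (mset ys) x" by (simp add: count_mset del: mset_map)
qed

lemma zpoly_eval_alt: "zpoly_eval P z = (\<Sum>m\<in>Poly_Mapping.keys P. Poly_Mapping.lookup P m * (case m of (\<rho>, \<gamma>) \<Rightarrow> cmonom \<rho> z * cmonom \<gamma> (vec_cnj z)))"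
  unfolding zpoly_eval_def by (rule sum.cong) (auto simp: mult.assoc)

lemma zpoly_eval_add: "zpoly_eval (P + Q) z = zpoly_eval P z + zpoly_eval Q z"
  by (simp only: zpoly_eval_alt poly_sum_add)

lemma zpoly_eval_map: "zpoly_eval (Poly_Mapping.map ((*) c) P) z = c * zpoly_eval P z"
  by (simp only: zpoly_eval_alt poly_sum_map)

section \<open>The Weyl correspondence to leading order\<close>

context fock begin

lemma weyl_alt: "weyl lam P u w = (\<Sum>m\<in>Poly_Mapping.keys P. Poly_Mapping.lookup P m * (case m of (\<rho>, \<gamma>) \<Rightarrow>
    (1 / 2) * (ops_power UNIV (Wbar_op lam) \<gamma> (ops_power UNIV (W_op lam) \<rho> u) w +
      ops_power UNIV (W_op lam) \<rho> (ops_power UNIV (Wbar_op lam) \<gamma> u) w)))"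
  unfolding weyl_def by (rule sum.cong) (auto simp: mult.assoc)

lemma weyl_add: "weyl lam (P + Q) u w = weyl lam P u w + weyl lam Q u w"
  by (simp only: weyl_alt poly_sum_add)

lemma weyl_map: "weyl lam (Poly_Mapping.map ((*) c) P) u w = c * weyl lam P u w"
  by (simp only: weyl_alt poly_sum_map)

lemma op_comp: "op \<circ> Inr = Wbar_op lam" "op \<circ> Inl = W_op lam"
  by (auto simp: op_def)

lemma ops_power_op: "ops_power UNIV (Wbar_op lam) \<gamma> f = foldr op (map Inr (mword UNIV \<gamma>)) f"
  "ops_power UNIV (W_op lam) \<gamma> f = foldr op (map Inl (mword UNIV \<gamma>)) f"
  by (simp_all add: ops_power_mword foldr_map op_comp)

text \<open>The two orderings averaged by \<open>weyl\<close> and the words averaged by the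
  symmetrisation are rearrangements of the same word, so they agree up to lower order.\<close>

lemma weyl_lmono:
  fixes ys :: "('m::finite + 'm) list"
  assumes ys: "ys \<in> words N"
  shows "\<exists>P. (\<forall>z. zpoly_eval P z = lmono ys (emb z)) \<and> wop N (\<lambda>u w. weyl lam P u w - opT N (symb N (lmono ys)) u w)"
proof -
  define \<rho> where "\<rho> = (\<lambda>j. count_list ys (Inl j))"
  define \<gamma> where "\<gamma> = (\<lambda>j. count_list ys (Inr j))"
  define P where "P = Poly_Mapping.single (\<rho>, \<gamma>) (1::complex)"
  have len: "length ys = N" using ys by (simp add: words_def)
  have ev: "zpoly_eval P z = lmono ys (emb z)" for z
    unfolding zpoly_eval_alt P_def poly_sum_single lmono_cmonom cmonom_def
    by (simp add: prod_UNIV_Plus \<rho>_def \<gamma>_def vec_cnj_def)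
  let ?r = "map Inr (mword UNIV \<gamma>) :: ('m + 'm) list" and ?l = "map Inl (mword UNIV \<rho>) :: ('m + 'm) list"
  have m1: "mset (?r @ ?l) = mset ys" unfolding \<rho>_def \<gamma>_def by (rule mset_mword_split)
  then have m2: "mset (?l @ ?r) = mset ys" by (simp add: add.commute)
  have l12: "length (?r @ ?l) = N" "length (?l @ ?r) = N" using m1 m2 len by (metis size_mset)+
  have w1: "wop N (\<lambda>u w. foldr op (?r @ ?l) u w - foldr op ys u w)" using wop_perm[OF m1] by (simp only: l12)
  have w2: "wop N (\<lambda>u w. foldr op (?l @ ?r) u w - foldr op ys u w)" using wop_perm[OF m2] by (simp only: l12)
  have w: "weyl lam P u w = 1/2 * (foldr op (?r @ ?l) u w + foldr op (?l @ ?r) u w)" for u w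
    unfolding weyl_alt P_def poly_sum_single by (simp add: ops_power_op)
  have "wop N (\<lambda>u w. weyl lam P u w - opT N (symb N (lmono ys)) u w)"
    by (rule wop.ext[OF wop_diff[OF wop.add[OF wop.scale[OF w1, of "1/2"] wop.scale[OF w2, of "1/2"]] opT_symb_lmono[OF ys]]])
       (simp add: w fun_eq_iff field_simps)
  with ev show ?thesis by blast
qed

lemma weyl_quantization:
  fixes p :: "complex^('m::finite + 'm) \<Rightarrow> complex"
  assumes "p \<in> hom N"
  shows "\<exists>P. (\<forall>z. zpoly_eval P z = p (emb z)) \<and> wop N (\<lambda>u w. weyl lam P u w - opT N (symb N p) u w)"
  using assms unfolding hom_def
proof (induction rule: span_induct_fun)
  case zero
  have "wop N (\<lambda>u w. weyl lam (0 :: 'm zpoly) u w - opT N (symb N (\<lambda>w. 0)) u w)"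
    by (simp add: weyl_alt symb_zero opT_zero wop.zero)
  then show ?case by (intro exI[of _ 0]) (simp add: zpoly_eval_alt)
next
  case (add u v)
  then have h: "u \<in> polys" "v \<in> polys" using hom_polys unfolding hom_def by blast+
  obtain P where P: "\<And>z. zpoly_eval P z = u (emb z)" "wop N (\<lambda>f w. weyl lam P f w - opT N (symb N u) f w)" using add.IH(1) by blast
  obtain Q where Q: "\<And>z. zpoly_eval Q z = v (emb z)" "wop N (\<lambda>f w. weyl lam Q f w - opT N (symb N v) f w)" using add.IH(2) by blast
  have "wop N (\<lambda>f w. weyl lam (P + Q) f w - opT N (symb N (\<lambda>w. u w + v w)) f w)"
    by (rule wop.ext[OF wop.add[OF P(2) Q(2)]]) (simp add: weyl_add symb_add[OF h] opT_add fun_eq_iff)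
  then show ?case by (intro exI[of _ "P + Q"]) (simp add: zpoly_eval_add P(1) Q(1))
next
  case (scale c u)
  then have h: "u \<in> polys" using hom_polys unfolding hom_def by blast
  obtain P where P: "\<And>z. zpoly_eval P z = u (emb z)" "wop N (\<lambda>f w. weyl lam P f w - opT N (symb N u) f w)" using scale.IH by blast
  have "wop N (\<lambda>f w. weyl lam (Poly_Mapping.map ((*) c) P) f w - opT N (symb N (\<lambda>w. c * u w)) f w)"
    by (rule wop.ext[OF wop.scale[OF P(2), of c]]) (simp add: weyl_map symb_scale[OF h] opT_scale fun_eq_iff right_diff_distrib)
  then show ?case by (intro exI[of _ "Poly_Mapping.map ((*) c) P"]) (simp add: zpoly_eval_map P(1))
next
  case (base u)
  then obtain ys where ys: "ys \<in> words N" "u = lmono ys" by auto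
  show ?case unfolding ys(2) by (rule weyl_lmono[OF ys(1)])
qed

end

lemma real_poly_zero:
  fixes c :: "nat \<Rightarrow> complex"
  assumes "\<And>s::real. (\<Sum>e\<le>D. c e * of_real s ^ e) = 0" "e \<le> D"
  shows "c e = 0"
proof (rule ccontr)
  assume "c e \<noteq> 0"
  then have "finite {z. (\<Sum>e\<le>D. c e * z ^ e) = 0}" by (rule polyfun_roots_finite) (rule assms(2))
  moreover have "range complex_of_real \<subseteq> {z. (\<Sum>e\<le>D. c e * z ^ e) = 0}" using assms(1) by auto
  ultimately have "finite (range complex_of_real)" by (rule finite_subset[rotated])
  then have "finite (UNIV :: real set)" by (rule finite_imageD) (simp add: inj_of_real)
  then show False using infinite_UNIV_char_0 by blast
qed

definition rmono :: "(complex^'m::finite) list \<Rightarrow> 'm cfn" where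
  "rmono bs z = prod_list (map (\<lambda>b. of_real (z \<bullet> b)) bs)"

lemma rmono_scale: "rmono bs (s *\<^sub>R z) = of_real s ^ length bs * rmono bs z"
  by (induction bs) (simp_all add: rmono_def)

lemma rmono_cnj: "cnj (rmono bs z) = rmono bs z"
  by (induction bs) (simp_all add: rmono_def)

lemma ells_emb: "ells bs (emb z) = 2 ^ length bs * rmono bs z"
  by (induction bs) (simp_all add: ells_def rmono_def ell_emb)

lemma rpoly_eval_rmono: "rpoly_eval q z = (\<Sum>m\<in>Poly_Mapping.keys q. Poly_Mapping.lookup q m * rmono (mword Basis m) z)"
proof -
  have "prod_list (map f (concat (map (\<lambda>j. replicate (m j) j) js))) = prod_list (map (\<lambda>j. f j ^ m j) js)"
    for f :: "'a cfn" and m js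
    by (induction js) (simp_all add: prod_list_replicate)
  moreover have "prod_list (map g (enum_list (Basis :: (complex^'a) set))) = (\<Prod>b\<in>Basis. g b)" for g :: "'a cfn"
    using enum_list[of "Basis :: (complex^'a) set"] prod.distinct_set_conv_list[of "enum_list Basis" g] by simp
  ultimately show ?thesis by (simp add: rpoly_eval_def rmono_def mword_def)
qed

section \<open>Invariant tensors, invariant polynomials and the Fischer decomposition\<close>

context fockK begin

text \<open>The matrix by which k acts on the letters: the conjugate of k on the \<open>Inl\<close>
  block and k itself on the \<open>Inr\<close> block. It is the same for both signs of
  \<open>lam\<close>, since the conjugation inside \<open>ks\<close> and the exchange of
  \<open>W_op\<close> and \<open>Wbar_op\<close> compensate each other; see
  \<open>op_ks\<close>.\<close>

definition \<kappa> :: "complex^'n^'n \<Rightarrow> 'n + 'n \<Rightarrow> 'n + 'n \<Rightarrow> complex" where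
  "\<kappa> k y x = (case (y, x) of (Inl l, Inl j) \<Rightarrow> cnj (k $ l $ j) | (Inr l, Inr j) \<Rightarrow> k $ l $ j | _ \<Rightarrow> 0)"

lemma \<kappa>_simps [simp]: "\<kappa> k (Inl l) (Inl j) = cnj (k $ l $ j)" "\<kappa> k (Inr l) (Inr j) = k $ l $ j"
  "\<kappa> k (Inl l) (Inr j) = 0" "\<kappa> k (Inr l) (Inl j) = 0"
  by (simp_all add: \<kappa>_def)

lemma unitary_columns:
  assumes "k \<in> K"
  shows "(\<Sum>l\<in>UNIV. cnj (k $ l $ j) * (k *v w) $ l) = w $ j" "(\<Sum>l\<in>UNIV. k $ l $ j * (mat_cnj k *v w) $ l) = w $ j"
proof -
  have gen: "(\<Sum>l\<in>UNIV. cnj (A $ l $ j) * (A *v w) $ l) = w $ j" if "A \<in> unitary_group" for A :: "complex^'n^'n"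
  proof -
    have "transpose (mat_cnj A) *v (A *v w) = w"
      using that by (simp add: matrix_vector_mul_assoc unitary_group_def)
    then have "(transpose (mat_cnj A) *v (A *v w)) $ j = w $ j" by simp
    then show ?thesis by (simp add: matrix_vector_mult_def transpose_def mat_cnj_def)
  qed
  show "(\<Sum>l\<in>UNIV. cnj (k $ l $ j) * (k *v w) $ l) = w $ j" by (rule gen[OF K_unitary[OF assms]])
  show "(\<Sum>l\<in>UNIV. k $ l $ j * (mat_cnj k *v w) $ l) = w $ j"
    using gen[OF unitary_mat_cnj[OF K_unitary[OF assms]]] by (simp add: mat_cnj_def)
qed

lemma op_ks:
  assumes k: "k \<in> K" and u: "u \<in> polys"
  shows "op x (\<lambda>w. u (ks k *v w)) = (\<lambda>w. \<Sum>y\<in>UNIV. \<kappa> k y x * op y u (ks k *v w))"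
proof
  fix w :: "complex^'n"
  have m: "(\<Sum>l\<in>UNIV. c l * (d * (A *v w) $ l * u (A *v w))) = d * (\<Sum>l\<in>UNIV. c l * (A *v w) $ l) * u (A *v w)"
    for c :: "'n \<Rightarrow> complex" and d A
    by (simp add: sum_distrib_left sum_distrib_right mult_ac)
  show "op x (\<lambda>w. u (ks k *v w)) w = (\<Sum>y\<in>UNIV. \<kappa> k y x * op y u (ks k *v w))"
    by (cases x; cases "lam > 0")
       (simp_all add: op_def W_op_def Wbar_op_def ks_def sum_UNIV_Plus hol_deriv_op_matrix[OF u] mult_op_eq m unitary_columns[OF k], simp_all add: mat_cnj_def)
qed

definition inv_tensor :: "nat \<Rightarrow> (('n + 'n) list \<Rightarrow> complex) \<Rightarrow> bool" where
  "inv_tensor N e \<longleftrightarrow> (\<forall>k\<in>K. \<forall>ys\<in>words N. (\<Sum>xs\<in>words N. tensor_power (\<kappa> k) ys xs * e xs) = e ys)"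

text \<open>The change of letters is absorbed by the invariance of the tensor. The same computation
  yields commutation with \<open>U\<close> and invariance under \<open>hact\<close>.\<close>

lemma inv_tensor_contract:
  assumes e: "inv_tensor N e" and k: "k \<in> K"
    and F: "\<And>xs. xs \<in> words N \<Longrightarrow> F xs = (\<Sum>ys\<in>words N. tensor_power (\<kappa> k) ys xs * G ys)"
  shows "(\<Sum>xs\<in>words N. e xs * F xs) = (\<Sum>ys\<in>words N. e ys * G ys)"
proof -
  have "(\<Sum>xs\<in>words N. e xs * F xs) = (\<Sum>xs\<in>words N. \<Sum>ys\<in>words N. tensor_power (\<kappa> k) ys xs * e xs * G ys)"
    by (rule sum.cong) (auto simp: F sum_distrib_left mult_ac)
  also have "\<dots> = (\<Sum>ys\<in>words N. (\<Sum>xs\<in>words N. tensor_power (\<kappa> k) ys xs * e xs) * G ys)"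
    by (subst sum.swap) (simp add: sum_distrib_right)
  also have "\<dots> = (\<Sum>ys\<in>words N. e ys * G ys)"
    by (rule sum.cong) (use e k in \<open>auto simp: inv_tensor_def\<close>)
  finally show ?thesis .
qed

lemma ops_ks:
  assumes k: "k \<in> K" and u: "u \<in> polys"
  shows "foldr op xs (\<lambda>w. u (ks k *v w)) = (\<lambda>w. \<Sum>ys\<in>words (length xs). tensor_power (\<kappa> k) ys xs * foldr op ys u (ks k *v w))"
  by (rule foldr_intertwine[where C=polys and \<Phi>=op and R="\<lambda>u w. u (ks k *v w)", OF polys_subspace lin_on_op op_polys polys_compose_matrix op_ks[OF k] u])

lemma opT_U:
  assumes e: "inv_tensor N e" and k: "k \<in> K" and u: "u \<in> polys"
  shows "opT N e (U k u) = U k (opT N e u)"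
proof
  fix w
  let ?k = "matrix_inv k"
  have k': "?k \<in> K" by (rule K_inv[OF k])
  have Uk: "U k f = (\<lambda>w. f (ks ?k *v w))" for f using U_inv_eq[OF k'] inv_inv[OF k] by simp
  show "opT N e (U k u) w = U k (opT N e u) w"
    unfolding Uk opT_def
    by (rule inv_tensor_contract[OF e k']) (simp add: ops_ks[OF k' u] words_def)
qed

definition Kinv :: "(complex^('n + 'n) \<Rightarrow> complex) \<Rightarrow> bool" where
  "Kinv i \<longleftrightarrow> (\<forall>k\<in>K. \<forall>z. i (emb (k *v z)) = i (emb z))"

lemma tensor_power_transpose: "length xs = length ys \<Longrightarrow> tensor_power (\<lambda>y x. c x y) ys xs = tensor_power c xs ys"
  by (induction xs ys rule: list_induct2) simp_all

text \<open>Invariance of \<open>i\<close> is given on \<open>range emb\<close> only, but it extends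
  to all of the doubled variables because a polynomial is determined by that restriction. The chain
  rule at 0 then turns it into invariance of the tensor of derivatives.\<close>

lemma symb_inv_tensor:
  assumes i: "i \<in> polys" "Kinv i"
  shows "inv_tensor N (symb N i)"
  unfolding inv_tensor_def
proof (intro ballI)
  fix k and ys :: "('n + 'n) list" assume k: "k \<in> K" and ys: "ys \<in> words N"
  \<comment> \<open>\<open>M\<close> is the transpose of \<open>\<kappa> k\<close>, which acts on
    \<open>range emb\<close> as the inverse of k.\<close>
  define M :: "complex^('n + 'n)^('n + 'n)" where "M = (\<chi> x y. \<kappa> k y x)"
  have Memb: "M *v emb z = emb (matrix_inv k *v z)" for z
    unfolding unitary_inv(1)[OF K_unitary[OF k]]
    by (auto simp: vec_eq_iff M_def matrix_vector_mult_def sum_UNIV_Plus transpose_def mat_cnj_def emb_def split: sum.splits)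
  have iM: "(\<lambda>w. i (M *v w)) = i"
  proof -
    have "(\<lambda>w. i (M *v w) - i w) = (\<lambda>w. 0)"
    proof (rule emb_zero_imp_zero)
      show "(\<lambda>w. i (M *v w) - i w) \<in> polys" by (intro polys_diff polys_compose_matrix i)
      show "i (M *v emb z) - i (emb z) = 0" for z
        using i(2) K_inv[OF k] by (simp add: Memb Kinv_def)
    qed
    then show ?thesis by (simp add: fun_eq_iff)
  qed
  have "dd ys (\<lambda>w. i (M *v w)) = (\<lambda>w. \<Sum>xs\<in>words (length ys). tensor_power (\<lambda>y x. M $ y $ x) xs ys * dd xs i (M *v w))"
    by (rule foldr_intertwine[where C=polys and R="\<lambda>u w. u (M *v w)", OF polys_subspace lin_on_hol_deriv_op polys_hol_deriv_op
          polys_compose_matrix hol_deriv_op_matrix i(1)])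
  then have "dd ys i 0 = (\<Sum>xs\<in>words N. tensor_power (\<lambda>y x. M $ y $ x) xs ys * dd xs i 0)"
    using ys unfolding iM by (simp add: words_def)
  also have "\<dots> = (\<Sum>xs\<in>words N. tensor_power (\<kappa> k) ys xs * dd xs i 0)"
  proof (rule sum.cong[OF refl])
    fix xs :: "('n + 'n) list" assume "xs \<in> words N"
    then have "length ys = length xs" using ys by (simp add: words_def)
    from tensor_power_transpose[OF this, of "\<kappa> k"]
    show "tensor_power (\<lambda>y x. M $ y $ x) xs ys * dd xs i 0 = tensor_power (\<kappa> k) ys xs * dd xs i 0"
      by (simp add: M_def)
  qed
  finally show "(\<Sum>xs\<in>words N. tensor_power (\<kappa> k) ys xs * symb N i xs) = symb N i ys"
    by (simp add: symb_def sum_divide_distrib[symmetric])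
qed

text \<open>Harmonicity of a polynomial in the doubled variables, demanded at all points and not
  only on \<open>range emb\<close>; \<open>harm_K_harmonic\<close> restricts it.\<close>

definition harm :: "(complex^('n + 'n) \<Rightarrow> complex) \<Rightarrow> bool" where
  "harm p \<longleftrightarrow> (\<forall>q. (\<forall>k\<in>K. \<forall>z. rpoly_eval q (k *v z) = rpoly_eval q z) \<longrightarrow> rpoly_eval q 0 = 0 \<longrightarrow>
     (\<forall>w. (\<Sum>m\<in>Poly_Mapping.keys q. Poly_Mapping.lookup q m * foldr delta (mword Basis m) p w) = 0))"

lemma harm_K_harmonic:
  assumes "p \<in> polys" "harm p" "\<And>z. zpoly_eval P z = p (emb z)"
  shows "K_harmonic K P"
proof -
  have "zpoly_eval P = (\<lambda>z. p (emb z))" using assms(3) by auto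
  then have "rpoly_op q (zpoly_eval P) z = (\<Sum>m\<in>Poly_Mapping.keys q. Poly_Mapping.lookup q m * foldr delta (mword Basis m) p (emb z))" for q z
    by (simp add: rpoly_op_def partials_def ops_power_mword foldr_dir_deriv_emb[OF assms(1)])
  then show ?thesis using assms(2) unfolding K_harmonic_def harm_def by simp
qed

lemma lin_on_deltas: "lin_on polys (foldr delta bs)"
proof (induction bs)
  case (Cons b bs)
  have "foldr delta bs u \<in> polys" if "u \<in> polys" for u :: "complex^('a + 'a) \<Rightarrow> complex"
    by (rule foldr_closed[of polys]) (auto intro: delta_polys that)
  then show ?case using lin_on_compose[OF Cons.IH _ lin_on_delta[of b]] by (simp add: o_def)
qed (simp add: lin_on_def)

lemma harm_add: "p \<in> polys \<Longrightarrow> q \<in> polys \<Longrightarrow> harm p \<Longrightarrow> harm q \<Longrightarrow> harm (\<lambda>w. p w + q w)"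
  unfolding harm_def by (simp add: lin_onD(1)[OF lin_on_deltas] distrib_left sum.distrib)

lemma harm_scale: "p \<in> polys \<Longrightarrow> harm p \<Longrightarrow> harm (\<lambda>w. c * p w)"
  unfolding harm_def
  by (simp add: lin_onD(2)[OF lin_on_deltas] mult.left_commute[of _ c] sum_distrib_left[symmetric])

text \<open>The part of degree \<open>N\<close> of the ideal generated by the homogeneous invariants
  of positive degree.\<close>

definition invJ :: "nat \<Rightarrow> (complex^('n + 'n) \<Rightarrow> complex) set" where
  "invJ N = cfun.span {\<lambda>w. r w * i w |r i e. 1 \<le> e \<and> e \<le> N \<and> i \<in> hom e \<and> r \<in> hom (N - e) \<and> Kinv i}"

text \<open>Adjointness of multiplication and differentiation: orthogonality to the ideal generated by the
  invariants without constant term means being annihilated by the corresponding operators.\<close>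

lemma orthogonal_invJ_harm:
  assumes h: "h \<in> hom N" and orth: "\<And>v. v \<in> invJ N \<Longrightarrow> fock_inner (1/2) h v = 0"
  shows "harm h"
  unfolding harm_def
proof (intro allI impI)
  fix q :: "(complex^'n \<Rightarrow> nat) \<Rightarrow>\<^sub>0 complex" and w
  assume inv: "\<forall>k\<in>K. \<forall>z. rpoly_eval q (k *v z) = rpoly_eval q z" and q0: "rpoly_eval q 0 = 0"
  define S where "S = Poly_Mapping.keys q"
  define c where "c = Poly_Mapping.lookup q"
  define W where "W = (\<lambda>m. mword (Basis :: (complex^'n) set) m)"
  define D where "D = Max (insert 0 ((\<lambda>m. length (W m)) ` S))"
  have fS: "finite S" by (simp add: S_def)
  have D: "length (W m) \<le> D" if "m \<in> S" for m unfolding D_def using fS that by simp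
  define Se where "Se = (\<lambda>e. {m \<in> S. length (W m) = e})"
  have split: "(\<Sum>m\<in>S. F m) = (\<Sum>e\<le>D. \<Sum>m\<in>Se e. F m)" for F :: "_ \<Rightarrow> complex"
    unfolding Se_def by (subst sum.group[of S "{..D}" "\<lambda>m. length (W m)"]) (use fS D in auto)
  \<comment> \<open>\<open>r e\<close> is the homogeneous component of degree \<open>e\<close> of
    \<open>q\<close>. Scaling \<open>z\<close> by a real number and comparing powers shows that each
    component is invariant.\<close>
  define r where "r = (\<lambda>e z. \<Sum>m\<in>Se e. c m * rmono (W m) z)"
  have ev: "rpoly_eval q (s *\<^sub>R z) = (\<Sum>e\<le>D. r e z * of_real s ^ e)" for s z
  proof -
    have "rpoly_eval q (s *\<^sub>R z) = (\<Sum>e\<le>D. \<Sum>m\<in>Se e. c m * (of_real s ^ length (W m) * rmono (W m) z))"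
      unfolding rpoly_eval_rmono rmono_scale S_def[symmetric] c_def[symmetric] W_def[symmetric] split ..
    also have "\<dots> = (\<Sum>e\<le>D. r e z * of_real s ^ e)"
      unfolding r_def sum_distrib_right by (intro sum.cong refl) (simp add: Se_def mult_ac)
    finally show ?thesis .
  qed
  have rinv: "r e (k *v z) = r e z" if "k \<in> K" "e \<le> D" for k e z
  proof -
    have "(\<Sum>e\<le>D. (r e (k *v z) - r e z) * of_real s ^ e) = 0" for s
    proof -
      have "rpoly_eval q (k *v (s *\<^sub>R z)) = rpoly_eval q (s *\<^sub>R z)" using inv that(1) by blast
      moreover have "k *v (s *\<^sub>R z) = s *\<^sub>R (k *v z)" by (simp add: linear_scale[OF matrix_vector_mul_linear])
      ultimately show ?thesis by (simp add: ev left_diff_distrib sum_subtractf)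
    qed
    from real_poly_zero[OF this that(2)] show ?thesis by simp
  qed
  have r0: "r 0 z = 0" for z
  proof -
    have "(\<Sum>e\<le>D. r e z * 0 ^ e) = (\<Sum>e\<in>{0}. r e z * 0 ^ e)"
      by (rule sum.mono_neutral_right) auto
    then show ?thesis using ev[of 0 z] q0 by simp
  qed
  \<comment> \<open>The conjugated coefficients compensate the conjugate linearity of the inner
    product in its second argument. On \<open>range emb\<close> this is a multiple of the conjugate
    of \<open>r e\<close>, hence invariant as well.\<close>
  define I where "I = (\<lambda>e w. \<Sum>m\<in>Se e. cnj (c m) * ells (W m) w)"
  have Ihom: "I e \<in> hom e" for e
    unfolding I_def by (intro subspace_csum hom_subspace) (use ells_hom in \<open>auto simp: Se_def\<close>)
  have Iemb: "I e (emb z) = 2 ^ e * cnj (r e z)" for e z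
  proof -
    have "I e (emb z) = (\<Sum>m\<in>Se e. cnj (c m) * (2 ^ e * rmono (W m) z))"
      unfolding I_def by (rule sum.cong) (simp_all add: ells_emb Se_def)
    then show ?thesis by (simp add: r_def sum_distrib_left rmono_cnj mult_ac)
  qed
  have Iinv: "Kinv (I e)" if "e \<le> D" for e
    unfolding Kinv_def using rinv that by (simp add: Iemb)
  have I0: "I 0 = (\<lambda>w. 0)"
    using emb_zero_imp_zero[OF hom_polys[OF Ihom], of 0] by (simp add: Iemb r0)
  let ?y = "\<lambda>w. \<Sum>m\<in>S. c m * foldr delta (W m) h w"
  have hp: "h \<in> polys" by (rule hom_polys[OF h])
  have dp: "foldr delta bs h \<in> polys" for bs
    by (rule foldr_closed[of polys]) (auto intro: delta_polys hp)
  have yp: "?y \<in> polys" by (intro polys_sum polys_cmult dp)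
  have yl: "fock_inner (1/2) ?y (lmono xs) = 0" for xs
  proof -
    have ep: "ells bs \<in> polys" for bs :: "(complex^'n) list" by (rule hom_polys[OF ells_hom])
    have lp: "lmono xs \<in> polys" by (rule polys_lmono)
    have "fock_inner (1/2) ?y (lmono xs) = (\<Sum>m\<in>S. c m * fock_inner (1/2) h (\<lambda>w. ells (W m) w * lmono xs w))"
      by (subst F.inn_sum_left) (auto intro: polys_cmult dp lp simp: F.inn_cmult_left inn_deltas[OF hp lp])
    also have "\<dots> = (\<Sum>e\<le>D. \<Sum>m\<in>Se e. c m * fock_inner (1/2) h (\<lambda>w. ells (W m) w * lmono xs w))" by (rule split)
    also have "\<dots> = (\<Sum>e\<le>D. fock_inner (1/2) h (\<lambda>w. I e w * lmono xs w))"
    proof (rule sum.cong[OF refl])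
      fix e
      have "(\<lambda>w. I e w * lmono xs w) = (\<lambda>w. \<Sum>m\<in>Se e. cnj (c m) * (ells (W m) w * lmono xs w))"
        by (simp add: I_def sum_distrib_right mult.assoc)
      then show "(\<Sum>m\<in>Se e. c m * fock_inner (1/2) h (\<lambda>w. ells (W m) w * lmono xs w)) = fock_inner (1/2) h (\<lambda>w. I e w * lmono xs w)"
        by (simp add: F.inn_sum_right[OF polys_cmult[OF polys_mult[OF ep lp]] hp] F.inn_cmult_right)
    qed
    also have "\<dots> = 0"
    proof (rule sum.neutral, rule ballI)
      fix e assume e: "e \<in> {..D}"
      show "fock_inner (1/2) h (\<lambda>w. I e w * lmono xs w) = 0"
      proof (cases "e = 0")
        case True
        then show ?thesis by (simp add: I0)
      next
        case False
        have lh: "lmono xs \<in> hom (length xs)" by (rule lmono_hom) (simp add: words_def)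
        show ?thesis
        proof (cases "e + length xs = N")
          case True
          then have "length xs = N - e" "1 \<le> e" "e \<le> N" using False by auto
          then have "\<exists>r i e'. (\<lambda>w. I e w * lmono xs w) = (\<lambda>w. r w * i w) \<and> 1 \<le> e' \<and> e' \<le> N \<and> i \<in> hom e' \<and> r \<in> hom (N - e') \<and> Kinv i"
            using Ihom[of e] Iinv[of e] e lh by (intro exI[of _ "lmono xs"] exI[of _ "I e"] exI[of _ e]) (simp add: mult.commute)
          then have "(\<lambda>w. I e w * lmono xs w) \<in> invJ N" unfolding invJ_def by (intro cfun.span_base) simp
          then show ?thesis by (rule orth)
        next
          case False
          then show ?thesis using hom_orth[OF h hom_mult[OF Ihom lh]] by metis
        qed
      qed
    qed
    finally show ?thesis .
  qed
  have "?y = (\<lambda>w. 0)" by (rule inn_lmono_zero[OF yp yl])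
  then show "(\<Sum>m\<in>Poly_Mapping.keys q. Poly_Mapping.lookup q m * foldr delta (mword Basis m) h w) = 0"
    unfolding S_def c_def W_def by (rule fun_cong)
qed

lemma fischer_decomposition:
  assumes p: "p \<in> hom N"
  shows "\<exists>h j. h \<in> hom N \<and> harm h \<and> j \<in> invJ N \<and> j \<in> hom N \<and> p = (\<lambda>w. h w + j w)"
proof -
  have sub: "invJ N \<subseteq> hom N" unfolding invJ_def
  proof (rule cfun.span_minimal[OF _ hom_subspace], rule subsetI)
    fix f assume "f \<in> {\<lambda>w. r w * i w |r i e. 1 \<le> e \<and> e \<le> N \<and> i \<in> hom e \<and> r \<in> hom (N - e) \<and> Kinv i}"
    then obtain r i e where "f = (\<lambda>w. r w * i w)" "e \<le> N" "i \<in> hom e" "r \<in> hom (N - e)" by auto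
    then show "f \<in> hom N" using hom_mult[of r "N - e" i e] by simp
  qed
  have "\<exists>B. F.onb B \<and> cfun.span B = invJ N"
    by (rule F.subspace_onb[of _ "lmono ` words N"]) (use sub in \<open>auto simp: invJ_def hom_def polys_lmono\<close>)
  then obtain B where B: "F.onb B" "cfun.span B = invJ N" by blast
  have pp: "p \<in> polys" by (rule hom_polys[OF p])
  let ?j = "F.proj B p"
  have j: "?j \<in> invJ N" using F.proj_span B(2) by blast
  then have jh: "?j \<in> hom N" using sub by blast
  have "harm (\<lambda>w. p w - ?j w)"
    by (rule orthogonal_invJ_harm[OF subspace_cdiff[OF hom_subspace p jh]]) (use F.inn_diff_proj[OF B(1) pp] B(2) in simp)
  moreover have "p = (\<lambda>w. (p w - ?j w) + ?j w)" by simp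
  ultimately show ?thesis using j jh subspace_cdiff[OF hom_subspace p jh] by blast
qed

end

section \<open>Operators on one isotypic component as quantized harmonic polynomials\<close>

context mult_free begin

lemma opT_scalar: "inv_tensor N e \<Longrightarrow> \<beta> \<in> \<Lambda> \<Longrightarrow> \<exists>c. \<forall>u\<in>V \<beta>. opT N e u = (\<lambda>w. c * u w)"
  by (rule commuting_scalar) (use wop_lin[OF wop_opT] opT_U in auto)

text \<open>For the product of \<open>r\<close> with an invariant \<open>i\<close> of degree
  \<open>e\<close>, quantization is multiplicative up to order below \<open>N\<close>. The factor
  from \<open>i\<close> is a scalar on \<open>V \<alpha>\<close>, and the factor from
  \<open>r\<close> has order \<open>N - e\<close>, which is below \<open>N\<close> because
  \<open>e\<close> is positive.\<close>

lemma invJ_lower: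
  assumes a: "\<alpha> \<in> \<Lambda>" and j: "j \<in> invJ N"
  shows "j \<in> polys \<and> (\<exists>C. wop N C \<and> (\<forall>u\<in>V \<alpha>. opT N (symb N j) u = C u))"
  using j unfolding invJ_def
proof (induction rule: span_induct_fun)
  case zero
  then show ?case by (intro conjI polys.const exI[of _ "\<lambda>u w. 0"]) (auto intro: wop.zero simp: symb_zero opT_zero)
next
  case (add p q)
  then obtain C D where CD: "wop N C" "\<And>u. u \<in> V \<alpha> \<Longrightarrow> opT N (symb N p) u = C u" "wop N D" "\<And>u. u \<in> V \<alpha> \<Longrightarrow> opT N (symb N q) u = D u"
    and pq: "p \<in> polys" "q \<in> polys" by blast
  have "opT N (symb N (\<lambda>w. p w + q w)) u = (\<lambda>w. C u w + D u w)" if "u \<in> V \<alpha>" for u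
    using CD(2,4)[OF that] by (simp add: symb_add[OF pq] opT_add[abs_def] fun_eq_iff)
  then show ?case using wop.add[OF CD(1,3)] polys.add[OF pq] by blast
next
  case (scale c p)
  then obtain C where C: "wop N C" "\<And>u. u \<in> V \<alpha> \<Longrightarrow> opT N (symb N p) u = C u" and p: "p \<in> polys" by blast
  have "opT N (symb N (\<lambda>w. c * p w)) u = (\<lambda>w. c * C u w)" if "u \<in> V \<alpha>" for u
    using C(2)[OF that] by (simp add: symb_scale[OF p] opT_scale[abs_def] fun_eq_iff)
  then show ?case using wop.scale[OF C(1)] polys_cmult[OF p] by blast
next
  case (base f)
  then obtain r i e where f: "f = (\<lambda>w. r w * i w)" and e: "1 \<le> e" "e \<le> N" and i: "i \<in> hom e" "Kinv i" and r: "r \<in> hom (N - e)" by auto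
  obtain c where c: "\<And>u. u \<in> V \<alpha> \<Longrightarrow> opT e (symb e i) u = (\<lambda>w. c * u w)"
    using opT_scalar[OF symb_inv_tensor[OF hom_polys[OF i(1)] i(2)] a] by blast
  define D where "D = (\<lambda>(u :: 'n cfn) w. opT N (symb N f) u w - opT (N - e) (symb (N - e) r) (opT e (symb e i) u) w)"
  have D: "wop N D"
    using opT_symb_mult[OF r i(1)] e unfolding D_def f by simp
  have R: "wop N (\<lambda>u w. c * opT (N - e) (symb (N - e) r) u w)"
    by (intro wop.scale wop_mono[OF wop_opT]) (use e in simp)
  have "opT N (symb N f) u = (\<lambda>w. D u w + c * opT (N - e) (symb (N - e) r) u w)" if u: "u \<in> V \<alpha>" for u
  proof -
    have up: "u \<in> polys" using u V_polys[OF a] by (rule subsetD[rotated])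
    have "lin_on polys (opT (N - e) (symb (N - e) r))" using wop_lin[OF wop_opT] by (rule conjunct1)
    from lin_onD(2)[OF this up, of c] show ?thesis unfolding D_def c[OF u] by simp
  qed
  moreover have "f \<in> polys" unfolding f by (intro polys_mult hom_polys[OF r] hom_polys[OF i(1)])
  ultimately show ?case using wop.add[OF D R] by blast
qed

text \<open>The polynomial \<open>p\<close> is carried along with \<open>P\<close>, because
  harmonicity of sums and multiples is established for \<open>p\<close>.\<close>

definition weyl_harm :: "'i \<Rightarrow> 'n pop \<Rightarrow> bool" where
  "weyl_harm \<alpha> A \<longleftrightarrow> (\<exists>P p. p \<in> polys \<and> harm p \<and> (\<forall>z. zpoly_eval P z = p (emb z)) \<and> (\<forall>u\<in>V \<alpha>. weyl lam P u = A u))"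

lemma weyl_harm_add: "weyl_harm \<alpha> A \<Longrightarrow> weyl_harm \<alpha> B \<Longrightarrow> weyl_harm \<alpha> (\<lambda>u w. A u w + B u w)"
proof -
  assume "weyl_harm \<alpha> A" "weyl_harm \<alpha> B"
  then obtain P p Q q where P: "p \<in> polys" "harm p" "\<And>z. zpoly_eval P z = p (emb z)" "\<And>u. u \<in> V \<alpha> \<Longrightarrow> weyl lam P u = A u"
    and Q: "q \<in> polys" "harm q" "\<And>z. zpoly_eval Q z = q (emb z)" "\<And>u. u \<in> V \<alpha> \<Longrightarrow> weyl lam Q u = B u"
    unfolding weyl_harm_def by blast
  have "weyl lam (P + Q) u = (\<lambda>w. A u w + B u w)" if "u \<in> V \<alpha>" for u
    using P(4)[OF that] Q(4)[OF that] by (simp add: weyl_add fun_eq_iff)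
  then show ?thesis unfolding weyl_harm_def
    by (intro exI[of _ "P + Q"] exI[of _ "\<lambda>w. p w + q w"]) (simp add: zpoly_eval_add P(1-3) Q(1-3) harm_add polys.add)
qed

lemma weyl_harm_scale: "weyl_harm \<alpha> A \<Longrightarrow> weyl_harm \<alpha> (\<lambda>u w. c * A u w)"
proof -
  assume "weyl_harm \<alpha> A"
  then obtain P p where P: "p \<in> polys" "harm p" "\<And>z. zpoly_eval P z = p (emb z)" "\<And>u. u \<in> V \<alpha> \<Longrightarrow> weyl lam P u = A u"
    unfolding weyl_harm_def by blast
  have "weyl lam (Poly_Mapping.map ((*) c) P) u = (\<lambda>w. c * A u w)" if "u \<in> V \<alpha>" for u
    using P(4)[OF that] by (simp add: weyl_map fun_eq_iff)
  then show ?thesis unfolding weyl_harm_def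
    by (intro exI[of _ "Poly_Mapping.map ((*) c) P"] exI[of _ "\<lambda>w. c * p w"]) (simp add: zpoly_eval_map P(1-3) harm_scale polys_cmult)
qed

lemma weyl_harm_cong: "weyl_harm \<alpha> A \<Longrightarrow> (\<And>u. u \<in> V \<alpha> \<Longrightarrow> A u = B u) \<Longrightarrow> weyl_harm \<alpha> B"
  unfolding weyl_harm_def by metis

lemma weyl_harm_zero: "weyl_harm \<alpha> (\<lambda>u w. 0)"
proof -
  have "harm (\<lambda>w. 0)"
    unfolding harm_def by (simp add: lin_on_zero[OF lin_on_deltas polys_subspace])
  then show ?thesis unfolding weyl_harm_def
    by (intro exI[of _ 0] exI[of _ "\<lambda>w. 0"]) (simp add: zpoly_eval_alt weyl_alt[abs_def] polys.const)
qed

theorem wop_weyl_harm: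
  assumes a: "\<alpha> \<in> \<Lambda>"
  shows "wop N A \<Longrightarrow> weyl_harm \<alpha> A"
proof (induction N arbitrary: A)
  case 0
  show ?case
  proof (rule weyl_harm_cong[OF weyl_harm_zero])
    fix u assume "u \<in> V \<alpha>"
    then have "u \<in> polys" using V_polys[OF a] by (rule subsetD[rotated])
    from wop_zero_iff[OF 0 this] show "(\<lambda>w. 0) = A u" by simp
  qed
next
  case (Suc N)
  from Suc.prems show ?case
  proof (induction rule: wop.induct)
    case (word xs)
    show ?case
    proof (cases "length xs < N")
      case True
      show ?thesis by (rule Suc.IH[OF wop.word[OF True]])
    next
      case False
      then have xs: "xs \<in> words N" using word by (simp add: words_def)
      obtain h j where hj: "h \<in> hom N" "harm h" "j \<in> invJ N" "j \<in> hom N" "lmono xs = (\<lambda>w. h w + j w)"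
        using fischer_decomposition[OF lmono_hom[OF xs]] by metis
      obtain C where C: "wop N C" "\<And>u. u \<in> V \<alpha> \<Longrightarrow> opT N (symb N j) u = C u"
        using invJ_lower[OF a hj(3)] by blast
      obtain P where P: "\<And>z. zpoly_eval P z = h (emb z)" "wop N (\<lambda>u w. weyl lam P u w - opT N (symb N h) u w)"
        using weyl_quantization[OF hj(1)] by blast
      have w0: "weyl_harm \<alpha> (weyl lam P)"
        unfolding weyl_harm_def by (intro exI[of _ P] exI[of _ h]) (simp add: hom_polys[OF hj(1)] hj(2) P(1))
      \<comment> \<open>Three corrections of order below \<open>N\<close> are collected: the ideal
        part acting on \<open>V \<alpha>\<close>, the symmetrisation of the word, and the ordering
        in the Weyl correspondence.\<close>
      have w1: "weyl_harm \<alpha> (\<lambda>u w. C u w - (opT N (symb N (lmono xs)) u w - foldr op xs u w) - (weyl lam P u w - opT N (symb N h) u w))"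
        by (intro Suc.IH wop_diff C(1) opT_symb_lmono[OF xs] P(2))
      show ?thesis
      proof (rule weyl_harm_cong[OF weyl_harm_add[OF w0 w1]])
        fix u assume u: "u \<in> V \<alpha>"
        have "opT N (symb N (lmono xs)) u w = opT N (symb N h) u w + C u w" for w
          unfolding hj(5) symb_add[OF hom_polys[OF hj(1)] hom_polys[OF hj(4)]] opT_add C(2)[OF u] ..
        then show "(\<lambda>w. weyl lam P u w + (C u w - (opT N (symb N (lmono xs)) u w - foldr op xs u w) - (weyl lam P u w - opT N (symb N h) u w))) = foldr op xs u"
          by (simp add: fun_eq_iff)
      qed
    qed
  next
    case (ext A B)
    show ?case by (rule weyl_harm_cong[OF ext.IH]) (use ext.hyps(2) V_polys[OF a] in auto)
  qed (auto intro: weyl_harm_zero weyl_harm_add weyl_harm_scale)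
qed

end

section \<open>Matrix coefficients of the Fock representation\<close>

lemma smooth_rpoly_gauss: "p \<in> rpolys \<Longrightarrow> smooth (\<lambda>z. exp (of_real (- c * (norm z)\<^sup>2)) * p z)"
proof -
  assume p: "p \<in> rpolys"
  have "(\<lambda>z::'a. of_real (- c) * of_real ((norm z)\<^sup>2)) \<in> rpolys"
    by (intro rpolys_mult rpolys.const rpolys_norm2)
  then have "(\<lambda>z::'a. of_real (- c * (norm z)\<^sup>2)) \<in> rpolys" by simp
  then show ?thesis by (intro smooth_mult smooth_exp rpolys_smooth p)
qed

lemma dir_deriv_rpoly_gauss:
  assumes "p \<in> rpolys"
  shows "dir_deriv b (\<lambda>z. exp (of_real (- c * (norm z)\<^sup>2)) * p z) z =
    exp (of_real (- c * (norm z)\<^sup>2)) * (dir_deriv b p z - of_real (2 * c * (z \<bullet> b)) * p z)"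
proof (rule dir_deriv_eqI)
  have "((\<lambda>z. - c * (norm z)\<^sup>2) has_derivative (\<lambda>b. - (2 * c * (z \<bullet> b)))) (at z)"
    unfolding power2_norm_eq_inner by (auto intro!: derivative_eq_intros simp: inner_commute)
  from has_derivative_mult[OF has_derivative_cexp[OF has_derivative_of_real[OF this]] smooth_has_derivative[OF rpolys_smooth[OF assms], of z]]
  show "((\<lambda>z. exp (of_real (- c * (norm z)\<^sup>2)) * p z) has_derivative
     (\<lambda>b. exp (of_real (- c * (norm z)\<^sup>2)) * (dir_deriv b p z - of_real (2 * c * (z \<bullet> b)) * p z))) (at z)"
    by (rule has_derivative_eq_rhs) (simp add: algebra_simps fun_eq_iff)
qed

lemma rpolys_compose_linear: "p \<in> rpolys \<Longrightarrow> linear A \<Longrightarrow> (\<lambda>z. p (A z)) \<in> rpolys"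
proof (induction rule: rpolys.induct)
  case (coord p y)
  have "(\<lambda>z. of_real (z \<bullet> adjoint A y) * p (A z)) \<in> rpolys" by (intro rpolys.coord coord.IH coord.prems)
  then show ?case using adjoint_works[OF coord.prems] by (simp add: inner_commute)
qed (auto intro: rpolys.intros)

text \<open>With this sign in the case \<open>Inr\<close>, the complexified left invariant vector fields act on the matrix
  coefficients of the Fock representation through \<open>W_op\<close> (\<open>Inl\<close>) and \<open>Wbar_op\<close> (\<open>Inr\<close>), for either sign of \<open>lam\<close>.\<close>

definition letter :: "'m + 'm \<Rightarrow> 'm::finite cfn \<Rightarrow> complex" where
  "letter x X = (case x of Inl j \<Rightarrow> 1/2 * (X (axis j 1) + \<i> * X (axis j \<i>))
     | Inr j \<Rightarrow> - (1/2) * (X (axis j 1) - \<i> * X (axis j \<i>)))"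

lemma letter_eq:
  obtains c d j where "\<And>X. letter x X = c * X (axis j 1) + d * X (axis j \<i>)"
proof (cases x)
  case (Inl j)
  show ?thesis by (rule that[of "1/2" j "\<i>/2"]) (simp add: Inl letter_def algebra_simps)
next
  case (Inr j)
  show ?thesis by (rule that[of "-1/2" j "\<i>/2"]) (simp add: Inr letter_def algebra_simps)
qed

context fock begin

definition bvec :: "complex^'m::finite \<Rightarrow> complex^'m" where
  "bvec a = (\<chi> j. - (2 * \<nu> * cnj (a $ j)))"

text \<open>The matrix coefficient stripped of its Gaussian factor; it is a polynomial in
  \<open>a\<close> and its conjugate by \<open>ncoef_rpolys\<close>.\<close>

definition ncoef :: "'m::finite cfn \<Rightarrow> 'm cfn \<Rightarrow> 'm cfn" where
  "ncoef u v a = inn (\<lambda>w. E (bvec a) w * u (w + a)) v"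

definition mcoef :: "'m::finite cfn \<Rightarrow> 'm cfn \<Rightarrow> 'm cfn" where
  "mcoef u v a = exp (of_real (- \<nu> * (norm a)\<^sup>2)) * ncoef u v a"

lemma ncoef_add_left: "u \<in> polys \<Longrightarrow> u' \<in> polys \<Longrightarrow> v \<in> polys \<Longrightarrow> ncoef (\<lambda>w. u w + u' w) v a = ncoef u v a + ncoef u' v a"
  unfolding ncoef_def by (intro inn_E_add_left polys_compose_shift)

lemma ncoef_add_right: "u \<in> polys \<Longrightarrow> v \<in> polys \<Longrightarrow> v' \<in> polys \<Longrightarrow> ncoef u (\<lambda>w. v w + v' w) a = ncoef u v a + ncoef u v' a"
  unfolding ncoef_def by (intro inn_E_add_right polys_compose_shift)

lemma ncoef_scale_left: "ncoef (\<lambda>w. c * u w) v a = c * ncoef u v a"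
  unfolding ncoef_def by (simp only: inn_cmult_left[symmetric] mult.left_commute)

lemma ncoef_scale_right: "ncoef u (\<lambda>w. c * v w) a = cnj c * ncoef u v a"
  unfolding ncoef_def by (rule inn_cmult_right)

lemma ncoef_0 [simp]: "ncoef (\<lambda>w. 0) v a = 0" "ncoef u (\<lambda>w. 0) a = 0"
  by (simp_all add: ncoef_def)

lemma ncoef_sum_left: "(\<And>i. i \<in> S \<Longrightarrow> u i \<in> polys) \<Longrightarrow> v \<in> polys \<Longrightarrow> ncoef (\<lambda>w. \<Sum>i\<in>S. u i w) v a = (\<Sum>i\<in>S. ncoef (u i) v a)"
  by (induction S rule: infinite_finite_induct) (auto simp: ncoef_add_left polys_sum)

lemma ncoef_sum_right: "(\<And>i. i \<in> S \<Longrightarrow> v i \<in> polys) \<Longrightarrow> u \<in> polys \<Longrightarrow> ncoef u (\<lambda>w. \<Sum>i\<in>S. v i w) a = (\<Sum>i\<in>S. ncoef u (v i) a)"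
  by (induction S rule: infinite_finite_induct) (auto simp: ncoef_add_right polys_sum)

text \<open>The adjoint of multiplication by \<open>w $ j\<close> brings down
  \<open>bvec a $ j\<close>, which is \<open>- 2 * \<nu> * cnj (a $ j)\<close>. Repeating this
  evaluates the conjugate of \<open>v\<close> at \<open>- a\<close>.\<close>

lemma ncoef_one: "v \<in> polys \<Longrightarrow> ncoef (\<lambda>w. 1) (v :: 'm::finite cfn) a = c0 TYPE('m) * cnj (v (- a))"
proof (induction rule: polys.induct)
  case (const c)
  show ?case using inn_cmult_right[of "E (bvec a)" c "\<lambda>w. 1"] by (simp add: ncoef_def inn_E_one)
next
  case (add p q)
  then show ?case using ncoef_add_right[OF polys.const[of 1] add.hyps] by (simp add: algebra_simps)
next
  case (coord p j)
  have "inn (\<lambda>w. E (bvec a) w * (bvec a $ j)) p = 2 * \<nu> * inn (\<lambda>w. E (bvec a) w) (\<lambda>w. w $ j * p w)"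
    using inn_E_adjoint(2)[OF polys.const[of 1] coord.hyps, of "bvec a" j] by simp
  moreover have "inn (\<lambda>w. E (bvec a) w * (bvec a $ j)) p = bvec a $ j * inn (E (bvec a)) p"
    by (simp only: mult.commute[of "E _ _"] inn_cmult_left)
  ultimately have "2 * complex_of_real \<nu> * inn (\<lambda>w. E (bvec a) w) (\<lambda>w. w $ j * p w) = 2 * complex_of_real \<nu> * (- cnj (a $ j) * inn (E (bvec a)) p)"
    by (simp add: bvec_def)
  moreover have "2 * complex_of_real \<nu> \<noteq> 0" using \<nu>_pos by simp
  ultimately have "inn (\<lambda>w. E (bvec a) w) (\<lambda>w. w $ j * p w) = - cnj (a $ j) * inn (E (bvec a)) p"
    using mult_left_cancel by blast
  then show ?case using coord.IH by (simp add: ncoef_def)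
qed

lemma ncoef_coord_left:
  assumes "u \<in> polys" "v \<in> polys"
  shows "ncoef (\<lambda>w. w $ j * u w) v a = a $ j * ncoef u v a + ncoef u (hol_deriv_op j v) a / (2 * \<nu>)"
proof -
  let ?u = "\<lambda>w. u (w + a)"
  have u: "?u \<in> polys" by (rule polys_compose_shift[OF assms(1)])
  have "ncoef (\<lambda>w. w $ j * u w) v a = inn (\<lambda>w. E (bvec a) w * (a $ j * ?u w + w $ j * ?u w)) v"
    unfolding ncoef_def by (simp add: algebra_simps)
  also have "\<dots> = inn (\<lambda>w. E (bvec a) w * (a $ j * ?u w)) v + inn (\<lambda>w. E (bvec a) w * (w $ j * ?u w)) v"
    by (rule inn_E_add_left[OF polys_cmult[OF u] polys.coord[OF u] assms(2)])
  also have "inn (\<lambda>w. E (bvec a) w * (a $ j * ?u w)) v = a $ j * ncoef u v a"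
    unfolding ncoef_def by (simp only: mult.left_commute[of _ "a $ j"] inn_cmult_left)
  also have "inn (\<lambda>w. E (bvec a) w * (w $ j * ?u w)) v = ncoef u (hol_deriv_op j v) a / (2 * \<nu>)"
    using inn_E_adjoint(1)[OF u assms(2), of "bvec a" j] \<nu>_pos by (simp add: ncoef_def field_simps)
  finally show ?thesis .
qed

lemma ncoef_coord_right:
  assumes "u \<in> polys" "v \<in> polys"
  shows "ncoef u (\<lambda>w. w $ j * v w) a = - cnj (a $ j) * ncoef u v a + ncoef (hol_deriv_op j u) v a / (2 * \<nu>)"
proof -
  let ?u = "\<lambda>w. u (w + a)"
  have u: "?u \<in> polys" by (rule polys_compose_shift[OF assms(1)])
  have "2 * \<nu> * ncoef u (\<lambda>w. w $ j * v w) a = inn (\<lambda>w. E (bvec a) w * (bvec a $ j * ?u w + hol_deriv_op j ?u w)) v"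
    unfolding ncoef_def by (rule inn_E_adjoint(2)[OF u assms(2), symmetric])
  also have "\<dots> = inn (\<lambda>w. E (bvec a) w * (bvec a $ j * ?u w)) v + inn (\<lambda>w. E (bvec a) w * (hol_deriv_op j ?u w)) v"
    by (rule inn_E_add_left[OF polys_cmult[OF u] polys_hol_deriv_op[OF u] assms(2)])
  also have "inn (\<lambda>w. E (bvec a) w * (bvec a $ j * ?u w)) v = bvec a $ j * ncoef u v a"
    unfolding ncoef_def by (simp only: mult.left_commute[of _ "bvec a $ j"] inn_cmult_left)
  also have "inn (\<lambda>w. E (bvec a) w * (hol_deriv_op j ?u w)) v = ncoef (hol_deriv_op j u) v a"
    unfolding ncoef_def hol_deriv_op_shift[OF assms(1)] ..
  finally have "2 * \<nu> * ncoef u (\<lambda>w. w $ j * v w) a = 2 * \<nu> * (- cnj (a $ j) * ncoef u v a) + ncoef (hol_deriv_op j u) v a"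
    by (simp add: bvec_def)
  moreover have "complex_of_real \<nu> \<noteq> 0" using \<nu>_pos by simp
  ultimately show ?thesis by (simp add: field_simps)
qed

lemma ncoef_rpolys: "u \<in> polys \<Longrightarrow> v \<in> polys \<Longrightarrow> ncoef u v \<in> rpolys"
proof (induction arbitrary: v rule: polys.induct)
  case (const c)
  have "(\<lambda>a. v (- a)) \<in> rpolys"
    by (rule rpolys_compose_linear[OF polys_rpolys[OF const]]) (simp add: linear_iff)
  then have "(\<lambda>a. c * (c0 TYPE('a) * cnj (v (- a)))) \<in> rpolys"
    by (intro rpolys_mult rpolys.const rpolys_cnj)
  moreover have "ncoef (\<lambda>w. c) v = (\<lambda>a. c * (c0 TYPE('a) * cnj (v (- a))))"
    using ncoef_scale_left[of c "\<lambda>w. 1" v] ncoef_one[OF const] by (simp add: fun_eq_iff)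
  ultimately show ?case by simp
next
  case (add p q)
  have "ncoef (\<lambda>w. p w + q w) v = (\<lambda>a. ncoef p v a + ncoef q v a)"
    by (rule HOL.ext) (rule ncoef_add_left[OF add.hyps add.prems])
  then show ?case using rpolys.add[OF add.IH(1)[OF add.prems] add.IH(2)[OF add.prems]] by simp
next
  case (coord p j)
  have "(\<lambda>a. a $ j * ncoef p v a + (1 / (2 * \<nu>)) * ncoef p (hol_deriv_op j v) a) \<in> rpolys"
    using coord.prems by (intro rpolys.add rpolys_mult rpolys.const rpolys_nth coord.IH polys_hol_deriv_op)
  moreover have "ncoef (\<lambda>w. w $ j * p w) v = (\<lambda>a. a $ j * ncoef p v a + (1 / (2 * \<nu>)) * ncoef p (hol_deriv_op j v) a)"
    by (rule HOL.ext) (simp add: ncoef_coord_left[OF coord.hyps coord.prems])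
  ultimately show ?case by simp
qed

definition Dh :: "complex^'m::finite \<Rightarrow> 'm cfn \<Rightarrow> 'm cfn" where
  "Dh b u = (\<lambda>w. \<Sum>j\<in>UNIV. b $ j * hol_deriv_op j u w)"

lemma Dh_polys: "u \<in> polys \<Longrightarrow> Dh b u \<in> polys"
  unfolding Dh_def by (intro polys_sum polys_cmult polys_hol_deriv_op)

lemma Dh_add: "u \<in> polys \<Longrightarrow> v \<in> polys \<Longrightarrow> Dh b (\<lambda>w. u w + v w) = (\<lambda>w. Dh b u w + Dh b v w)"
  by (simp add: Dh_def hol_deriv_op_add distrib_left sum.distrib)

lemma Dh_coord: "u \<in> polys \<Longrightarrow> Dh b (\<lambda>w. w $ j * u w) = (\<lambda>w. b $ j * u w + w $ j * Dh b u w)"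
  by (simp only: Dh_def hol_deriv_op_coord)
     (simp add: distrib_left sum.distrib sum_distrib_left mult_ac if_distrib[of "\<lambda>x. _ * x"] cong: if_cong)

lemma hol_deriv_Dh: "u \<in> polys \<Longrightarrow> hol_deriv_op j (Dh b u) = Dh b (hol_deriv_op j u)"
  unfolding Dh_def by (subst hol_deriv_op_sum)
    (auto intro: polys_cmult polys_hol_deriv_op simp: hol_deriv_op_cmult polys_hol_deriv_op hol_deriv_op_commute[of u j])

lemma dir_deriv_nth: "dir_deriv b (\<lambda>a::complex^'m::finite. a $ j) a = b $ j"
  by (rule dir_deriv_eqI, rule bounded_linear_imp_has_derivative, rule bounded_linear_vec_nth)

text \<open>\<open>ncoef_coord_left\<close> reduces a coordinate factor of \<open>u\<close> to
  multiplication by \<open>a $ j\<close> and a derivative of \<open>v\<close>; for constant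
  \<open>u\<close> the coefficient is explicit by \<open>ncoef_one\<close>.\<close>

lemma dir_deriv_ncoef: "u \<in> polys \<Longrightarrow> v \<in> polys \<Longrightarrow> dir_deriv b (ncoef u v) a = ncoef (Dh b u) v a - ncoef u (Dh b v) a"
proof (induction arbitrary: v rule: polys.induct)
  case (const c)
  have e: "ncoef (\<lambda>w. c) v = (\<lambda>a. c * (c0 TYPE('a) * cnj (v (- a))))" if "v \<in> polys" for v :: "'a cfn"
    using ncoef_scale_left[of c "\<lambda>w. 1" v] ncoef_one[OF that] by (simp add: fun_eq_iff)
  have "((\<lambda>a. v (- a)) has_derivative (\<lambda>b. Dh (- b) v (- a))) (at a)"
  proof -
    have "((\<lambda>a::complex^'a. - a) has_derivative (\<lambda>b. - b)) (at a)" by (auto intro!: derivative_eq_intros)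
    from has_derivative_compose[OF this has_derivative_polys[OF const, of "- a"]] show ?thesis by (simp only: Dh_def)
  qed
  then have "((\<lambda>a. c * (c0 TYPE('a) * cnj (v (- a)))) has_derivative (\<lambda>b. c * (c0 TYPE('a) * cnj (Dh (- b) v (- a))))) (at a)"
    by (intro has_derivative_mult_right has_derivative_cnj)
  then have "dir_deriv b (ncoef (\<lambda>w. c) v) a = c * (c0 TYPE('a) * cnj (Dh (- b) v (- a)))"
    unfolding e[OF const] by (rule dir_deriv_eqI)
  also have "\<dots> = - (c * (c0 TYPE('a) * cnj (Dh b v (- a))))"
    by (simp add: Dh_def sum_negf)
  finally show ?case by (simp add: e[OF Dh_polys[OF const]]) (simp add: Dh_def)
next
  case (add p q)
  have e: "ncoef (\<lambda>w. p w + q w) v = (\<lambda>a. ncoef p v a + ncoef q v a)" if "v \<in> polys" for v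
    by (rule HOL.ext) (rule ncoef_add_left[OF add.hyps that])
  have "dir_deriv b (ncoef (\<lambda>w. p w + q w) v) a = dir_deriv b (ncoef p v) a + dir_deriv b (ncoef q v) a"
    unfolding e[OF add.prems] by (intro dir_deriv_add smooth_differentiable rpolys_smooth ncoef_rpolys add.hyps add.prems)
  then show ?case
    unfolding add.IH(1)[OF add.prems] add.IH(2)[OF add.prems] Dh_add[OF add.hyps] e[OF Dh_polys[OF add.prems]]
      ncoef_add_left[OF Dh_polys[OF add.hyps(1)] Dh_polys[OF add.hyps(2)] add.prems] by simp
next
  case (coord p j)
  let ?k = "1 / (2 * of_real \<nu>) :: complex"
  note p = coord.hyps and v = coord.prems
  note dv = polys_hol_deriv_op[OF v, of j]
  have e: "ncoef (\<lambda>w. w $ j * q w) v = (\<lambda>a. a $ j * ncoef q v a + ?k * ncoef q (hol_deriv_op j v) a)"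
    if "q \<in> polys" "v \<in> polys" for q v :: "'a cfn"
    by (rule HOL.ext) (simp add: ncoef_coord_left[OF that])
  note df = smooth_differentiable[OF rpolys_smooth[OF ncoef_rpolys]]
  have dn: "(\<lambda>a::complex^'a. a $ j) differentiable (at a)" by (rule smooth_differentiable[OF rpolys_smooth[OF rpolys_nth(1)]])
  have "dir_deriv b (ncoef (\<lambda>w. w $ j * p w) v) a =
      (b $ j * ncoef p v a + a $ j * dir_deriv b (ncoef p v) a) + ?k * dir_deriv b (ncoef p (hol_deriv_op j v)) a"
    unfolding e[OF p v]
    by (subst dir_deriv_add, intro differentiable_mult dn df p v, intro differentiable_mult differentiable_const df p dv)
       (simp only: dir_deriv_mult[OF dn df[OF p v]] dir_deriv_cmult[OF df[OF p dv]] dir_deriv_nth)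
  also have "\<dots> = b $ j * ncoef p v a + (a $ j * ncoef (Dh b p) v a + ?k * ncoef (Dh b p) (hol_deriv_op j v) a) -
      (a $ j * ncoef p (Dh b v) a + ?k * ncoef p (Dh b (hol_deriv_op j v)) a)"
    unfolding coord.IH[OF v] coord.IH[OF dv] by (simp add: algebra_simps)
  also have "\<dots> = ncoef (Dh b (\<lambda>w. w $ j * p w)) v a - ncoef (\<lambda>w. w $ j * p w) (Dh b v) a"
    unfolding Dh_coord[OF p] ncoef_add_left[OF polys_cmult[OF p] polys.coord[OF Dh_polys[OF p]] v] ncoef_scale_left
      e[OF Dh_polys[OF p] v] e[OF p Dh_polys[OF v]] hol_deriv_Dh[OF v] ..
  finally show ?case .
qed

text \<open>The infinitesimal representation in direction \<open>b\<close>, namely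
  \<open>Dh b\<close> minus its adjoint.\<close>

definition Xh :: "complex^'m::finite \<Rightarrow> 'm cfn \<Rightarrow> 'm cfn" where
  "Xh b u = (\<lambda>w. Dh b u w + (\<Sum>j\<in>UNIV. (- (2 * \<nu> * cnj (b $ j))) * (w $ j * u w)))"

lemma Xh_polys: "u \<in> polys \<Longrightarrow> Xh b u \<in> polys"
  unfolding Xh_def by (intro polys.add Dh_polys polys_sum polys_cmult polys.coord)

lemma dir_deriv_mcoef:
  assumes u: "u \<in> polys" and v: "v \<in> polys"
  shows "dir_deriv b (mcoef u v) a = mcoef (Xh b u) v a + 2 * \<i> * \<nu> * Im (cdot a (vec_cnj b)) * mcoef u v a"
proof -
  have X: "ncoef (Xh b u) v a = ncoef (Dh b u) v a + (\<Sum>j\<in>UNIV. (- (2 * \<nu> * cnj (b $ j))) * ncoef (\<lambda>w. w $ j * u w) v a)"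
    by (simp only: Xh_def ncoef_add_left[OF Dh_polys[OF u] polys_sum[OF polys_cmult[OF polys.coord[OF u]]] v]
        ncoef_sum_left[OF polys_cmult[OF polys.coord[OF u]] v] ncoef_scale_left)
  have "ncoef u (Dh b v) a = (\<Sum>j\<in>UNIV. cnj (b $ j) * ncoef u (hol_deriv_op j v) a)"
    unfolding Dh_def by (subst ncoef_sum_right) (auto intro: polys_cmult polys_hol_deriv_op u v simp: ncoef_scale_right)
  also have "\<dots> = (\<Sum>j\<in>UNIV. 2 * \<nu> * cnj (b $ j) * (ncoef (\<lambda>w. w $ j * u w) v a - a $ j * ncoef u v a))"
    using \<nu>_pos by (intro sum.cong refl) (simp only: ncoef_coord_left[OF u v], simp)
  also have "\<dots> = - (\<Sum>j\<in>UNIV. (- (2 * \<nu> * cnj (b $ j))) * ncoef (\<lambda>w. w $ j * u w) v a) - 2 * \<nu> * cdot a (vec_cnj b) * ncoef u v a"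
    by (simp add: right_diff_distrib sum_subtractf sum_negf cdot_def vec_cnj_def sum_distrib_left sum_distrib_right mult_ac)
  finally have D: "ncoef u (Dh b v) a = - (\<Sum>j\<in>UNIV. (- (2 * \<nu> * cnj (b $ j))) * ncoef (\<lambda>w. w $ j * u w) v a) - 2 * \<nu> * cdot a (vec_cnj b) * ncoef u v a" .
  have re: "Re (cdot a (vec_cnj b)) = a \<bullet> b"
    by (simp add: cdot_def vec_cnj_def inner_vec_def inner_complex_def)
  \<comment> \<open>The real part cancels against the derivative of the Gaussian; the imaginary part
    is left as the central term.\<close>
  have c: "cdot a (vec_cnj b) = of_real (a \<bullet> b) + \<i> * Im (cdot a (vec_cnj b))"
    unfolding re[symmetric] by (simp add: complex_eq_iff)
  have "dir_deriv b (ncoef u v) a - of_real (2 * \<nu> * (a \<bullet> b)) * ncoef u v a =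
      ncoef (Xh b u) v a + 2 * \<i> * \<nu> * Im (cdot a (vec_cnj b)) * ncoef u v a"
    unfolding dir_deriv_ncoef[OF u v] D X by (subst c) (simp add: algebra_simps)
  then show ?thesis
    unfolding mcoef_def[abs_def] dir_deriv_rpoly_gauss[OF ncoef_rpolys[OF u v]] by (simp add: algebra_simps)
qed

text \<open>Both cases of \<open>fock_rep\<close> become
  \<open>exp (\<i> * lam * t) * exp (- \<nu> * (norm a)\<^sup>2) * E (bvec a) w * u (w + a)\<close> with \<open>a = av z\<close>.\<close>

definition av :: "complex^'m::finite \<Rightarrow> complex^'m" where
  "av z = (if lam > 0 then vec_cnj z else - z)"

lemma linear_av: "linear av"
  by (rule linearI) (auto simp: av_def vec_cnj_def vec_eq_iff)

lemma norm_vec_cnj: "norm (vec_cnj z) = norm z"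
  by (simp add: norm_vec_def vec_cnj_def)

lemma norm_av [simp]: "norm (av z) = norm z"
  by (simp add: av_def norm_vec_cnj)

definition mc :: "'m::finite cfn \<Rightarrow> 'm cfn \<Rightarrow> 'm cfn" where
  "mc u v z = mcoef u v (av z)"

lemma mc_smooth: "u \<in> polys \<Longrightarrow> v \<in> polys \<Longrightarrow> smooth (mc u v)"
proof -
  assume "u \<in> polys" "v \<in> polys"
  then have "smooth (mcoef u v)" unfolding mcoef_def[abs_def] by (intro smooth_rpoly_gauss ncoef_rpolys)
  from smooth_affine[OF this linear_av, of 0] show ?thesis by (simp add: mc_def[abs_def])
qed

text \<open>Left invariant vector fields acting on functions \<open>exp (\<i> * lam * t) * g z\<close>.\<close>

definition tw :: "complex^'m::finite \<Rightarrow> 'm cfn \<Rightarrow> 'm cfn" where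
  "tw b g z = dir_deriv b g z + 2 * \<i> * of_real (lam * Im (cdot z (vec_cnj b))) * g z"

lemma tw_mc:
  assumes u: "u \<in> polys" and v: "v \<in> polys"
  shows "tw b (mc u v) z = mc (Xh (av b) u) v z"
proof -
  have s: "smooth (mcoef u v)" unfolding mcoef_def[abs_def] by (intro smooth_rpoly_gauss ncoef_rpolys u v)
  have "dir_deriv b (mc u v) z = dir_deriv (av b) (mcoef u v) (av z)"
    using dir_deriv_affine[where A=av and x=z and c=0 and b=b and f="mcoef u v", OF smooth_differentiable[OF s] linear_av]
    by (simp add: mc_def[abs_def])
  \<comment> \<open>For positive \<open>lam\<close> the conjugation in \<open>av\<close> flips the
    imaginary part, and for negative \<open>lam\<close> the number \<open>lam\<close> is
    \<open>- \<nu>\<close>. Either way the central term of \<open>tw\<close> cancels the one in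
    \<open>dir_deriv_mcoef\<close>.\<close>
  moreover have "lam * Im (cdot z (vec_cnj b)) = - \<nu> * Im (cdot (av z) (vec_cnj (av b)))"
    by (auto simp: av_def \<nu>_def cdot_def vec_cnj_def sum_negf[symmetric] sum_distrib_left algebra_simps intro!: sum.cong)
  ultimately show ?thesis unfolding tw_def dir_deriv_mcoef[OF u v] mc_def by simp
qed

definition ltw :: "'m + 'm \<Rightarrow> 'm::finite cfn \<Rightarrow> 'm cfn" where
  "ltw x g z = letter x (\<lambda>b. tw b g z)"

lemma Xh_axis: "Xh (axis j c) u w = c * hol_deriv_op j u w - 2 * \<nu> * cnj c * (w $ j * u w)"
proof -
  have "(\<Sum>i\<in>UNIV. (- (2 * \<nu> * cnj (axis j c $ i))) * (w $ i * u w)) = (\<Sum>i\<in>UNIV. cnj (axis j c $ i) * (- (2 * \<nu>) * (w $ i * u w)))"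
    by (simp add: mult_ac)
  then show ?thesis by (simp only: Xh_def Dh_def sum_axis) simp
qed

lemma av_axis: "av (axis j c) = axis j (if lam > 0 then cnj c else - c)"
  by (auto simp: av_def vec_cnj_def axis_def vec_eq_iff)

lemma mc_linear: "u \<in> polys \<Longrightarrow> u' \<in> polys \<Longrightarrow> v \<in> polys \<Longrightarrow> c * mc u v z + d * mc u' v z = mc (\<lambda>w. c * u w + d * u' w) v z"
  unfolding mc_def mcoef_def by (subst ncoef_add_left) (auto intro: polys_cmult simp: ncoef_scale_left algebra_simps)

lemma ltw_mc:
  assumes u: "u \<in> polys" and v: "v \<in> polys"
  shows "ltw x (mc u v) z = mc (op x u) v z"
proof -
  have X: "Xh b u \<in> polys" for b by (rule Xh_polys[OF u])
  show ?thesis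
  proof (cases x)
    case (Inl j)
    have "ltw x (mc u v) z = 1/2 * mc (Xh (av (axis j 1)) u) v z + (\<i>/2) * mc (Xh (av (axis j \<i>)) u) v z"
      unfolding Inl ltw_def letter_def by (simp add: tw_mc[OF u v])
    also have "\<dots> = mc (\<lambda>w. 1/2 * Xh (av (axis j 1)) u w + (\<i>/2) * Xh (av (axis j \<i>)) u w) v z" by (rule mc_linear[OF X X v])
    also have "(\<lambda>w. 1/2 * Xh (av (axis j 1)) u w + (\<i>/2) * Xh (av (axis j \<i>)) u w) = op x u"
      unfolding av_axis Inl by (cases "lam > 0") (simp_all add: Xh_axis op_def W_op_def mult_op_eq fun_eq_iff algebra_simps)
    finally show ?thesis .
  next
    case (Inr j)
    have "ltw x (mc u v) z = (-1/2) * mc (Xh (av (axis j 1)) u) v z + (\<i>/2) * mc (Xh (av (axis j \<i>)) u) v z"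
      unfolding Inr ltw_def letter_def by (simp add: tw_mc[OF u v] algebra_simps)
    also have "\<dots> = mc (\<lambda>w. (-1/2) * Xh (av (axis j 1)) u w + (\<i>/2) * Xh (av (axis j \<i>)) u w) v z" by (rule mc_linear[OF X X v])
    also have "(\<lambda>w. (-1/2) * Xh (av (axis j 1)) u w + (\<i>/2) * Xh (av (axis j \<i>)) u w) = op x u"
      unfolding av_axis Inr by (cases "lam > 0") (simp_all add: Xh_axis op_def Wbar_op_def mult_op_eq fun_eq_iff algebra_simps)
    finally show ?thesis .
  qed
qed

lemma ltws_mc:
  assumes u: "u \<in> polys" and v: "v \<in> polys"
  shows "foldr ltw xs (mc u v) = mc (foldr op xs u) v"
  by (induction xs) (simp_all add: ltw_mc[OF ops_polys[OF u] v] fun_eq_iff, simp add: fun_eq_iff[symmetric], simp add: ltw_mc[OF ops_polys[OF u] v])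

lemma rpolys_tw_factor: "(\<lambda>z::complex^'m::finite. 2 * \<i> * complex_of_real (lam * Im (cdot z (vec_cnj b)))) \<in> rpolys"
proof -
  have c: "(\<lambda>z::complex^'m. cdot z (vec_cnj b)) \<in> rpolys"
    unfolding cdot_def by (intro rpolys_sum rpolys_mult rpolys_nth rpolys.const)
  have "(\<lambda>z::complex^'m. of_real lam * (cdot z (vec_cnj b) + (-1) * cnj (cdot z (vec_cnj b)))) \<in> rpolys"
    by (intro rpolys_mult rpolys.const rpolys.add rpolys_cnj c)
  moreover have "of_real lam * (c + (-1) * cnj c) = 2 * \<i> * complex_of_real (lam * Im c)" for c
    by (simp add: complex_eq_iff)
  ultimately show ?thesis by (simp only:)
qed

lemma tw_smooth: "smooth g \<Longrightarrow> smooth (tw b g)"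
  unfolding tw_def[abs_def] by (intro smooth_add smooth_mult smooth_dir_deriv rpolys_smooth[OF rpolys_tw_factor])

lemma ltw_smooth: "smooth g \<Longrightarrow> smooth (ltw x g)"
proof -
  assume "smooth g"
  then have t: "smooth (tw b g)" for b by (rule tw_smooth)
  obtain c d j where "\<And>X. letter x X = c * X (axis j 1) + d * X (axis j \<i>)" by (rule letter_eq[of x]) (rule that)
  then show ?thesis unfolding ltw_def[abs_def] by (simp only:) (intro smooth_add smooth_mult smooth_const t)
qed

lemma ltws_smooth: "smooth g \<Longrightarrow> smooth (foldr ltw xs g)"
  by (induction xs) (auto intro: ltw_smooth)

section \<open>Integration by parts with a cutoff\<close>

text \<open>The transpose of \<open>tw b\<close> for the bilinear pairing by integration, without
  conjugation.\<close>

definition ttw :: "complex^'m::finite \<Rightarrow> 'm cfn \<Rightarrow> 'm cfn" where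
  "ttw b f z = - dir_deriv b f z + 2 * \<i> * of_real (lam * Im (cdot z (vec_cnj b))) * f z"

definition tltw :: "'m + 'm \<Rightarrow> 'm::finite cfn \<Rightarrow> 'm cfn" where
  "tltw x f z = letter x (\<lambda>b. ttw b f z)"

definition phi :: "'m::finite cfn \<Rightarrow> 'm cfn \<Rightarrow> 'm cfn" where
  "phi u v z = cnj (mc u v z)"

text \<open>On conjugated coefficients \<open>ttw b\<close> is minus the conjugate of
  \<open>tw b\<close>. With the sign in the \<open>Inr\<close> case of \<open>letter\<close> this
  exchanges the two kinds of letters, which is passage to the adjoint.\<close>

lemma tltw_phi:
  assumes u: "u \<in> polys" and v: "v \<in> polys"
  shows "tltw x (phi u v) = phi (op (swap x) u) v"
proof
  fix z
  have d: "dir_deriv b (phi u v) z = cnj (dir_deriv b (mc u v) z)" for b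
    unfolding phi_def[abs_def] by (rule dir_deriv_eqI, rule has_derivative_cnj, rule smooth_has_derivative, rule mc_smooth[OF u v])
  have t: "ttw b (phi u v) z = - cnj (tw b (mc u v) z)" for b
    unfolding ttw_def tw_def d by (simp add: phi_def)
  have "tltw x (phi u v) z = cnj (ltw (swap x) (mc u v) z)"
    by (cases x) (simp_all add: tltw_def ltw_def letter_def t algebra_simps)
  then show "tltw x (phi u v) z = phi (op (swap x) u) v z"
    by (simp add: ltw_mc[OF u v] phi_def)
qed

text \<open>Test functions that contain the conjugated coefficients and are stable under derivatives
  and polynomial factors, so that integration by parts can be repeated.\<close>

definition gauss_polys :: "'m::finite cfn set" where
  "gauss_polys = {\<lambda>z. exp (of_real (- \<nu> * (norm z)\<^sup>2)) * p z |p. p \<in> rpolys}"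

lemma phi_gauss_polys: "u \<in> polys \<Longrightarrow> v \<in> polys \<Longrightarrow> phi u v \<in> gauss_polys"
proof -
  assume uv: "u \<in> polys" "v \<in> polys"
  have "(\<lambda>z. cnj (ncoef u v (av z))) \<in> rpolys"
    by (rule rpolys_compose_linear[OF rpolys_cnj[OF ncoef_rpolys[OF uv]] linear_av])
  moreover have "phi u v = (\<lambda>z. exp (of_real (- \<nu> * (norm z)\<^sup>2)) * cnj (ncoef u v (av z)))"
    by (rule HOL.ext) (simp add: phi_def mc_def mcoef_def exp_cnj)
  ultimately show ?thesis unfolding gauss_polys_def by (intro CollectI exI conjI)
qed

lemma gauss_polys_subspace: "cfun.subspace gauss_polys"
proof (rule subspaceI_fun)
  show "(\<lambda>w. 0) \<in> gauss_polys" unfolding gauss_polys_def by (rule CollectI, rule exI[of _ "\<lambda>w. 0"]) (simp add: rpolys.const)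
  fix u v :: "'a cfn" and c assume uv: "u \<in> gauss_polys"
  then obtain p where p: "p \<in> rpolys" "u = (\<lambda>z. exp (of_real (- \<nu> * (norm z)\<^sup>2)) * p z)" by (auto simp: gauss_polys_def)
  show "(\<lambda>w. c * u w) \<in> gauss_polys" unfolding gauss_polys_def p(2)
    by (rule CollectI, rule exI[of _ "\<lambda>z. c * p z"]) (simp add: rpolys_mult[OF rpolys.const] p(1) algebra_simps)
  assume "v \<in> gauss_polys"
  then obtain q where q: "q \<in> rpolys" "v = (\<lambda>z. exp (of_real (- \<nu> * (norm z)\<^sup>2)) * q z)" by (auto simp: gauss_polys_def)
  show "(\<lambda>w. u w + v w) \<in> gauss_polys" unfolding gauss_polys_def p(2) q(2)
    by (rule CollectI, rule exI[of _ "\<lambda>z. p z + q z"]) (simp add: rpolys.add p(1) q(1) algebra_simps)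
qed

lemma gauss_polys_mult: "f \<in> gauss_polys \<Longrightarrow> q \<in> rpolys \<Longrightarrow> (\<lambda>z. q z * f z) \<in> gauss_polys"
proof -
  assume "f \<in> gauss_polys" and q: "q \<in> rpolys"
  then obtain p where p: "p \<in> rpolys" "f = (\<lambda>z. exp (of_real (- \<nu> * (norm z)\<^sup>2)) * p z)" by (auto simp: gauss_polys_def)
  show ?thesis unfolding gauss_polys_def p(2)
    by (rule CollectI, rule exI[of _ "\<lambda>z. q z * p z"]) (simp add: rpolys_mult p(1) q algebra_simps)
qed

lemma gauss_polys_smooth: "f \<in> gauss_polys \<Longrightarrow> smooth f"
  unfolding gauss_polys_def by (elim CollectE exE conjE) (simp only: smooth_rpoly_gauss)

lemma gauss_polys_dir_deriv: "f \<in> gauss_polys \<Longrightarrow> dir_deriv b f \<in> gauss_polys"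
proof -
  assume "f \<in> gauss_polys"
  then obtain p where p: "p \<in> rpolys" "f = (\<lambda>z. exp (of_real (- \<nu> * (norm z)\<^sup>2)) * p z)" by (auto simp: gauss_polys_def)
  have "(\<lambda>z. dir_deriv b p z + (- of_real (2 * \<nu>)) * (of_real (z \<bullet> b) * p z)) \<in> rpolys"
    by (intro rpolys.add rpolys_dir_deriv rpolys_mult rpolys.const rpolys_inner p(1))
  moreover have "dir_deriv b f = (\<lambda>z. exp (of_real (- \<nu> * (norm z)\<^sup>2)) * (dir_deriv b p z + (- of_real (2 * \<nu>)) * (of_real (z \<bullet> b) * p z)))"
    unfolding p(2) by (rule HOL.ext, subst dir_deriv_rpoly_gauss[OF p(1)]) (simp add: algebra_simps)
  ultimately show ?thesis unfolding gauss_polys_def by (intro CollectI exI conjI)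
qed

lemma ttw_gauss_polys: "f \<in> gauss_polys \<Longrightarrow> ttw b f \<in> gauss_polys"
proof -
  assume f: "f \<in> gauss_polys"
  have "(\<lambda>z. (-1) * dir_deriv b f z + 2 * \<i> * of_real (lam * Im (cdot z (vec_cnj b))) * f z) \<in> gauss_polys"
    by (intro subspace_cadd subspace_cscale gauss_polys_subspace gauss_polys_dir_deriv gauss_polys_mult rpolys_tw_factor f)
  then show ?thesis by (simp add: ttw_def[abs_def])
qed

lemma tltw_gauss_polys: "f \<in> gauss_polys \<Longrightarrow> tltw x f \<in> gauss_polys"
proof -
  assume "f \<in> gauss_polys"
  then have t: "ttw b f \<in> gauss_polys" for b by (rule ttw_gauss_polys)
  obtain c d j where "\<And>X. letter x X = c * X (axis j 1) + d * X (axis j \<i>)" by (rule letter_eq[of x]) (rule that)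
  then show ?thesis unfolding tltw_def[abs_def] by (simp only:) (intro subspace_cadd subspace_cscale gauss_polys_subspace t)
qed

end

text \<open>At 0 the difference quotient is bounded by \<open>\<bar>h\<bar> ^ (M - 1)\<close>, which
  tends to 0 because \<open>M \<ge> 2\<close>.\<close>

lemma max_power_derivative:
  assumes "M \<ge> 2"
  shows "((\<lambda>y::real. max 0 y ^ M) has_real_derivative of_nat M * max 0 y ^ (M - 1)) (at y)"
proof -
  consider "y > 0" | "y < 0" | "y = 0" by linarith
  then show ?thesis
  proof cases
    case 1
    have "((\<lambda>y::real. y ^ M) has_real_derivative of_nat M * y ^ (M - 1)) (at y)"
      by (auto intro!: derivative_eq_intros)
    then have "((\<lambda>y::real. max 0 y ^ M) has_real_derivative of_nat M * y ^ (M - 1)) (at y)"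
      by (rule has_field_derivative_transform_within_open[of _ _ _ "{0<..}"]) (use 1 in auto)
    then show ?thesis using 1 by simp
  next
    case 2
    have "((\<lambda>y::real. 0) has_real_derivative 0) (at y)" by simp
    then have "((\<lambda>y::real. max 0 y ^ M) has_real_derivative 0) (at y)"
      by (rule has_field_derivative_transform_within_open[of _ _ _ "{..<0}"]) (use 2 assms in auto)
    moreover have "max 0 y = 0" "(0::real) ^ (M - 1) = 0" using 2 assms by (simp_all add: zero_power)
    ultimately show ?thesis by (simp only: mult_zero_right)
  next
    case 3
    have "(\<lambda>h::real. (max 0 (0 + h) ^ M - max 0 0 ^ M) / h) \<midarrow>0\<rightarrow> 0"
    proof (rule Lim_null_comparison)
      have "norm ((max 0 (0 + h) ^ M - max 0 0 ^ M) / h) \<le> \<bar>h\<bar> ^ (M - 1)" for h :: real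
      proof (cases "h > 0")
        case True
        then show ?thesis using assms by (cases M) (auto simp: max_def zero_power)
      next
        case False
        then show ?thesis using assms by (auto simp: max_def zero_power)
      qed
      then show "\<forall>\<^sub>F h::real in at 0. norm ((max 0 (0 + h) ^ M - max 0 0 ^ M) / h) \<le> \<bar>h\<bar> ^ (M - 1)"
        by (intro always_eventually allI)
      have "((\<lambda>h::real. \<bar>h\<bar> ^ (M - 1)) \<longlongrightarrow> \<bar>0\<bar> ^ (M - 1)) (at 0)" by (intro tendsto_intros)
      then show "((\<lambda>h::real. \<bar>h\<bar> ^ (M - 1)) \<longlongrightarrow> 0) (at 0)" using assms by (simp add: zero_power)
    qed
    then have "((\<lambda>y::real. max 0 y ^ M) has_real_derivative 0) (at 0)"
      by (simp add: DERIV_def)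
    then show ?thesis using 3 assms by (simp add: zero_power)
  qed
qed

text \<open>Powers of this function serve as cutoffs. For \<open>M \<ge> 2\<close> the power is
  differentiable, and its derivative lowers the exponent by one and produces the factor
  \<open>s\<close>, which tends to 0 as the cutoff spreads out.\<close>

definition chi :: "real \<Rightarrow> 'a::euclidean_space \<Rightarrow> real" where
  "chi s z = max 0 (1 - s * (norm z)\<^sup>2)"

abbreviation cut_int :: "real \<Rightarrow> nat \<Rightarrow> ('a::euclidean_space \<Rightarrow> complex) \<Rightarrow> complex" where
  "cut_int s M h \<equiv> \<integral>z. h z * of_real (chi s z ^ M) \<partial>lborel"

lemma chi_bounds: "0 \<le> chi s z" "s \<ge> 0 \<Longrightarrow> chi s z \<le> 1"
  by (auto simp: chi_def)

lemma chi_power_bounds: "s \<ge> 0 \<Longrightarrow> chi s z ^ M \<le> 1" "0 \<le> chi s z ^ M"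
  by (rule power_le_one[OF chi_bounds(1) chi_bounds(2)], assumption) (rule zero_le_power[OF chi_bounds(1)])

lemma continuous_chi: "continuous_on S (\<lambda>z. chi s z)"
  unfolding chi_def by (intro continuous_intros)

lemma chi_power_derivative:
  assumes "M \<ge> 2"
  shows "((\<lambda>z. complex_of_real (chi s z ^ M)) has_derivative
     (\<lambda>b. of_real (chi s z ^ (M - 1)) * (- of_real (s * (2 * of_nat M * (z \<bullet> b)))))) (at z)"
proof -
  have "((\<lambda>z. 1 - s * (norm z)\<^sup>2) has_derivative (\<lambda>b. - (s * (2 * (z \<bullet> b))))) (at z)"
    unfolding power2_norm_eq_inner by (auto intro!: derivative_eq_intros simp: inner_commute)
  from has_derivative_of_real[OF has_derivative_compose[OF this max_power_derivative[OF assms, unfolded has_field_derivative_def]]]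
  show ?thesis unfolding chi_def by (rule has_derivative_eq_rhs) (simp add: fun_eq_iff)
qed

lemma integrable_cutoff:
  fixes h :: "'a::euclidean_space \<Rightarrow> complex"
  assumes h: "continuous_on UNIV h" and s: "s > 0" and M: "M \<ge> 1"
  shows "integrable lborel (\<lambda>z. h z * of_real (chi s z ^ M))"
proof -
  let ?R = "cball (0::'a) (sqrt (1 / s))"
  let ?f = "\<lambda>z. h z * of_real (chi s z ^ M)"
  have "integrable lborel (\<lambda>z. indicator ?R z *\<^sub>R ?f z)"
    by (intro borel_integrable_compact compact_cball continuous_intros continuous_chi continuous_on_subset[OF h]) auto
  moreover have "indicator ?R z *\<^sub>R ?f z = ?f z" for z
  proof (cases "z \<in> ?R")
    case False
    then have "norm z > sqrt (1 / s)" by simp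
    then have "(norm z)\<^sup>2 > (sqrt (1 / s))\<^sup>2" using s by (intro power_strict_mono) auto
    then have "s * (norm z)\<^sup>2 > 1" using s by (simp add: field_simps)
    then have "chi s z = 0" by (simp add: chi_def)
    then show ?thesis using M by (simp add: zero_power)
  qed simp
  ultimately show ?thesis by simp
qed

lemma ibp_cutoff:
  fixes G f :: "'a::euclidean_space \<Rightarrow> complex"
  assumes G: "smooth G" and f: "smooth f" and M: "M \<ge> 2" and s: "s > 0"
  shows "cut_int s M (\<lambda>z. dir_deriv b G z * f z) =
    - cut_int s M (\<lambda>z. G z * dir_deriv b f z) +
    of_real s * cut_int s (M - 1) (\<lambda>z. G z * (of_real (2 * of_nat M * (z \<bullet> b)) * f z))"
proof -
  note cG = smooth_continuous[OF G] and cf = smooth_continuous[OF f]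
    and cdG = smooth_continuous[OF smooth_dir_deriv[OF G]] and cdf = smooth_continuous[OF smooth_dir_deriv[OF f]]
  let ?c = "\<lambda>z. complex_of_real (chi s z ^ M)"
  have cM: "continuous_on UNIV (\<lambda>z. complex_of_real (chi s z ^ k))" for k
    by (intro continuous_intros continuous_chi)
  have i1: "integrable lborel (\<lambda>z. dir_deriv b G z * f z * ?c z)"
    by (intro integrable_cutoff continuous_on_mult cdG cf s) (use M in simp)
  have i2: "integrable lborel (\<lambda>z. G z * dir_deriv b f z * ?c z)"
    by (intro integrable_cutoff continuous_on_mult cG cdf s) (use M in simp)
  have i3: "integrable lborel (\<lambda>z. G z * (of_real (2 * of_nat M * (z \<bullet> b)) * f z) * of_real (chi s z ^ (M - 1)))"
    by (intro integrable_cutoff continuous_on_mult cG cf s continuous_intros) (use M in simp)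
  have i3': "integrable lborel (\<lambda>z. of_real s * (G z * (of_real (2 * of_nat M * (z \<bullet> b)) * f z) * of_real (chi s z ^ (M - 1))))"
    by (intro integrable_mult_right i3)
  let ?D = "\<lambda>z b. dir_deriv b G z * f z * ?c z + G z * dir_deriv b f z * ?c z -
      of_real s * (G z * (of_real (2 * of_nat M * (z \<bullet> b)) * f z) * of_real (chi s z ^ (M - 1)))"
  have "(\<integral>z. ?D z b \<partial>lborel) = 0"
  proof (rule integral_dir_deriv_zero[where h="\<lambda>z. G z * f z * ?c z" and D="?D"])
    fix z
    from has_derivative_mult[OF has_derivative_mult[OF smooth_has_derivative[OF G] smooth_has_derivative[OF f]] chi_power_derivative[OF M]]
    show "((\<lambda>z. G z * f z * ?c z) has_derivative ?D z) (at z)"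
      by (rule has_derivative_eq_rhs) (simp add: fun_eq_iff algebra_simps)
  next
    show "continuous_on UNIV (\<lambda>z. ?D z b)"
      by (intro continuous_on_add continuous_on_diff continuous_on_mult cG cf cdG cdf cM continuous_intros)
    show "integrable lborel (\<lambda>z. G z * f z * ?c z)"
      by (intro integrable_cutoff continuous_on_mult cG cf s) (use M in simp)
    show "integrable lborel (\<lambda>z. ?D z b)"
      by (intro Bochner_Integration.integrable_add Bochner_Integration.integrable_diff i1 i2 i3')
  qed
  moreover have "(\<integral>z. ?D z b \<partial>lborel) = (\<integral>z. dir_deriv b G z * f z * ?c z \<partial>lborel) + (\<integral>z. G z * dir_deriv b f z * ?c z \<partial>lborel) -
      of_real s * cut_int s (M - 1) (\<lambda>z. G z * (of_real (2 * of_nat M * (z \<bullet> b)) * f z))"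
    by (simp only: Bochner_Integration.integral_diff[OF Bochner_Integration.integrable_add[OF i1 i2] i3']
        Bochner_Integration.integral_add[OF i1 i2] integral_mult_right_zero)
  ultimately show ?thesis by (simp add: algebra_simps)
qed

context fock begin

lemma ibp_tw:
  fixes G f :: "'m::finite cfn"
  assumes G: "smooth G" and f: "smooth f" and M: "M \<ge> 2" and s: "s > 0"
  shows "cut_int s M (\<lambda>z. tw b G z * f z) =
    cut_int s M (\<lambda>z. G z * ttw b f z) +
    of_real s * cut_int s (M - 1) (\<lambda>z. G z * (of_real (2 * of_nat M * (z \<bullet> b)) * f z))"
proof -
  note cG = smooth_continuous[OF G] and cf = smooth_continuous[OF f]
    and cdG = smooth_continuous[OF smooth_dir_deriv[OF G]] and cdf = smooth_continuous[OF smooth_dir_deriv[OF f]]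
  let ?c = "\<lambda>z. complex_of_real (chi s z ^ M)"
  let ?l = "\<lambda>z. 2 * \<i> * complex_of_real (lam * Im (cdot z (vec_cnj b)))"
  have cl: "continuous_on UNIV ?l" by (rule smooth_continuous[OF rpolys_smooth[OF rpolys_tw_factor]])
  have i1: "integrable lborel (\<lambda>z. dir_deriv b G z * f z * ?c z)"
    by (intro integrable_cutoff continuous_on_mult cdG cf s) (use M in simp)
  have i2: "integrable lborel (\<lambda>z. G z * dir_deriv b f z * ?c z)"
    by (intro integrable_cutoff continuous_on_mult cG cdf s) (use M in simp)
  have i3: "integrable lborel (\<lambda>z. ?l z * G z * f z * ?c z)"
    by (intro integrable_cutoff continuous_on_mult cG cf cl s) (use M in simp)
  have "(\<integral>z. tw b G z * f z * ?c z \<partial>lborel) = (\<integral>z. dir_deriv b G z * f z * ?c z + ?l z * G z * f z * ?c z \<partial>lborel)"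
    by (simp only: tw_def distrib_right)
  also have "\<dots> = (\<integral>z. dir_deriv b G z * f z * ?c z \<partial>lborel) + (\<integral>z. ?l z * G z * f z * ?c z \<partial>lborel)"
    by (rule Bochner_Integration.integral_add[OF i1 i3])
  finally have L: "(\<integral>z. tw b G z * f z * ?c z \<partial>lborel) = (\<integral>z. dir_deriv b G z * f z * ?c z \<partial>lborel) + (\<integral>z. ?l z * G z * f z * ?c z \<partial>lborel)" .
  have "(\<integral>z. G z * ttw b f z * ?c z \<partial>lborel) = (\<integral>z. ?l z * G z * f z * ?c z - G z * dir_deriv b f z * ?c z \<partial>lborel)"
    by (rule Bochner_Integration.integral_cong[OF refl]) (simp add: ttw_def algebra_simps)
  also have "\<dots> = (\<integral>z. ?l z * G z * f z * ?c z \<partial>lborel) - (\<integral>z. G z * dir_deriv b f z * ?c z \<partial>lborel)"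
    by (rule Bochner_Integration.integral_diff[OF i3 i2])
  finally have R: "(\<integral>z. G z * ttw b f z * ?c z \<partial>lborel) = (\<integral>z. ?l z * G z * f z * ?c z \<partial>lborel) - (\<integral>z. G z * dir_deriv b f z * ?c z \<partial>lborel)" .
  show ?thesis unfolding L R ibp_cutoff[OF G f M s] by simp
qed

text \<open>The function \<open>g\<close> in the error term is chosen before \<open>G\<close> and
  \<open>s\<close>, so it stays fixed when \<open>s\<close> tends to 0.\<close>

lemma ibp_ltw:
  fixes f :: "'m::finite cfn"
  assumes f: "f \<in> gauss_polys" and M: "M \<ge> 2"
  shows "\<exists>g\<in>gauss_polys. \<forall>G s. smooth G \<longrightarrow> s > 0 \<longrightarrow>
    cut_int s M (\<lambda>z. ltw x G z * f z) =
    cut_int s M (\<lambda>z. G z * tltw x f z) +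
    of_real s * cut_int s (M - 1) (\<lambda>z. G z * g z)"
proof -
  obtain c d j where l: "\<And>X. letter x X = c * X (axis j 1) + d * X (axis j \<i>)" by (rule letter_eq[of x]) (rule that)
  then have x: "\<And>G z. ltw x G z = c * tw (axis j 1) G z + d * tw (axis j \<i>) G z"
    "\<And>f z. tltw x f z = c * ttw (axis j 1) f z + d * ttw (axis j \<i>) f z" by (simp_all only: ltw_def tltw_def)
  define m where "m = (\<lambda>b z. complex_of_real (2 * of_nat M * (z \<bullet> b)) * f z)"
  have mQ: "m b \<in> gauss_polys" for b
  proof -
    have "(\<lambda>z::complex^'m. of_real (2 * of_nat M) * of_real (z \<bullet> b)) \<in> rpolys" by (intro rpolys_mult rpolys.const rpolys_inner)
    then have "(\<lambda>z::complex^'m. complex_of_real (2 * of_nat M * (z \<bullet> b))) \<in> rpolys" by simp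
    from gauss_polys_mult[OF f this] show ?thesis by (simp add: m_def)
  qed
  define g where "g = (\<lambda>z. c * m (axis j 1) z + d * m (axis j \<i>) z)"
  have gQ: "g \<in> gauss_polys" unfolding g_def by (intro subspace_cadd subspace_cscale gauss_polys_subspace mQ)
  have fs: "smooth f" by (rule gauss_polys_smooth[OF f])
  show ?thesis
  proof (rule bexI[OF _ gQ], intro allI impI)
    fix G :: "'m cfn" and s :: real assume G: "smooth G" and s: "s > 0"
    have two: "cut_int s k (\<lambda>z. P z * (c * p z + d * q z)) =
       c * cut_int s k (\<lambda>z. P z * p z) + d * cut_int s k (\<lambda>z. P z * q z)"
      if "continuous_on UNIV P" "continuous_on UNIV p" "continuous_on UNIV q" "k \<ge> 1" for P p q :: "'m cfn" and k
    proof -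
      have i: "integrable lborel (\<lambda>z. P z * p z * of_real (chi s z ^ k))" "integrable lborel (\<lambda>z. P z * q z * of_real (chi s z ^ k))"
        by (intro integrable_cutoff continuous_on_mult that s)+
      have "cut_int s k (\<lambda>z. P z * (c * p z + d * q z)) =
        (\<integral>z. c * (P z * p z * of_real (chi s z ^ k)) + d * (P z * q z * of_real (chi s z ^ k)) \<partial>lborel)"
        by (rule Bochner_Integration.integral_cong[OF refl]) (simp add: algebra_simps)
      also have "\<dots> = c * cut_int s k (\<lambda>z. P z * p z) + d * cut_int s k (\<lambda>z. P z * q z)"
        by (simp only: Bochner_Integration.integral_add[OF integrable_mult_right[OF i(1)] integrable_mult_right[OF i(2)]] integral_mult_right_zero)
      finally show ?thesis .
    qed
    note cG = smooth_continuous[OF G] and cf = smooth_continuous[OF fs]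
    have ct: "continuous_on UNIV (tw b G)" for b by (rule smooth_continuous[OF tw_smooth[OF G]])
    have ctt: "continuous_on UNIV (ttw b f)" for b by (rule smooth_continuous[OF gauss_polys_smooth[OF ttw_gauss_polys[OF f]]])
    have cm: "continuous_on UNIV (m b)" for b by (rule smooth_continuous[OF gauss_polys_smooth[OF mQ]])
    have "cut_int s M (\<lambda>z. ltw x G z * f z) = cut_int s M (\<lambda>z. f z * (c * tw (axis j 1) G z + d * tw (axis j \<i>) G z))"
      by (simp only: x mult.commute[of "f _"])
    also have "\<dots> = c * cut_int s M (\<lambda>z. tw (axis j 1) G z * f z) + d * cut_int s M (\<lambda>z. tw (axis j \<i>) G z * f z)"
      by (subst two[OF cf ct ct]) (use M in \<open>auto simp: mult.commute[of "f _"]\<close>)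
    also have "\<dots> = (c * cut_int s M (\<lambda>z. G z * ttw (axis j 1) f z) + d * cut_int s M (\<lambda>z. G z * ttw (axis j \<i>) f z)) +
       of_real s * (c * cut_int s (M - 1) (\<lambda>z. G z * m (axis j 1) z) + d * cut_int s (M - 1) (\<lambda>z. G z * m (axis j \<i>) z))"
      unfolding ibp_tw[OF G fs M s] m_def by (simp add: algebra_simps)
    also have "c * cut_int s M (\<lambda>z. G z * ttw (axis j 1) f z) + d * cut_int s M (\<lambda>z. G z * ttw (axis j \<i>) f z)
       = cut_int s M (\<lambda>z. G z * tltw x f z)"
      unfolding x(2) by (rule two[OF cG ctt ctt, symmetric]) (use M in simp)
    also have "c * cut_int s (M - 1) (\<lambda>z. G z * m (axis j 1) z) + d * cut_int s (M - 1) (\<lambda>z. G z * m (axis j \<i>) z)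
       = cut_int s (M - 1) (\<lambda>z. G z * g z)"
      unfolding g_def by (rule two[OF cG cm cm, symmetric]) (use M in simp)
    finally show "cut_int s M (\<lambda>z. ltw x G z * f z) =
      cut_int s M (\<lambda>z. G z * tltw x f z) +
      of_real s * cut_int s (M - 1) (\<lambda>z. G z * g z)" .
  qed
qed

text \<open>Each letter may cost one power of the cutoff, and the bound on \<open>M\<close> keeps
  the exponent at least 2 throughout. All functions \<open>q j\<close> are fixed before
  \<open>G\<close> and \<open>s\<close>.\<close>

lemma ibp_word:
  fixes f :: "'m::finite cfn"
  assumes "f \<in> gauss_polys" "M \<ge> length xs + 2"
  shows "\<exists>q. (\<forall>j. q j \<in> gauss_polys) \<and> q 0 = fold tltw xs f \<and> (\<forall>G s. smooth G \<longrightarrow> s > 0 \<longrightarrow>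
    cut_int s M (\<lambda>z. foldr ltw xs G z * f z) =
    (\<Sum>j\<le>length xs. of_real s ^ j * cut_int s (M - j) (\<lambda>z. G z * q j z)))"
  using assms
proof (induction xs arbitrary: f M)
  case Nil
  then show ?case by (intro exI[of _ "\<lambda>j. f"]) simp
next
  case (Cons x xs)
  have M: "M \<ge> 2" "M \<ge> length xs + 2" "M - 1 \<ge> length xs + 2" using Cons.prems(2) by auto
  obtain g where g: "g \<in> gauss_polys" "\<And>G s. smooth G \<Longrightarrow> s > 0 \<Longrightarrow>
    cut_int s M (\<lambda>z. ltw x G z * f z) =
    cut_int s M (\<lambda>z. G z * tltw x f z) +
    of_real s * cut_int s (M - 1) (\<lambda>z. G z * g z)"
    using ibp_ltw[OF Cons.prems(1) M(1), of x] by blast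
  obtain q where q: "\<And>j. q j \<in> gauss_polys" "q 0 = fold tltw xs (tltw x f)" "\<And>G s. smooth G \<Longrightarrow> s > 0 \<Longrightarrow>
    cut_int s M (\<lambda>z. foldr ltw xs G z * tltw x f z) =
    (\<Sum>j\<le>length xs. of_real s ^ j * cut_int s (M - j) (\<lambda>z. G z * q j z))"
    using Cons.IH[OF tltw_gauss_polys[OF Cons.prems(1), of x] M(2)] by blast
  obtain r where r: "\<And>j. r j \<in> gauss_polys" "\<And>G s. smooth G \<Longrightarrow> s > 0 \<Longrightarrow>
    cut_int s (M - 1) (\<lambda>z. foldr ltw xs G z * g z) =
    (\<Sum>j\<le>length xs. of_real s ^ j * cut_int s (M - 1 - j) (\<lambda>z. G z * r j z))"
    using Cons.IH[OF g(1) M(3)] by blast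
  define L where "L = length xs"
  \<comment> \<open>The expansions of the main term and of the error term are padded with zeros and
    added, the second one shifted by one power of \<open>s\<close>.\<close>
  define q1 where "q1 = (\<lambda>j z. if j \<le> L then q j z else 0)"
  define r1 where "r1 = (\<lambda>j z. case j of 0 \<Rightarrow> 0 | Suc i \<Rightarrow> r i z)"
  have q1Q: "q1 j \<in> gauss_polys" for j
    unfolding q1_def by (cases "j \<le> L") (simp_all add: q(1) subspace_czero[OF gauss_polys_subspace])
  have r1Q: "r1 j \<in> gauss_polys" for j
    unfolding r1_def by (cases j) (simp_all add: r(1) subspace_czero[OF gauss_polys_subspace])
  let ?Q = "\<lambda>j z. q1 j z + r1 j z"
  show ?case
  proof (intro exI[of _ ?Q] conjI allI impI)
    show "?Q j \<in> gauss_polys" for j by (intro subspace_cadd gauss_polys_subspace q1Q r1Q)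
    show "(\<lambda>z. q1 0 z + r1 0 z) = fold tltw (x # xs) f" by (simp add: q1_def r1_def q(2))
    fix G :: "'m cfn" and s :: real assume G: "smooth G" and s: "s > 0"
    have cc: "continuous_on UNIV h" if "h \<in> gauss_polys" for h :: "'m cfn" by (rule smooth_continuous[OF gauss_polys_smooth[OF that]])
    have i: "integrable lborel (\<lambda>z. G z * h z * of_real (chi s z ^ k))" if "h \<in> gauss_polys" "k \<ge> 1" for h k
      by (intro integrable_cutoff continuous_on_mult smooth_continuous[OF G] cc that s)
    have split_int: "cut_int s (M - j) (\<lambda>z. G z * (q1 j z + r1 j z)) =
      cut_int s (M - j) (\<lambda>z. G z * q1 j z) + cut_int s (M - j) (\<lambda>z. G z * r1 j z)"
      if "j \<le> Suc L" for j
    proof -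
      have k: "M - j \<ge> 1" using that M(2) by (simp add: L_def)
      show ?thesis unfolding distrib_left distrib_right
        by (rule Bochner_Integration.integral_add[OF i[OF q1Q k] i[OF r1Q k]])
    qed
    have "(\<Sum>j\<le>length (x # xs). of_real s ^ j * cut_int s (M - j) (\<lambda>z. G z * (q1 j z + r1 j z))) =
      (\<Sum>j\<le>Suc L. of_real s ^ j * cut_int s (M - j) (\<lambda>z. G z * q1 j z)) +
      (\<Sum>j\<le>Suc L. of_real s ^ j * cut_int s (M - j) (\<lambda>z. G z * r1 j z))"
      unfolding sum.distrib[symmetric]
      by (rule sum.cong, simp add: L_def) (simp only: atMost_iff split_int distrib_left[symmetric])
    also have "(\<Sum>j\<le>Suc L. of_real s ^ j * cut_int s (M - j) (\<lambda>z. G z * q1 j z)) =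
       (\<Sum>j\<le>L. of_real s ^ j * cut_int s (M - j) (\<lambda>z. G z * q j z))"
      by (simp add: q1_def)
    also have "(\<Sum>j\<le>Suc L. of_real s ^ j * cut_int s (M - j) (\<lambda>z. G z * r1 j z)) =
       of_real s * (\<Sum>j\<le>L. of_real s ^ j * cut_int s (M - 1 - j) (\<lambda>z. G z * r j z))"
      by (simp add: sum.atMost_Suc_shift r1_def sum_distrib_left mult.assoc del: sum.atMost_Suc)
    also have "(\<Sum>j\<le>L. of_real s ^ j * cut_int s (M - j) (\<lambda>z. G z * q j z)) +
       of_real s * (\<Sum>j\<le>L. of_real s ^ j * cut_int s (M - 1 - j) (\<lambda>z. G z * r j z)) =
       cut_int s M (\<lambda>z. foldr ltw (x # xs) G z * f z)"
      unfolding L_def q(3)[OF G s, symmetric] r(2)[OF G s, symmetric] using g(2)[OF ltws_smooth[OF G] s, of xs] by simp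
    finally show "cut_int s M (\<lambda>z. foldr ltw (x # xs) G z * f z) =
       (\<Sum>j\<le>length (x # xs). of_real s ^ j * cut_int s (M - j) (\<lambda>z. G z * (q1 j z + r1 j z)))" ..
  qed
qed

text \<open>An L^1 form of the growth condition with some margin \<delta>. It bounds
  \<open>G\<close> itself and says nothing on derivatives.\<close>

definition gint :: "'m::finite cfn \<Rightarrow> bool" where
  "gint G \<longleftrightarrow> continuous_on UNIV G \<and> (\<exists>\<delta>>0. integrable lborel (\<lambda>z. norm (G z) * exp (- (\<nu> - \<delta>) * (norm z)\<^sup>2)))"

lemma gint_integrable:
  assumes G: "gint G" and f: "f \<in> gauss_polys"
  shows "integrable lborel (\<lambda>z. G z * f z)"
proof -
  obtain \<delta> where d: "\<delta> > 0" "integrable lborel (\<lambda>z. norm (G z) * exp (- (\<nu> - \<delta>) * (norm z)\<^sup>2))" and cG: "continuous_on UNIV G"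
    using G by (auto simp: gint_def)
  obtain p where p: "p \<in> rpolys" "f = (\<lambda>z. exp (of_real (- \<nu> * (norm z)\<^sup>2)) * p z)" using f by (auto simp: gauss_polys_def)
  obtain C where C: "C \<ge> 0" "\<And>z. norm (p z) \<le> C * exp (\<delta> * (norm z)\<^sup>2)" using rpolys_growth[OF p(1) d(1)] by blast
  show ?thesis
  proof (rule Bochner_Integration.integrable_bound[OF integrable_mult_right[OF d(2), of C]])
    have "continuous_on UNIV (\<lambda>z. G z * f z)" by (intro continuous_on_mult cG smooth_continuous gauss_polys_smooth f)
    then show "(\<lambda>z. G z * f z) \<in> borel_measurable lborel" by (rule continuous_lborel)
    have "norm (G z * f z) \<le> C * (norm (G z) * exp (- (\<nu> - \<delta>) * (norm z)\<^sup>2))" for z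
    proof -
      have "norm (G z * f z) = norm (G z) * (exp (- \<nu> * (norm z)\<^sup>2) * norm (p z))"
        unfolding p(2) norm_mult norm_exp_eq_Re by simp
      also have "\<dots> \<le> norm (G z) * (exp (- \<nu> * (norm z)\<^sup>2) * (C * exp (\<delta> * (norm z)\<^sup>2)))"
        by (intro mult_left_mono C) auto
      also have "\<dots> = C * (norm (G z) * (exp (- \<nu> * (norm z)\<^sup>2) * exp (\<delta> * (norm z)\<^sup>2)))" by simp
      also have "exp (- \<nu> * (norm z)\<^sup>2) * exp (\<delta> * (norm z)\<^sup>2) = exp (- (\<nu> - \<delta>) * (norm z)\<^sup>2)"
        unfolding exp_add[symmetric] by (simp add: algebra_simps)
      finally show ?thesis .
    qed
    then show "AE z in lborel. norm (G z * f z) \<le> norm (C * (norm (G z) * exp (- (\<nu> - \<delta>) * (norm z)\<^sup>2)))"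
      using C(1) by simp
  qed
qed

lemma cutoff_limit:
  assumes G: "gint G" and f: "f \<in> gauss_polys"
  shows "(\<lambda>i. \<integral>z. G z * f z * of_real (chi (1 / real (Suc i)) z ^ M) \<partial>lborel) \<longlonglongrightarrow> (\<integral>z. G z * f z \<partial>lborel)"
proof (rule integral_dominated_convergence[where w="\<lambda>z. norm (G z * f z)"])
  have c: "continuous_on UNIV (\<lambda>z. G z * f z)"
    using G by (intro continuous_on_mult smooth_continuous[OF gauss_polys_smooth[OF f]]) (simp add: gint_def)
  then show "(\<lambda>z. G z * f z) \<in> borel_measurable lborel" by (rule continuous_lborel)
  have "continuous_on UNIV (\<lambda>z. G z * f z * of_real (chi (1 / real (Suc i)) z ^ M))" for i
    by (intro continuous_on_mult c continuous_intros continuous_chi)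
  then show "(\<lambda>z. G z * f z * of_real (chi (1 / real (Suc i)) z ^ M)) \<in> borel_measurable lborel" for i
    by (rule continuous_lborel)
  show "integrable lborel (\<lambda>z. norm (G z * f z))" by (rule integrable_norm[OF gint_integrable[OF G f]])
  show "AE z in lborel. (\<lambda>i. G z * f z * of_real (chi (1 / real (Suc i)) z ^ M)) \<longlonglongrightarrow> G z * f z"
  proof (rule AE_I2)
    fix z :: "complex^'a"
    have "(\<lambda>i. G z * f z * of_real (max 0 (1 - (1 / real (Suc i)) * (norm z)\<^sup>2) ^ M)) \<longlonglongrightarrow> G z * f z * of_real (max 0 (1 - 0 * (norm z)\<^sup>2) ^ M)"
      by (intro tendsto_intros LIMSEQ_inverse_real_of_nat[unfolded inverse_eq_divide])
    then show "(\<lambda>i. G z * f z * of_real (chi (1 / real (Suc i)) z ^ M)) \<longlonglongrightarrow> G z * f z" by (simp add: chi_def)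
  qed
  show "AE z in lborel. norm (G z * f z * of_real (chi (1 / real (Suc i)) z ^ M)) \<le> norm (G z * f z)" for i
  proof (rule AE_I2)
    fix z :: "complex^'a"
    have "chi (1 / real (Suc i)) z ^ M \<le> 1" "0 \<le> chi (1 / real (Suc i)) z ^ M" using chi_power_bounds[of "1 / real (Suc i)" z M] by simp_all
    then show "norm (G z * f z * of_real (chi (1 / real (Suc i)) z ^ M)) \<le> norm (G z * f z)"
      unfolding norm_mult norm_of_real by (simp add: mult_left_le)
  qed
qed

text \<open>The individual derivatives of \<open>G\<close> may fail to be integrable against
  \<open>f\<close>; only their combination \<open>H\<close> obeys the growth condition. So the
  cutoff is kept until all derivatives are on \<open>f\<close>, and it is removed on both sides
  afterwards.\<close>

theorem ibp_gint:
  assumes G: "smooth G" "gint G" and H: "gint H" "\<And>z. H z = (\<Sum>xs\<in>words N. e xs * foldr ltw xs G z)" and f: "f \<in> gauss_polys"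
  shows "(\<integral>z. H z * f z \<partial>lborel) = (\<Sum>xs\<in>words N. e xs * (\<integral>z. G z * fold tltw xs f z \<partial>lborel))"
proof -
  define M where "M = N + 2"
  let ?s = "\<lambda>i. 1 / real (Suc i)"
  have "\<forall>xs. \<exists>q. xs \<in> words N \<longrightarrow> (\<forall>j. q j \<in> gauss_polys) \<and> q 0 = fold tltw xs f \<and> (\<forall>G s. smooth G \<longrightarrow> s > 0 \<longrightarrow>
    cut_int s M (\<lambda>z. foldr ltw xs G z * f z) =
    (\<Sum>j\<le>N. of_real s ^ j * cut_int s (M - j) (\<lambda>z. G z * q j z)))"
  proof
    fix xs
    show "\<exists>q. xs \<in> words N \<longrightarrow> (\<forall>j. q j \<in> gauss_polys) \<and> q 0 = fold tltw xs f \<and> (\<forall>G s. smooth G \<longrightarrow> s > 0 \<longrightarrow>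
      cut_int s M (\<lambda>z. foldr ltw xs G z * f z) =
      (\<Sum>j\<le>N. of_real s ^ j * cut_int s (M - j) (\<lambda>z. G z * q j z)))"
    proof (cases "length xs = N")
      case True
      have "M \<ge> length xs + 2" by (simp add: M_def True)
      from ibp_word[OF f this] show ?thesis unfolding True by (elim exE) (intro exI impI)
    qed (simp add: words_def)
  qed
  from choice[OF this] obtain q where q: "\<And>xs j. xs \<in> words N \<Longrightarrow> q xs j \<in> gauss_polys" "\<And>xs. xs \<in> words N \<Longrightarrow> q xs 0 = fold tltw xs f"
    "\<And>xs G s. xs \<in> words N \<Longrightarrow> smooth G \<Longrightarrow> s > 0 \<Longrightarrow>
    cut_int s M (\<lambda>z. foldr ltw xs G z * f z) =
    (\<Sum>j\<le>N. of_real s ^ j * cut_int s (M - j) (\<lambda>z. G z * q xs j z))" by blast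
  have eq: "cut_int (?s i) M (\<lambda>z. H z * f z) =
     (\<Sum>xs\<in>words N. e xs * (\<Sum>j\<le>N. of_real (?s i) ^ j * cut_int (?s i) (M - j) (\<lambda>z. G z * q xs j z)))" for i
  proof -
    have int: "integrable lborel (\<lambda>z. e xs * (foldr ltw xs G z * f z * of_real (chi (?s i) z ^ M)))" for xs
      by (intro integrable_mult_right integrable_cutoff continuous_on_mult smooth_continuous[OF ltws_smooth[OF G(1)]] smooth_continuous[OF gauss_polys_smooth[OF f]])
         (simp_all add: M_def)
    have "cut_int (?s i) M (\<lambda>z. H z * f z) =
       (\<integral>z. (\<Sum>xs\<in>words N. e xs * (foldr ltw xs G z * f z * of_real (chi (?s i) z ^ M))) \<partial>lborel)"
      by (simp only: H(2) sum_distrib_right mult.assoc)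
    also have "\<dots> = (\<Sum>xs\<in>words N. e xs * cut_int (?s i) M (\<lambda>z. foldr ltw xs G z * f z))"
      by (subst Bochner_Integration.integral_sum[OF int]) (simp only: integral_mult_right_zero)
    also have "\<dots> = (\<Sum>xs\<in>words N. e xs * (\<Sum>j\<le>N. of_real (?s i) ^ j * cut_int (?s i) (M - j) (\<lambda>z. G z * q xs j z)))"
      by (intro sum.cong refl) (simp only: q(3)[OF _ G(1)] zero_less_divide_1_iff of_nat_0_less_iff zero_less_Suc)
    finally show ?thesis .
  qed
  \<comment> \<open>The terms with \<open>j > 0\<close> carry a positive power of the cutoff
    parameter and vanish in the limit.\<close>
  have lim: "(\<lambda>i. \<Sum>xs\<in>words N. e xs * (\<Sum>j\<le>N. of_real (?s i) ^ j * cut_int (?s i) (M - j) (\<lambda>z. G z * q xs j z)))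
     \<longlonglongrightarrow> (\<Sum>xs\<in>words N. e xs * (\<Sum>j\<le>N. of_real 0 ^ j * (\<integral>z. G z * q xs j z \<partial>lborel)))"
    by (intro tendsto_sum tendsto_mult tendsto_const tendsto_power tendsto_of_real cutoff_limit[OF G(2)] q(1)
        LIMSEQ_inverse_real_of_nat[unfolded inverse_eq_divide])
  have "(\<Sum>j\<le>N. of_real 0 ^ j * (\<integral>z. G z * q xs j z \<partial>lborel)) = (\<integral>z. G z * fold tltw xs f z \<partial>lborel)" if "xs \<in> words N" for xs
  proof -
    have "(\<Sum>j\<le>N. of_real 0 ^ j * (\<integral>z. G z * q xs j z \<partial>lborel)) = (\<Sum>j\<in>{0}. of_real 0 ^ j * (\<integral>z. G z * q xs j z \<partial>lborel))"
      by (rule sum.mono_neutral_right) auto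
    then show ?thesis using q(2)[OF that] by simp
  qed
  then have "(\<lambda>i. \<integral>z. H z * f z * of_real (chi (?s i) z ^ M) \<partial>lborel) \<longlonglongrightarrow> (\<Sum>xs\<in>words N. e xs * (\<integral>z. G z * fold tltw xs f z \<partial>lborel))"
    unfolding eq using lim by simp
  moreover note cutoff_limit[OF H(1) f, of M]
  ultimately show ?thesis by (rule LIMSEQ_unique[rotated])
qed

end

section \<open>Pairings with matrix coefficients and the Moyal relations\<close>

context fock begin

lemma fold_tltw_phi:
  "u \<in> polys \<Longrightarrow> v \<in> polys \<Longrightarrow> fold tltw xs (phi u v) = phi (foldr op (rev (map swap xs)) u) v"
  by (induction xs arbitrary: u) (simp_all add: tltw_phi op_polys)

lemma gint_mono:
  assumes c: "continuous_on UNIV G" and d: "\<delta>' \<le> \<delta>"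
    and i: "integrable lborel (\<lambda>z. norm (G z) * exp (- (\<nu> - \<delta>) * (norm z)\<^sup>2))"
  shows "integrable lborel (\<lambda>z. norm (G z) * exp (- (\<nu> - \<delta>') * (norm z)\<^sup>2))"
proof (rule Bochner_Integration.integrable_bound[OF i])
  show "(\<lambda>z. norm (G z) * exp (- (\<nu> - \<delta>') * (norm z)\<^sup>2)) \<in> borel_measurable lborel"
    by (intro continuous_lborel continuous_intros c)
  show "AE z in lborel. norm (norm (G z) * exp (- (\<nu> - \<delta>') * (norm z)\<^sup>2)) \<le> norm (norm (G z) * exp (- (\<nu> - \<delta>) * (norm z)\<^sup>2))"
    using d by (intro AE_I2) (simp add: mult_left_mono mult_right_mono)
qed

lemma gint_lin:
  assumes "gint G" "gint H" shows "gint (\<lambda>z. c * G z + d * H z)"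
proof -
  obtain \<delta> \<delta>' where d: "\<delta> > 0" "integrable lborel (\<lambda>z. norm (G z) * exp (- (\<nu> - \<delta>) * (norm z)\<^sup>2))"
    "\<delta>' > 0" "integrable lborel (\<lambda>z. norm (H z) * exp (- (\<nu> - \<delta>') * (norm z)\<^sup>2))"
    and cont: "continuous_on UNIV G" "continuous_on UNIV H" using assms by (auto simp: gint_def)
  let ?d = "min \<delta> \<delta>'"
  have i: "integrable lborel (\<lambda>z. norm c * (norm (G z) * exp (- (\<nu> - ?d) * (norm z)\<^sup>2)) + norm d * (norm (H z) * exp (- (\<nu> - ?d) * (norm z)\<^sup>2)))"
    by (intro Bochner_Integration.integrable_add integrable_mult_right gint_mono[OF cont(1) _ d(2)] gint_mono[OF cont(2) _ d(4)]) auto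
  have cc: "continuous_on UNIV (\<lambda>z. c * G z + d * H z)" by (intro continuous_intros cont)
  have "integrable lborel (\<lambda>z. norm (c * G z + d * H z) * exp (- (\<nu> - ?d) * (norm z)\<^sup>2))"
  proof (rule Bochner_Integration.integrable_bound[OF i])
    show "(\<lambda>z. norm (c * G z + d * H z) * exp (- (\<nu> - ?d) * (norm z)\<^sup>2)) \<in> borel_measurable lborel"
      by (intro continuous_lborel continuous_intros cc cont)
    have "norm (c * G z + d * H z) * E \<le> norm c * (norm (G z) * E) + norm d * (norm (H z) * E)" if "E \<ge> 0" for z and E :: real
      using mult_right_mono[OF norm_triangle_ineq[of "c * G z" "d * H z"] that] by (simp add: norm_mult algebra_simps)
    then show "AE z in lborel. norm (norm (c * G z + d * H z) * exp (- (\<nu> - ?d) * (norm z)\<^sup>2)) \<le>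
      norm (norm c * (norm (G z) * exp (- (\<nu> - ?d) * (norm z)\<^sup>2)) + norm d * (norm (H z) * exp (- (\<nu> - ?d) * (norm z)\<^sup>2)))"
      by (intro AE_I2) (simp add: abs_mult)
  qed
  then show ?thesis using cc d(1,3) unfolding gint_def by (intro conjI exI[of _ ?d]) auto
qed

lemma gauss_polys_gint: "f \<in> gauss_polys \<Longrightarrow> gint f"
proof -
  assume f: "f \<in> gauss_polys"
  then obtain p where p: "p \<in> rpolys" "f = (\<lambda>z. exp (of_real (- \<nu> * (norm z)\<^sup>2)) * p z)" by (auto simp: gauss_polys_def)
  have h: "\<nu> / 2 > 0" using \<nu>_pos by simp
  obtain C where C: "C \<ge> 0" "\<And>z. norm (p z) \<le> C * exp (\<nu> / 2 * (norm z)\<^sup>2)" using rpolys_growth[OF p(1) h] by blast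
  have c: "continuous_on UNIV f" by (rule smooth_continuous[OF gauss_polys_smooth[OF f]])
  have "integrable lborel (\<lambda>z. norm (f z) * exp (- (\<nu> - \<nu> / 2) * (norm z)\<^sup>2))"
  proof (rule Bochner_Integration.integrable_bound[OF integrable_mult_right[OF gaussian_integrable[OF \<nu>_pos], of C]])
    show "(\<lambda>z. norm (f z) * exp (- (\<nu> - \<nu> / 2) * (norm z)\<^sup>2)) \<in> borel_measurable lborel"
      by (intro continuous_lborel continuous_intros c)
    have "norm (f z) * exp (- (\<nu> - \<nu> / 2) * (norm z)\<^sup>2) \<le> C * exp (- \<nu> * (norm z)\<^sup>2)" for z
    proof -
      have "norm (f z) * exp (- (\<nu> - \<nu> / 2) * (norm z)\<^sup>2) \<le> exp (- \<nu> * (norm z)\<^sup>2) * (C * exp (\<nu> / 2 * (norm z)\<^sup>2)) * exp (- (\<nu> - \<nu> / 2) * (norm z)\<^sup>2)"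
        unfolding p(2) norm_mult norm_exp_eq_Re by (intro mult_right_mono mult_left_mono) (use C(2)[of z] in auto)
      also have "\<dots> = C * exp (- \<nu> * (norm z)\<^sup>2) * (exp (\<nu> / 2 * (norm z)\<^sup>2) * exp (- (\<nu> - \<nu> / 2) * (norm z)\<^sup>2))" by simp
      also have "exp (\<nu> / 2 * (norm z)\<^sup>2) * exp (- (\<nu> - \<nu> / 2) * (norm z)\<^sup>2) = 1" unfolding exp_add[symmetric] by simp
      finally show ?thesis by simp
    qed
    then show "AE z in lborel. norm (norm (f z) * exp (- (\<nu> - \<nu> / 2) * (norm z)\<^sup>2)) \<le> norm (C * exp (- \<nu> * (norm z)\<^sup>2))"
      using C(1) by (intro AE_I2) simp
  qed
  then show ?thesis using c h unfolding gint_def by blast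
qed

lemma mc_gauss_polys: "u \<in> polys \<Longrightarrow> v \<in> polys \<Longrightarrow> mc u v \<in> gauss_polys"
  unfolding gauss_polys_def mc_def[abs_def] mcoef_def norm_av
  by (rule CollectI, rule exI[of _ "\<lambda>z. ncoef u v (av z)"]) (simp add: rpolys_compose_linear[OF ncoef_rpolys linear_av])

lemma phi_eq: "phi u v z = exp (of_real (- \<nu> * (norm z)\<^sup>2)) * cnj (ncoef u v (av z))"
  by (simp add: phi_def mc_def mcoef_def exp_cnj)

text \<open>The L^2 inner product of \<open>G\<close> with \<open>mc u v\<close>, hence linear in
  \<open>v\<close> and conjugate linear in \<open>u\<close>.\<close>

definition pairing :: "'m::finite cfn \<Rightarrow> 'm cfn \<Rightarrow> 'm cfn \<Rightarrow> complex" where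
  "pairing G u v = (\<integral>z. G z * phi u v z \<partial>lborel)"

lemma pairing_integrable: "gint G \<Longrightarrow> u \<in> polys \<Longrightarrow> v \<in> polys \<Longrightarrow> integrable lborel (\<lambda>z. G z * phi u v z)"
  by (intro gint_integrable phi_gauss_polys)

lemma pairing_add_right: "gint G \<Longrightarrow> u \<in> polys \<Longrightarrow> v \<in> polys \<Longrightarrow> v' \<in> polys \<Longrightarrow> pairing G u (\<lambda>w. v w + v' w) = pairing G u v + pairing G u v'"
  unfolding pairing_def
  by (subst Bochner_Integration.integral_add[symmetric, OF pairing_integrable pairing_integrable])
     (simp_all add: phi_eq ncoef_add_right algebra_simps)

lemma pairing_add_left: "gint G \<Longrightarrow> u \<in> polys \<Longrightarrow> u' \<in> polys \<Longrightarrow> v \<in> polys \<Longrightarrow> pairing G (\<lambda>w. u w + u' w) v = pairing G u v + pairing G u' v"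
  unfolding pairing_def
  by (subst Bochner_Integration.integral_add[symmetric, OF pairing_integrable pairing_integrable])
     (simp_all add: phi_eq ncoef_add_left algebra_simps)

lemma pairing_scale_right: "pairing G u (\<lambda>w. c * v w) = c * pairing G u v"
  unfolding pairing_def integral_mult_right_zero[symmetric] by (simp add: phi_eq ncoef_scale_right mult_ac)

lemma pairing_scale_left: "pairing G (\<lambda>w. c * u w) v = cnj c * pairing G u v"
  unfolding pairing_def integral_mult_right_zero[symmetric] by (simp add: phi_eq ncoef_scale_left mult_ac)

text \<open>A scalar functional is viewed as a map into functions on \<open>unit\<close>, the form
  that \<open>lin_on\<close> expects; in the other argument a conjugation restores
  linearity.\<close>

lemma lin_on_pairing_right: "gint G \<Longrightarrow> u \<in> polys \<Longrightarrow> lin_on polys (\<lambda>v (_::unit). pairing G u v)"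
  by (simp add: lin_on_def pairing_add_right pairing_scale_right)

lemma lin_on_pairing_left: "gint G \<Longrightarrow> v \<in> polys \<Longrightarrow> lin_on polys (\<lambda>u (_::unit). cnj (pairing G u v))"
  by (simp add: lin_on_def pairing_add_left pairing_scale_left)

lemma pairing_sum_right: "gint G \<Longrightarrow> u \<in> polys \<Longrightarrow> (\<And>i. i \<in> S \<Longrightarrow> v i \<in> polys) \<Longrightarrow>
    pairing G u (\<lambda>w. \<Sum>i\<in>S. c i * v i w) = (\<Sum>i\<in>S. c i * pairing G u (v i))"
  by (rule fun_cong[OF lin_on_sum[OF lin_on_pairing_right polys_subspace]])

lemma pairing_sum_left: "gint G \<Longrightarrow> v \<in> polys \<Longrightarrow> (\<And>i. i \<in> S \<Longrightarrow> u i \<in> polys) \<Longrightarrow>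
    pairing G (\<lambda>w. \<Sum>i\<in>S. c i * u i w) v = (\<Sum>i\<in>S. cnj (c i) * pairing G (u i) v)"
proof -
  assume a: "gint G" "v \<in> polys" "\<And>i. i \<in> S \<Longrightarrow> u i \<in> polys"
  have "cnj (pairing G (\<lambda>w. \<Sum>i\<in>S. c i * u i w) v) = (\<Sum>i\<in>S. c i * cnj (pairing G (u i) v))"
    by (rule fun_cong[OF lin_on_sum[OF lin_on_pairing_left[OF a(1,2)] polys_subspace a(3)]])
  from arg_cong[OF this, of cnj] show ?thesis by simp
qed

lemma pairing_zero_right [simp]: "pairing G u (\<lambda>w. 0) = 0" using pairing_scale_right[of G u 0 "\<lambda>w. 0"] by simp

lemma pairing_lin_fun: "gint G \<Longrightarrow> gint H \<Longrightarrow> u \<in> polys \<Longrightarrow> v \<in> polys \<Longrightarrow> pairing (\<lambda>z. c * G z + d * H z) u v = c * pairing G u v + d * pairing H u v"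
  unfolding pairing_def integral_mult_right_zero[symmetric]
  by (subst Bochner_Integration.integral_add[symmetric, OF integrable_mult_right[OF pairing_integrable] integrable_mult_right[OF pairing_integrable]])
     (simp_all add: algebra_simps)

lemma pairing_fun_subspace:
  fixes u v :: "'m::finite cfn"
  assumes uv: "u \<in> polys" "v \<in> polys"
  shows "cfun.subspace {G. gint G \<and> pairing G u v = 0}"
proof (rule subspaceI_fun)
  have z: "gint (\<lambda>w::complex^'m. 0)" by (rule gauss_polys_gint[OF subspace_czero[OF gauss_polys_subspace]])
  then show "(\<lambda>w. 0) \<in> {G. gint G \<and> pairing G u v = 0}" by (simp add: pairing_def)
  fix G H :: "'m cfn" and c
  show "(\<lambda>w. c * G w) \<in> {G. gint G \<and> pairing G u v = 0}" if "G \<in> {G. gint G \<and> pairing G u v = 0}"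
    using that gint_lin[of G G c 0] pairing_lin_fun[of G G u v c 0] uv by simp
  show "(\<lambda>w. G w + H w) \<in> {G. gint G \<and> pairing G u v = 0}" if "G \<in> {G. gint G \<and> pairing G u v = 0}" "H \<in> {G. gint G \<and> pairing G u v = 0}"
    using that gint_lin[of G H 1 1] pairing_lin_fun[of G H u v 1 1] uv by simp
qed

lemma pairing_mc_op:
  assumes "u' \<in> polys" "v' \<in> polys" "u \<in> polys" "v \<in> polys"
  shows "pairing (mc (op x u') v') u v = pairing (mc u' v') (op (swap x) u) v"
proof -
  \<comment> \<open>The tensor concentrated at the word \<open>[x]\<close>, for which
    \<open>ibp_gint\<close> moves a single letter.\<close>
  define e :: "('a + 'a) list \<Rightarrow> complex" where "e xs = (if xs = [x] then 1 else 0)" for xs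
  have s: "(\<Sum>xs\<in>words 1. e xs * F xs) = F [x]" for F
  proof -
    have "(\<Sum>xs\<in>words 1. e xs * F xs) = (\<Sum>xs\<in>words 1. if xs = [x] then F xs else 0)"
      by (rule sum.cong) (simp_all add: e_def)
    moreover have "[x] \<in> words 1" by (simp add: words_def)
    ultimately show ?thesis unfolding sum.delta[OF finite_words] by (simp only: if_True)
  qed
  have H: "mc (op x u') v' z = (\<Sum>xs\<in>words 1. e xs * foldr ltw xs (mc u' v') z)" for z
    unfolding s using ltw_mc[OF assms(1,2), of x z] by simp
  show ?thesis unfolding pairing_def
    using ibp_gint[OF mc_smooth[OF assms(1,2)] gauss_polys_gint[OF mc_gauss_polys[OF assms(1,2)]] gauss_polys_gint[OF mc_gauss_polys[OF op_polys[OF assms(1)] assms(2)]] H phi_gauss_polys[OF assms(3,4)]]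
    unfolding s by (simp add: tltw_phi[OF assms(3,4)])
qed

text \<open>The constant 1 is annihilated by derivatives and generates all polynomials by
  multiplications. A sesquilinear form with the adjoint relations of \<open>inn\<close> is therefore
  determined by its value on the constants.\<close>

lemma adjoint_form_unique:
  fixes F :: "'m::finite cfn \<Rightarrow> 'm cfn \<Rightarrow> complex"
  assumes add: "\<And>u u' w. u \<in> polys \<Longrightarrow> u' \<in> polys \<Longrightarrow> w \<in> polys \<Longrightarrow> F (\<lambda>x. u x + u' x) w = F u w + F u' w"
    "\<And>u w w'. u \<in> polys \<Longrightarrow> w \<in> polys \<Longrightarrow> w' \<in> polys \<Longrightarrow> F u (\<lambda>x. w x + w' x) = F u w + F u w'"
    and scale: "\<And>c u w. u \<in> polys \<Longrightarrow> w \<in> polys \<Longrightarrow> F (\<lambda>x. c * u x) w = c * F u w" "\<And>c u w. u \<in> polys \<Longrightarrow> w \<in> polys \<Longrightarrow> F u (\<lambda>x. c * w x) = cnj c * F u w"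
    and adj: "\<And>x u w. u \<in> polys \<Longrightarrow> w \<in> polys \<Longrightarrow> F (op x u) w = F u (op (swap x) w)"
    and u: "u \<in> polys" and w: "w \<in> polys"
  shows "c0 TYPE('m) * F u w = inn u w * F (\<lambda>x. 1) (\<lambda>x. 1)"
proof -
  note one = polys.const[of 1]
  have one_left: "c0 TYPE('m) * F (\<lambda>x. 1) w = inn (\<lambda>x. 1) w * F (\<lambda>x. 1) (\<lambda>x. 1)" if "w \<in> polys" for w
    using that
  proof (induction rule: polys.induct)
    case (const c)
    show ?case using scale(2)[OF one one, of c] inn_cmult_right[of "\<lambda>w::complex^'m. 1" c "\<lambda>w. 1"] by (simp add: c0_def)
  next
    case (add p q)
    then show ?case by (simp add: assms(2)[OF one] inn_add_right[OF one] distrib_left distrib_right)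
  next
    case (coord p j)
    obtain x where x: "op x = hol_deriv_op j" "op (swap x) = mult_op lam j" using letter_exists by blast
    have "F (\<lambda>x. 1) (\<lambda>w. of_real (2 * \<nu>) * (w $ j * p w)) = F (\<lambda>x. 0) p"
      using adj[OF one coord.hyps, of x] unfolding x mult_op_eq by (simp add: mult.assoc)
    also have "\<dots> = 0" using scale(1)[OF one coord.hyps, of 0] by simp
    finally have 1: "F (\<lambda>x. 1) (\<lambda>w. w $ j * p w) = 0"
      unfolding scale(2)[OF one polys.coord[OF coord.hyps]] using \<nu>_pos by simp
    have "inn (\<lambda>x. 1) (\<lambda>w. w $ j * p w) = 0"
      using inn_deriv_left[OF one coord.hyps, of j] \<nu>_pos by simp
    then show ?case using 1 by simp
  qed
  show ?thesis using u w
  proof (induction arbitrary: w rule: polys.induct)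
    case (const c)
    show ?case using scale(1)[OF one const, of c] one_left[OF const] inn_cmult_left[of c "\<lambda>x. 1" w] by simp
  next
    case (add p q)
    show ?case using add.IH[OF add.prems] by (simp add: assms(1)[OF add.hyps add.prems] inn_add_left[OF add.hyps add.prems] distrib_left distrib_right)
  next
    case (coord p j)
    obtain x where x: "op x = hol_deriv_op j" "op (swap x) = mult_op lam j" using letter_exists by blast
    have "F (\<lambda>w. of_real (2 * \<nu>) * (w $ j * p w)) w = F p (hol_deriv_op j w)"
      using adj[OF coord.hyps coord.prems, of "swap x"] unfolding x swap_simps mult_op_eq by (simp add: mult.assoc)
    then have 1: "2 * \<nu> * F (\<lambda>w. w $ j * p w) w = F p (hol_deriv_op j w)"
      unfolding scale(1)[OF polys.coord[OF coord.hyps] coord.prems] by simp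
    have 2: "2 * \<nu> * inn (\<lambda>w. w $ j * p w) w = inn p (hol_deriv_op j w)"
      using inn_coord_left[OF coord.hyps coord.prems, of j] \<nu>_pos by simp
    have "2 * \<nu> * (c0 TYPE('m) * F (\<lambda>w. w $ j * p w) w) = 2 * \<nu> * (inn (\<lambda>w. w $ j * p w) w * F (\<lambda>x. 1) (\<lambda>x. 1))"
      using coord.IH[OF polys_hol_deriv_op[OF coord.prems, of j]] unfolding 1[symmetric] 2[symmetric] by (simp add: mult_ac)
    then show ?case using \<nu>_pos by simp
  qed
qed

text \<open>What is left when the explicit vacuum pairing is compared with the normalisation of the
  Fock inner product.\<close>

definition moyal_const :: "'m::finite itself \<Rightarrow> complex" where
  "moyal_const t = cnj (c0 t) / of_real ((2 * \<nu> / pi) ^ CARD('m))"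

lemma moyal_const_nonzero: "moyal_const TYPE('m::finite) \<noteq> 0"
  using c0_nonzero \<nu>_pos by (simp add: moyal_const_def)

text \<open>For fixed \<open>v'\<close> and \<open>v\<close> the pairing obeys the adjoint relations
  in \<open>u'\<close> and \<open>u\<close>, hence is a multiple of \<open>inn u' u\<close>. The
  multiple is found with both equal to 1, where the coefficients are explicit and their two Gaussian
  factors combine into the Fock weight.\<close>

theorem moyal:
  fixes u :: "'m::finite cfn"
  assumes "u' \<in> polys" "v' \<in> polys" "u \<in> polys" "v \<in> polys"
  shows "pairing (mc u' v') u v = moyal_const TYPE('m) * inn u' u * inn v v'"
proof -
  note one = polys.const[of 1]
  note g = gauss_polys_gint[OF mc_gauss_polys[OF _ assms(2)]]
  have "c0 TYPE('m) * pairing (mc u' v') u v = inn u' u * pairing (mc (\<lambda>x. 1) v') (\<lambda>x. 1) v"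
  proof (rule adjoint_form_unique[where F="\<lambda>u' u. pairing (mc u' v') u v"])
    fix p q :: "'m cfn" and c assume p: "p \<in> polys" and q: "q \<in> polys"
    have e: "mc (\<lambda>w. c * p w) v' = (\<lambda>z. c * mc p v' z)" by (simp add: mc_def[abs_def] mcoef_def ncoef_scale_left mult_ac)
    show "pairing (mc (\<lambda>x. c * p x) v') q v = c * pairing (mc p v') q v" unfolding e pairing_def by (simp add: mult.assoc)
    show "pairing (mc p v') (\<lambda>x. c * q x) v = cnj c * pairing (mc p v') q v" by (rule pairing_scale_left)
    show "pairing (mc (op x p) v') q v = pairing (mc p v') (op (swap x) q) v" for x by (rule pairing_mc_op[OF p assms(2) q assms(4)])
    fix r :: "'m cfn" assume r: "r \<in> polys"
    show "pairing (mc p v') (\<lambda>x. q x + r x) v = pairing (mc p v') q v + pairing (mc p v') r v" by (rule pairing_add_left[OF g[OF p] q r assms(4)])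
    have "mc (\<lambda>x. p x + q x) v' = (\<lambda>z. 1 * mc p v' z + 1 * mc q v' z)"
      using mc_linear[OF p q assms(2), of 1 _ 1] by (simp add: fun_eq_iff)
    then show "pairing (mc (\<lambda>x. p x + q x) v') r v = pairing (mc p v') r v + pairing (mc q v') r v"
      using pairing_lin_fun[OF g[OF p] g[OF q] r assms(4), of 1 1] by simp
  qed (use assms in auto)
  also have "pairing (mc (\<lambda>x. 1) v') (\<lambda>x. 1) v = c0 TYPE('m) * cnj (c0 TYPE('m)) * (\<integral>z. v (- av z) * cnj (v' (- av z)) * gauss (- av z) \<partial>lborel)"
  proof -
    have x: "exp (of_real (- \<nu> * (norm z)\<^sup>2)) * exp (of_real (- \<nu> * (norm z)\<^sup>2)) = gauss (- av z)" for z :: "complex^'m"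
      unfolding gauss_def norm_minus_cancel norm_av exp_add[symmetric] by (simp add: exp_of_real[symmetric] mult.assoc)
    have "mc (\<lambda>x. 1) v' z * phi (\<lambda>x. 1) v z = c0 TYPE('m) * cnj (c0 TYPE('m)) * (v (- av z) * cnj (v' (- av z)) * gauss (- av z))" for z
      unfolding phi_eq mc_def mcoef_def norm_av ncoef_one[OF assms(2)] ncoef_one[OF assms(4)] x[symmetric] by (simp add: mult_ac)
    then show ?thesis unfolding pairing_def by (simp only: integral_mult_right_zero)
  qed
  also have "(\<integral>z. v (- av z) * cnj (v' (- av z)) * gauss (- av z) \<partial>lborel) = (\<integral>z. v z * cnj (v' z) * gauss z \<partial>lborel)"
  proof (rule integral_lborel_isometry(1)[where T="\<lambda>z. - av z"])
    show "linear (\<lambda>z::complex^'m. - av z)" by (rule linear_compose_neg[OF linear_av])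
  qed simp
  finally have "c0 TYPE('m) * pairing (mc u' v') u v = c0 TYPE('m) * (inn u' u * (cnj (c0 TYPE('m)) * (\<integral>z. v z * cnj (v' z) * gauss z \<partial>lborel)))"
    by (simp add: mult_ac)
  then have "pairing (mc u' v') u v = inn u' u * (cnj (c0 TYPE('m)) * (\<integral>z. v z * cnj (v' z) * gauss z \<partial>lborel))"
    using c0_nonzero mult_left_cancel by blast
  then show ?thesis unfolding moyal_const_def fock_inner_eq[of v v'] using \<nu>_pos by simp
qed

definition coefs :: "'m::finite cfn set" where
  "coefs = cfun.span {\<lambda>z. cnj (ncoef u v (av z)) |u v. u \<in> polys \<and> v \<in> polys}"

text \<open>The recursions \<open>ncoef_coord_left\<close> and \<open>ncoef_coord_right\<close> are
  read backwards: a coefficient times a coordinate or its conjugate is a combination of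
  coefficients.\<close>

lemma coefs_coord: "p \<in> coefs \<Longrightarrow> (\<lambda>z. z $ j * p z) \<in> coefs \<and> (\<lambda>z. cnj (z $ j) * p z) \<in> coefs"
  unfolding coefs_def
proof (induction rule: span_induct_fun)
  case zero
  show ?case by (simp add: subspace_czero[OF cfun.subspace_span])
next
  case (add u v)
  show ?case unfolding distrib_left
    by (intro conjI subspace_cadd cfun.subspace_span conjunct1[OF add.IH(1)] conjunct2[OF add.IH(1)] conjunct1[OF add.IH(2)] conjunct2[OF add.IH(2)])
next
  case (scale c u)
  show ?case unfolding mult.left_commute[of _ c]
    by (intro conjI subspace_cscale cfun.subspace_span conjunct1[OF scale.IH] conjunct2[OF scale.IH])
next
  case (base p)
  then obtain u v where uv: "u \<in> polys" "v \<in> polys" and p: "p = (\<lambda>z. cnj (ncoef u v (av z)))" by blast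
  let ?S = "cfun.span {\<lambda>z::complex^'a. cnj (ncoef u v (av z)) |u v. u \<in> polys \<and> v \<in> polys}"
  have b: "(\<lambda>z. cnj (ncoef u v (av z))) \<in> ?S" if "u \<in> polys" "v \<in> polys" for u v
    by (rule cfun.span_base) (use that in blast)
  have l: "(\<lambda>z. c * x z + d * y z) \<in> ?S" if "x \<in> ?S" "y \<in> ?S" for c d x y
    using that by (intro subspace_cadd subspace_cscale cfun.subspace_span)
  have 1: "(\<lambda>z. cnj (av z $ j) * p z) \<in> ?S"
    using l[OF b[OF polys.coord[OF uv(1), of j] uv(2)] b[OF uv(1) polys_hol_deriv_op[OF uv(2), of j]], of 1 "- 1 / (2 * \<nu>)"]
    by (simp add: p ncoef_coord_left[OF uv])
  have 2: "(\<lambda>z. av z $ j * p z) \<in> ?S"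
    using l[OF b[OF uv(1) polys.coord[OF uv(2), of j]] b[OF polys_hol_deriv_op[OF uv(1), of j] uv(2)], of "-1" "1 / (2 * \<nu>)"]
    by (simp add: p ncoef_coord_right[OF uv])
  show ?case
  proof (cases "lam > 0")
    case True
    then show ?thesis using 1 2 by (simp add: av_def vec_cnj_def)
  next
    case False
    have "(\<lambda>z. (-1) * (cnj (av z $ j) * p z)) \<in> ?S" "(\<lambda>z. (-1) * (av z $ j * p z)) \<in> ?S"
      by (rule subspace_cscale[OF cfun.subspace_span 1], rule subspace_cscale[OF cfun.subspace_span 2])
    then show ?thesis using False by (simp add: av_def)
  qed
qed

lemma rpolys_coefs: "p \<in> rpolys \<Longrightarrow> (p :: 'm::finite cfn) \<in> coefs"
proof (induction rule: rpolys.induct)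
  case (const c)
  have "(\<lambda>z::complex^'m. cnj (ncoef (\<lambda>w. 1) (\<lambda>w. 1) (av z))) \<in> coefs"
    unfolding coefs_def by (rule cfun.span_base) (use polys.const in blast)
  then have "(\<lambda>z::complex^'m. cnj (c0 TYPE('m))) \<in> coefs" by (simp add: ncoef_one[OF polys.const])
  then have "(\<lambda>z::complex^'m. c / cnj (c0 TYPE('m)) * cnj (c0 TYPE('m))) \<in> coefs"
    unfolding coefs_def by (rule subspace_cscale[OF cfun.subspace_span])
  then show ?case by (simp add: c0_nonzero)
next
  case (add p q)
  then show ?case unfolding coefs_def by (intro subspace_cadd cfun.subspace_span)
next
  case (coord p y)
  have sub: "cfun.subspace (coefs :: 'm cfn set)" unfolding coefs_def by (rule cfun.subspace_span)
  have "(\<lambda>z. \<Sum>j\<in>UNIV. 1/2 * (cnj (y $ j) * (z $ j * p z) + y $ j * (cnj (z $ j) * p z))) \<in> coefs"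
    by (rule subspace_csum[OF sub]) (intro subspace_cadd subspace_cscale sub conjunct1[OF coefs_coord] conjunct2[OF coefs_coord] coord.IH)
  moreover have "(\<Sum>j\<in>UNIV. 1/2 * (cnj (y $ j) * (z $ j * p z) + y $ j * (cnj (z $ j) * p z))) = of_real (z \<bullet> y) * p z" for z
  proof -
    have "1/2 * (cnj a * (b * P) + a * (cnj b * P)) = of_real (b \<bullet> a) * P" for a b P :: complex
    proof -
      have "cnj a * b + a * cnj b = 2 * of_real (b \<bullet> a)" by (simp add: complex_eq_iff inner_complex_def)
      then have "(cnj a * b + a * cnj b) * P = 2 * of_real (b \<bullet> a) * P" by simp
      then show ?thesis by (simp add: algebra_simps)
    qed
    then show ?thesis by (simp add: inner_vec_def sum_distrib_right)
  qed
  ultimately show ?case by (simp only:)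
qed

text \<open>The margin in \<open>gint\<close> supplies the integrability that
  \<open>moments_zero_imp_zero\<close> demands of \<open>G\<close> times the Gaussian.\<close>

theorem pairing_determines:
  fixes G :: "'m::finite cfn"
  assumes G: "gint G" and z: "\<And>u v. u \<in> polys \<Longrightarrow> v \<in> polys \<Longrightarrow> pairing G u v = 0"
  shows "G x = 0"
proof -
  obtain \<delta> where d: "\<delta> > 0" "integrable lborel (\<lambda>z. norm (G z) * exp (- (\<nu> - \<delta>) * (norm z)\<^sup>2))" and cG: "continuous_on UNIV G"
    using G by (auto simp: gint_def)
  let ?g = "\<lambda>z::complex^'m. complex_of_real (exp (- \<nu> * (norm z)\<^sup>2))"
  have ie: "integrable lborel (\<lambda>z. G z * ?g z * p z)" if "p \<in> rpolys" for p
  proof -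
    have "(\<lambda>z. exp (of_real (- \<nu> * (norm z)\<^sup>2)) * p z) \<in> gauss_polys" unfolding gauss_polys_def by (rule CollectI, rule exI, rule conjI[OF refl that])
    from gint_integrable[OF G this] show ?thesis by (simp only: exp_of_real mult.assoc)
  qed
  have rp: "p \<in> rpolys" if "p \<in> coefs" for p :: "'m cfn"
    using that unfolding coefs_def
  proof (induction rule: span_induct_fun)
    case (base p)
    then show ?case using rpolys_compose_linear[OF rpolys_cnj[OF ncoef_rpolys] linear_av] by blast
  qed (auto intro: rpolys.intros rpolys_mult)
  have "p \<in> rpolys \<and> (\<integral>z. G z * ?g z * p z \<partial>lborel) = 0" if "p \<in> coefs" for p
    using that unfolding coefs_def
  proof (induction rule: span_induct_fun)
    case (add u v)
    then show ?case using Bochner_Integration.integral_add[OF ie ie, of u v] by (simp add: distrib_left rpolys.add)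
  next
    case (scale c u)
    then show ?case by (simp add: rpolys_mult rpolys.const mult.left_commute)
  next
    case (base p)
    then obtain u v where uv: "u \<in> polys" "v \<in> polys" and p: "p = (\<lambda>z. cnj (ncoef u v (av z)))" by blast
    have "(\<integral>z. G z * ?g z * p z \<partial>lborel) = pairing G u v" unfolding pairing_def phi_eq p by (simp add: exp_of_real[symmetric] mult.assoc)
    then show ?case using z[OF uv] rpolys_compose_linear[OF rpolys_cnj[OF ncoef_rpolys[OF uv]] linear_av] by (simp add: p)
  qed (simp add: rpolys.const)
  then have m: "(\<integral>z. G z * ?g z * p z \<partial>lborel) = 0" if "p \<in> rpolys" for p using rpolys_coefs[OF that] by simp
  have "G x * ?g x = 0"
  proof (rule moments_zero_imp_zero[OF _ d(1) _ m])
    show "continuous_on UNIV (\<lambda>z. G z * ?g z)" by (intro continuous_intros cG)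
    have "norm (G z * ?g z) * exp (\<delta> * (norm z)\<^sup>2) = norm (G z) * exp (- (\<nu> - \<delta>) * (norm z)\<^sup>2)" for z
      unfolding norm_mult norm_of_real by (simp add: exp_add[symmetric] algebra_simps mult_exp_exp)
    then show "integrable lborel (\<lambda>x. norm (G x * ?g x) * exp (\<delta> * (norm x)\<^sup>2))" using d(2) by simp
  qed
  then show ?thesis by simp
qed

end

section \<open>Equivariance of matrix coefficients and pairings under K\<close>

context fockK begin

lemma av_K: "k \<in> K \<Longrightarrow> av (k *v z) = ks k *v av z"
  by (simp add: av_def ks_def vec_cnj_mult) (simp add: vec_eq_iff matrix_vector_mult_def sum_negf)

lemma ncoef_unitary:
  assumes A: "A \<in> unitary_group"
  shows "ncoef u v (A *v a) = ncoef (\<lambda>w. u (A *v w)) (\<lambda>w. v (A *v w)) (a :: complex^'n)"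
proof -
  have "vec_cnj (A *v a) = mat_cnj A *v vec_cnj a" by (rule vec_cnj_mult)
  then have b: "bvec (A *v a) = mat_cnj A *v bvec a"
    unfolding bvec_def vec_cnj_def by (simp add: vec_eq_iff matrix_vector_mult_def mat_cnj_def sum_distrib_left sum_negf mult_ac)
  have E: "E (bvec (A *v a)) (A *v w) = E (bvec a) w" for w
    unfolding E_def b cdot_unitary[OF A] ..
  show ?thesis
    using inn_unitary[OF A, of "\<lambda>w. E (bvec (A *v a)) w * u (w + A *v a)" v]
    unfolding ncoef_def E matrix_vector_right_distrib[symmetric] by simp
qed

lemma mc_K: "k \<in> K \<Longrightarrow> mc u v (k *v z) = mc (U (matrix_inv k) u) (U (matrix_inv k) v) z"
  unfolding mc_def mcoef_def norm_av U_inv_eq av_K ncoef_unitary[OF ks_unitary] by (simp add: unitary_norm[OF ks_unitary])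

lemma linear_matrix: "linear ((*v) (A :: complex^'n^'n))"
  by (rule linearI, rule matrix_vector_right_distrib) (simp add: vec_eq_iff matrix_vector_mult_def scaleR_sum_right)

lemma pairing_K:
  assumes k: "k \<in> K"
  shows "pairing (\<lambda>z. G (matrix_inv k *v z)) u v = pairing G (U (matrix_inv k) u) (U (matrix_inv k) v)"
proof -
  have "pairing (\<lambda>z. G (matrix_inv k *v z)) u v = (\<integral>z. G (matrix_inv k *v (k *v z)) * phi u v (k *v z) \<partial>lborel)"
    unfolding pairing_def by (rule integral_lborel_isometry(1)[OF linear_matrix unitary_norm[OF K_unitary[OF k]], symmetric])
  also have "\<dots> = pairing G (U (matrix_inv k) u) (U (matrix_inv k) v)"
    unfolding pairing_def by (simp add: matrix_vector_mul_assoc unitary_inv(3)[OF K_unitary[OF k]] phi_def mc_K[OF k])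
  finally show ?thesis .
qed

lemma gint_K:
  assumes k: "k \<in> K" and G: "gint G"
  shows "gint (\<lambda>z. G (matrix_inv k *v z))"
proof -
  obtain \<delta> where d: "\<delta> > 0" "integrable lborel (\<lambda>z. norm (G z) * exp (- (\<nu> - \<delta>) * (norm z)\<^sup>2))" and cG: "continuous_on UNIV G"
    using G by (auto simp: gint_def)
  note n = unitary_norm[OF K_unitary[OF K_inv[OF k]]]
  have "integrable lborel (\<lambda>z. norm (G (matrix_inv k *v z)) * exp (- (\<nu> - \<delta>) * (norm (matrix_inv k *v z))\<^sup>2))"
    by (rule integral_lborel_isometry(2)[OF linear_matrix n d(2)])
  moreover have "continuous_on UNIV (\<lambda>z. G (matrix_inv k *v z))"
    by (rule continuous_on_compose2[OF cG linear_continuous_on]) (auto intro: linear_conv_bounded_linear[THEN iffD1] linear_matrix)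
  ultimately show ?thesis using d(1) unfolding gint_def n by blast
qed

end

section \<open>Closure properties of differential operators with smooth coefficients\<close>

lemma differential_operator_cong:
  assumes "differential_operator D" "\<And>f x. smooth f \<Longrightarrow> D f x = D' f x"
  shows "differential_operator D'"
  using assms by (auto simp: differential_operator_def)

lemma differential_operatorE:
  assumes "differential_operator D"
  obtains S c where "finite S" "\<And>m. m \<in> S \<Longrightarrow> smooth (c m)" "\<And>f x. smooth f \<Longrightarrow> D f x = (\<Sum>m\<in>S. c m x * partials m f x)"
  using assms unfolding differential_operator_def by (elim exE conjE) (rule that; simp)

lemma differential_operatorI:
  assumes "finite S" "\<And>m. m \<in> S \<Longrightarrow> smooth (c m)" "\<And>f x. smooth f \<Longrightarrow> D f x = (\<Sum>m\<in>S. c m x * partials m f x)"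
  shows "differential_operator D"
  unfolding differential_operator_def using assms by (intro exI[of _ S] exI[of _ c]) simp

lemma differential_operator_zero: "differential_operator (\<lambda>f x. 0)"
  unfolding differential_operator_def by (rule exI[of _ "{}"]) simp

lemma differential_operator_add:
  assumes "differential_operator D" "differential_operator D'"
  shows "differential_operator (\<lambda>f x. D f x + D' f x)"
proof -
  from assms(1) obtain S c where S: "finite S" "\<And>m. m \<in> S \<Longrightarrow> smooth (c m)" "\<And>f x. smooth f \<Longrightarrow> D f x = (\<Sum>m\<in>S. c m x * partials m f x)"
    by (rule differential_operatorE) (rule that)
  from assms(2) obtain S' c' where S': "finite S'" "\<And>m. m \<in> S' \<Longrightarrow> smooth (c' m)" "\<And>f x. smooth f \<Longrightarrow> D' f x = (\<Sum>m\<in>S'. c' m x * partials m f x)"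
    by (rule differential_operatorE) (rule that)
  define d where "d m x = (if m \<in> S then c m x else 0) + (if m \<in> S' then c' m x else 0)" for m x
  have "smooth (d m)" for m
    unfolding d_def by (cases "m \<in> S"; cases "m \<in> S'") (simp_all add: smooth_add S(2) S'(2))
  moreover have "D f x + D' f x = (\<Sum>m\<in>S \<union> S'. d m x * partials m f x)" if "smooth f" for f x
  proof -
    have "(\<Sum>m\<in>S. c m x * partials m f x) = (\<Sum>m\<in>S \<union> S'. (if m \<in> S then c m x else 0) * partials m f x)"
      by (rule sum.mono_neutral_cong_left) (auto simp: S S')
    moreover have "(\<Sum>m\<in>S'. c' m x * partials m f x) = (\<Sum>m\<in>S \<union> S'. (if m \<in> S' then c' m x else 0) * partials m f x)"
      by (rule sum.mono_neutral_cong_left) (auto simp: S S')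
    ultimately show ?thesis by (simp only: S(3)[OF that] S'(3)[OF that] d_def distrib_right sum.distrib)
  qed
  ultimately show ?thesis by (intro differential_operatorI[of "S \<union> S'" d]) (simp_all add: S(1) S'(1))
qed

lemma differential_operator_mult:
  assumes "differential_operator D" "smooth a"
  shows "differential_operator (\<lambda>f x. a x * D f x)"
proof -
  from assms(1) obtain S c where S: "finite S" "\<And>m. m \<in> S \<Longrightarrow> smooth (c m)" "\<And>f x. smooth f \<Longrightarrow> D f x = (\<Sum>m\<in>S. c m x * partials m f x)"
    by (rule differential_operatorE) (rule that)
  show ?thesis
    by (rule differential_operatorI[of S "\<lambda>m x. a x * c m x"]) (simp_all add: S assms(2) smooth_mult sum_distrib_left mult.assoc)
qed

lemma differential_operator_sum:
  "(\<And>i. i \<in> I \<Longrightarrow> differential_operator (D i)) \<Longrightarrow> differential_operator (\<lambda>f x. \<Sum>i\<in>I. D i f x)"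
  by (induction I rule: infinite_finite_induct) (simp_all add: differential_operator_zero differential_operator_add)

lemma smooth_dir_derivs: "smooth f \<Longrightarrow> smooth (foldr dir_deriv bs f)"
  by (induction bs) (simp_all add: smooth_dir_deriv)

text \<open>Derivatives of smooth functions commute, so a word may be rearranged into the order
  fixed by \<open>partials\<close>.\<close>

lemma differential_operator_partials:
  assumes "set bs \<subseteq> Basis"
  shows "differential_operator (\<lambda>f. foldr dir_deriv bs f)"
proof -
  have "foldr dir_deriv bs f x = partials (count_list bs) f x" if f: "smooth f" for f :: "'a \<Rightarrow> complex" and x
  proof -
    have "count_list bs j = count_list (mword Basis (count_list bs)) j" for j
      using assms count_list_0_iff[of bs j] by (auto simp: count_mword)
    then have "mset bs = mset (mword Basis (count_list bs))"
      by (intro multiset_eqI) (simp add: count_mset)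
    from foldr_mset_commute[where C="Collect smooth" and W=dir_deriv, OF _ _ this] f
    show ?thesis by (simp add: partials_def ops_power_mword smooth_dir_deriv dir_deriv_commute)
  qed
  then show ?thesis by (intro differential_operatorI[of "{count_list bs}" "\<lambda>m x. 1"]) simp_all
qed

lemma differential_operator_dir_deriv:
  assumes "differential_operator D"
  shows "differential_operator (\<lambda>f. dir_deriv b (D f))"
proof -
  from assms obtain S c where S: "finite S" "\<And>m. m \<in> S \<Longrightarrow> smooth (c m)" "\<And>f x. smooth f \<Longrightarrow> D f x = (\<Sum>m\<in>S. c m x * partials m f x)"
    by (rule differential_operatorE) (rule that)
  let ?p = "\<lambda>m. foldr dir_deriv (mword Basis m)"
  have set: "set (mword Basis m) \<subseteq> (Basis :: 'a set)" for m
    by (auto simp: mword_def enum_list)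
  have p: "differential_operator (?p m)" "differential_operator (\<lambda>f. dir_deriv \<beta> (?p m f))" if "\<beta> \<in> Basis" for m :: "'a \<Rightarrow> nat" and \<beta>
    using differential_operator_partials[OF set[of m]] differential_operator_partials[of "\<beta> # mword Basis m"] set[of m] that by simp_all
  have "differential_operator (\<lambda>f x. \<Sum>m\<in>S. dir_deriv b (c m) x * ?p m f x + (\<Sum>\<beta>\<in>Basis. (c m x * of_real (b \<bullet> \<beta>)) * dir_deriv \<beta> (?p m f) x))"
    by (intro differential_operator_sum differential_operator_add differential_operator_mult p smooth_dir_deriv smooth_mult smooth_const)
       (use S(2) SOME_Basis in auto)
  then show ?thesis
  proof (rule differential_operator_cong)
    fix f :: "'a \<Rightarrow> complex" and x assume f: "smooth f"
    have D: "D f = (\<lambda>x. \<Sum>m\<in>S. c m x * ?p m f x)" using S(3)[OF f] by (simp add: fun_eq_iff partials_def ops_power_mword)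
    have d: "smooth (?p m f)" for m by (rule smooth_dir_derivs[OF f])
    have l: "dir_deriv b h x = (\<Sum>\<beta>\<in>Basis. of_real (b \<bullet> \<beta>) * dir_deriv \<beta> h x)" if "smooth h" for h
      using dir_deriv_linear_sum[OF smooth_differentiable[OF that], of "\<lambda>\<beta>. b \<bullet> \<beta>" "\<lambda>\<beta>. \<beta>" Basis x] by (simp add: euclidean_representation)
    have "dir_deriv b (D f) x = (\<Sum>m\<in>S. dir_deriv b (\<lambda>x. c m x * ?p m f x) x)"
      unfolding D by (intro dir_deriv_sum S smooth_differentiable smooth_mult d) (use S(2) in auto)
    also have "\<dots> = (\<Sum>m\<in>S. dir_deriv b (c m) x * ?p m f x + (\<Sum>\<beta>\<in>Basis. (c m x * of_real (b \<bullet> \<beta>)) * dir_deriv \<beta> (?p m f) x))"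
      using S(2) by (intro sum.cong refl, subst dir_deriv_mult)
        (auto intro: smooth_differentiable d simp: l[OF d] sum_distrib_left mult.assoc)
    finally show "(\<Sum>m\<in>S. dir_deriv b (c m) x * ?p m f x + (\<Sum>\<beta>\<in>Basis. (c m x * of_real (b \<bullet> \<beta>)) * dir_deriv \<beta> (?p m f) x)) = dir_deriv b (D f) x" ..
  qed
qed

section \<open>Invariant differential operators on the Heisenberg group\<close>

text \<open>The left invariant field with value \<open>(b, 0)\<close> at the origin; its central
  component comes from the group law.\<close>

definition hX :: "complex^'n \<Rightarrow> ('n::finite heis \<Rightarrow> complex) \<Rightarrow> 'n heis \<Rightarrow> complex" where
  "hX b f x = dir_deriv (b, 2 * Im (cdot (fst x) (vec_cnj b))) f x"

definition hZ :: "'n + 'n \<Rightarrow> ('n::finite heis \<Rightarrow> complex) \<Rightarrow> 'n heis \<Rightarrow> complex" where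
  "hZ x f p = letter x (\<lambda>b. hX b f p)"

lemma hX_split: "smooth f \<Longrightarrow> hX b f x = dir_deriv (b, 0) f x + of_real (2 * Im (cdot (fst x) (vec_cnj b))) * dir_deriv (0, 1) f x"
  using dir_deriv_linear[OF smooth_differentiable, of f 1 "(b, 0)" "2 * Im (cdot (fst x) (vec_cnj b))" "(0, 1)" x]
  by (simp add: hX_def)

lemma cdot_cnj_simps: "vec_cnj (a + b) = vec_cnj a + vec_cnj b" "vec_cnj (r *\<^sub>R a) = r *\<^sub>R vec_cnj a"
  "cdot (r *\<^sub>R a) c = of_real r * cdot a c" "cdot c (r *\<^sub>R a) = of_real r * cdot c a"
  by (simp_all add: vec_cnj_def vec_eq_iff cdot_def sum_distrib_left scaleR_conv_of_real[where 'a=complex] mult_ac)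

lemma linear_Im_cdot: "linear (\<lambda>z::complex^'n::finite. Im (cdot z c))"
  by (rule linearI) (simp_all add: cdot_add cdot_cnj_simps)

lemma smooth_hX_coeff: "smooth (\<lambda>x::'n::finite heis. of_real (2 * Im (cdot (fst x) c)))"
proof (rule smooth_bounded_linear)
  have "linear (\<lambda>x::'n heis. complex_of_real (2 * Im (cdot (fst x) c)))"
    by (rule linearI) (simp_all add: linear_add[OF linear_Im_cdot] linear_cmul[OF linear_Im_cdot] algebra_simps scaleR_conv_of_real[where 'a=complex])
  then show "bounded_linear (\<lambda>x::'n heis. complex_of_real (2 * Im (cdot (fst x) c)))" by (simp add: linear_conv_bounded_linear)
qed

lemma hX_smooth: "smooth f \<Longrightarrow> smooth (hX b f)"
proof -
  assume f: "smooth f"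
  have "hX b f = (\<lambda>x. dir_deriv (b, 0) f x + of_real (2 * Im (cdot (fst x) (vec_cnj b))) * dir_deriv (0, 1) f x)"
    using hX_split[OF f] by (intro HOL.ext)
  then show ?thesis by (simp only:) (intro smooth_add smooth_mult smooth_hX_coeff smooth_dir_deriv f)
qed

lemma hZ_smooth: "smooth f \<Longrightarrow> smooth (hZ x f)"
proof -
  assume f: "smooth f"
  obtain c d j where "\<And>X. letter x X = c * X (axis j 1) + d * X (axis j \<i>)" by (rule letter_eq[of x]) (rule that)
  then show ?thesis unfolding hZ_def[abs_def] by (simp only:) (intro smooth_add smooth_mult smooth_const hX_smooth f)
qed

lemma hZs_smooth: "smooth f \<Longrightarrow> smooth (foldr hZ xs f)"
  by (induction xs) (simp_all add: hZ_smooth)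

lemma differential_operator_hZs: "differential_operator (foldr hZ xs)"
proof (induction xs)
  case Nil
  show ?case using differential_operator_partials[of "[]"] by simp
next
  case (Cons x xs)
  obtain c d j where Z: "\<And>X. letter x X = c * X (axis j 1) + d * X (axis j \<i>)" by (rule letter_eq[of x]) (rule that)
  have X: "differential_operator (\<lambda>f p. dir_deriv (b, 0) (foldr hZ xs f) p + of_real (2 * Im (cdot (fst p) (vec_cnj b))) * dir_deriv (0, 1) (foldr hZ xs f) p)" for b
    by (intro differential_operator_add differential_operator_mult differential_operator_dir_deriv Cons.IH smooth_hX_coeff)
  have X': "differential_operator (\<lambda>f. hX b (foldr hZ xs f))" for b
    by (rule differential_operator_cong[OF X]) (rule hX_split[symmetric], rule hZs_smooth)
  have "differential_operator (\<lambda>f p. c * hX (axis j 1) (foldr hZ xs f) p + d * hX (axis j \<i>) (foldr hZ xs f) p)"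
    by (intro differential_operator_add differential_operator_mult smooth_const X')
  then show ?case by (rule differential_operator_cong) (simp add: hZ_def[of x] Z)
qed

lemma hmult_affine: "hmult g x = (fst x, snd x + 2 * Im (cdot (fst g) (vec_cnj (fst x)))) + g"
  by (cases g; cases x) (simp add: add.commute)

lemma linear_hmult: "linear (\<lambda>x::'n::finite heis. (fst x, snd x + 2 * Im (cdot z (vec_cnj (fst x)))))"
  by (rule linearI) (simp_all add: cdot_add cdot_cnj_simps algebra_simps)

lemma dir_deriv_hmult: "smooth f \<Longrightarrow> dir_deriv b (\<lambda>x. f (hmult g x)) x = dir_deriv (fst b, snd b + 2 * Im (cdot (fst g) (vec_cnj (fst b)))) f (hmult g x)"
  unfolding hmult_affine by (rule dir_deriv_affine[OF smooth_differentiable linear_hmult])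

lemma hX_hmult: "smooth f \<Longrightarrow> hX b (\<lambda>x. f (hmult g x)) = (\<lambda>x. hX b f (hmult g x))"
  by (rule HOL.ext) (simp only: hX_def dir_deriv_hmult, simp add: hmult_affine cdot_add algebra_simps)

lemma hZs_hmult: "smooth f \<Longrightarrow> foldr hZ xs (\<lambda>x. f (hmult g x)) = (\<lambda>x. foldr hZ xs f (hmult g x))"
proof (induction xs)
  case (Cons x xs)
  have "hZ x (\<lambda>p. h (hmult g p)) = (\<lambda>p. hZ x h (hmult g p))" if "smooth h" for h
    by (rule HOL.ext) (simp add: hZ_def hX_hmult[OF that])
  then show ?case using Cons by (simp add: hZs_smooth)
qed simp

lemma linear_hact: "linear (hact (k :: complex^'n::finite^'n))"
proof -
  have "hact k x = (k *v fst x, snd x)" for x by (cases x) simp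
  then have e: "hact k = (\<lambda>x. (k *v fst x, snd x))" by (rule HOL.ext)
  show ?thesis unfolding e
    by (rule linearI, simp add: matrix_vector_right_distrib) (simp add: vec_eq_iff matrix_vector_mult_def scaleR_sum_right)
qed

lemma hact_eq: "hact k x = (k *v fst x, snd x)" by (cases x) simp

lemma smooth_hact: "smooth f \<Longrightarrow> smooth (\<lambda>x. f (hact k x))"
  using smooth_affine[OF _ linear_hact, of f k 0] by simp

lemma dir_deriv_hact: "smooth f \<Longrightarrow> dir_deriv b (\<lambda>x. f (hact k x)) x = dir_deriv (hact k b) f (hact k x)"
  using dir_deriv_affine[OF smooth_differentiable linear_hact, of f b k 0 x] by simp

text \<open>Inverts \<open>letter\<close>: the real fields are combinations of the complex ones, by
  which the action of \<open>K\<close> on fields becomes an action on letters.\<close>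

lemma hX_axes:
  assumes f: "smooth f"
  shows "hX b f x = (\<Sum>l\<in>UNIV. cnj (b $ l) * hZ (Inl l) f x - b $ l * hZ (Inr l) f x)"
proof -
  define v where "v b = (b, 2 * Im (cdot (fst x) (vec_cnj b)))" for b :: "complex^'a"
  have lin: "linear v" unfolding v_def by (rule linearI) (simp_all add: cdot_add cdot_cnj_simps algebra_simps)
  have b: "b = (\<Sum>l\<in>UNIV. Re (b $ l) *\<^sub>R axis l 1 + Im (b $ l) *\<^sub>R axis l \<i>)"
    by (simp add: vec_eq_iff axis_def if_distrib[of "scaleR _"] sum.distrib complex_eq_iff cong: if_cong)
  have "hX b f x = dir_deriv (\<Sum>l\<in>UNIV. 1 *\<^sub>R (Re (b $ l) *\<^sub>R v (axis l 1) + Im (b $ l) *\<^sub>R v (axis l \<i>))) f x"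
    unfolding hX_def v_def[symmetric] by (subst b) (simp only: linear_sum[OF lin] linear_add[OF lin] linear_cmul[OF lin] scaleR_one)
  also have "\<dots> = (\<Sum>l\<in>UNIV. of_real (Re (b $ l)) * hX (axis l 1) f x + of_real (Im (b $ l)) * hX (axis l \<i>) f x)"
    unfolding dir_deriv_linear_sum[OF smooth_differentiable[OF f]] dir_deriv_linear[OF smooth_differentiable[OF f]] hX_def v_def by simp
  also have "\<dots> = (\<Sum>l\<in>UNIV. cnj (b $ l) * hZ (Inl l) f x - b $ l * hZ (Inr l) f x)"
  proof (rule sum.cong[OF refl])
    fix l
    have "of_real (Re c) * A + of_real (Im c) * B = cnj c * (1/2 * (A + \<i> * B)) - c * (- (1/2) * (A - \<i> * B))" for c A B
    proof -
      have "of_real (Re c) = (c + cnj c) / 2" "of_real (Im c) = \<i> * (cnj c - c) / 2" by (simp_all add: complex_eq_iff)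
      then show ?thesis by (simp only:) (simp add: field_simps)
    qed
    then show "of_real (Re (b $ l)) * hX (axis l 1) f x + of_real (Im (b $ l)) * hX (axis l \<i>) f x = cnj (b $ l) * hZ (Inl l) f x - b $ l * hZ (Inr l) f x"
      by (simp add: hZ_def letter_def)
  qed
  finally show ?thesis .
qed

context fockK begin

lemma hX_hact:
  assumes k: "k \<in> K" and f: "smooth f"
  shows "hX b (\<lambda>x. f (hact k x)) x = hX (k *v b) f (hact k x)"
  unfolding hX_def dir_deriv_hact[OF f] by (simp add: hact_eq vec_cnj_mult cdot_unitary[OF K_unitary[OF k]])

text \<open>The fields transform by the same matrix \<open>\<kappa> k\<close> as the operators on
  polynomials in \<open>op_ks\<close>. This is why one notion of invariant tensor serves both
  sides.\<close>

lemma hZ_hact: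
  assumes k: "k \<in> K" and f: "smooth f"
  shows "hZ x (\<lambda>x. f (hact k x)) = (\<lambda>p. \<Sum>y\<in>UNIV. \<kappa> k y x * hZ y f (hact k p))"
proof
  fix p
  have c: "(k *v axis j c) $ l = k $ l $ j * c" for l j c
    by (simp add: matrix_vector_mult_def axis_def if_distrib cong: if_cong)
  show "hZ x (\<lambda>x. f (hact k x)) p = (\<Sum>y\<in>UNIV. \<kappa> k y x * hZ y f (hact k p))"
    unfolding hZ_def[of x] hX_hact[OF k f] hX_axes[OF f] c sum_UNIV_Plus
    by (cases x) (simp_all add: letter_def c sum_distrib_left sum.distrib[symmetric] sum_subtractf[symmetric] algebra_simps)
qed

lemma smooth_subspace: "cfun.subspace (Collect smooth)"
  by (rule subspaceI_fun) (simp_all add: smooth_add smooth_mult)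

lemma lin_on_hZ: "lin_on (Collect smooth) (hZ x)"
  unfolding lin_on_def
  by (auto simp: fun_eq_iff hZ_def letter_def hX_def dir_deriv_add dir_deriv_cmult smooth_differentiable algebra_simps split: sum.splits)

definition DT :: "nat \<Rightarrow> (('n + 'n) list \<Rightarrow> complex) \<Rightarrow> ('n heis \<Rightarrow> complex) \<Rightarrow> 'n heis \<Rightarrow> complex" where
  "DT N e f = (\<lambda>x. \<Sum>xs\<in>words N. e xs * foldr hZ xs f x)"

theorem DT_invariant:
  assumes e: "inv_tensor N e"
  shows "DT N e \<in> invariant_operators K"
  unfolding invariant_operators_def
proof (intro CollectI conjI allI impI ballI)
  show "differential_operator (DT N e)" unfolding DT_def[abs_def]
    by (intro differential_operator_sum differential_operator_mult smooth_const differential_operator_hZs)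
  fix f :: "'n heis \<Rightarrow> complex" assume f: "smooth f"
  show "DT N e (\<lambda>x. f (hmult g x)) = (\<lambda>x. DT N e f (hmult g x))" for g
    by (simp add: DT_def hZs_hmult[OF f])
  show "DT N e (\<lambda>x. f (hact k x)) = (\<lambda>x. DT N e f (hact k x))" if k: "k \<in> K" for k
  proof
    fix p
    have "foldr hZ xs (\<lambda>x. f (hact k x)) p = (\<Sum>ys\<in>words N. tensor_power (\<kappa> k) ys xs * foldr hZ ys f (hact k p))"
      if "xs \<in> words N" for xs
    proof -
      have "foldr hZ xs (\<lambda>x. f (hact k x)) = (\<lambda>p. \<Sum>ys\<in>words (length xs). tensor_power (\<kappa> k) ys xs * foldr hZ ys f (hact k p))"
        by (rule foldr_intertwine[where R="\<lambda>f x. f (hact k x)", OF smooth_subspace lin_on_hZ])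
           (simp_all add: f hZ_smooth smooth_hact hZ_hact[OF k])
      then show ?thesis using that by (simp add: words_def)
    qed
    then show "DT N e (\<lambda>x. f (hact k x)) p = DT N e f (hact k p)"
      unfolding DT_def by (rule inv_tensor_contract[OF e k])
  qed
qed

lemma dt_invariant: "dir_deriv (0, 1) \<in> invariant_operators K"
  unfolding invariant_operators_def
proof (intro CollectI conjI allI impI ballI)
  show "differential_operator (dir_deriv (0::complex^'n, 1::real))"
    using differential_operator_dir_deriv[OF differential_operator_partials[of "[]"]] by simp
qed (rule HOL.ext, simp only: dir_deriv_hmult dir_deriv_hact, simp add: vec_cnj_def cdot_def hact_eq)+

end

section \<open>Functions with a fixed character of the centre\<close>

context fock begin

definition tens :: "'m::finite cfn \<Rightarrow> 'm heis \<Rightarrow> complex" where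
  "tens g x = exp (\<i> * of_real (lam * snd x)) * g (fst x)"

lemma linear_phase: "bounded_linear (\<lambda>x::'m::finite heis. \<i> * complex_of_real (lam * snd x))"
  unfolding linear_conv_bounded_linear[symmetric] by (rule linearI) (simp_all add: algebra_simps scaleR_conv_of_real)

lemma dir_deriv_tens:
  assumes g: "smooth g"
  shows "dir_deriv b (tens g) x = exp (\<i> * of_real (lam * snd x)) * (dir_deriv (fst b) g (fst x) + \<i> * of_real (lam * snd b) * g (fst x))"
proof (rule dir_deriv_eqI)
  from has_derivative_mult[OF has_derivative_cexp[OF bounded_linear_imp_has_derivative[OF linear_phase]] has_derivative_compose[OF bounded_linear_imp_has_derivative[OF bounded_linear_fst] smooth_has_derivative[OF g]]]
  show "(tens g has_derivative (\<lambda>b. exp (\<i> * of_real (lam * snd x)) * (dir_deriv (fst b) g (fst x) + \<i> * of_real (lam * snd b) * g (fst x)))) (at x)"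
    unfolding tens_def[abs_def] by (rule has_derivative_eq_rhs) (simp add: fun_eq_iff algebra_simps)
qed

lemma hZ_tens: "smooth g \<Longrightarrow> hZ x (tens g) = tens (ltw x g)"
proof
  fix p assume g: "smooth g"
  have X: "hX b (tens g) p = exp (\<i> * of_real (lam * snd p)) * tw b g (fst p)" for b
    unfolding hX_def dir_deriv_tens[OF g] tw_def by (simp add: algebra_simps)
  show "hZ x (tens g) p = tens (ltw x g) p"
    by (cases x) (simp_all add: hZ_def letter_def X tens_def ltw_def algebra_simps)
qed

lemma hZs_tens: "smooth g \<Longrightarrow> foldr hZ xs (tens g) = tens (foldr ltw xs g)"
  by (induction xs) (simp_all add: hZ_tens ltws_smooth)

end

context fock begin

lemma fock_rep_eq:
  "fock_rep lam (z, t) u w = exp (\<i> * of_real (lam * t)) * exp (of_real (- \<nu> * (norm z)\<^sup>2)) * (E (bvec (av z)) w * u (w + av z))"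
proof (cases "lam > 0")
  case True
  have "cdot w (bvec (vec_cnj z)) = - 2 * of_real lam * cdot w z"
    using True by (simp add: cdot_def bvec_def vec_cnj_def \<nu>_def sum_distrib_left mult_ac sum_negf)
  then show ?thesis using True by (simp add: av_def \<nu>_def E_def exp_add[symmetric] mult_ac algebra_simps mult_exp_exp)
next
  case False
  have "cdot w (bvec (- z)) = - 2 * of_real lam * cdot w (vec_cnj z)"
    using False by (simp add: cdot_def bvec_def vec_cnj_def \<nu>_def sum_distrib_left mult_ac sum_negf)
  then show ?thesis using False by (simp add: av_def \<nu>_def E_def exp_add[symmetric] mult_ac algebra_simps mult_exp_exp)
qed

lemma inn_fock_rep: "inn (fock_rep lam (z, t) u) v = exp (\<i> * of_real (lam * t)) * mc u v z"
proof -
  have "fock_rep lam (z, t) u = (\<lambda>w. (exp (\<i> * of_real (lam * t)) * exp (of_real (- \<nu> * (norm z)\<^sup>2))) * (E (bvec (av z)) w * u (w + av z)))"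
    by (rule HOL.ext) (simp only: fock_rep_eq)
  then show ?thesis by (simp only: inn_cmult_left mc_def mcoef_def ncoef_def norm_av mult.assoc)
qed

lemma mc_0: "mc u v 0 = inn u v"
proof -
  have "av 0 = (0 :: complex^'a)" using linear_0[OF linear_av] .
  moreover have "bvec 0 = (0 :: complex^'a)" by (simp add: bvec_def vec_eq_iff)
  ultimately show ?thesis by (simp add: mc_def mcoef_def ncoef_def)
qed

lemma mc_sum_left: "(\<And>i. i \<in> S \<Longrightarrow> u i \<in> polys) \<Longrightarrow> v \<in> polys \<Longrightarrow> mc (\<lambda>w. \<Sum>i\<in>S. c i * u i w) v z = (\<Sum>i\<in>S. c i * mc (u i) v z)"
  unfolding mc_def mcoef_def
  by (subst ncoef_sum_left) (auto intro: polys_cmult simp: ncoef_scale_left sum_distrib_left mult_ac)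

lemma mc_sum_right: "(\<And>i. i \<in> S \<Longrightarrow> v i \<in> polys) \<Longrightarrow> u \<in> polys \<Longrightarrow> mc u (\<lambda>w. \<Sum>i\<in>S. c i * v i w) z = (\<Sum>i\<in>S. cnj (c i) * mc u (v i) z)"
  unfolding mc_def mcoef_def
  by (subst ncoef_sum_right) (auto intro: polys_cmult simp: ncoef_scale_right sum_distrib_left mult_ac)

lemma lin_on_tw: "lin_on (Collect smooth) (tw b)"
  unfolding lin_on_def
  by (auto simp: fun_eq_iff tw_def dir_deriv_add dir_deriv_cmult smooth_differentiable algebra_simps)

lemma lin_on_ltws: "lin_on (Collect smooth) (foldr ltw xs)"
proof (induction xs)
  case (Cons x xs)
  have l: "lin_on (Collect smooth) (ltw x)"
  proof -
    have t: "tw b (\<lambda>w. u w + v w) z = tw b u z + tw b v z" "tw b (\<lambda>w. c * u w) z = c * tw b u z"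
      if "smooth u" "smooth v" for b u v c z
      using fun_cong[OF lin_onD(1)[OF lin_on_tw, of u v b], of z] fun_cong[OF lin_onD(2)[OF lin_on_tw, of u b c], of z] that by simp_all
    show ?thesis unfolding lin_on_def by (cases x) (auto simp: fun_eq_iff ltw_def letter_def t algebra_simps)
  qed
  have "lin_on (Collect smooth) (\<lambda>u. ltw x (foldr ltw xs u))"
    by (rule lin_on_compose[OF Cons _ l]) (simp add: ltws_smooth)
  then show ?case by (simp add: comp_def)
qed (simp add: lin_on_def)

end

section \<open>Averaging over K\<close>

locale haar = mult_free lam K \<Lambda> V for lam :: real and K :: "(complex^'n::finite^'n) set" and \<Lambda> :: "'i set"
    and V :: "'i \<Rightarrow> 'n cfn set" +
  fixes dk :: "(complex^'n^'n) measure"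
  assumes cK: "compact K" and haar: "normalized_haar K dk"
begin

lemma prob_dk: "prob_space dk"
  using haar by (intro prob_spaceI) (simp add: normalized_haar_def)

lemma dk_measurable: "continuous_on K h \<Longrightarrow> h \<in> borel_measurable dk"
  using borel_measurable_continuous_on_restrict[of K h] haar
  by (simp add: normalized_haar_def cong: measurable_cong_sets)

lemma dk_integrable:
  fixes h :: "complex^'n^'n \<Rightarrow> complex"
  assumes "continuous_on K h" shows "integrable dk h"
proof -
  interpret prob_space dk by (rule prob_dk)
  have "bounded (h ` K)" by (rule compact_imp_bounded[OF compact_continuous_image[OF assms cK]])
  then obtain C where C: "\<And>k. k \<in> K \<Longrightarrow> norm (h k) \<le> C" by (auto simp: bounded_iff)
  have "space dk = K" using haar by (simp add: normalized_haar_def)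
  then show ?thesis using C by (intro integrable_const_bound[of _ C] AE_I2 dk_measurable assms) auto
qed

lemma dk_const: "(\<integral>k. c \<partial>dk) = (c::complex)"
  using prob_space.prob_space[OF prob_dk] by simp

lemma dk_cong: "(\<And>k. k \<in> K \<Longrightarrow> f k = g k) \<Longrightarrow> (\<integral>k. f k \<partial>dk) = (\<integral>k. g k \<partial>dk)"
  using haar by (intro Bochner_Integration.integral_cong) (auto simp: normalized_haar_def)

lemma dk_left_invariant:
  fixes h :: "complex^'n^'n \<Rightarrow> complex"
  assumes l: "l \<in> K" and h: "continuous_on K h"
  shows "(\<integral>k. h (l ** k) \<partial>dk) = (\<integral>k. h k \<partial>dk)"
proof -
  have sp: "space dk = K" and st: "sets dk = sets (restrict_space borel K)" and d: "distr dk dk (\<lambda>x. l ** x) = dk"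
    using haar l by (auto simp: normalized_haar_def)
  have "continuous_on K (\<lambda>x. l ** x)"
    unfolding matrix_matrix_mult_def by (intro continuous_intros continuous_on_vec_lambda)
  then have "(\<lambda>x. l ** x) \<in> measurable (restrict_space borel K) (restrict_space borel K)"
    by (intro measurable_restrict_space2 borel_measurable_continuous_on_restrict) (auto simp: K_mult l space_restrict_space)
  then have m: "(\<lambda>x. l ** x) \<in> measurable dk dk" using st by (simp cong: measurable_cong_sets)
  have "(\<integral>k. h (l ** k) \<partial>dk) = (\<integral>k. h k \<partial>distr dk dk (\<lambda>x. l ** x))"
    by (rule integral_distr[OF m dk_measurable[OF h], symmetric])
  then show ?thesis unfolding d .
qed

text \<open>The coordinates of \<open>ks k *v w\<close> are linear in the entries of
  \<open>ks k\<close>, so the induction writes the coefficient through these entries and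
  coefficients of lower degree.\<close>

lemma continuous_coef:
  "u \<in> polys \<Longrightarrow> p \<in> polys \<Longrightarrow> continuous_on S (\<lambda>k. inn (\<lambda>w. u (ks k *v w)) p)"
proof (induction arbitrary: p rule: polys.induct)
  case (const c)
  then show ?case by simp
next
  case (add u v)
  have "inn (\<lambda>w. u (ks k *v w) + v (ks k *v w)) p = inn (\<lambda>w. u (ks k *v w)) p + inn (\<lambda>w. v (ks k *v w)) p" for k
    by (intro inn_add_left polys_compose_matrix add.hyps add.prems)
  then show ?case using add.IH[OF add.prems] by (simp add: continuous_on_add)
next
  case (coord u j)
  have e: "inn (\<lambda>w. (ks k *v w) $ j * u (ks k *v w)) p =
     (\<Sum>i\<in>UNIV. ks k $ j $ i * (inn (\<lambda>w. u (ks k *v w)) (hol_deriv_op i p) / (2 * \<nu>)))" for k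
  proof -
    have u: "(\<lambda>w. u (ks k *v w)) \<in> polys" by (rule polys_compose_matrix[OF coord.hyps])
    have "inn (\<lambda>w. (ks k *v w) $ j * u (ks k *v w)) p = inn (\<lambda>w. \<Sum>i\<in>UNIV. ks k $ j $ i * (w $ i * u (ks k *v w))) p"
      by (simp add: matrix_vector_mult_def sum_distrib_right mult.assoc)
    also have "\<dots> = (\<Sum>i\<in>UNIV. inn (\<lambda>w. ks k $ j $ i * (w $ i * u (ks k *v w))) p)"
      by (intro inn_sum_left polys_cmult polys.coord u coord.prems)
    finally show ?thesis by (simp only: inn_cmult_left inn_coord_left[OF u coord.prems])
  qed
  have "continuous_on S (\<lambda>k. ks k $ j $ i)" for i
    by (cases "lam > 0") (simp_all add: ks_def mat_cnj_def, intro continuous_intros, intro continuous_intros)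
  then show ?case unfolding e using \<nu>_pos
    by (intro continuous_on_sum continuous_on_mult continuous_on_divide continuous_on_const coord.IH polys_hol_deriv_op coord.prems) auto
qed

section \<open>The eigenvalue of the spherical function\<close>

text \<open>The spherical function without its central factor, written as a finite sum of matrix
  coefficients. The integral over \<open>K\<close> sits in the scalars, so derivatives do not have
  to pass under it.\<close>

definition sph :: "'i \<Rightarrow> 'n cfn \<Rightarrow> 'n cfn" where
  "sph \<alpha> v z = (\<Sum>(e, e')\<in>BV \<alpha> \<times> BV \<alpha>.
     (\<integral>k. inn (\<lambda>w. v (ks k *v w)) e * cnj (inn (\<lambda>w. v (ks k *v w)) e') \<partial>dk) * mc e e' z)"

lemma BV_polys: "\<alpha> \<in> \<Lambda> \<Longrightarrow> e \<in> BV \<alpha> \<Longrightarrow> e \<in> polys"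
  using BV(1) by (auto simp: onb_def)

text \<open>Translates of \<open>v\<close> stay in \<open>V \<alpha>\<close>, so
  \<open>mc v v (k *v z)\<close> expands in the coefficients of an orthonormal basis of that
  space.\<close>

lemma spherical_function_eq:
  assumes a: "\<alpha> \<in> \<Lambda>" and v: "v \<in> V \<alpha>"
  shows "spherical_function dk lam v = tens (sph \<alpha> v)"
proof
  fix x :: "'n heis"
  obtain z t where x: "x = (z, t)" by (cases x)
  let ?a = "\<lambda>k e. inn (\<lambda>w. v (ks k *v w)) e"
  have vp: "v \<in> polys" using V_polys[OF a] v by blast
  have mcK: "mc v v (k *v z) = (\<Sum>(e, e')\<in>BV \<alpha> \<times> BV \<alpha>. (?a k e * cnj (?a k e')) * mc e e' z)" if k: "k \<in> K" for k
  proof -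
    let ?u = "U (matrix_inv k) v"
    have u: "?u = (\<lambda>w. v (ks k *v w))" by (rule U_inv_eq[OF k])
    have "?u \<in> V \<alpha>" by (rule V_inv[OF a K_inv[OF k] v])
    then have "proj (BV \<alpha>) ?u = ?u" using proj_id[OF BV(1)[OF a]] BV(2)[OF a] by simp
    then have p: "?u = (\<lambda>w. \<Sum>e\<in>BV \<alpha>. ?a k e * e w)" unfolding proj_def u by simp
    have "mc v v (k *v z) = mc ?u ?u z" by (rule mc_K[OF k])
    also have "\<dots> = (\<Sum>e\<in>BV \<alpha>. ?a k e * mc e ?u z)"
      by (subst (1) p, rule mc_sum_left) (auto intro: BV_polys[OF a] U_polys vp)
    also have "\<dots> = (\<Sum>e\<in>BV \<alpha>. ?a k e * (\<Sum>e'\<in>BV \<alpha>. cnj (?a k e') * mc e e' z))"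
      by (subst p, intro sum.cong refl arg_cong2[where f="(*)"] mc_sum_right) (auto intro: BV_polys[OF a])
    finally show ?thesis by (simp add: sum_distrib_left sum.cartesian_product mult_ac)
  qed
  have int: "integrable dk (\<lambda>k. (?a k e * cnj (?a k e')) * mc e e' z)" if "e \<in> BV \<alpha>" "e' \<in> BV \<alpha>" for e e'
    using that by (intro dk_integrable continuous_intros continuous_coef vp BV_polys[OF a])
  have "spherical_function dk lam v x = (\<integral>k. exp (\<i> * of_real (lam * t)) * mc v v (k *v z) \<partial>dk)"
    unfolding spherical_function_def x by (simp only: hact.simps inn_fock_rep)
  also have "\<dots> = exp (\<i> * of_real (lam * t)) * (\<integral>k. mc v v (k *v z) \<partial>dk)" by (rule integral_mult_right_zero)
  also have "(\<integral>k. mc v v (k *v z) \<partial>dk) = (\<integral>k. (\<Sum>(e, e')\<in>BV \<alpha> \<times> BV \<alpha>. (?a k e * cnj (?a k e')) * mc e e' z) \<partial>dk)"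
    by (rule dk_cong[OF mcK])
  also have "\<dots> = sph \<alpha> v z"
    unfolding sph_def case_prod_beta
    by (subst Bochner_Integration.integral_sum) (auto intro!: int sum.cong simp: integral_mult_left_zero)
  finally show "spherical_function dk lam v x = tens (sph \<alpha> v) x" by (simp add: tens_def x)
qed

lemma spherical_function_0:
  assumes "inn v v = 1" shows "spherical_function dk lam v (0, 0) = 1"
  unfolding spherical_function_def hact.simps matrix_vector_mult_0_right inn_fock_rep mc_0 assms dk_const by simp

lemma smooth_sph: "\<alpha> \<in> \<Lambda> \<Longrightarrow> smooth (sph \<alpha> v)"
  unfolding sph_def[abs_def] case_prod_beta by (auto intro!: smooth_sum smooth_mult mc_smooth BV_polys)

lemma DT_tens: "smooth g \<Longrightarrow> DT N e (tens g) = tens (\<lambda>z. \<Sum>xs\<in>words N. e xs * foldr ltw xs g z)"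
  unfolding DT_def hZs_tens by (rule HOL.ext) (simp add: tens_def sum_distrib_left mult_ac)

lemma DT_sph:
  assumes a: "\<alpha> \<in> \<Lambda>" and c: "\<And>u. u \<in> V \<alpha> \<Longrightarrow> opT N e u = (\<lambda>w. c * u w)"
  shows "(\<Sum>xs\<in>words N. e xs * foldr ltw xs (sph \<alpha> v) z) = c * sph \<alpha> v z"
proof -
  let ?I = "\<lambda>p. (\<integral>k. inn (\<lambda>w. v (ks k *v w)) (fst p) * cnj (inn (\<lambda>w. v (ks k *v w)) (snd p)) \<partial>dk)"
  have s: "sph \<alpha> v = (\<lambda>z. \<Sum>p\<in>BV \<alpha> \<times> BV \<alpha>. ?I p * mc (fst p) (snd p) z)"
    by (simp add: sph_def[abs_def] case_prod_beta)

  have "foldr ltw xs (sph \<alpha> v) = (\<lambda>z. \<Sum>p\<in>BV \<alpha> \<times> BV \<alpha>. ?I p * foldr ltw xs (mc (fst p) (snd p)) z)" for xs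
    unfolding s by (rule lin_on_sum[OF lin_on_ltws smooth_subspace]) (auto intro!: mc_smooth BV_polys[OF a])
  then have "foldr ltw xs (sph \<alpha> v) z = (\<Sum>p\<in>BV \<alpha> \<times> BV \<alpha>. ?I p * mc (foldr op xs (fst p)) (snd p) z)" for xs
    by (auto intro!: sum.cong simp: ltws_mc BV_polys[OF a])
  then have "(\<Sum>xs\<in>words N. e xs * foldr ltw xs (sph \<alpha> v) z) =
    (\<Sum>p\<in>BV \<alpha> \<times> BV \<alpha>. ?I p * (\<Sum>xs\<in>words N. e xs * mc (foldr op xs (fst p)) (snd p) z))"
    by (simp only: sum_distrib_left) (subst sum.swap, simp add: mult_ac)
  also have "\<dots> = (\<Sum>p\<in>BV \<alpha> \<times> BV \<alpha>. ?I p * (c * mc (fst p) (snd p) z))"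
  proof (intro sum.cong refl arg_cong2[where f="(*)"])
    fix p assume "p \<in> BV \<alpha> \<times> BV \<alpha>"
    then have p: "fst p \<in> BV \<alpha>" "snd p \<in> BV \<alpha>" by auto
    have "(\<Sum>xs\<in>words N. e xs * mc (foldr op xs (fst p)) (snd p) z) = mc (opT N e (fst p)) (snd p) z"
      unfolding opT_def by (rule mc_sum_left[symmetric]) (auto intro: ops_polys BV_polys[OF a] p)
    also have "opT N e (fst p) = (\<lambda>w. c * fst p w)" using c[of "fst p"] p(1) BV(2)[OF a] cfun.span_base by blast
    finally show "(\<Sum>xs\<in>words N. e xs * mc (foldr op xs (fst p)) (snd p) z) = c * mc (fst p) (snd p) z"
      by (simp add: mc_def mcoef_def ncoef_scale_left)
  qed
  finally show ?thesis by (simp add: s sum_distrib_left mult_ac)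
qed

text \<open>The spherical function is 1 at the origin, so the eigenvalue equations evaluated there
  determine \<open>\<mu>\<close>.\<close>

lemma eigenvalues:
  assumes a: "\<alpha> \<in> \<Lambda>" and v: "v \<in> V \<alpha>" "inn v v = 1" and j: "joint_eigenfunction K \<mu> (spherical_function dk lam v)"
  shows "\<mu> (dir_deriv (0, 1)) = \<i> * of_real lam"
    and "inv_tensor N e \<Longrightarrow> (\<And>u. u \<in> V \<alpha> \<Longrightarrow> opT N e u = (\<lambda>w. c * u w)) \<Longrightarrow> \<mu> (DT N e) = c"
proof -
  have one: "tens (sph \<alpha> v) (0, 0) = 1" using spherical_function_0[OF v(2)] by (simp add: spherical_function_eq[OF a v(1)])
  have mu: "D (tens (sph \<alpha> v)) (0, 0) = \<mu> D" if "D \<in> invariant_operators K" for D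
    using j that one by (simp add: joint_eigenfunction_def spherical_function_eq[OF a v(1)])
  have d0: "dir_deriv 0 (sph \<alpha> v) 0 = 0" using dir_deriv_linear[OF smooth_differentiable[OF smooth_sph[OF a]], of 0 0 0 0 v 0] by simp
  show "\<mu> (dir_deriv (0, 1)) = \<i> * of_real lam"
    using mu[OF dt_invariant] one by (simp add: dir_deriv_tens[OF smooth_sph[OF a]] d0 tens_def)
  assume e: "inv_tensor N e" and c: "\<And>u. u \<in> V \<alpha> \<Longrightarrow> opT N e u = (\<lambda>w. c * u w)"
  have "DT N e (tens (sph \<alpha> v)) (0, 0) = c * tens (sph \<alpha> v) (0, 0)"
    unfolding DT_tens[OF smooth_sph[OF a]] tens_def by (simp add: DT_sph[OF a c])
  then show "\<mu> (DT N e) = c" using mu[OF DT_invariant[OF e]] one by simp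
qed

section \<open>Separation of the isotypic components by invariant operators\<close>

lemma \<kappa>_mult: "\<kappa> (l ** k) y z = (\<Sum>x\<in>UNIV. \<kappa> l y x * \<kappa> k x z)"
  by (cases y; cases z) (simp_all add: sum_UNIV_Plus matrix_matrix_mult_def)

lemma continuous_tensor_power: "continuous_on S (\<lambda>k. tensor_power (\<kappa> k) ys xs)"
proof (induction ys arbitrary: xs)
  case (Cons y ys)
  have "continuous_on S (\<lambda>k. \<kappa> k y x)" for x
    by (cases y; cases x) (simp_all, intro continuous_intros, intro continuous_intros)
  then show ?case by (cases xs) (simp_all add: continuous_on_mult Cons)
qed simp

definition avg :: "nat \<Rightarrow> (('n + 'n) list \<Rightarrow> complex) \<Rightarrow> ('n + 'n) list \<Rightarrow> complex" where
  "avg N c zs = (\<integral>k. (\<Sum>xs\<in>words N. tensor_power (\<kappa> k) zs xs * c xs) \<partial>dk)"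

lemma continuous_avg: "continuous_on S (\<lambda>k. \<Sum>xs\<in>words N. tensor_power (\<kappa> k) zs xs * c xs)"
  by (intro continuous_intros continuous_tensor_power)

text \<open>Tensor powers are multiplicative in k, so the left invariance of the Haar measure
  absorbs a further factor.\<close>

lemma inv_tensor_avg: "inv_tensor N (avg N c)"
  unfolding inv_tensor_def
proof (intro ballI)
  fix l and ys :: "('n + 'n) list" assume l: "l \<in> K" and ys: "ys \<in> words N"
  have "(\<Sum>zs\<in>words N. tensor_power (\<kappa> l) ys zs * avg N c zs) =
    (\<integral>k. (\<Sum>zs\<in>words N. tensor_power (\<kappa> l) ys zs * (\<Sum>xs\<in>words N. tensor_power (\<kappa> k) zs xs * c xs)) \<partial>dk)"
    unfolding avg_def
    by (subst Bochner_Integration.integral_sum) (auto intro!: dk_integrable continuous_intros continuous_avg)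
  also have "\<dots> = (\<integral>k. (\<Sum>xs\<in>words N. tensor_power (\<kappa> (l ** k)) ys xs * c xs) \<partial>dk)"
  proof (rule arg_cong[where f="integral\<^sup>L dk"], rule HOL.ext)
    fix k
    have "(\<Sum>zs\<in>words N. tensor_power (\<kappa> l) ys zs * (\<Sum>xs\<in>words N. tensor_power (\<kappa> k) zs xs * c xs)) =
      (\<Sum>xs\<in>words N. (\<Sum>zs\<in>words N. tensor_power (\<kappa> l) ys zs * tensor_power (\<kappa> k) zs xs) * c xs)"
      by (simp only: sum_distrib_left sum_distrib_right mult.assoc) (rule sum.swap)
    also have "\<dots> = (\<Sum>xs\<in>words N. tensor_power (\<kappa> (l ** k)) ys xs * c xs)"
    proof (rule sum.cong[OF refl])
      fix xs :: "('n + 'n) list" assume "xs \<in> words N"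
      then have "(\<Sum>zs\<in>words N. tensor_power (\<kappa> l) ys zs * tensor_power (\<kappa> k) zs xs) = tensor_power (\<kappa> (l ** k)) ys xs"
        using tensor_power_mult[of ys N xs "\<kappa> l" "\<kappa> k"] ys by (simp add: words_def \<kappa>_mult[abs_def])
      then show "(\<Sum>zs\<in>words N. tensor_power (\<kappa> l) ys zs * tensor_power (\<kappa> k) zs xs) * c xs = tensor_power (\<kappa> (l ** k)) ys xs * c xs"
        by simp
    qed
    finally show "(\<Sum>zs\<in>words N. tensor_power (\<kappa> l) ys zs * (\<Sum>xs\<in>words N. tensor_power (\<kappa> k) zs xs * c xs)) =
      (\<Sum>xs\<in>words N. tensor_power (\<kappa> (l ** k)) ys xs * c xs)" .
  qed
  also have "\<dots> = avg N c ys" unfolding avg_def by (rule dk_left_invariant[OF l continuous_avg])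
  finally show "(\<Sum>zs\<in>words N. tensor_power (\<kappa> l) ys zs * avg N c zs) = avg N c ys" .
qed

text \<open>Averaging the tensor amounts to averaging the conjugates of the operator, because
  conjugation by \<open>U k\<close> acts on words through tensor powers.\<close>

lemma opT_avg:
  assumes u: "u \<in> polys"
  shows "opT N (avg N c) u w = (\<integral>k. U k (opT N c (U (matrix_inv k) u)) w \<partial>dk)"
    and "integrable dk (\<lambda>k. U k (opT N c (U (matrix_inv k) u)) w)"
proof -
  have e: "U k (opT N c (U (matrix_inv k) u)) w = (\<Sum>zs\<in>words N. (\<Sum>xs\<in>words N. tensor_power (\<kappa> k) zs xs * c xs) * foldr op zs u w)" if k: "k \<in> K" for k
  proof -
    have "ks k *v (matrix_inv (ks k) *v w) = w"
      by (simp add: matrix_vector_mul_assoc unitary_inv(2)[OF ks_unitary[OF k]])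
    then have "U k (opT N c (U (matrix_inv k) u)) w = (\<Sum>xs\<in>words N. c xs * (\<Sum>zs\<in>words N. tensor_power (\<kappa> k) zs xs * foldr op zs u w))"
      unfolding U_eq[of k] U_inv_eq[OF k] opT_def by (intro sum.cong refl) (simp add: ops_ks[OF k u] words_def)
    also have "\<dots> = (\<Sum>zs\<in>words N. (\<Sum>xs\<in>words N. tensor_power (\<kappa> k) zs xs * c xs) * foldr op zs u w)"
      by (simp only: sum_distrib_left sum_distrib_right) (subst sum.swap, simp add: mult_ac)
    finally show ?thesis .
  qed
  have i: "integrable dk (\<lambda>k. (\<Sum>xs\<in>words N. tensor_power (\<kappa> k) zs xs * c xs) * foldr op zs u w)" for zs
    by (intro dk_integrable continuous_intros continuous_avg)
  have "integrable dk (\<lambda>k. \<Sum>zs\<in>words N. (\<Sum>xs\<in>words N. tensor_power (\<kappa> k) zs xs * c xs) * foldr op zs u w)"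
    by (intro Bochner_Integration.integrable_sum i)
  then show "integrable dk (\<lambda>k. U k (opT N c (U (matrix_inv k) u)) w)"
    by (rule Bochner_Integration.integrable_cong[THEN iffD1, rotated -1, OF _ refl]) (use haar in \<open>simp add: e normalized_haar_def\<close>)
  have "(\<integral>k. U k (opT N c (U (matrix_inv k) u)) w \<partial>dk) = (\<integral>k. (\<Sum>zs\<in>words N. (\<Sum>xs\<in>words N. tensor_power (\<kappa> k) zs xs * c xs) * foldr op zs u w) \<partial>dk)"
    by (rule dk_cong[OF e])
  also have "\<dots> = opT N (avg N c) u w"
    unfolding opT_def avg_def by (subst Bochner_Integration.integral_sum[OF i]) (simp only: integral_mult_left_zero)
  finally show "opT N (avg N c) u w = (\<integral>k. U k (opT N c (U (matrix_inv k) u)) w \<partial>dk)" ..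
qed

lemma onb_Union:
  assumes "finite S" "S \<subseteq> \<Lambda>"
  shows "onb (\<Union>\<gamma>\<in>S. BV \<gamma>)"
  unfolding onb_def
proof (intro conjI ballI)
  show "finite (\<Union>\<gamma>\<in>S. BV \<gamma>)" using assms BV(1) by (auto simp: onb_def)
  show "(\<Union>\<gamma>\<in>S. BV \<gamma>) \<subseteq> polys" using assms BV_polys by auto
  fix u v assume "u \<in> (\<Union>\<gamma>\<in>S. BV \<gamma>)" "v \<in> (\<Union>\<gamma>\<in>S. BV \<gamma>)"
  then obtain \<beta> \<gamma> where b: "\<beta> \<in> \<Lambda>" "u \<in> BV \<beta>" and g: "\<gamma> \<in> \<Lambda>" "v \<in> BV \<gamma>" using assms by auto
  have uV: "u \<in> V \<beta>" and vV: "v \<in> V \<gamma>" using b g BV(2) cfun.span_base by blast+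
  show "inn u v = (if u = v then 1 else 0)"
  proof (cases "\<beta> = \<gamma>")
    case True
    then show ?thesis using BV(1)[OF b(1)] b(2) g(2) by (simp add: onb_def)
  next
    case False
    have "inn u v = 0" by (rule V_orth[OF b(1) g(1) False uV vV])
    moreover have "u \<noteq> v"
      using BV(1)[OF b(1)] b(2) \<open>inn u v = 0\<close> by (auto simp: onb_def)
    ultimately show ?thesis by simp
  qed
qed

text \<open>By density some \<open>A\<close> in the Weyl algebra is the identity on
  \<open>V \<alpha>\<close> and 0 on \<open>V \<beta>\<close>. Averaging over \<open>K\<close>
  preserves this, and the part of each word length becomes an invariant tensor. If none of these had
  different scalars on the two spaces, the total scalar would be both 1 and 0.\<close>

theorem separation:
  assumes a: "\<alpha> \<in> \<Lambda>" and b: "\<beta> \<in> \<Lambda>" and ne: "\<alpha> \<noteq> \<beta>"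
  shows "\<exists>N e c d. inv_tensor N e \<and> (\<forall>u\<in>V \<alpha>. opT N e u = (\<lambda>w. c * u w)) \<and> (\<forall>u\<in>V \<beta>. opT N e u = (\<lambda>w. d * u w)) \<and> c \<noteq> d" (is ?S)
proof (rule ccontr)
  assume no: "\<not> ?S"
  have o: "onb (BV \<alpha> \<union> BV \<beta>)" using onb_Union[of "{\<alpha>, \<beta>}"] a b by simp
  let ?r = "\<lambda>u. if u \<in> BV \<alpha> then u else (\<lambda>w. 0)"
  have "\<exists>N A. wop N A \<and> (\<forall>v\<in>BV \<alpha> \<union> BV \<beta>. A v = ?r v)"
    by (rule weyl_density[OF o]) (auto intro: BV_polys[OF a] polys.const)
  then obtain N A where A: "wop N A" "\<And>v. v \<in> BV \<alpha> \<union> BV \<beta> \<Longrightarrow> A v = ?r v" by blast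
  obtain c where c: "\<And>u w. u \<in> polys \<Longrightarrow> A u w = (\<Sum>n<N. \<Sum>xs\<in>words n. c xs * foldr op xs u w)" using wop_expand[OF A(1)] by blast
  have lA: "lin_on polys A" using wop_lin[OF A(1)] by blast
  have Aa: "A u = u" if "u \<in> V \<alpha>" for u
  proof (rule lin_on_eq_span[OF lA _ polys_subspace, of "\<lambda>u. u" "BV \<alpha>"])
    show "u \<in> cfun.span (BV \<alpha>)" using BV(2)[OF a] that by simp
  qed (auto simp: A(2) lin_on_def BV_polys[OF a])
  have Ab: "A u = (\<lambda>w. 0)" if "u \<in> V \<beta>" for u
  proof (rule lin_on_eq_span[OF lA _ polys_subspace, of "\<lambda>u w. 0" "BV \<beta>"])
    show "u \<in> cfun.span (BV \<beta>)" using BV(2)[OF b] that by simp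
    fix e assume e: "e \<in> BV \<beta>"
    have "e \<notin> BV \<alpha>"
    proof
      assume e': "e \<in> BV \<alpha>"
      then have "inn e e = 0" using V_orth[OF a b ne] BV(2)[OF a] BV(2)[OF b] e cfun.span_base by blast
      then show False using BV(1)[OF a] e' by (simp add: onb_def)
    qed
    then show "A e = (\<lambda>w. 0)" using A(2)[of e] e by simp
  qed (auto simp: lin_on_def BV_polys[OF b])
  have sum: "(\<Sum>n<N. opT n (avg n c) u w) = (\<integral>k. U k (A (U (matrix_inv k) u)) w \<partial>dk)" if u: "u \<in> polys" for u w
  proof -
    have "U k (A (U (matrix_inv k) u)) w = (\<Sum>n<N. U k (opT n c (U (matrix_inv k) u)) w)" for k
      unfolding U_eq[of k] by (simp add: c[OF U_polys[OF u]] opT_def)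
    then show ?thesis
      by (simp only:) (subst Bochner_Integration.integral_sum[OF opT_avg(2)[OF u]], simp only: opT_avg(1)[OF u])
  qed
  have "\<forall>n. \<exists>c'. (\<forall>u\<in>V \<alpha>. opT n (avg n c) u = (\<lambda>w. c' * u w)) \<and> (\<forall>u\<in>V \<beta>. opT n (avg n c) u = (\<lambda>w. c' * u w))"
  proof
    fix n
    obtain p where p: "\<forall>u\<in>V \<alpha>. opT n (avg n c) u = (\<lambda>w. p * u w)" using opT_scalar[OF inv_tensor_avg a] by blast
    obtain q where q: "\<forall>u\<in>V \<beta>. opT n (avg n c) u = (\<lambda>w. q * u w)" using opT_scalar[OF inv_tensor_avg b] by blast
    have "p = q"
    proof (rule ccontr)
      assume "p \<noteq> q"
      with p q inv_tensor_avg[of n c] have ?S by (intro exI conjI)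
      with no show False by (rule notE)
    qed
    with p q show "\<exists>c'. (\<forall>u\<in>V \<alpha>. opT n (avg n c) u = (\<lambda>w. c' * u w)) \<and> (\<forall>u\<in>V \<beta>. opT n (avg n c) u = (\<lambda>w. c' * u w))"
      by (intro exI[of _ p] conjI) simp_all
  qed
  from choice[OF this] obtain s where s: "\<And>n u. u \<in> V \<alpha> \<Longrightarrow> opT n (avg n c) u = (\<lambda>w. s n * u w)" "\<And>n u. u \<in> V \<beta> \<Longrightarrow> opT n (avg n c) u = (\<lambda>w. s n * u w)"
    by (elim exE) (rule that; simp)
  obtain u0 where u0: "u0 \<in> V \<alpha>" "u0 \<noteq> (\<lambda>w. 0)" using V_nonzero[OF a] by blast
  then obtain w0 where w0: "u0 w0 \<noteq> 0" by blast
  obtain u1 where u1: "u1 \<in> V \<beta>" "u1 \<noteq> (\<lambda>w. 0)" using V_nonzero[OF b] by blast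
  then obtain w1 where w1: "u1 w1 \<noteq> 0" by blast
  have "(\<Sum>n<N. s n) * u0 w0 = (\<integral>k. U k (A (U (matrix_inv k) u0)) w0 \<partial>dk)"
    using sum[of u0 w0] V_polys[OF a] u0(1) by (auto simp: s(1) sum_distrib_right)
  also have "\<dots> = (\<integral>k. u0 w0 \<partial>dk)"
    by (rule dk_cong) (simp add: Aa V_inv[OF a K_inv u0(1)] U_inv)
  also have "\<dots> = u0 w0" by (rule dk_const)
  finally have 1: "(\<Sum>n<N. s n) = 1" using w0 by simp
  have "(\<Sum>n<N. s n) * u1 w1 = (\<integral>k. U k (A (U (matrix_inv k) u1)) w1 \<partial>dk)"
    using sum[of u1 w1] V_polys[OF b] u1(1) by (auto simp: s(2) sum_distrib_right)
  also have "\<dots> = (\<integral>k. 0 \<partial>dk)"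
    by (rule dk_cong) (simp add: Ab V_inv[OF b K_inv u1(1)], simp add: U_eq)
  finally show False using 1 w1 by simp
qed

end

section \<open>The growth hypothesis and the central variable\<close>

context fock begin

lemma E_space_gint:
  fixes g :: "'m::finite cfn"
  assumes "g \<in> E_space lam" shows "gint g"
proof -
  obtain \<epsilon> p where e: "\<epsilon> > 0" and p: "1 \<le> p" and sm: "smooth g"
    and Lp: "in_Lp p (\<lambda>z. exp (- (\<nu> - \<epsilon>) * (norm z)\<^sup>2) * norm (g z))"
    using assms unfolding E_space_def \<nu>_def[symmetric] by blast
  define h where "h z = exp (- (\<nu> - \<epsilon>) * (norm z)\<^sup>2) * norm (g z)" for z
  have h0: "0 \<le> h z" for z by (simp add: h_def)
  \<comment> \<open>Half of the margin becomes an integrable Gaussian by which L^p bounds are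
    compared with L^1; the other half remains as the margin in \<open>gint\<close>.\<close>
  let ?d = "\<epsilon> / 2"
  have d: "?d > 0" using e by simp
  have gi: "integrable lborel (\<lambda>z::complex^'m. exp (- ?d * (norm z)\<^sup>2))" by (rule gaussian_integrable[OF d])
  have eq: "norm (g z) * exp (- (\<nu> - ?d) * (norm z)\<^sup>2) = h z * exp (- ?d * (norm z)\<^sup>2)" for z
  proof -
    have "exp (- (\<nu> - ?d) * (norm z)\<^sup>2) = exp (- (\<nu> - \<epsilon>) * (norm z)\<^sup>2) * exp (- ?d * (norm z)\<^sup>2)"
      unfolding exp_add[symmetric] by (simp add: algebra_simps field_simps)
    then show ?thesis by (simp add: h_def)
  qed
  have c: "continuous_on UNIV g" by (rule smooth_continuous[OF sm])
  have m: "(\<lambda>z. norm (g z) * exp (- (\<nu> - ?d) * (norm z)\<^sup>2)) \<in> borel_measurable lborel"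
    by (intro continuous_lborel continuous_intros c)
  have "integrable lborel (\<lambda>z. norm (g z) * exp (- (\<nu> - ?d) * (norm z)\<^sup>2))"
  proof (cases "p = \<infinity>")
    case True
    then obtain C where C: "AE z in lborel. \<bar>h z\<bar> \<le> C" using Lp by (auto simp: in_Lp_def h_def)
    show ?thesis
    proof (rule Bochner_Integration.integrable_bound[OF integrable_mult_right[OF gi, of C] m])
      show "AE z in lborel. norm (norm (g z) * exp (- (\<nu> - ?d) * (norm z)\<^sup>2)) \<le> norm (C * exp (- ?d * (norm z)\<^sup>2))"
        using C unfolding eq by eventually_elim (auto simp: abs_mult intro!: mult_right_mono)
    qed
  next
    case False
    let ?r = "enn2real p"
    have r: "?r \<ge> 1"
    proof -
      have "p < top" using False by (simp add: top.not_eq_extremum)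
      then show ?thesis using enn2real_mono[OF p] by simp
    qed
    have "integrable lborel (\<lambda>z. h z powr ?r)" using Lp False h0 by (simp add: in_Lp_def h_def)
    then have i: "integrable lborel (\<lambda>z. exp (- ?d * (norm z)\<^sup>2) + h z powr ?r)"
      by (rule Bochner_Integration.integrable_add[OF gi])
    show ?thesis
    proof (rule Bochner_Integration.integrable_bound[OF i m], rule AE_I2)
      fix z
      \<comment> \<open>An elementary comparison in the role of the Hoelder inequality, valid
        because the exponent is at least 1.\<close>
      have "h z \<le> 1 + h z powr ?r"
      proof (cases "h z \<le> 1")
        case False
        then have "h z powr 1 \<le> h z powr ?r" using r by (intro powr_mono) auto
        then show ?thesis using h0[of z] by simp
      qed (use powr_ge_zero[of "h z" ?r] in linarith)
      then have "h z * exp (- ?d * (norm z)\<^sup>2) \<le> (1 + h z powr ?r) * exp (- ?d * (norm z)\<^sup>2)"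
        by (intro mult_right_mono) auto
      also have "\<dots> \<le> exp (- ?d * (norm z)\<^sup>2) + h z powr ?r * 1"
        unfolding distrib_right mult_1_left using e by (intro add_mono mult_left_mono order.refl) auto
      finally show "norm (norm (g z) * exp (- (\<nu> - ?d) * (norm z)\<^sup>2)) \<le> norm (exp (- ?d * (norm z)\<^sup>2) + h z powr ?r)"
        unfolding eq using h0[of z] by (simp add: abs_mult)
    qed
  qed
  then show ?thesis unfolding gint_def using c d by blast
qed

text \<open>Multiplication by the inverse phase gives a function whose derivative in the central
  variable is 0.\<close>

lemma dt_eigenfunction:
  assumes f: "smooth f" and d: "\<And>x. dir_deriv (0, 1) f x = \<i> * of_real lam * f x"
  shows "f = tens (\<lambda>z. f (z, 0))"
proof
  fix x :: "'a heis"
  obtain z t where x: "x = (z, t)" by (cases x)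
  define h where "h s = f (z, s) * exp (- \<i> * of_real (lam * s))" for s
  have "(h has_derivative (\<lambda>b. 0)) (at s within UNIV)" for s
  proof -
    have "((\<lambda>s. (z, s)) has_derivative (\<lambda>b. (0, b))) (at s)" by (auto intro!: derivative_eq_intros)
    from has_derivative_compose[OF this smooth_has_derivative[OF f]]
    have 1: "((\<lambda>s. f (z, s)) has_derivative (\<lambda>b. dir_deriv (0, b) f (z, s))) (at s)" .
    have "dir_deriv (0, b) f (z, s) = of_real b * (\<i> * of_real lam * f (z, s))" for b
      using dir_deriv_linear[OF smooth_differentiable[OF f], of b "(0, 1)" 0 "(0, 1)" "(z, s)"] d[of "(z, s)"] by simp
    with 1 have 1: "((\<lambda>s. f (z, s)) has_derivative (\<lambda>b. of_real b * (\<i> * of_real lam * f (z, s)))) (at s)" by simp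
    have l: "bounded_linear (\<lambda>s::real. - \<i> * complex_of_real (lam * s))"
      unfolding linear_conv_bounded_linear[symmetric] by (rule linearI) (simp_all add: algebra_simps scaleR_conv_of_real)
    show ?thesis unfolding h_def[abs_def]
      by (rule has_derivative_eq_rhs[OF has_derivative_mult[OF 1 has_derivative_cexp[OF bounded_linear_imp_has_derivative[OF l]]]]) (simp add: fun_eq_iff algebra_simps)
  qed
  from has_derivative_zero_constant[OF convex_UNIV this] obtain C where "\<And>s. h s = C" by auto
  then have "h t = h 0" by simp
  then have "f (z, t) * exp (- \<i> * of_real (lam * t)) * exp (\<i> * of_real (lam * t)) = exp (\<i> * of_real (lam * t)) * f (z, 0)"
    by (simp add: h_def)
  moreover have "f (z, t) * exp (- \<i> * of_real (lam * t)) * exp (\<i> * of_real (lam * t)) = f (z, t)"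
    unfolding mult.assoc exp_add[symmetric] by simp
  ultimately show "f x = tens (\<lambda>z. f (z, 0)) x" unfolding x tens_def fst_conv snd_conv by metis
qed

end

section \<open>K-finiteness and the expansion in matrix coefficients\<close>

context haar begin

text \<open>The sum is the adjoint of \<open>opT N e\<close> applied to \<open>u\<close>. It is
  compared with \<open>cnj c * u\<close> by testing against every component: on those other than
  \<open>V \<beta>\<close> the operator \<open>opT N e\<close> is scalar too, so both sides vanish
  by orthogonality.\<close>

lemma adjoint_scalar:
  assumes b: "\<beta> \<in> \<Lambda>" and e: "inv_tensor N e" and c: "\<And>v. v \<in> V \<beta> \<Longrightarrow> opT N e v = (\<lambda>w. c * v w)" and u: "u \<in> V \<beta>"
  shows "(\<lambda>w. \<Sum>xs\<in>words N. cnj (e xs) * foldr op (rev (map swap xs)) u w) = (\<lambda>w. cnj c * u w)"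
proof -
  let ?A = "\<lambda>w. \<Sum>xs\<in>words N. cnj (e xs) * foldr op (rev (map swap xs)) u w"
  have up: "u \<in> polys" using V_polys[OF b] u by blast
  have Ap: "?A \<in> polys" by (intro polys_sum polys_cmult ops_polys up)
  have "(\<lambda>w. ?A w - cnj c * u w) = (\<lambda>w. 0)"
  proof (rule orth_all_zero)
    show "(\<lambda>w. ?A w - cnj c * u w) \<in> polys" by (intro polys_diff polys_cmult Ap up)
    fix \<gamma> v assume g: "\<gamma> \<in> \<Lambda>" and v: "v \<in> V \<gamma>"
    have vp: "v \<in> polys" using V_polys[OF g] v by blast
    have "inn ?A v = (\<Sum>xs\<in>words N. cnj (e xs) * inn (foldr op (rev (map swap xs)) u) v)"
      by (subst inn_sum_left) (auto intro: polys_cmult ops_polys up vp simp: inn_cmult_left)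
    also have "\<dots> = cnj (\<Sum>xs\<in>words N. e xs * inn (foldr op xs v) u)"
      by (simp add: ops_adjoint[OF vp up] inn_cnj[of "foldr op _ u" v])
    also have "(\<Sum>xs\<in>words N. e xs * inn (foldr op xs v) u) = inn (opT N e v) u"
      unfolding opT_def by (subst inn_sum_left) (auto intro: polys_cmult ops_polys up vp simp: inn_cmult_left)
    also have "cnj (inn (opT N e v) u) = cnj c * inn u v"
    proof (cases "\<gamma> = \<beta>")
      case True
      then show ?thesis using c[of v] v by (simp add: inn_cmult_left inn_cnj[of u v])
    next
      case False
      obtain c' where "opT N e v = (\<lambda>w. c' * v w)" using opT_scalar[OF e g] v by blast
      then show ?thesis using V_orth[OF g b False v u] by (simp add: inn_cmult_left inn_cnj[of u v])
    qed
    finally show "inn (\<lambda>w. ?A w - cnj c * u w) v = 0"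
      by (simp add: inn_diff_left[OF Ap polys_cmult[OF up] vp] inn_cmult_left)
  qed
  then show ?thesis by (simp add: fun_eq_iff)
qed

lemma V_BV: "\<gamma> \<in> \<Lambda> \<Longrightarrow> e \<in> BV \<gamma> \<Longrightarrow> e \<in> V \<gamma>"
  using BV(2) cfun.span_base by blast

lemma pairing_expand_left:
  assumes a: "\<alpha> \<in> \<Lambda>" and G: "gint G" and u: "u \<in> V \<alpha>" and v: "v \<in> polys" and z: "\<And>e. e \<in> BV \<alpha> \<Longrightarrow> pairing G e v = 0"
  shows "pairing G u v = 0"
proof -
  have "proj (BV \<alpha>) u = u" using proj_id[OF BV(1)[OF a]] BV(2)[OF a] u by simp
  then have p: "u = (\<lambda>w. \<Sum>e\<in>BV \<alpha>. inn u e * e w)" unfolding proj_def by simp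
  have "pairing G u v = (\<Sum>e\<in>BV \<alpha>. cnj (inn u e) * pairing G e v)"
    by (subst p, rule pairing_sum_left[OF G v]) (auto intro: BV_polys[OF a])
  then show ?thesis by (simp add: z)
qed

text \<open>The translates of \<open>g\<close> span a finite dimensional space, so membership in the
  invariant space \<open>M\<close> is guaranteed by finitely many linear conditions. More components
  outside \<open>M\<close> than conditions would put a nonzero combination of vectors from them into
  \<open>M\<close>, which multiplicity freeness excludes.\<close>

lemma K_finite_pairing:
  assumes a: "\<alpha> \<in> \<Lambda>" and fin: "K_finite K (tens g)" and G: "gint g"
  shows "finite {\<gamma>\<in>\<Lambda>. \<exists>u\<in>V \<alpha>. \<exists>v\<in>V \<gamma>. pairing g u v \<noteq> 0}"
proof -
  let ?T = "{\<lambda>x. tens g (hact (matrix_inv k) x) |k. k \<in> K}"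
  let ?r = "\<lambda>h z. h (z, 0::real)"
  obtain B where B: "finite B" "cfun.span ?T = cfun.span B" using fin by (auto simp: K_finite_def)
  have T: "?r (\<lambda>x. tens g (hact (matrix_inv k) x)) = (\<lambda>z. g (matrix_inv k *v z))" for k by (simp add: tens_def)
  have gB: "gint (?r h)" if "h \<in> cfun.span ?T" for h
    using that
  proof (induction rule: span_induct_fun)
    case zero
    show ?case by (rule gauss_polys_gint[OF subspace_czero[OF gauss_polys_subspace]])
  next
    case (add u v)
    then show ?case using gint_lin[of "?r u" "?r v" 1 1] by simp
  next
    case (scale c u)
    then show ?case using gint_lin[of "?r u" "?r u" c 0] by simp
  next
    case (base h)
    then show ?case using gint_K[OF _ G] T by auto
  qed
  have zB: "pairing (?r h) u v = 0" if h: "h \<in> cfun.span ?T" and uv: "u \<in> polys" "v \<in> polys" and z: "\<And>b. b \<in> B \<Longrightarrow> pairing (?r b) u v = 0" for h u v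
  proof -
    have "gint (?r h) \<and> pairing (?r h) u v = 0" using h unfolding B(2)
    proof (induction rule: span_induct_fun)
      case zero
      show ?case using subspace_czero[OF pairing_fun_subspace[OF uv]] by simp
    next
      case (add h k)
      then show ?case using subspace_cadd[OF pairing_fun_subspace[OF uv], of "?r h" "?r k"] by simp
    next
      case (scale c h)
      then show ?case using subspace_cscale[OF pairing_fun_subspace[OF uv], of "?r h" c] by simp
    next
      case (base b)
      then show ?case using z gB B(2) cfun.span_base by blast
    qed
    then show ?thesis ..
  qed
  \<comment> \<open>The largest \<open>K\<close>-invariant space of polynomials that pair to 0 with
    \<open>g\<close> and all of \<open>V \<alpha>\<close>.\<close>
  define M where "M = {v. v \<in> polys \<and> (\<forall>k\<in>K. \<forall>u\<in>V \<alpha>. pairing g u (U k v) = 0)}"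
  have aP: "u \<in> polys" if "u \<in> V \<alpha>" for u using V_polys[OF a] that by blast
  have Msub: "cfun.subspace M"
  proof (rule subspaceI_fun)
    have "U k (\<lambda>w. 0) = (\<lambda>w. 0)" for k by (simp add: U_eq)
    then show "(\<lambda>w. 0) \<in> M" by (simp add: M_def polys.const)
  next
    fix u v assume "u \<in> M" "v \<in> M"
    then show "(\<lambda>w. u w + v w) \<in> M" by (auto simp: M_def polys.add U_linear pairing_add_right[OF G aP U_polys U_polys])
  next
    fix c u assume "u \<in> M"
    then show "(\<lambda>w. c * u w) \<in> M" by (auto simp: M_def polys_cmult U_linear pairing_scale_right)
  qed
  have MK: "U l v \<in> M" if "l \<in> K" "v \<in> M" for l v
    using that by (auto simp: M_def U_polys U_mult[symmetric] K_mult)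
  \<comment> \<open>Equivariance moves the group element from \<open>v\<close> to \<open>g\<close>
    and \<open>u\<close>. The translates of \<open>g\<close> lie in the span of \<open>B\<close>,
    and \<open>V \<alpha>\<close> is the span of \<open>BV \<alpha>\<close>, so the finitely many
    pairs suffice.\<close>
  have MI: "v \<in> M" if v: "v \<in> polys" and z: "\<And>b e. b \<in> B \<Longrightarrow> e \<in> BV \<alpha> \<Longrightarrow> pairing (?r b) e v = 0" for v
    unfolding M_def
  proof (intro CollectI conjI ballI v)
    fix k u assume k: "k \<in> K" and u: "u \<in> V \<alpha>"
    note k' = K_inv[OF k]
    let ?h = "\<lambda>x. tens g (hact (matrix_inv (matrix_inv k)) x)"
    have h: "?h \<in> cfun.span ?T" by (rule cfun.span_base) (use k' in blast)
    have 0: "pairing (?r ?h) e v = 0" if "e \<in> BV \<alpha>" for e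
      by (rule zB[OF h BV_polys[OF a that] v]) (rule z[OF _ that])
    have "pairing (?r ?h) (U (matrix_inv k) u) v = 0"
      by (rule pairing_expand_left[OF a gB[OF h] V_inv[OF a k' u] v 0])
    then show "pairing g u (U k v) = 0"
      unfolding T pairing_K[OF k'] by (simp add: inv_inv[OF k] U_inv[OF k])
  qed
  have "finite {\<gamma>\<in>\<Lambda>. \<not> V \<gamma> \<subseteq> M}"
  proof (rule ccontr)
    assume "infinite {\<gamma>\<in>\<Lambda>. \<not> V \<gamma> \<subseteq> M}"
    then obtain s :: "nat \<Rightarrow> 'i" where s: "inj s" "range s \<subseteq> {\<gamma>\<in>\<Lambda>. \<not> V \<gamma> \<subseteq> M}"
      using infinite_countable_subset by blast
    have sL: "s i \<in> \<Lambda>" and sM: "\<not> V (s i) \<subseteq> M" for i using s(2) by auto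
    have "\<forall>i. \<exists>x. x \<in> V (s i) \<and> x \<noteq> (\<lambda>w. 0)" using V_nonzero[OF sL] by blast
    from choice[OF this] obtain x where x: "\<And>i. x i \<in> V (s i)" "\<And>i. x i \<noteq> (\<lambda>w. 0)" by blast
    have xP: "x i \<in> polys" for i using V_polys[OF sL] x(1) by blast
    let ?P = "B \<times> BV \<alpha>"
    have fP: "finite ?P" using B(1) BV(1)[OF a] by (simp add: onb_def)
    define d where "d = card ?P"
    define F where "F i p = (if p \<in> ?P then pairing (?r (fst p)) (snd p) (x i) else 0)" for i p
    let ?D = "(\<lambda>q p. if p = q then 1 else 0 :: complex) ` ?P"
    have "F i \<in> cfun.span ?D" for i
    proof -
      have "F i = (\<lambda>p. \<Sum>q\<in>?P. F i q * (if p = q then 1 else 0))"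
        by (rule HOL.ext) (simp add: if_distrib fP F_def cong: if_cong)
      also have "\<dots> \<in> cfun.span ?D"
        by (rule subspace_csum[OF cfun.subspace_span]) (rule cfun.span_base, rule imageI)
      finally show ?thesis .
    qed
    \<comment> \<open>There are \<open>d + 1\<close> vectors \<open>x i\<close> and at most
      \<open>d\<close> conditions.\<close>
    then obtain c where c: "\<exists>i\<le>d. c i \<noteq> 0" "\<And>p. (\<Sum>i\<le>d. c i * F i p) = 0"
      using family_dependent[of ?D d F] fP card_image_le[OF fP] unfolding d_def by blast
    define w where "w = (\<lambda>y. \<Sum>i\<le>d. c i * x i y)"
    have wP: "w \<in> polys" unfolding w_def by (intro polys_sum polys_cmult xP)
    have wM: "w \<in> M"
    proof (rule MI[OF wP])
      fix b e assume b: "b \<in> B" and e: "e \<in> BV \<alpha>"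
      have gb: "gint (?r b)" using gB B(2) b cfun.span_base by blast
      have "pairing (?r b) e w = (\<Sum>i\<le>d. c i * pairing (?r b) e (x i))"
        unfolding w_def by (rule pairing_sum_right[OF gb BV_polys[OF a e] xP])
      also have "\<dots> = (\<Sum>i\<le>d. c i * F i (b, e))" using b e by (simp add: F_def)
      finally show "pairing (?r b) e w = 0" using c(2) by simp
    qed
    let ?W = "cfun.span (\<Union>i\<le>d. BV (s i))"
    have VW: "V (s i) \<subseteq> ?W" if "i \<le> d" for i
    proof -
      have "cfun.span (BV (s i)) \<subseteq> ?W" by (rule cfun.span_mono) (use that in auto)
      then show ?thesis using BV(2)[OF sL] by simp
    qed
    have WK: "U k u \<in> ?W" if k: "k \<in> K" and u: "u \<in> ?W" for k u
      using u
    proof (induction rule: span_induct_fun)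
      case zero
      have "U k (\<lambda>w. 0) = (\<lambda>w. 0)" by (simp add: U_eq)
      then show ?case by (simp add: subspace_czero[OF cfun.subspace_span])
    next
      case (add u v)
      then show ?case unfolding U_linear by (intro subspace_cadd[OF cfun.subspace_span])
    next
      case (scale c u)
      then show ?case unfolding U_linear by (intro subspace_cscale[OF cfun.subspace_span])
    next
      case (base u)
      then obtain i where i: "i \<le> d" "u \<in> BV (s i)" by blast
      then show ?case using VW[OF i(1)] V_inv[OF sL k V_BV[OF sL i(2)]] by blast
    qed
    \<comment> \<open>The projection to this invariant space is scalar on each
      \<open>V (s i)\<close>, and the scalar is 0, as otherwise \<open>V (s i)\<close> would lie in
      \<open>M\<close>. So the projection both fixes \<open>w\<close> and kills it.\<close>
    let ?N = "M \<inter> ?W"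
    have Nsub: "cfun.subspace ?N" by (intro cfun.subspace_inter Msub cfun.subspace_span)
    have "\<exists>B'. onb B' \<and> cfun.span B' = ?N"
    proof (rule subspace_onb[OF Nsub Int_lower2])
      show "finite (\<Union>i\<le>d. BV (s i))" using BV(1)[OF sL] by (auto simp: onb_def)
      show "(\<Union>i\<le>d. BV (s i)) \<subseteq> polys" using BV_polys[OF sL] by auto
    qed
    then obtain B' where B': "onb B'" "cfun.span B' = ?N" by blast
    have NK: "K_invariant_subspace K lam (cfun.span B')"
      unfolding K_invariant_subspace_def B'(2) using Nsub MK WK by auto
    have px: "proj B' (x i) = (\<lambda>w. 0)" if i: "i \<le> d" for i
    proof -
      obtain q where q: "\<And>u. u \<in> V (s i) \<Longrightarrow> proj B' u = (\<lambda>w. q * u w)"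
        using commuting_scalar[OF lin_on_proj[OF B'(1)] proj_polys[OF B'(1)] proj_U[OF B'(1) NK] sL] by blast
      have "q = 0"
      proof (rule ccontr)
        assume q0: "q \<noteq> 0"
        have "V (s i) \<subseteq> M"
        proof
          fix u assume u: "u \<in> V (s i)"
          have "(\<lambda>w. q * u w) \<in> ?N" using proj_span[of B' u] unfolding q[OF u] B'(2) .
          from subspace_cscale[OF Nsub this, of "1 / q"] show "u \<in> M" using q0 by simp
        qed
        then show False using sM by blast
      qed
      then show ?thesis using q[OF x(1)] by simp
    qed
    have "w \<in> ?N"
    proof
      show "w \<in> ?W" unfolding w_def by (rule subspace_csum[OF cfun.subspace_span]) (use VW x(1) in auto)
    qed (rule wM)
    then have "w = proj B' w" using proj_id[OF B'(1)] B'(2) by simp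
    also have "\<dots> = (\<lambda>y. \<Sum>i\<le>d. c i * proj B' (x i) y)"
      unfolding w_def by (rule lin_on_sum[OF lin_on_proj[OF B'(1)] polys_subspace xP])
    finally have w0: "w = (\<lambda>y. 0)" by (simp add: px)
    obtain j where j: "j \<le> d" "c j \<noteq> 0" using c(1) by blast
    have "inn w (x j) = (\<Sum>i\<le>d. c i * inn (x i) (x j))"
      unfolding w_def by (subst inn_sum_left) (auto intro: polys_cmult xP simp: inn_cmult_left)
    also have "\<dots> = (\<Sum>i\<le>d. if i = j then c j * inn (x j) (x j) else 0)"
    proof (rule sum.cong[OF refl])
      fix i
      have "inn (x i) (x j) = 0" if "i \<noteq> j"
        by (rule V_orth[OF sL sL _ x(1) x(1)]) (use that s(1) in \<open>simp add: inj_eq\<close>)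
      then show "c i * inn (x i) (x j) = (if i = j then c j * inn (x j) (x j) else 0)" by simp
    qed
    also have "\<dots> = c j * inn (x j) (x j)" using j by simp
    finally have "inn (x j) (x j) = 0" using j w0 by simp
    then show False using inn_self_eq_0[OF xP] x(2) by blast
  qed
  then show ?thesis
  proof (rule finite_subset[rotated], intro subsetI CollectI)
    fix \<gamma> assume "\<gamma> \<in> {\<gamma>\<in>\<Lambda>. \<exists>u\<in>V \<alpha>. \<exists>v\<in>V \<gamma>. pairing g u v \<noteq> 0}"
    then obtain u v where uv: "\<gamma> \<in> \<Lambda>" "u \<in> V \<alpha>" "v \<in> V \<gamma>" "pairing g u v \<noteq> 0" by blast
    have "U (mat 1) v = v" using U_mult[OF K_1 K_1, of v] U_inv(1)[OF K_1, of v]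
      by (simp add: U_eq ks_def matrix_inv_eqI[of "mat 1" "mat 1"])
    moreover have "pairing g u (U (mat 1) v) = 0" if "v \<in> M" using that K_1 uv(2) unfolding M_def by simp
    ultimately have "v \<notin> M" using uv(4) by metis
    then show "\<gamma> \<in> \<Lambda> \<and> \<not> V \<gamma> \<subseteq> M" using uv by blast
  qed
qed

text \<open>After integration by parts the scalar \<open>c\<close> from the eigenvalue equation of
  \<open>g\<close> and the scalar \<open>d\<close> of the same tensor on \<open>V \<beta>\<close>
  multiply the same pairing. The two conjugations, from the adjoint and from the conjugate linear
  slot, cancel.\<close>

lemma pairing_other_zero:
  assumes a: "\<alpha> \<in> \<Lambda>" and b: "\<beta> \<in> \<Lambda>" "\<beta> \<noteq> \<alpha>" and G: "smooth g" "gint g"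
    and eig: "\<And>N e c z. inv_tensor N e \<Longrightarrow> (\<And>u. u \<in> V \<alpha> \<Longrightarrow> opT N e u = (\<lambda>w. c * u w)) \<Longrightarrow>
      (\<Sum>xs\<in>words N. e xs * foldr ltw xs g z) = c * g z"
    and u: "u \<in> V \<beta>" and v: "v \<in> polys"
  shows "pairing g u v = 0"
proof -
  from separation[OF a b(1) b(2)[symmetric]]
  obtain N e c d where s: "inv_tensor N e" "\<forall>u\<in>V \<alpha>. opT N e u = (\<lambda>w. c * u w)" "\<forall>u\<in>V \<beta>. opT N e u = (\<lambda>w. d * u w)" "c \<noteq> d"
    by (elim exE conjE)
  note e = s(1) bspec[OF s(2)] bspec[OF s(3)] s(4)
  have up: "u \<in> polys" using V_polys[OF b(1)] u by blast
  have H: "gint (\<lambda>z. c * g z)" using gint_lin[OF G(2) G(2), of c 0] by simp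
  have "c * pairing g u v = (\<integral>z. (c * g z) * phi u v z \<partial>lborel)" by (simp add: pairing_def mult.assoc)
  also have "\<dots> = (\<Sum>xs\<in>words N. e xs * (\<integral>z. g z * fold tltw xs (phi u v) z \<partial>lborel))"
    by (rule ibp_gint[OF G H _ phi_gauss_polys[OF up v]]) (rule eig[OF e(1,2), symmetric])
  also have "\<dots> = (\<Sum>xs\<in>words N. cnj (cnj (e xs)) * pairing g (foldr op (rev (map swap xs)) u) v)"
    by (simp add: fold_tltw_phi[OF up v] pairing_def)
  also have "\<dots> = pairing g (\<lambda>w. \<Sum>xs\<in>words N. cnj (e xs) * foldr op (rev (map swap xs)) u w) v"
    by (rule pairing_sum_left[symmetric, OF G(2) v ops_polys[OF up]])
  also have "\<dots> = pairing g (\<lambda>w. cnj d * u w) v" by (simp only: adjoint_scalar[OF b(1) e(1,3) u])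
  also have "\<dots> = d * pairing g u v" by (simp add: pairing_scale_left)
  finally show ?thesis using e(4) by simp
qed

text \<open>The proposed sum is built to have the same pairings as \<open>g\<close>, and pairings
  determine a function within the growth bound.\<close>

theorem finite_expansion:
  assumes a: "\<alpha> \<in> \<Lambda>" and G: "gint g" and B0: "onb B0" "cfun.span B0 = V \<alpha>"
    and other: "\<And>\<beta> u v. \<beta> \<in> \<Lambda> \<Longrightarrow> \<beta> \<noteq> \<alpha> \<Longrightarrow> u \<in> V \<beta> \<Longrightarrow> v \<in> polys \<Longrightarrow> pairing g u v = 0"
    and fin: "finite {\<gamma>\<in>\<Lambda>. \<exists>u\<in>V \<alpha>. \<exists>v\<in>V \<gamma>. pairing g u v \<noteq> 0}" (is "finite ?S")
  shows "\<exists>R. (\<forall>e\<in>B0. R e \<in> polys) \<and> (\<forall>z. g z = (\<Sum>e\<in>B0. mc e (R e) z))"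
proof -
  define W where "W = (\<Union>\<gamma>\<in>?S. BV \<gamma>)"
  have SL: "?S \<subseteq> \<Lambda>" by blast
  have W: "onb W" unfolding W_def by (rule onb_Union[OF fin SL])
  have WP: "x \<in> polys" if "x \<in> W" for x using W that by (auto simp: onb_def)
  have eP: "e \<in> polys" and eV: "e \<in> V \<alpha>" if "e \<in> B0" for e using B0 that cfun.span_base by (auto simp: onb_def)
  let ?C = "moyal_const TYPE('n)"
  \<comment> \<open>This solves the Moyal relations: the pairing of \<open>mc e (R e)\<close> with
    \<open>e\<close> and \<open>x\<close> becomes that of \<open>g\<close>. The conjugate reflects
    that \<open>mc\<close> is conjugate linear in its second argument.\<close>
  define R where "R e = (\<lambda>w. \<Sum>x\<in>W. cnj (pairing g e x / ?C) * x w)" for e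
  have RP: "R e \<in> polys" for e unfolding R_def by (intro polys_sum polys_cmult WP)
  define g' where "g' z = (\<Sum>e\<in>B0. 1 * mc e (R e) z)" for z
  have Q: "g' \<in> gauss_polys" unfolding g'_def[abs_def] by (rule subspace_csum[OF gauss_polys_subspace]) (intro mc_gauss_polys eP RP)
  note G' = gauss_polys_gint[OF Q]
  \<comment> \<open>In the second argument only the finitely many exceptional components contribute.
    In the first, treated by \<open>left\<close>, only \<open>V \<alpha>\<close> survives.\<close>
  have right: "pairing g e v = (\<Sum>x\<in>W. inn v x * pairing g e x)" if e: "e \<in> B0" and v: "v \<in> polys" for e v
    using v unfolding V_span[symmetric]
  proof (induction rule: span_induct_fun)
    case (add u v)
    have uv: "u \<in> polys" "v \<in> polys" using add.hyps by (simp_all add: V_span)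
    show ?case unfolding pairing_add_right[OF G eP[OF e] uv] add.IH
      by (simp add: inn_add_left[OF uv WP] sum.distrib[symmetric] distrib_right)
  next
    case (scale c u)
    then show ?case by (simp add: pairing_scale_right inn_cmult_left sum_distrib_left mult.assoc)
  next
    case (base v)
    then obtain \<gamma> where g: "\<gamma> \<in> \<Lambda>" "v \<in> V \<gamma>" by blast
    show ?case
    proof (cases "\<gamma> \<in> ?S")
      case True
      have "cfun.span (BV \<gamma>) \<subseteq> cfun.span W" unfolding W_def by (rule cfun.span_mono) (use True in blast)
      then have "v \<in> cfun.span W" using BV(2)[OF g(1)] g(2) by blast
      from proj_id[OF W this] have p: "v = (\<lambda>w. \<Sum>x\<in>W. inn v x * x w)" unfolding proj_def by simp
      show ?thesis by (subst (1) p) (rule pairing_sum_right[OF G eP[OF e] WP])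
    next
      case False
      have "pairing g e v = 0" using False g eV[OF e] by blast
      moreover have "inn v x = 0" if xW: "x \<in> W" for x
      proof -
        from xW[unfolded W_def] obtain \<gamma>' where g': "\<gamma>' \<in> ?S" "x \<in> BV \<gamma>'" by (rule UN_E)
        have L: "\<gamma>' \<in> \<Lambda>" using g'(1) by blast
        have "\<gamma> \<noteq> \<gamma>'" using False g'(1) by blast
        then show ?thesis by (rule V_orth[OF g(1) L _ g(2) V_BV[OF L g'(2)]])
      qed
      ultimately show ?thesis by simp
    qed
  qed simp
  have left: "pairing g u v = (\<Sum>e\<in>B0. inn e u * pairing g e v)" if u: "u \<in> polys" and v: "v \<in> polys" for u v
    using u unfolding V_span[symmetric]
  proof (induction rule: span_induct_fun)
    case zero
    show ?case using pairing_scale_left[of g 0 "\<lambda>w. 0" v] by simp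
  next
    case (add p q)
    have pq: "p \<in> polys" "q \<in> polys" using add.hyps by (simp_all add: V_span)
    show ?case unfolding pairing_add_left[OF G pq v] add.IH
      by (simp add: inn_add_right[OF eP pq] sum.distrib[symmetric] distrib_right)
  next
    case (scale c u)
    then show ?case by (simp add: pairing_scale_left inn_cmult_right sum_distrib_left mult.assoc)
  next
    case (base u)
    then obtain \<beta> where b: "\<beta> \<in> \<Lambda>" "u \<in> V \<beta>" by blast
    show ?case
    proof (cases "\<beta> = \<alpha>")
      case True
      then have "u \<in> cfun.span B0" using b B0 by simp
      from proj_id[OF B0(1) this] have p: "u = (\<lambda>w. \<Sum>e\<in>B0. inn u e * e w)" unfolding proj_def by simp
      have "pairing g u v = (\<Sum>e\<in>B0. cnj (inn u e) * pairing g e v)" by (subst (1) p) (rule pairing_sum_left[OF G v eP])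
      then show ?thesis by (simp add: inn_cnj[of _ u])
    next
      case False
      have "pairing g u v = 0" by (rule other[OF b(1) False b(2) v])
      moreover have "inn e u = 0" if "e \<in> B0" for e
        by (rule V_orth[OF a b(1) _ eV[OF that] b(2)]) (use False in simp)
      ultimately show ?thesis by simp
    qed
  qed
  have pairing': "pairing g' u v = pairing g u v" if u: "u \<in> polys" and v: "v \<in> polys" for u v
  proof -
    have "pairing g' u v = (\<Sum>e\<in>B0. pairing (mc e (R e)) u v)"
      unfolding pairing_def g'_def sum_distrib_right mult_1_left
      by (rule Bochner_Integration.integral_sum) (intro pairing_integrable gauss_polys_gint mc_gauss_polys eP RP u v)
    also have "\<dots> = (\<Sum>e\<in>B0. inn e u * (\<Sum>x\<in>W. inn v x * pairing g e x))"
    proof (rule sum.cong[OF refl])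
      fix e assume e: "e \<in> B0"
      have "inn v (R e) = (\<Sum>x\<in>W. pairing g e x / ?C * inn v x)"
        unfolding R_def by (subst inn_sum_right[OF polys_cmult[OF WP] v]) (simp_all only: inn_cmult_right complex_cnj_cnj)
      then have "?C * inn v (R e) = (\<Sum>x\<in>W. inn v x * pairing g e x)"
        using moyal_const_nonzero[where 'm='n] by (simp add: sum_distrib_left mult_ac)
      then show "pairing (mc e (R e)) u v = inn e u * (\<Sum>x\<in>W. inn v x * pairing g e x)"
        unfolding moyal[OF eP[OF e] RP u v] by (simp add: mult_ac)
    qed
    also have "\<dots> = pairing g u v" unfolding left[OF u v] using right[OF _ v] by simp
    finally show ?thesis .
  qed
  have "1 * g z + (-1) * g' z = 0" for z
  proof (rule pairing_determines[OF gint_lin[OF G G', of 1 "-1"]])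
    show "pairing (\<lambda>z. 1 * g z + (-1) * g' z) u v = 0" if "u \<in> polys" "v \<in> polys" for u v
      using pairing_lin_fun[OF G G' that, of 1 "-1"] pairing'[OF that] by simp
  qed
  then have "g z = g' z" for z by simp
  then show ?thesis using RP by (intro exI[of _ R]) (simp add: g'_def)
qed

end

theorem theorem8p3:
  fixes K :: "(complex^'n^'n) set"
    and dk :: "(complex^'n^'n) measure"
    and lam :: real
    and \<Lambda> :: "'i set"
    and V :: "'i \<Rightarrow> (complex^'n \<Rightarrow> complex) set"
    and \<alpha> :: 'i
    and v :: "complex^'n \<Rightarrow> complex"
    and \<mu> :: "(((complex^'n) \<times> real \<Rightarrow> complex) \<Rightarrow> (complex^'n) \<times> real \<Rightarrow> complex) \<Rightarrow> complex"
    and f :: "(complex^'n) \<times> real \<Rightarrow> complex"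
  assumes "unitary_subgroup K" and "compact K" and "connected K"
    and "gelfand_pair K"
    and "polar_action K"
    and "normalized_haar K dk"
    and "lam \<noteq> 0"
    and "multiplicity_free_decomposition K lam \<Lambda> V" and "\<alpha> \<in> \<Lambda>"
    and "v \<in> V \<alpha>" and "fock_inner lam v v = 1"
    and "joint_eigenfunction K \<mu> (spherical_function dk lam v)"
    and "K_finite K f"
    and "joint_eigenfunction K \<mu> f"
    and "(\<lambda>z. f (z, 0)) \<in> E_space lam"
  shows "\<exists>P. K_harmonic K P \<and>
           (\<forall>z t. f (z, t) = op_inner lam (V \<alpha>) (fock_rep lam (z, t)) (weyl lam P))"
proof -
  interpret haar lam K \<Lambda> V dk using assms by unfold_locales
  note a = \<open>\<alpha> \<in> \<Lambda>\<close>
  note ev = eigenvalues[OF a \<open>v \<in> V \<alpha>\<close> \<open>fock_inner lam v v = 1\<close> \<open>joint_eigenfunction K \<mu> (spherical_function dk lam v)\<close>]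
  have fs: "smooth f" and fe: "\<And>D. D \<in> invariant_operators K \<Longrightarrow> D f = (\<lambda>x. \<mu> D * f x)"
    using \<open>joint_eigenfunction K \<mu> f\<close> by (auto simp: joint_eigenfunction_def)
  define g where "g z = f (z, 0)" for z
  have g: "gint g" and gs: "smooth g"
    using \<open>(\<lambda>z. f (z, 0)) \<in> E_space lam\<close> E_space_gint[of g] by (simp_all add: g_def[abs_def] E_space_def)
  have ft: "f = tens g" unfolding g_def[abs_def]
    by (rule dt_eigenfunction[OF fs]) (simp add: fe[OF dt_invariant] ev(1))
  have eig: "(\<Sum>xs\<in>words N. e xs * foldr ltw xs g z) = c * g z"
    if e: "inv_tensor N e" and c: "\<And>u. u \<in> V \<alpha> \<Longrightarrow> opT N e u = (\<lambda>w. c * u w)" for N e c z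
    using fun_cong[OF fe[OF DT_invariant[OF e]], of "(z, 0)"]
    unfolding ft DT_tens[OF gs] tens_def by (simp add: ev(2)[OF e c])
  let ?P = "\<lambda>B. orthonormal_basis lam (V \<alpha>) B"
  \<comment> \<open>This has to be the very basis chosen inside \<open>op_inner\<close>, since the
    expansion of \<open>g\<close> is formed with it.\<close>
  define B0 where "B0 = (SOME B. ?P B)"
  have "?P (BV \<alpha>)" using BV[OF a] V_BV[OF a] by (auto simp: orthonormal_basis_def onb_def)
  then have P0: "?P B0" unfolding B0_def by (rule someI)
  then have B0: "onb B0" "cfun.span B0 = V \<alpha>" and B0V: "B0 \<subseteq> V \<alpha>" using V_polys[OF a] by (auto simp: orthonormal_basis_def onb_def)
  obtain R where R: "\<And>e. e \<in> B0 \<Longrightarrow> R e \<in> polys" "\<And>z. g z = (\<Sum>e\<in>B0. mc e (R e) z)"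
  proof -
    have o: "pairing g u v = 0" if "\<beta> \<in> \<Lambda>" "\<beta> \<noteq> \<alpha>" "u \<in> V \<beta>" "v \<in> polys" for \<beta> u v
      by (rule pairing_other_zero[OF a that(1,2) gs g eig that(3,4)])
    have "K_finite K (tens g)" using \<open>K_finite K f\<close> ft by simp
    then have "\<exists>R. (\<forall>e\<in>B0. R e \<in> polys) \<and> (\<forall>z. g z = (\<Sum>e\<in>B0. mc e (R e) z))"
      by (intro finite_expansion[OF a g B0] o K_finite_pairing[OF a _ g])
    then show ?thesis using that by blast
  qed
  obtain N A where A: "wop N A" "\<And>e. e \<in> B0 \<Longrightarrow> A e = R e" using weyl_density[of B0 R, OF B0(1) R(1)] by blast
  obtain P p where P: "p \<in> polys" "harm p" "\<And>z. zpoly_eval P z = p (emb z)" "\<And>u. u \<in> V \<alpha> \<Longrightarrow> weyl lam P u = A u"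
    using wop_weyl_harm[OF a A(1)] unfolding weyl_harm_def by blast
  have "f (z, t) = op_inner lam (V \<alpha>) (fock_rep lam (z, t)) (weyl lam P)" for z t
  proof -
    have "op_inner lam (V \<alpha>) (fock_rep lam (z, t)) (weyl lam P) = (\<Sum>e\<in>B0. inn (fock_rep lam (z, t) e) (R e))"
      unfolding op_inner_def B0_def[symmetric] using P(4) A(2) B0V by (intro sum.cong refl) auto
    also have "\<dots> = tens g (z, t)"
      unfolding inn_fock_rep by (simp add: tens_def R(2) sum_distrib_left)
    finally show ?thesis using ft by simp
  qed
  then show ?thesis using harm_K_harmonic[OF P(1-3)] by blast
qed

end
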